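(* Let $(G_1,P_1)$ and $(G_2,P_2)$ be two Artin group-monoid pairs with canonical generating sets $P_a^1$ and $P_a^2$ respectively, and suppose that $\mathcal{A}_{P_a^1}$ and $\mathcal{A}_{P_a^2}$ are algebras of subsets of $P_1$ and $P_2$ respectively. Let $P_a=P_a^1\cup P_a^2$, and let $(G,P)$ denote either the free product $(G_1*G_2,P_1*P_2)$ or the direct product $(G_1\times G_2,P_1\times P_2)$. Let $\{X_p\}_{p\in P}$ be a compactly aligned product system of essential $C^*$-correspondences over $P$ with $X_e=A$, let $N:P\to(0,\infty)$ be a homomorphism and let $\beta\in\mathbb{R}$. Then reduction of the positivity condition to generators holds for $P$: a tracial state $\tau$ on $A$ satisfies $$\tau(a)+\sum_{\emptyset\neq K\subset J}(-1)^{|K|}N(\vee K)^{-\beta}\,\mathrm{Tr}_\tau^{\vee K}(a)\ \geq\ 0$$ for all $a\in A_+$ and all finite $J\subset P\setminus\{e\}$ if and only if it satisfies this inequality for all $a\in A_+$ and all finite $J\subset P_a$. Summands with $\vee K=\infty$ are zero.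
   Context: Artin monoids. A Coxeter matrix over a set $S$ is a symmetric matrix $M=(m_{st})_{s,t\in S}$ with $m_{ss}=1$ and $m_{st}\in\{2,3,\dots,\infty\}$ for $s\ne t$. The Artin group $A_M$ and Artin monoid $A_M^+$ are the group and monoid generated by $S$ with relations $\langle st\rangle^{m_{st}}=\langle ts\rangle^{m_{st}}$ for $s\ne t$ with $m_{st}<\infty$, where $\langle st\rangle^m=sts\cdots$ is the alternating product of length $m$. $A_M^+$ embeds in $A_M$; it is cancellative, its only invertible element is the identity $e$, and $S$ is its set of atoms. In an Artin monoid $P$ write $p\le q$ if $q\in pP$, and then $p^{-1}q$ is the unique $x$ with $px=q$. For finite nonempty $K\subset P$ either $\bigcap_{k\in K}kP=\emptyset$ and $\vee K:=\infty$, or $\bigcap_{k\in K}kP=(\vee K)P$ for a unique $\vee K\in P$. Sets. In a monoid $Q$ with set $Q_a$ of atoms, for finite $K\subset Q$ put $\Omega_K=\bigcap_{k\in K}(Q\setminus kQ)$, $\Omega_\emptyset=Q$. $\mathcal{A}_{Q_a}$ consists of all finite (possibly empty) disjoint unions of sets $q\Omega_K$ with $q\in Q$ and $K\subset Q_a$ finite or empty. An algebra of subsets is a nonempty collection closed under complements and finite unions. Product systems. A $C^*$-correspondence over a $C^*$-algebra $A$ is a right Hilbert $A$-module $X$ with a left action $\varphi:A\to\mathcal{L}(X)$; it is essential if $\overline{\varphi(A)X}=X$. A product system over $P$ is a family $(X_p)_{p\in P}$ of $C^*$-correspondences over $A$ with a monoid structure on $\bigcup_pX_p$ such that $\xi\zeta\in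 X_{pq}$ for $\xi\in X_p,\zeta\in X_q$, the map $\xi\otimes\zeta\mapsto\xi\zeta$ extends to an isometric isomorphism $X_p\otimes_AX_q\simeq X_{pq}$ for all $p,q\in P$ with $p\ne e$, $X_e={}_AA_A$, and multiplication by $X_e$ gives the bimodule structure. For $p\le r$ let $\iota_p^r:\mathcal{L}(X_p)\to\mathcal{L}(X_r)$ be $S\mapsto S\otimes I_{p^{-1}r}$ under $X_r\simeq X_p\otimes_AX_{p^{-1}r}$. $X$ is compactly aligned if $\iota^r_p(\mathcal{K}(X_p))\iota^r_q(\mathcal{K}(X_q))\subset\mathcal{K}(X_r)$ whenever $pP\cap qP=rP$. Induced traces. For a finite positive trace $\tau$ on $A$ and a $C^*$-correspondence $Y$, $\mathrm{Tr}^Y_\tau(T)=\sup_H\sum_{\xi\in H}\tau(\langle\xi,T\xi\rangle)$ for $T\in\mathcal{L}(Y)_+$, the supremum over finite $H\subset Y$ with $\sum_{\xi\in H}\theta_{\xi,\xi}\le1$, where $\theta_{\xi,\zeta}\eta=\xi\langle\zeta,\eta\rangle$. $\mathrm{Tr}^p_\tau(a)$ means $\mathrm{Tr}^{X_p}_\tau(\varphi_p(a))$ for $a\in A_+$, a possibly infinite trace on $A$; the inequality for $J=\{q\}$ forces $\mathrm{Tr}^q_\tau(a)<\infty$. *)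

theory Defs
  imports "HOL-Analysis.Analysis" "HOL-Algebra.Group" "HOL-Library.Extended_Nat"
    "HOL-Library.Disjoint_Sets"
begin

section \<open>Presented monoids, Artin monoids, free products\<close>

inductive word_cong :: "('g list \<times> 'g list) set \<Rightarrow> 'g list \<Rightarrow> 'g list \<Rightarrow> bool"
  for R where
  rel: "(u, v) \<in> R \<Longrightarrow> word_cong R (x @ u @ y) (x @ v @ y)"
| refl: "word_cong R u u"
| sym: "word_cong R u v \<Longrightarrow> word_cong R v u"
| trans: "word_cong R u v \<Longrightarrow> word_cong R v w \<Longrightarrow> word_cong R u w"

definition word_class :: "'g set \<Rightarrow> ('g list \<times> 'g list) set \<Rightarrow> 'g list \<Rightarrow> 'g list set" where
  "word_class S R u = {v \<in> lists S. word_cong R u v}"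

definition presented_monoid :: "'g set \<Rightarrow> ('g list \<times> 'g list) set \<Rightarrow> 'g list set monoid" where
  "presented_monoid S R =
    \<lparr>carrier = word_class S R ` lists S,
     monoid.mult = (\<lambda>A B. {w \<in> lists S. \<exists>u\<in>A. \<exists>v\<in>B. word_cong R (u @ v) w}),
     one = word_class S R []\<rparr>"

definition coxeter_matrix :: "'s set \<Rightarrow> ('s \<Rightarrow> 's \<Rightarrow> enat) \<Rightarrow> bool" where
  "coxeter_matrix S m \<longleftrightarrow>
    (\<forall>s\<in>S. m s s = 1) \<and>
    (\<forall>s\<in>S. \<forall>t\<in>S. m s t = m t s) \<and>
    (\<forall>s\<in>S. \<forall>t\<in>S. s \<noteq> t \<longrightarrow> 2 \<le> m s t)"

primrec alternating :: "'s \<Rightarrow> 's \<Rightarrow> nat \<Rightarrow> 's list" where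
  "alternating s t 0 = []"
| "alternating s t (Suc n) = s # alternating t s n"

definition artin_relations :: "'s set \<Rightarrow> ('s \<Rightarrow> 's \<Rightarrow> enat) \<Rightarrow> ('s list \<times> 's list) set" where
  "artin_relations S m =
    {(alternating s t n, alternating t s n) | s t n. s \<in> S \<and> t \<in> S \<and> s \<noteq> t \<and> m s t = enat n}"

definition artin_monoid :: "'s set \<Rightarrow> ('s \<Rightarrow> 's \<Rightarrow> enat) \<Rightarrow> 's list set monoid" where
  "artin_monoid S m = presented_monoid S (artin_relations S m)"

definition artin_generators :: "'s set \<Rightarrow> ('s \<Rightarrow> 's \<Rightarrow> enat) \<Rightarrow> 's list set set" where
  "artin_generators S m = (\<lambda>s. word_class S (artin_relations S m) [s]) ` S"

text \<open>The free product is the coproduct of monoids: words in the disjoint union of the two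
  carriers, modulo the multiplication tables and the identification of both units with the
  empty word.\<close>

definition free_product_gens ::
    "('p, 'm) monoid_scheme \<Rightarrow> ('q, 'n) monoid_scheme \<Rightarrow> ('p + 'q) set" where
  "free_product_gens P Q = carrier P <+> carrier Q"

definition free_product_relations ::
    "('p, 'm) monoid_scheme \<Rightarrow> ('q, 'n) monoid_scheme
      \<Rightarrow> (('p + 'q) list \<times> ('p + 'q) list) set" where
  "free_product_relations P Q =
    {([Inl a, Inl b], [Inl (a \<otimes>\<^bsub>P\<^esub> b)]) | a b. a \<in> carrier P \<and> b \<in> carrier P} \<union>
    {([Inr a, Inr b], [Inr (a \<otimes>\<^bsub>Q\<^esub> b)]) | a b. a \<in> carrier Q \<and> b \<in> carrier Q} \<union>
    {([Inl \<one>\<^bsub>P\<^esub>], []), ([Inr \<one>\<^bsub>Q\<^esub>], [])}"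

definition free_product ::
    "('p, 'm) monoid_scheme \<Rightarrow> ('q, 'n) monoid_scheme \<Rightarrow> ('p + 'q) list set monoid" where
  "free_product P Q = presented_monoid (free_product_gens P Q) (free_product_relations P Q)"

definition free_product_generators ::
    "('p, 'm) monoid_scheme \<Rightarrow> 'p set \<Rightarrow> ('q, 'n) monoid_scheme \<Rightarrow> 'q set
      \<Rightarrow> ('p + 'q) list set set" where
  "free_product_generators P Pa Q Qa =
    (\<lambda>x. word_class (free_product_gens P Q) (free_product_relations P Q) [x]) ` (Pa <+> Qa)"

definition direct_product_generators ::
    "('p, 'm) monoid_scheme \<Rightarrow> 'p set \<Rightarrow> ('q, 'n) monoid_scheme \<Rightarrow> 'q set \<Rightarrow> ('p \<times> 'q) set" where
  "direct_product_generators P Pa Q Qa =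
    (\<lambda>s. (s, \<one>\<^bsub>Q\<^esub>)) ` Pa \<union> (\<lambda>t. (\<one>\<^bsub>P\<^esub>, t)) ` Qa"

section \<open>Right ideals, joins, and the family of sets attached to the atoms\<close>

definition right_ideal :: "('p, 'm) monoid_scheme \<Rightarrow> 'p \<Rightarrow> 'p set" where
  "right_ideal P p = (\<lambda>x. p \<otimes>\<^bsub>P\<^esub> x) ` carrier P"

text \<open>The value None stands for infinity.  Only used for nonempty $K$.\<close>

definition join :: "('p, 'm) monoid_scheme \<Rightarrow> 'p set \<Rightarrow> 'p option" where
  "join P K =
    (if (\<Inter>k\<in>K. right_ideal P k) = {} then None
     else Some (THE p. p \<in> carrier P \<and> (\<Inter>k\<in>K. right_ideal P k) = right_ideal P p))"

definition left_quotient :: "('p, 'm) monoid_scheme \<Rightarrow> 'p \<Rightarrow> 'p \<Rightarrow> 'p" where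
  "left_quotient P p q = (THE x. x \<in> carrier P \<and> p \<otimes>\<^bsub>P\<^esub> x = q)"

definition Omega_set :: "('p, 'm) monoid_scheme \<Rightarrow> 'p set \<Rightarrow> 'p set" where
  "Omega_set Q K = carrier Q \<inter> (\<Inter>k\<in>K. carrier Q - right_ideal Q k)"

definition atom_family :: "('p, 'm) monoid_scheme \<Rightarrow> 'p set \<Rightarrow> 'p set set" where
  "atom_family Q Qa =
    {\<Union>\<C> | \<C>. finite \<C> \<and> disjoint \<C> \<and>
      \<C> \<subseteq> {(\<lambda>x. q \<otimes>\<^bsub>Q\<^esub> x) ` Omega_set Q K | q K. q \<in> carrier Q \<and> finite K \<and> K \<subseteq> Qa}}"

section \<open>$C^*$-algebras and $C^*$-correspondences\<close>

class complex_vector = ab_group_add +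
  fixes scaleC :: "complex \<Rightarrow> 'a \<Rightarrow> 'a"
  assumes scaleC_add_right: "scaleC c (x + y) = scaleC c x + scaleC c y"
    and scaleC_add_left: "scaleC (c + d) x = scaleC c x + scaleC d x"
    and scaleC_scaleC: "scaleC c (scaleC d x) = scaleC (c * d) x"
    and scaleC_one: "scaleC 1 x = x"

text \<open>No unit is required.\<close>

class cstar_algebra = real_normed_algebra + banach + complex_vector +
  fixes star :: "'a \<Rightarrow> 'a"
  assumes scaleR_eq_scaleC: "scaleR r x = scaleC (complex_of_real r) x"
    and norm_scaleC: "norm (scaleC c x) = cmod c * norm x"
    and scaleC_mult_left: "scaleC c x * y = scaleC c (x * y)"
    and scaleC_mult_right: "x * scaleC c y = scaleC c (x * y)"
    and star_star: "star (star x) = x"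
    and star_add: "star (x + y) = star x + star y"
    and star_scaleC: "star (scaleC c x) = scaleC (cnj c) (star x)"
    and star_mult: "star (x * y) = star y * star x"
    and cstar_identity: "norm (star x * x) = (norm x)\<^sup>2"

definition positive_cone :: "'a::cstar_algebra set" where
  "positive_cone = range (\<lambda>b. star b * b)"

definition tracial_state :: "('a::cstar_algebra \<Rightarrow> complex) \<Rightarrow> bool" where
  "tracial_state \<tau> \<longleftrightarrow>
    bounded_linear \<tau> \<and> (\<forall>c a. \<tau> (scaleC c a) = c * \<tau> a) \<and>
    (\<forall>a\<in>positive_cone. \<tau> a \<in> \<real>\<^sub>\<ge>\<^sub>0) \<and> onorm \<tau> = 1 \<and>
    (\<forall>a b. \<tau> (a * b) = \<tau> (b * a))"

text \<open>The underlying vector space of a Hilbert module is a linear subspace of an ambient complex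
  vector space.  This loses nothing, even for families of modules in one ambient space: the ambient
  space may be taken to be the direct sum of the family.\<close>

record ('a, 'x) hilbert_mod = "'x partial_object" +
  ip :: "'x \<Rightarrow> 'x \<Rightarrow> 'a"
  ract :: "'x \<Rightarrow> 'a \<Rightarrow> 'x"

record ('a, 'x) correspondence = "('a, 'x) hilbert_mod" +
  lact :: "'a \<Rightarrow> 'x \<Rightarrow> 'x"

definition mod_norm :: "('a::cstar_algebra, 'x, 'm) hilbert_mod_scheme \<Rightarrow> 'x \<Rightarrow> real" where
  "mod_norm E \<xi> = sqrt (norm (ip E \<xi> \<xi>))"

locale hilbert_module =
  fixes E :: "('a::cstar_algebra, 'x::complex_vector, 'm) hilbert_mod_scheme"
  assumes zero_mem: "0 \<in> carrier E"
    and add_mem: "\<lbrakk>\<xi> \<in> carrier E; \<eta> \<in> carrier E\<rbrakk> \<Longrightarrow> \<xi> + \<eta> \<in> carrier E"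
    and scaleC_mem: "\<xi> \<in> carrier E \<Longrightarrow> scaleC c \<xi> \<in> carrier E"
    and ract_mem: "\<xi> \<in> carrier E \<Longrightarrow> ract E \<xi> a \<in> carrier E"
    and ract_add_left:
      "\<lbrakk>\<xi> \<in> carrier E; \<eta> \<in> carrier E\<rbrakk> \<Longrightarrow> ract E (\<xi> + \<eta>) a = ract E \<xi> a + ract E \<eta> a"
    and ract_add_right: "\<xi> \<in> carrier E \<Longrightarrow> ract E \<xi> (a + b) = ract E \<xi> a + ract E \<xi> b"
    and ract_scaleC_left: "\<xi> \<in> carrier E \<Longrightarrow> ract E (scaleC c \<xi>) a = scaleC c (ract E \<xi> a)"
    and ract_scaleC_right: "\<xi> \<in> carrier E \<Longrightarrow> ract E \<xi> (scaleC c a) = scaleC c (ract E \<xi> a)"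
    and ract_mult: "\<xi> \<in> carrier E \<Longrightarrow> ract E \<xi> (a * b) = ract E (ract E \<xi> a) b"
    and ip_add: "\<lbrakk>\<xi> \<in> carrier E; \<eta> \<in> carrier E; \<zeta> \<in> carrier E\<rbrakk>
      \<Longrightarrow> ip E \<xi> (\<eta> + \<zeta>) = ip E \<xi> \<eta> + ip E \<xi> \<zeta>"
    and ip_scaleC: "\<lbrakk>\<xi> \<in> carrier E; \<eta> \<in> carrier E\<rbrakk>
      \<Longrightarrow> ip E \<xi> (scaleC c \<eta>) = scaleC c (ip E \<xi> \<eta>)"
    and ip_ract: "\<lbrakk>\<xi> \<in> carrier E; \<eta> \<in> carrier E\<rbrakk> \<Longrightarrow> ip E \<xi> (ract E \<eta> a) = ip E \<xi> \<eta> * a"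
    and ip_star: "\<lbrakk>\<xi> \<in> carrier E; \<eta> \<in> carrier E\<rbrakk> \<Longrightarrow> star (ip E \<xi> \<eta>) = ip E \<eta> \<xi>"
    and ip_positive: "\<xi> \<in> carrier E \<Longrightarrow> ip E \<xi> \<xi> \<in> positive_cone"
    and ip_definite: "\<lbrakk>\<xi> \<in> carrier E; ip E \<xi> \<xi> = 0\<rbrakk> \<Longrightarrow> \<xi> = 0"
    and complete: "\<lbrakk>\<And>n. s n \<in> carrier E;
        \<forall>\<epsilon>>0. \<exists>M. \<forall>i\<ge>M. \<forall>j\<ge>M. mod_norm E (s i - s j) < \<epsilon>\<rbrakk>
      \<Longrightarrow> \<exists>l\<in>carrier E. (\<lambda>n. mod_norm E (s n - l)) \<longlonglongrightarrow> 0"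

definition adjoint_pair ::
    "('a, 'x, 'm) hilbert_mod_scheme \<Rightarrow> ('x \<Rightarrow> 'x) \<Rightarrow> ('x \<Rightarrow> 'x) \<Rightarrow> bool" where
  "adjoint_pair E T T' \<longleftrightarrow>
    (\<forall>\<xi>\<in>carrier E. \<forall>\<eta>\<in>carrier E. ip E (T \<xi>) \<eta> = ip E \<xi> (T' \<eta>))"

text \<open>Operators are extensional functions, so that equality in $\mathcal{L}(E)$ is equality of
  functions.\<close>

definition adjointable :: "('a, 'x, 'm) hilbert_mod_scheme \<Rightarrow> ('x \<Rightarrow> 'x) set" where
  "adjointable E =
    {T \<in> carrier E \<rightarrow>\<^sub>E carrier E. \<exists>T' \<in> carrier E \<rightarrow>\<^sub>E carrier E. adjoint_pair E T T'}"

definition positive_op :: "('a, 'x, 'm) hilbert_mod_scheme \<Rightarrow> ('x \<Rightarrow> 'x) set" where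
  "positive_op E =
    {compose (carrier E) S' S | S S'. S \<in> adjointable E \<and> S' \<in> adjointable E \<and> adjoint_pair E S S'}"

definition theta :: "('a, 'x, 'm) hilbert_mod_scheme \<Rightarrow> 'x \<Rightarrow> 'x \<Rightarrow> 'x \<Rightarrow> 'x" where
  "theta E \<xi> \<zeta> = (\<lambda>\<eta>\<in>carrier E. ract E \<xi> (ip E \<zeta> \<eta>))"

text \<open>Operator-norm closure of the linear span of the $\theta_{\xi,\zeta}$; scalars are absorbed
  into $\xi$.\<close>

definition compact_op ::
    "('a::cstar_algebra, 'x::complex_vector, 'm) hilbert_mod_scheme \<Rightarrow> ('x \<Rightarrow> 'x) set" where
  "compact_op E =
    {T \<in> adjointable E. \<forall>\<epsilon>>0. \<exists>ps \<in> lists (carrier E \<times> carrier E). \<forall>\<eta>\<in>carrier E.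
      mod_norm E (T \<eta> - (\<Sum>(\<xi>, \<zeta>)\<leftarrow>ps. theta E \<xi> \<zeta> \<eta>)) \<le> \<epsilon> * mod_norm E \<eta>}"

definition left_action_op :: "('a, 'x, 'm) correspondence_scheme \<Rightarrow> 'a \<Rightarrow> 'x \<Rightarrow> 'x" where
  "left_action_op E a = (\<lambda>\<xi>\<in>carrier E. lact E a \<xi>)"

locale cstar_correspondence = hilbert_module E
  for E :: "('a::cstar_algebra, 'x::complex_vector, 'm) correspondence_scheme" +
  assumes lact_adjointable: "left_action_op E a \<in> adjointable E"
    and lact_add: "\<xi> \<in> carrier E \<Longrightarrow> lact E (a + b) \<xi> = lact E a \<xi> + lact E b \<xi>"
    and lact_scaleC: "\<xi> \<in> carrier E \<Longrightarrow> lact E (scaleC c a) \<xi> = scaleC c (lact E a \<xi>)"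
    and lact_mult: "\<xi> \<in> carrier E \<Longrightarrow> lact E (a * b) \<xi> = lact E a (lact E b \<xi>)"
    and lact_star: "adjoint_pair E (lact E a) (lact E (star a))"

definition essential ::
    "('a::cstar_algebra, 'x::complex_vector, 'm) correspondence_scheme \<Rightarrow> bool" where
  "essential E \<longleftrightarrow>
    (\<forall>\<xi>\<in>carrier E. \<forall>\<epsilon>>0. \<exists>a. \<exists>\<eta>\<in>carrier E. mod_norm E (\<xi> - lact E a \<eta>) < \<epsilon>)"

text \<open>The interior tensor product $E \otimes_A F$ is the Hausdorff completion of the space of finite
  sums of elementary tensors, a list of pairs standing for the sum of its entries, in the
  semi-inner product below.\<close>

definition tensor_ip ::
    "('a::cstar_algebra, 'x, 'm) correspondence_scheme \<Rightarrow> ('a, 'y, 'n) correspondence_scheme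
      \<Rightarrow> ('x \<times> 'y) list \<Rightarrow> ('x \<times> 'y) list \<Rightarrow> 'a" where
  "tensor_ip E F us vs =
    (\<Sum>(\<xi>, \<zeta>)\<leftarrow>us. \<Sum>(\<xi>', \<zeta>')\<leftarrow>vs. ip F \<zeta> (lact F (ip E \<xi> \<xi>') \<zeta>'))"

text \<open>The map $\xi\otimes\zeta \mapsto \mu(\xi,\zeta)$ extends to an isometric isomorphism of
  $E\otimes_A F$ onto the complete module $Z$: it preserves the inner product of finite sums of
  elementary tensors, and their images are dense.  Well-definedness, bilinearity and balancedness
  follow from the former.\<close>

definition tensor_iso ::
    "('a::cstar_algebra, 'x, 'm) correspondence_scheme \<Rightarrow> ('a, 'y, 'n) correspondence_scheme
      \<Rightarrow> ('a, 'z::complex_vector, 'k) correspondence_scheme \<Rightarrow> ('x \<Rightarrow> 'y \<Rightarrow> 'z) \<Rightarrow> bool" where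
  "tensor_iso E F Z \<mu> \<longleftrightarrow>
    (\<forall>us \<in> lists (carrier E \<times> carrier F). \<forall>vs \<in> lists (carrier E \<times> carrier F).
      ip Z (\<Sum>(\<xi>, \<zeta>)\<leftarrow>us. \<mu> \<xi> \<zeta>) (\<Sum>(\<xi>, \<zeta>)\<leftarrow>vs. \<mu> \<xi> \<zeta>) = tensor_ip E F us vs) \<and>
    (\<forall>z\<in>carrier Z. \<forall>\<epsilon>>0. \<exists>us \<in> lists (carrier E \<times> carrier F).
      mod_norm Z (z - (\<Sum>(\<xi>, \<zeta>)\<leftarrow>us. \<mu> \<xi> \<zeta>)) < \<epsilon>)"

section \<open>Product systems\<close>

text \<open>An element of the disjoint union of the fibres is a pair of an index and a vector, so the
  multiplication $\mu\,p\,q\,\xi\,\zeta$ takes the indices as arguments.  The map $j$ is the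
  identification of $A$ with the fibre over the identity.  No unit for the multiplication is
  postulated, so that $A$ may be nonunital; when $A$ is unital and the fibres are essential, the
  unit of $A$ is one.\<close>

locale product_system =
  fixes P :: "('p, 'k) monoid_scheme"
    and X :: "'p \<Rightarrow> ('a::cstar_algebra, 'x::complex_vector) correspondence"
    and \<mu> :: "'p \<Rightarrow> 'p \<Rightarrow> 'x \<Rightarrow> 'x \<Rightarrow> 'x"
    and j :: "'a \<Rightarrow> 'x"
  assumes fibre: "p \<in> carrier P \<Longrightarrow> cstar_correspondence (X p)"
    and mult_mem: "\<lbrakk>p \<in> carrier P; q \<in> carrier P; \<xi> \<in> carrier (X p); \<zeta> \<in> carrier (X q)\<rbrakk>
      \<Longrightarrow> \<mu> p q \<xi> \<zeta> \<in> carrier (X (p \<otimes>\<^bsub>P\<^esub> q))"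
    and mult_assoc: "\<lbrakk>p \<in> carrier P; q \<in> carrier P; r \<in> carrier P;
        \<xi> \<in> carrier (X p); \<zeta> \<in> carrier (X q); \<eta> \<in> carrier (X r)\<rbrakk>
      \<Longrightarrow> \<mu> (p \<otimes>\<^bsub>P\<^esub> q) r (\<mu> p q \<xi> \<zeta>) \<eta> = \<mu> p (q \<otimes>\<^bsub>P\<^esub> r) \<xi> (\<mu> q r \<zeta> \<eta>)"
    and mult_tensor: "\<lbrakk>p \<in> carrier P; q \<in> carrier P; p \<noteq> \<one>\<^bsub>P\<^esub>\<rbrakk>
      \<Longrightarrow> tensor_iso (X p) (X q) (X (p \<otimes>\<^bsub>P\<^esub> q)) (\<mu> p q)"
    and unit_bij: "bij_betw j UNIV (carrier (X \<one>\<^bsub>P\<^esub>))"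
    and unit_add: "j (a + b) = j a + j b"
    and unit_scaleC: "j (scaleC c a) = scaleC c (j a)"
    and unit_ip: "ip (X \<one>\<^bsub>P\<^esub>) (j a) (j b) = star a * b"
    and unit_ract: "ract (X \<one>\<^bsub>P\<^esub>) (j a) b = j (a * b)"
    and unit_lact: "lact (X \<one>\<^bsub>P\<^esub>) a (j b) = j (a * b)"
    and mult_left_unit: "\<lbrakk>p \<in> carrier P; \<xi> \<in> carrier (X p)\<rbrakk>
      \<Longrightarrow> \<mu> \<one>\<^bsub>P\<^esub> p (j a) \<xi> = lact (X p) a \<xi>"
    and mult_right_unit: "\<lbrakk>p \<in> carrier P; \<xi> \<in> carrier (X p)\<rbrakk>
      \<Longrightarrow> \<mu> p \<one>\<^bsub>P\<^esub> \<xi> (j a) = ract (X p) \<xi> a"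

text \<open>The operator $S\otimes I$ on $X_r\simeq X_p\otimes_A X_{p^{-1}r}$.\<close>

definition amplify ::
    "('p, 'k) monoid_scheme \<Rightarrow> ('p \<Rightarrow> ('a, 'x) correspondence)
      \<Rightarrow> ('p \<Rightarrow> 'p \<Rightarrow> 'x \<Rightarrow> 'x \<Rightarrow> 'x) \<Rightarrow> 'p \<Rightarrow> 'p \<Rightarrow> ('x \<Rightarrow> 'x) \<Rightarrow> 'x \<Rightarrow> 'x" where
  "amplify P X \<mu> p r S =
    (THE T. T \<in> adjointable (X r) \<and>
      (\<forall>\<xi>\<in>carrier (X p). \<forall>\<eta>\<in>carrier (X (left_quotient P p r)).
        T (\<mu> p (left_quotient P p r) \<xi> \<eta>) = \<mu> p (left_quotient P p r) (S \<xi>) \<eta>))"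

locale compactly_aligned_product_system = product_system +
  assumes compactly_aligned:
    "\<lbrakk>p \<in> carrier P; q \<in> carrier P; r \<in> carrier P;
      right_ideal P p \<inter> right_ideal P q = right_ideal P r;
      S \<in> compact_op (X p); T \<in> compact_op (X q)\<rbrakk>
    \<Longrightarrow> compose (carrier (X r)) (amplify P X \<mu> p r S) (amplify P X \<mu> q r T) \<in> compact_op (X r)"

section \<open>Induced traces and the positivity condition\<close>

definition induced_trace ::
    "('a::cstar_algebra \<Rightarrow> complex) \<Rightarrow> ('a, 'x::complex_vector, 'm) hilbert_mod_scheme
      \<Rightarrow> ('x \<Rightarrow> 'x) \<Rightarrow> ereal" where
  "induced_trace \<tau> E T =
    (SUP H \<in> {H. finite H \<and> H \<subseteq> carrier E \<and>
        (\<lambda>\<eta>\<in>carrier E. \<eta> - (\<Sum>\<xi>\<in>H. theta E \<xi> \<xi> \<eta>)) \<in> positive_op E}.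
      \<Sum>\<xi>\<in>H. ereal (Re (\<tau> (ip E \<xi> (T \<xi>)))))"

text \<open>The inequality is read in the extended reals, where HOL has $\infty-\infty=\infty$.  This
  convention is immaterial once the condition is imposed for all $a\in A_+$ and all finite subsets
  $J$ of the given set.  The instances $J=\{q\}$ force $\mathrm{Tr}^q_\tau\le N(q)^\beta\tau$.  When
  $q$ ranges over generators, $\mathrm{Tr}^{pq}_\tau(a)=\mathrm{Tr}^p_{\mathrm{Tr}^q_\tau}(a)
  \le N(q)^\beta\,\mathrm{Tr}^p_\tau(a)$ then makes all the other traces finite as well.\<close>

definition positivity_ineq ::
    "('p, 'k) monoid_scheme \<Rightarrow> ('p \<Rightarrow> ('a::cstar_algebra, 'x::complex_vector) correspondence)
      \<Rightarrow> ('p \<Rightarrow> real) \<Rightarrow> real \<Rightarrow> ('a \<Rightarrow> complex) \<Rightarrow> 'p set \<Rightarrow> 'a \<Rightarrow> bool" where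
  "positivity_ineq P X N \<beta> \<tau> J a \<longleftrightarrow>
    0 \<le> ereal (Re (\<tau> a)) +
      (\<Sum>K \<in> Pow J - {{}}.
        case join P K of
          None \<Rightarrow> 0
        | Some q \<Rightarrow> (-1) ^ card K * ereal (N q powr (-\<beta>))
            * induced_trace \<tau> (X q) (left_action_op (X q) a))"

definition positive_reals :: "real monoid" where
  "positive_reals = \<lparr>carrier = {0<..}, monoid.mult = (*), one = 1\<rparr>"

definition reduction_to_generators ::
    "('p, 'k) monoid_scheme \<Rightarrow> 'p set
      \<Rightarrow> ('p \<Rightarrow> ('a::cstar_algebra, 'x::complex_vector) correspondence)
      \<Rightarrow> ('p \<Rightarrow> real) \<Rightarrow> real \<Rightarrow> bool" where
  "reduction_to_generators P Pa X N \<beta> \<longleftrightarrow>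
    (\<forall>\<tau>. tracial_state \<tau> \<longrightarrow>
      ((\<forall>a\<in>positive_cone. \<forall>J. finite J \<and> J \<subseteq> carrier P - {\<one>\<^bsub>P\<^esub>} \<longrightarrow> positivity_ineq P X N \<beta> \<tau> J a)
      \<longleftrightarrow>
       (\<forall>a\<in>positive_cone. \<forall>J. finite J \<and> J \<subseteq> Pa \<longrightarrow> positivity_ineq P X N \<beta> \<tau> J a)))"

end

theory Submission
  imports Defs
begin

text \<open>Put $F(p)=N(p)^{-\beta}\,\mathrm{Tr}^p_\tau(a)$. The left-hand side of the
  inequality for $J$ is $\sum_{K\subset J}(-1)^{|K|}F(\vee K)$, because
  $\mathrm{Tr}^e_\tau=\tau$. If $F$ is replaced by the function $p\mapsto 1_{pP}(x)$,
  inclusion-exclusion turns the same sum into the indicator function of $\Omega_J$ at $x$, and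
  in the same way $\sum_{K'\subset K}(-1)^{|K'|}F(q(\vee K'))$ corresponds to $q\Omega_K$.
  Suppose that $\Omega_J$ is a finite disjoint union of sets $q\Omega_K$ with $K$ a finite set
  of generators. This is a linear relation between indicator functions of right ideals. These
  functions are linearly independent, so the relation holds for $F$ as well
  (\<open>jsum_decompose\<close>), and the expression for $J$ is the sum of the expressions for
  the pairs $(q,K)$.\<close>

text \<open>Each of these is nonnegative. By \<open>induced_trace_tensor\<close>,
  $\mathrm{Tr}^{qr}_\tau(a)=\lim\sum_{\xi\in H}\mathrm{Tr}^r_\tau(\langle\xi,a\xi\rangle)$,
  where $\sum_{\xi\in H}\theta_{\xi,\xi}$ runs through an approximate unit of $\mathcal K(X_q)$
  that does not depend on $r$. Hence the expression for $(q,K)$ and $a$ is a positive multiple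
  of a limit of sums of expressions for $K$ and the positive elements $\langle\xi,a\xi\rangle$,
  which are nonnegative by assumption. The same formula, used along a product of generators,
  shows that all traces involved are finite. This is
  \<open>reduction_to_generators_criterion\<close>; the facts on $C^*$-algebras and Hilbert
  modules on which it rests (sums of positive elements, the form of positive operators, frames
  that approximate the identity) are developed from square roots obtained by iteration.\<close>

text \<open>The algebraic part shows that the monoids are cancellative with least common
  multiples and that every $\Omega_J$ decomposes in this way. In an Artin monoid, two words that
  are equal and begin with different letters $s$ and $t$ are both multiples of the alternating
  word of length $m_{st}$ (\<open>first_letters_eqM\<close>). This yields left cancellation and
  least common multiples. It is deduced from Matsumoto's theorem on reduced words in the Coxeter
  group, which in turn comes from the geometric representation. The decomposition of $\Omega_J$
  in each factor holds because the family of sets is an algebra. In the direct product,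
  rectangles are cut up coordinatewise. In the free product, normal forms reduce the statement
  to one letter at a time, and hence to the factors.\<close>

section \<open>Elementary identities\<close>

class unital_cstar_algebra = cstar_algebra + real_normed_algebra_1

lemma scaleC_zero_left [simp]: "scaleC 0 (x::'a::complex_vector) = 0"
  using scaleC_add_left[of 0 0 x] by simp
lemma scaleC_zero_right [simp]: "scaleC c (0::'a::complex_vector) = 0"
  using scaleC_add_right[of c 0 "0::'a"] by simp
lemma scaleC_minus_right: "scaleC c (- x::'a::complex_vector) = - scaleC c x"
  using scaleC_add_right[of c x "-x"] by (simp add: eq_neg_iff_add_eq_0 add.commute)
lemma scaleC_minus_left: "scaleC (- c) (x::'a::complex_vector) = - scaleC c x"
  using scaleC_add_left[of c "-c" x] by (simp add: eq_neg_iff_add_eq_0 add.commute)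
lemma scaleC_diff_right: "scaleC c (x - y::'a::complex_vector) = scaleC c x - scaleC c y"
  using scaleC_add_right[of c x "-y"] by (simp add: scaleC_minus_right)

context cstar_algebra begin

lemma star_zero [simp]: "star 0 = 0"
  using star_add[of 0 0] by simp
lemma star_minus: "star (- x) = - star x"
  using star_add[of x "-x"] by (simp add: eq_neg_iff_add_eq_0 add.commute)
lemma star_diff: "star (x - y) = star x - star y"
  using star_add[of x "-y"] by (simp add: star_minus)
lemma star_scaleR: "star (scaleR r x) = scaleR r (star x)"
  by (simp add: scaleR_eq_scaleC star_scaleC)

lemma norm_star: "norm (star x) = norm x"
proof -
  have le: "norm y \<le> norm (star y)" for y
  proof (cases "norm y = 0")
    case False
    have "(norm y)\<^sup>2 \<le> norm (star y) * norm y"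
      using norm_mult_ineq[of "star y" y] by (simp add: cstar_identity)
    then show ?thesis using False by (simp add: power2_eq_square)
  qed simp
  show ?thesis using le[of x] le[of "star x"] by (simp add: star_star)
qed

lemma norm_square: "star k = k \<Longrightarrow> norm (k * k) = (norm k)\<^sup>2"
  using cstar_identity[of k] by simp
end

lemma bounded_linear_star: "bounded_linear (star :: 'a::cstar_algebra \<Rightarrow> 'a)"
  by (rule bounded_linear_intro[where K=1]) (auto simp: star_add star_scaleR norm_star)

lemma star_one [simp]: "star (1::'a::unital_cstar_algebra) = 1"
  by (metis mult.left_neutral star_mult star_star mult.right_neutral)

section \<open>Square roots by iteration\<close>

text \<open>A limit $y$ satisfies $2y=T+y^2$, that is $(1-y)^2=1-T$; in this form the iteration
  makes sense without a unit.\<close>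

fun root_seq :: "'a::real_normed_algebra \<Rightarrow> nat \<Rightarrow> 'a" where
  "root_seq T 0 = 0"
| "root_seq T (Suc n) = scaleR (1/2) (T + root_seq T n * root_seq T n)"

text \<open>The iteration for the scalar $T=1$. It dominates the iteration for every $T$ of norm
  at most one, both in norm and in its increments.\<close>

fun root_bound :: "nat \<Rightarrow> real" where
  "root_bound 0 = 0"
| "root_bound (Suc n) = (1 + (root_bound n)\<^sup>2) / 2"

lemma root_bound_range: "0 \<le> root_bound n \<and> root_bound n \<le> 1"
  by (induction n) (auto simp: power_le_one)

lemma root_bound_mono: "root_bound n \<le> root_bound (Suc n)"
proof -
  have "0 \<le> (1 - root_bound n)\<^sup>2" by simp
  then show ?thesis by (simp add: power2_eq_square algebra_simps)
qed

lemma root_bound_Cauchy: "Cauchy root_bound"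
proof -
  have "incseq root_bound" by (rule incseq_SucI) (rule root_bound_mono)
  then have "convergent root_bound"
    by (rule incseq_convergent[of root_bound 1, THEN exE]) (use root_bound_range in \<open>auto simp: convergent_def\<close>)
  then show ?thesis by (rule convergent_Cauchy)
qed

lemma root_seq_commute:
  "d * T = T * d \<Longrightarrow> d * root_seq T n = root_seq T n * d"
proof (induction n)
  case (Suc n)
  have "d * (root_seq T n * root_seq T n) = (root_seq T n * root_seq T n) * d"
    using Suc by (metis mult.assoc)
  then show ?case using Suc by (simp add: distrib_left distrib_right)
qed simp

lemma root_seq_commute2: "root_seq T m * root_seq T n = root_seq T n * root_seq T m"
  by (rule root_seq_commute) (rule root_seq_commute[symmetric, OF HOL.refl])

lemma root_seq_norm:
  assumes "norm T \<le> 1" shows "norm (root_seq T n) \<le> root_bound n"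
proof (induction n)
  case (Suc n)
  have "norm (T + root_seq T n * root_seq T n) \<le> 1 + root_bound n * root_bound n"
    by (rule norm_triangle_mono[OF assms order_trans[OF norm_mult_ineq]])
       (use Suc root_bound_range in \<open>auto intro!: mult_mono\<close>)
  then show ?case by (simp add: power2_eq_square)
qed simp

lemma root_seq_step:
  assumes "norm T \<le> 1"
  shows "norm (root_seq T (Suc n) - root_seq T n) \<le> root_bound (Suc n) - root_bound n"
proof (induction n)
  case 0 then show ?case using assms by simp
next
  case (Suc n)
  let ?x = "root_seq T (Suc n)" and ?y = "root_seq T n"
  have eq: "root_seq T (Suc (Suc n)) - ?x = scaleR (1/2) ((?x + ?y) * (?x - ?y))"
  proof -
    have "(?x + ?y) * (?x - ?y) = ?x * ?x - ?y * ?y"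
      using root_seq_commute2[of T "Suc n" n] by (simp only: ring_distribs) simp
    moreover have "root_seq T (Suc (Suc n)) - ?x = scaleR (1/2) (?x * ?x - ?y * ?y)"
      by (simp only: root_seq.simps(2)[of T "Suc n"], subst (3) root_seq.simps(2)) (simp add: scaleR_diff_right[symmetric] del: root_seq.simps)
    ultimately show ?thesis by simp
  qed
  have "norm (?x + ?y) \<le> root_bound (Suc n) + root_bound n"
    by (rule norm_triangle_mono) (rule root_seq_norm[OF assms])+
  then have "norm ((?x + ?y) * (?x - ?y)) \<le> (root_bound (Suc n) + root_bound n) * (root_bound (Suc n) - root_bound n)"
    by (intro order_trans[OF norm_mult_ineq] mult_mono Suc) (use root_bound_range[of n] root_bound_range[of "Suc n"] in auto)
  also have "\<dots> = 2 * (root_bound (Suc (Suc n)) - root_bound (Suc n))"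
  proof -
    have "(x + y) * (x - y) = 2 * (z - x)" if "2 * z = 1 + x\<^sup>2" "2 * x = 1 + y\<^sup>2" for x y z :: real
    proof -
      have "(x + y) * (x - y) = x\<^sup>2 - y\<^sup>2" by (simp add: algebra_simps power2_eq_square)
      also have "\<dots> = 2 * z - 2 * x" unfolding that by simp
      finally show ?thesis by simp
    qed
    moreover have "2 * root_bound (Suc k) = 1 + (root_bound k)\<^sup>2" for k by simp
    ultimately show ?thesis by metis
  qed
  finally show ?case by (simp only: eq norm_scaleR) (simp del: root_seq.simps root_bound.simps)
qed

text \<open>The iterates are polynomials in $T$, so whatever commutes with $T$ commutes with the
  limit.\<close>

lemma ex_root_complement:
  fixes T :: "'a::{real_normed_algebra,banach}"
  assumes "norm T \<le> 1"
  shows "\<exists>y. norm y \<le> 1 \<and> y + y = T + y * y \<and> (\<forall>d. d * T = T * d \<longrightarrow> d * y = y * d) \<and> root_seq T \<longlonglongrightarrow> y"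
proof -
  have diff: "norm (root_seq T (n + k) - root_seq T n) \<le> root_bound (n + k) - root_bound n" for n k
  proof (induction k)
    case (Suc k)
    have "norm (root_seq T (n + Suc k) - root_seq T n)
        \<le> norm (root_seq T (Suc (n + k)) - root_seq T (n + k)) + norm (root_seq T (n + k) - root_seq T n)"
      using norm_triangle_ineq[of "root_seq T (Suc (n + k)) - root_seq T (n + k)" "root_seq T (n + k) - root_seq T n"]
      by (simp del: root_seq.simps)
    then show ?case using Suc root_seq_step[OF assms, of "n + k"] by (simp del: root_seq.simps root_bound.simps)
  qed simp
  have "Cauchy (root_seq T)"
  proof (rule CauchyI)
    fix e :: real assume "0 < e"
    then obtain M where M: "\<And>m n. m \<ge> M \<Longrightarrow> n \<ge> M \<Longrightarrow> norm (root_bound m - root_bound n) < e"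
      using root_bound_Cauchy by (meson CauchyD)
    have le: "norm (root_seq T m - root_seq T n) < e" if "M \<le> n" "n \<le> m" for m n
    proof -
      have "root_bound m - root_bound n < e" using M[of m n] that by simp
      then show ?thesis using diff[of n "m - n"] that by simp
    qed
    have "norm (root_seq T m - root_seq T n) < e" if "M \<le> n" "M \<le> m" for m n
      using that le[of n m] le[of m n] by (cases "n \<le> m") (simp_all add: norm_minus_commute)
    then show "\<exists>M. \<forall>m\<ge>M. \<forall>n\<ge>M. norm (root_seq T m - root_seq T n) < e" by blast
  qed
  then obtain y where y: "root_seq T \<longlonglongrightarrow> y" using Cauchy_convergent convergent_def by blast
  have "norm (root_seq T n) \<le> 1" for n
    using root_seq_norm[OF assms, of n] root_bound_range[of n] by linarith
  then have 1: "norm y \<le> 1"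
    by (intro tendsto_upperbound[OF tendsto_norm[OF y]]) auto
  have "(\<lambda>n. root_seq T (Suc n)) \<longlonglongrightarrow> scaleR (1/2) (T + y * y)"
    by (simp only: root_seq.simps) (intro tendsto_intros y)
  then have "y = scaleR (1/2) (T + y * y)"
    using y LIMSEQ_Suc LIMSEQ_unique by blast
  then have "scaleR 2 y = scaleR 2 (scaleR (1/2) (T + y * y))" by (rule arg_cong)
  then have 2: "y + y = T + y * y" by (simp add: scaleR_2)
  have 3: "d * y = y * d" if "d * T = T * d" for d
  proof -
    have "(\<lambda>n. d * root_seq T n) \<longlonglongrightarrow> d * y" "(\<lambda>n. root_seq T n * d) \<longlonglongrightarrow> y * d"
      by (intro tendsto_intros y)+
    then show ?thesis using root_seq_commute[OF that] LIMSEQ_unique by simp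
  qed
  show ?thesis using 1 2 3 y by blast
qed

lemma ex_root_complement_star:
  fixes T :: "'a::cstar_algebra"
  assumes "norm T \<le> 1" "star T = T"
  shows "\<exists>y. norm y \<le> 1 \<and> y + y = T + y * y \<and> (\<forall>d. d * T = T * d \<longrightarrow> d * y = y * d) \<and> star y = y"
proof -
  from ex_root_complement[OF assms(1)]
  obtain y where y: "norm y \<le> 1 \<and> y + y = T + y * y \<and> (\<forall>d. d * T = T * d \<longrightarrow> d * y = y * d) \<and> root_seq T \<longlonglongrightarrow> y"
    by (rule exE)
  have "star (root_seq T n) = root_seq T n" for n
    by (induction n) (simp_all add: star_add star_mult star_scaleR assms)
  then have "root_seq T \<longlonglongrightarrow> star y"
    using bounded_linear.tendsto[OF bounded_linear_star, of "root_seq T" y] y by simp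
  with y have "star y = y" by (meson LIMSEQ_unique)
  show ?thesis
    by (intro exI[of _ y] conjI; (rule y[THEN conjunct1] y[THEN conjunct2, THEN conjunct1]
      y[THEN conjunct2, THEN conjunct2, THEN conjunct1] \<open>star y = y\<close>))
qed

section \<open>Positive elements of unital $C^*$-algebras\<close>

text \<open>For a selfadjoint element the norm condition expresses that the spectrum is
  nonnegative, but sums, multiples and limits are handled by the triangle inequality
  alone.\<close>

definition pos_elem :: "'a::unital_cstar_algebra \<Rightarrow> bool" where
  "pos_elem a \<longleftrightarrow> star a = a \<and> (\<exists>t\<ge>0. norm (of_real t - a) \<le> t)"

lemma pos_elem_zero [simp]: "pos_elem 0" unfolding pos_elem_def by auto

lemma pos_elem_one [simp]: "pos_elem 1" unfolding pos_elem_def by (auto intro!: exI[of _ 1])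

lemma pos_elem_star: "pos_elem a \<Longrightarrow> star a = a" unfolding pos_elem_def by simp

lemma pos_elem_add: assumes "pos_elem a" "pos_elem b" shows "pos_elem (a + b)"
proof -
  obtain s t where st: "s \<ge> 0" "norm (of_real s - a) \<le> s" "t \<ge> 0" "norm (of_real t - b) \<le> t"
    using assms unfolding pos_elem_def by blast
  have "norm ((of_real s - a) + (of_real t - b)) \<le> s + t"
    by (rule norm_triangle_mono) (rule st)+
  then have "norm (of_real (s + t) - (a + b)) \<le> s + t" by (simp add: algebra_simps)
  then show ?thesis using st assms unfolding pos_elem_def
    by (auto simp: star_add intro!: exI[of _ "s + t"])
qed

lemma pos_elem_scaleR: assumes "pos_elem a" "r \<ge> 0" shows "pos_elem (scaleR r a)"
proof -
  obtain s where s: "s \<ge> 0" "norm (of_real s - a) \<le> s"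
    using assms unfolding pos_elem_def by blast
  have "of_real (r * s) - scaleR r a = scaleR r (of_real s - a)"
    by (simp add: scaleR_diff_right of_real_def)
  then have "norm (of_real (r * s) - scaleR r a) \<le> r * s" using assms s by (simp add: mult_left_mono)
  then show ?thesis using s assms unfolding pos_elem_def
    by (auto simp: star_scaleR intro!: exI[of _ "r * s"])
qed

text \<open>If $t>0$ is as in the definition of positivity, $a/t=1-T$ with $T$ of norm at most
  one, and the iteration applies to $T$.\<close>

lemma pos_elem_sqrt:
  assumes "pos_elem a"
  obtains k where "pos_elem k" "k * k = a" "\<And>d. d * a = a * d \<Longrightarrow> d * k = k * d"
proof -
  obtain t where t: "t \<ge> 0" "norm (of_real t - a) \<le> t"
    using assms unfolding pos_elem_def by blast
  show ?thesis
  proof (cases "t = 0")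
    case True
    then have "a = 0" using t by simp
    then show ?thesis using that[of 0] by simp
  next
    case False
    define T where "T = 1 - scaleR (1/t) a"
    have "T = scaleR (1/t) (of_real t - a)"
      using False by (simp add: T_def scaleR_diff_right) (simp add: of_real_def)
    then have "norm T = (1/t) * norm (of_real t - a)" using t by (simp only: norm_scaleR) simp
    then have "norm T \<le> (1/t) * t" using t by (auto intro!: mult_left_mono)
    then have "norm T \<le> 1" using False by simp
    moreover have "star T = T" using assms by (simp add: T_def star_diff star_scaleR pos_elem_star)
    ultimately obtain y where y: "norm y \<le> 1" "y + y = T + y * y" "\<And>d. d * T = T * d \<Longrightarrow> d * y = y * d" "star y = y"
      using ex_root_complement_star[of T] by metis
    define k where "k = scaleR (sqrt t) (1 - y)"
    have "scaleR t ((1 - y) * (1 - y)) = scaleR t (1 - T)"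
      using y(2) by (simp add: algebra_simps)
    then have "k * k = a" using t False by (simp add: k_def T_def)
    moreover have "d * k = k * d" if "d * a = a * d" for d
    proof -
      have "d * T = T * d" using that by (simp add: T_def algebra_simps)
      then have "d * y = y * d" by (rule y)
      then show ?thesis by (simp add: k_def algebra_simps)
    qed
    moreover have "pos_elem k"
    proof -
      have "of_real (sqrt t) - k = scaleR (sqrt t) y"
        by (simp add: k_def scaleR_diff_right of_real_def)
      then have "norm (of_real (sqrt t) - k) \<le> sqrt t" using y(1) t by (simp add: mult_left_le)
      moreover have "star k = k" using y(4) by (simp add: k_def star_scaleR star_diff)
      ultimately show ?thesis using t unfolding pos_elem_def by (auto intro!: exI[of _ "sqrt t"])
    qed
    ultimately show ?thesis using that by blast
  qed
qed

text \<open>The element $u=k+ic$ satisfies $u^*u=1$, so it has norm one, and $2k=u+u^*$,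
  $2(k^2-c^2)=u^2+(u^*)^2$.\<close>

lemma commuting_squares_sum_one:
  fixes k c :: "'a::unital_cstar_algebra"
  assumes "star k = k" "star c = c" "k * c = c * k" "k * k + c * c = 1"
  shows "norm k \<le> 1" "norm (k * k - c * c) \<le> 1"
proof -
  define u where "u = k + scaleC \<i> c"
  have su: "star u = k - scaleC \<i> c"
    by (simp add: u_def star_add star_scaleC assms scaleC_minus_left)
  have ii: "scaleC \<i> (scaleC \<i> x) = - x" for x :: 'a
    using scaleC_scaleC[of \<i> \<i> x] scaleC_minus_left[of 1 x] scaleC_one[of x] by simp
  have "star u * u = 1"
    unfolding su unfolding u_def using assms(3,4)
    by (simp add: algebra_simps scaleC_mult_left scaleC_mult_right ii scaleC_diff_right scaleC_add_right)
  then have "(norm u)\<^sup>2 = 1" using cstar_identity[of u] by simp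
  then have nu: "norm u = 1" using power2_eq_iff_nonneg[of "norm u" 1] by simp
  then have nsu: "norm (star u) = 1" by (simp add: norm_star)
  have "k + k = u + star u" unfolding su unfolding u_def by simp
  then have "2 * norm k \<le> 2"
    using norm_triangle_ineq[of u "star u"] nu nsu norm_scaleR[of 2 k] by (simp add: scaleR_2)
  then show "norm k \<le> 1" by simp
  have "(k * k - c * c) + (k * k - c * c) = u * u + star u * star u"
    unfolding su unfolding u_def using assms(3)
    by (simp add: algebra_simps scaleC_mult_left scaleC_mult_right ii scaleC_diff_right scaleC_add_right)
  moreover have "norm (u * u) \<le> 1" "norm (star u * star u) \<le> 1"
    using norm_mult_ineq[of u u] norm_mult_ineq[of "star u" "star u"] nu nsu by auto
  ultimately have "norm (scaleR 2 (k * k - c * c)) \<le> 2"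
    using norm_triangle_ineq[of "u * u" "star u * star u"] by (simp add: scaleR_2)
  then show "norm (k * k - c * c) \<le> 1" by simp
qed

text \<open>With $c$ the square root of $1-k^2$, the preceding lemma bounds $c^2-k^2$, and
  $2(1-k^2)=1+(c^2-k^2)$.\<close>

lemma norm_one_minus_square:
  fixes k :: "'a::unital_cstar_algebra"
  assumes "star k = k" "norm k \<le> 1" shows "norm (1 - k * k) \<le> 1"
proof -
  have "norm (k * k) \<le> 1" using norm_square[OF assms(1)] assms(2) by (simp add: power_le_one)
  moreover have "star (k * k) = k * k" by (simp add: star_mult assms)
  ultimately obtain y where y: "y + y = k * k + y * y" "\<And>d. d * (k * k) = k * k * d \<Longrightarrow> d * y = y * d" "star y = y"
    using ex_root_complement_star[of "k * k"] by metis
  define c where "c = 1 - y"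
  have cc: "c * c = 1 - k * k" using y(1) by (simp add: c_def algebra_simps)
  have "k * y = y * k" by (rule y) (simp add: mult.assoc)
  then have "norm (k * k - c * c) \<le> 1"
    by (intro commuting_squares_sum_one(2)) (auto simp: c_def assms y star_diff algebra_simps cc[unfolded c_def, simplified algebra_simps])
  then have "norm (1 + (c * c - k * k)) \<le> 1 + 1"
    using norm_triangle_ineq[of 1 "c * c - k * k"] by (simp add: norm_minus_commute)
  moreover have "1 + (c * c - k * k) = scaleR 2 (1 - k * k)" by (simp add: cc scaleR_2 algebra_simps)
  ultimately show ?thesis by simp
qed

lemma pos_elem_square: assumes "star k = k" shows "pos_elem (k * k)"
proof (cases "k = 0")
  case False
  define k' where "k' = scaleR (1 / norm k) k"
  have "norm (1 - k' * k') \<le> 1"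
    by (rule norm_one_minus_square) (auto simp: k'_def star_scaleR assms)
  then have "pos_elem (k' * k')" unfolding pos_elem_def
    by (auto intro!: exI[of _ 1] simp: star_mult k'_def star_scaleR assms)
  then have "pos_elem (scaleR ((norm k)\<^sup>2) (k' * k'))" by (rule pos_elem_scaleR) simp
  then show ?thesis using False by (simp add: k'_def power2_eq_square)
qed simp

lemma pos_elem_norm_le_one:
  assumes "pos_elem a" "pos_elem (1 - a)" shows "norm a \<le> 1"
proof -
  obtain k where k: "pos_elem k" "k * k = a" "\<And>d. d * a = a * d \<Longrightarrow> d * k = k * d"
    using pos_elem_sqrt[OF assms(1)] by metis
  obtain c where c: "pos_elem c" "c * c = 1 - a" "\<And>d. d * (1 - a) = (1 - a) * d \<Longrightarrow> d * c = c * d"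
    using pos_elem_sqrt[OF assms(2)] by metis
  have "k * a = a * k" by (simp add: k(2)[symmetric] mult.assoc)
  then have "k * c = c * k" by (intro c(3)) (simp add: algebra_simps)
  then have "norm k \<le> 1"
    by (intro commuting_squares_sum_one(1)[of k c]) (auto simp: k c pos_elem_star)
  then show ?thesis using norm_square[OF pos_elem_star[OF k(1)]] k(2) by (simp add: power_le_one)
qed

lemma pos_elem_norm_complement: "star d = d \<Longrightarrow> norm d \<le> t \<Longrightarrow> pos_elem (of_real t - d)"
  unfolding pos_elem_def by (auto simp: star_diff of_real_def star_scaleR intro!: exI[of _ t] order_trans[OF norm_ge_zero])

lemma pos_elem_norm_mono:
  assumes "pos_elem a" "pos_elem b" shows "norm a \<le> norm (a + b)"
proof (rule dense_ge)
  fix t assume t: "norm (a + b) < t"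
  then have "t > 0" using norm_ge_zero[of "a + b"] by linarith
  have "pos_elem (of_real t - (a + b))"
    by (rule pos_elem_norm_complement) (use assms t in \<open>auto simp: star_add pos_elem_star\<close>)
  then have "pos_elem ((of_real t - (a + b)) + b)" using assms(2) by (rule pos_elem_add)
  then have "pos_elem (of_real t - a)" by (simp add: algebra_simps)
  then have "pos_elem (scaleR (1/t) (of_real t - a))" by (rule pos_elem_scaleR) (use \<open>t > 0\<close> in simp)
  moreover have "scaleR (1/t) (of_real t - a) = 1 - scaleR (1/t) a"
    using \<open>t > 0\<close> by (simp add: scaleR_diff_right of_real_def)
  ultimately have "norm (scaleR (1/t) a) \<le> 1"
    using pos_elem_norm_le_one[of "scaleR (1/t) a"] pos_elem_scaleR[OF assms(1), of "1/t"] \<open>t > 0\<close> by simp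
  then show "norm a \<le> t" using \<open>t > 0\<close> by (simp add: field_simps)
qed

lemma pos_elem_commuting_mult:
  assumes "pos_elem a" "pos_elem b" "a * b = b * a" shows "pos_elem (a * b)"
proof -
  obtain k where k: "pos_elem k" "k * k = a" "\<And>d. d * a = a * d \<Longrightarrow> d * k = k * d"
    using pos_elem_sqrt[OF assms(1)] by metis
  obtain c where c: "pos_elem c" "c * c = b" "\<And>d. d * b = b * d \<Longrightarrow> d * c = c * d"
    using pos_elem_sqrt[OF assms(2)] by metis
  have "b * k = k * b" using assms(3) by (intro k(3)) simp
  then have kc: "k * c = c * k" by (intro c(3)) simp
  have "a * b = (k * c) * (k * c)" using kc unfolding k(2)[symmetric] c(2)[symmetric] by (metis mult.assoc)
  moreover have "star (k * c) = k * c" using kc by (simp add: star_mult pos_elem_star k c)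
  ultimately show ?thesis by (simp add: pos_elem_square)
qed

lemma pos_elem_iff_norm: "pos_elem a \<longleftrightarrow> star a = a \<and> norm (of_real (norm a) - a) \<le> norm a"
proof
  assume a: "pos_elem a"
  show "star a = a \<and> norm (of_real (norm a) - a) \<le> norm a"
  proof (cases "a = 0")
    case False
    obtain k where k: "pos_elem k" "k * k = scaleR (1 / norm a) a"
      using pos_elem_sqrt[OF pos_elem_scaleR[OF a, of "1 / norm a"]] by (metis norm_ge_zero zero_le_divide_1_iff)
    have "(norm k)\<^sup>2 = 1" using norm_square[OF pos_elem_star[OF k(1)]] k(2) False by simp
    then have "norm k \<le> 1" using power2_eq_iff_nonneg[of "norm k" 1] by simp
    then have "norm (1 - scaleR (1 / norm a) a) \<le> 1" using norm_one_minus_square[of k] k pos_elem_star by metis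
    moreover have "of_real (norm a) - a = scaleR (norm a) (1 - scaleR (1 / norm a) a)"
      using False by (simp add: scaleR_diff_right of_real_def)
    ultimately have "norm (of_real (norm a) - a) \<le> norm a" by (simp add: mult_left_le)
    then show ?thesis using a pos_elem_star by blast
  qed simp
next
  assume "star a = a \<and> norm (of_real (norm a) - a) \<le> norm a"
  then show "pos_elem a" unfolding pos_elem_def by (intro conjI exI[of _ "norm a"]) simp_all
qed

lemma pos_elem_closed: assumes "s \<longlonglongrightarrow> l" "\<And>n::nat. pos_elem (s n)" shows "pos_elem l"
proof -
  have "(\<lambda>n. star (s n)) \<longlonglongrightarrow> star l" by (rule bounded_linear.tendsto[OF bounded_linear_star assms(1)])
  then have "star l = l" using assms pos_elem_star LIMSEQ_unique by (metis (no_types, lifting) ext)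
  moreover have "norm (of_real (norm l) - l) \<le> norm l"
  proof (rule tendsto_le[OF trivial_limit_sequentially tendsto_norm[OF assms(1)]])
    show "(\<lambda>n. norm (of_real (norm (s n)) - s n)) \<longlonglongrightarrow> norm (of_real (norm l) - l)"
      by (intro tendsto_intros assms(1))
  qed (use assms(2) in \<open>simp add: pos_elem_iff_norm\<close>)
  ultimately show ?thesis by (simp add: pos_elem_iff_norm)
qed

text \<open>Normalize $x$ to $z$ of norm one and put $q=-z^*z$ and $w=zz^*$. Since $z^*z+zz^*$
  is half a sum of squares of selfadjoint elements and $q$ is positive, $w$ is positive. Now
  $(1+q)^nz^*=z^*(1-w)^n$ shows that $(1+q)^nq$ stays bounded, while it dominates $nq^2$; hence
  $q^2=0$. This replaces the comparison of the spectra of $z^*z$ and $zz^*$.\<close>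

lemma neg_square_zero:
  fixes x :: "'a::unital_cstar_algebra"
  assumes "pos_elem (- (star x * x))" shows "x = 0"
proof (rule ccontr)
  assume "x \<noteq> 0"
  define z where "z = scaleR (1 / norm x) x"
  have nz: "norm z = 1" using \<open>x \<noteq> 0\<close> by (simp add: z_def)
  define q where "q = - (star z * z)"
  have "q = scaleR ((1 / norm x) * (1 / norm x)) (- (star x * x))"
    by (simp add: q_def z_def star_scaleR)
  then have q: "pos_elem q" using pos_elem_scaleR[OF assms, of "(1 / norm x) * (1 / norm x)"] by simp
  define w where "w = z * star z"
  have w: "pos_elem w"
  proof -
    define h where "h = z + star z"
    define k where "k = scaleC \<i> (z - star z)"
    have ii: "scaleC \<i> (scaleC \<i> y) = - y" for y :: 'a
      using scaleC_scaleC[of \<i> \<i> y] scaleC_minus_left[of 1 y] scaleC_one[of y] by simp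
    have "star h = h" "star k = k"
      by (simp_all add: h_def k_def star_add star_diff star_star star_scaleC scaleC_minus_left scaleC_diff_right)
    then have "pos_elem (h * h + k * k)" by (intro pos_elem_add pos_elem_square)
    moreover have "h * h + k * k = scaleR 2 (star z * z + z * star z)"
      by (simp add: h_def k_def algebra_simps scaleC_mult_left scaleC_mult_right ii scaleC_diff_right scaleR_2)
    ultimately have "pos_elem (scaleR (1/2) (scaleR 2 (star z * z + z * star z)))"
      by (intro pos_elem_scaleR[of _ "1/2"]) auto
    then have "pos_elem ((star z * z + z * star z) + q)" using pos_elem_add[of "star z * z + z * star z" q] q by simp
    then show ?thesis by (simp add: q_def w_def)
  qed
  have "norm w \<le> 1" using norm_mult_ineq[of z "star z"] nz by (simp add: w_def norm_star)
  obtain r where r: "pos_elem r" "r * r = w" using pos_elem_sqrt[OF w] by metis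
  have "(norm r)\<^sup>2 \<le> 1\<^sup>2" using norm_square[OF pos_elem_star[OF r(1)]] r(2) \<open>norm w \<le> 1\<close> by simp
  then have "norm r \<le> 1" by (rule power2_le_imp_le) simp
  then have nw: "norm (1 - w) \<le> 1" using norm_one_minus_square[of r] r pos_elem_star by metis
  have swap: "(1 + q) ^ n * star z = star z * (1 - w) ^ n" for n
  proof (induction n)
    case (Suc n)
    have "(1 + q) ^ Suc n * star z = (1 + q) * (star z * (1 - w) ^ n)" using Suc by (simp add: mult.assoc)
    also have "\<dots> = (star z * (1 - w)) * (1 - w) ^ n"
      by (simp add: q_def w_def algebra_simps)
    finally show ?case by (simp add: mult.assoc)
  qed simp
  have bound: "norm ((1 + q) ^ n * q) \<le> 1" for n
  proof -
    have "norm ((1 - w) ^ n) \<le> 1"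
      using norm_power_ineq[of "1 - w" n] power_le_one[OF norm_ge_zero nw, of n] by linarith
    then have "norm (star z * (1 - w) ^ n) \<le> 1"
      using norm_mult_ineq[of "star z" "(1 - w) ^ n"] nz by (simp add: norm_star)
    then have "norm (((1 + q) ^ n * star z) * z) \<le> 1"
      using norm_mult_ineq[of "(1 + q) ^ n * star z" z] nz by (simp add: swap)
    then show ?thesis by (simp add: q_def mult.assoc)
  qed
  have comm: "(1 + q) ^ n * q = q * (1 + q) ^ n" for n
    by (metis add.commute distrib_left distrib_right mult.left_neutral mult.right_neutral power_commuting_commutes)
  \<comment> \<open>A binomial estimate: the higher powers of $q$ in $(1+q)^nq$ are
    positive.\<close>
  have pp: "pos_elem ((1 + q) ^ n * q - scaleR (real n) (q * q) - q)" for n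
  proof (induction n)
    case (Suc n)
    define D where "D = (1 + q) ^ n * q - scaleR (real n) (q * q) - q"
    have "D * (1 + q) = (1 + q) * D"
      using comm[of n] by (simp add: D_def algebra_simps)
    then have "pos_elem (D * (1 + q))"
      using Suc by (intro pos_elem_commuting_mult pos_elem_add q pos_elem_one) (simp add: D_def)
    moreover have "pos_elem (scaleR (real n) (q * q * q))"
      by (intro pos_elem_scaleR pos_elem_commuting_mult q) (simp_all add: mult.assoc)
    ultimately have "pos_elem (D * (1 + q) + scaleR (real n) (q * q * q))" by (rule pos_elem_add)
    moreover have "(1 + q) ^ Suc n * q = (1 + q) ^ n * q * (1 + q)"
      by (simp add: power_Suc2 mult.assoc distrib_left distrib_right del: power_Suc)
    ultimately show ?case
      by (simp add: D_def algebra_simps del: power_Suc)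
  qed simp
  have "real n * norm (q * q) \<le> 1" for n
  proof -
    have "norm (scaleR (real n) (q * q)) \<le> norm (scaleR (real n) (q * q) + (((1 + q) ^ n * q - scaleR (real n) (q * q) - q) + q))"
      by (intro pos_elem_norm_mono pos_elem_add pp q pos_elem_scaleR pos_elem_commuting_mult) simp_all
    then show ?thesis using bound[of n] by simp
  qed
  then have "\<not> 0 < norm (q * q)"
    using reals_Archimedean3[of "norm (q * q)"] by (metis not_le)
  then have "norm (q * q) = 0" by simp
  then have "q = 0" using norm_square[OF pos_elem_star[OF q]] by simp
  then have "star z * z = 0" by (simp add: q_def)
  then show False using cstar_identity[of z] nz by simp
qed

text \<open>Compare $a=b^*b$ with its absolute value $m$, the square root of $a^2$. For $p=m-a$,
  twice the negative part of $a$, the element $x=bp$ has $x^*x=pap=-p^2m$, so $x=0$ by the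
  preceding lemma, and then $p=0$.\<close>

lemma pos_elem_star_mult: "pos_elem (star b * b)" for b :: "'a::unital_cstar_algebra"
proof -
  define a where "a = star b * b"
  have sa: "star a = a" by (simp add: a_def star_mult star_star)
  obtain m where m: "pos_elem m" "m * m = a * a" "\<And>d. d * (a * a) = (a * a) * d \<Longrightarrow> d * m = m * d"
    using pos_elem_sqrt[OF pos_elem_square[OF sa]] by metis
  have am: "a * m = m * a" by (rule m(3)) (simp add: mult.assoc)
  define p where "p = m - a"
  have sp: "star p = p" by (simp add: p_def star_diff sa pos_elem_star m)
  have pa: "p * a = - (p * m)" using m(2) am by (simp add: p_def algebra_simps)
  have ppm: "p * p = scaleR 2 (p * m)"
    using pa by (simp add: p_def[symmetric] scaleR_2) (simp add: p_def algebra_simps)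
  have pm: "p * m = m * p" using am by (simp add: p_def algebra_simps)
  define x where "x = b * p"
  have xx: "star x * x = - (p * p * m)"
  proof -
    have "star x * x = p * a * p" by (simp add: x_def a_def star_mult sp mult.assoc)
    also have "\<dots> = - (p * (m * p))" by (simp add: pa mult.assoc)
    finally show ?thesis by (simp add: pm[symmetric] mult.assoc)
  qed
  have "(p * p) * m = m * (p * p)" using pm by (metis mult.assoc)
  then have "pos_elem (p * p * m)" by (intro pos_elem_commuting_mult[of "p * p" m] pos_elem_square sp m(1))
  then have "x = 0" using neg_square_zero[of x] by (simp add: xx)
  then have "p * p * m = 0" using xx by simp
  then have "(p * p) * (p * p) = 0"
    using ppm by (metis mult.assoc mult_zero_right scaleR_zero_right mult_scaleR_right)
  then have "(norm (p * p))\<^sup>2 = 0" using norm_square[of "p * p"] sp by (simp add: star_mult)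
  then have "(norm p)\<^sup>2 = 0" using norm_square[OF sp] by simp
  then have "m = a" by (simp add: p_def)
  then show ?thesis using m(1) by (simp add: a_def)
qed

section \<open>The unitization and the positive cone\<close>

text \<open>The norm of $\lambda+a$ is the larger one of $|\lambda|$ and the norm of left
  multiplication by $\lambda+a$ on $A$. The first number makes this a norm even if $A$ has a
  unit already.\<close>

datatype 'a unitization = Unitz (scl: complex) (elt: 'a)

definition unitz_act :: "'a::cstar_algebra unitization \<Rightarrow> 'a \<Rightarrow> 'a" where
  "unitz_act u x = scaleC (scl u) x + elt u * x"

lemma bounded_linear_unitz_act: "bounded_linear (unitz_act u)"
proof (rule bounded_linear_intro[where K="cmod (scl u) + norm (elt u)"])
  show "unitz_act u (x + y) = unitz_act u x + unitz_act u y" for x y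
    by (simp add: unitz_act_def scaleC_add_right algebra_simps)
  show "unitz_act u (scaleR r x) = scaleR r (unitz_act u x)" for r x
    by (simp add: unitz_act_def scaleR_eq_scaleC scaleC_scaleC scaleC_mult_right scaleC_add_right mult.commute)
  show "norm (unitz_act u x) \<le> norm x * (cmod (scl u) + norm (elt u))" for x
    using norm_triangle_ineq[of "scaleC (scl u) x" "elt u * x"] norm_mult_ineq[of "elt u" x]
    by (simp add: unitz_act_def norm_scaleC algebra_simps)
qed

lemma norm_unitz_act: "norm (unitz_act u x) \<le> onorm (unitz_act u) * norm x"
  by (rule onorm[OF bounded_linear_unitz_act])

instantiation unitization :: (cstar_algebra) real_normed_algebra_1
begin
definition "0 = Unitz 0 0"
definition "1 = Unitz 1 0"
definition "u + v = Unitz (scl u + scl v) (elt u + elt v)"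
definition "u - v = Unitz (scl u - scl v) (elt u - elt v)"
definition "- u = Unitz (- scl u) (- elt u)"
definition "u * v = Unitz (scl u * scl v) (scaleC (scl u) (elt v) + scaleC (scl v) (elt u) + elt u * elt v)"
definition "scaleR r (u::'a unitization) = Unitz (of_real r * scl u) (scaleR r (elt u))"
definition "norm (u::'a unitization) = max (cmod (scl u)) (onorm (unitz_act u))"
definition "dist (u::'a unitization) v = norm (u - v)"
definition "sgn (u::'a unitization) = scaleR (inverse (norm u)) u"
definition "(uniformity :: ('a unitization \<times> 'a unitization) filter) = (INF e\<in>{0 <..}. principal {(x, y). dist x y < e})"
definition "open (U :: 'a unitization set) = (\<forall>x\<in>U. eventually (\<lambda>(x', y). x' = x \<longrightarrow> y \<in> U) uniformity)"

lemma act_add: "unitz_act (u + v) = (\<lambda>x. unitz_act u x + unitz_act v x)"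
  by (simp add: fun_eq_iff unitz_act_def plus_unitization_def scaleC_add_left algebra_simps)
lemma act_scaleR: "unitz_act (scaleR r u) = (\<lambda>x. scaleR r (unitz_act u x))"
  by (simp add: fun_eq_iff unitz_act_def scaleR_unitization_def scaleR_eq_scaleC scaleC_add_right scaleC_scaleC scaleC_mult_left)
lemma act_mult: "unitz_act (u * v) = unitz_act u \<circ> unitz_act v"
  by (simp add: fun_eq_iff unitz_act_def times_unitization_def scaleC_add_right scaleC_scaleC algebra_simps
      scaleC_mult_left scaleC_mult_right)
lemma act_one: "unitz_act 1 = (\<lambda>x. x)"
  by (simp add: fun_eq_iff unitz_act_def one_unitization_def scaleC_one)

instance
proof
  fix u v w :: "'a unitization" and r s :: real
  show "dist u v = norm (u - v)" by (rule dist_unitization_def)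
  show "sgn u = inverse (norm u) *\<^sub>R u" by (rule sgn_unitization_def)
  show "(uniformity :: ('a unitization \<times> 'a unitization) filter) = (INF e\<in>{0 <..}. principal {(x, y). dist x y < e})"
    by (rule uniformity_unitization_def)
  show "open U = (\<forall>x\<in>U. eventually (\<lambda>(x', y). x' = x \<longrightarrow> y \<in> U) uniformity)" for U :: "'a unitization set"
    by (rule open_unitization_def)
  show "u + v + w = u + (v + w)" "u + v = v + u" "0 + u = u" "- u + u = 0" "u - v = u + - v"
    by (simp_all add: plus_unitization_def zero_unitization_def uminus_unitization_def minus_unitization_def add.assoc add.commute)
  show "r *\<^sub>R (u + v) = r *\<^sub>R u + r *\<^sub>R v" "(r + s) *\<^sub>R u = r *\<^sub>R u + s *\<^sub>R u"
    "r *\<^sub>R s *\<^sub>R u = (r * s) *\<^sub>R u" "1 *\<^sub>R u = u"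
    by (simp_all add: plus_unitization_def scaleR_unitization_def algebra_simps)
  show "u * v * w = u * (v * w)"
    by (simp add: times_unitization_def algebra_simps scaleC_add_right scaleC_scaleC scaleC_mult_left scaleC_mult_right)
  show "(u + v) * w = u * w + v * w" "u * (v + w) = u * v + u * w"
    by (simp_all add: times_unitization_def plus_unitization_def algebra_simps scaleC_add_right scaleC_add_left)
  show "r *\<^sub>R u * v = r *\<^sub>R (u * v)" "u * r *\<^sub>R v = r *\<^sub>R (u * v)"
    by (simp_all add: times_unitization_def scaleR_unitization_def algebra_simps scaleC_add_right scaleC_scaleC scaleR_eq_scaleC scaleC_mult_left scaleC_mult_right)
  show "1 * u = u" "u * 1 = u" by (simp_all add: times_unitization_def one_unitization_def scaleC_one)
  show "(0::'a unitization) \<noteq> 1" by (simp add: zero_unitization_def one_unitization_def)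
  show "norm (1 :: 'a unitization) = 1"
    using onorm_id_le[where 'a='a] by (simp add: norm_unitization_def act_one) (simp add: one_unitization_def)
  show "norm u = 0 \<longleftrightarrow> u = 0"
  proof
    assume u: "norm u = 0"
    then have s: "scl u = 0"
      using norm_ge_zero[of "scl u"] unfolding norm_unitization_def by (smt (verit) norm_eq_zero)
    have "onorm (unitz_act u) = 0"
      using u onorm_pos_le[OF bounded_linear_unitz_act[of u]] unfolding norm_unitization_def by (smt (verit) norm_ge_zero)
    then have "unitz_act u (star (elt u)) = 0" by (simp add: onorm_eq_0[OF bounded_linear_unitz_act])
    then have "star (star (elt u)) * star (elt u) = 0" using s by (simp add: unitz_act_def star_star)
    then have "elt u = 0" using cstar_identity[of "star (elt u)"] by (simp add: norm_star)
    then show "u = 0" using s by (simp add: zero_unitization_def unitization.expand)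
  next
    assume "u = 0"
    moreover have "unitz_act 0 = (\<lambda>x::'a. 0)" by (simp add: fun_eq_iff unitz_act_def zero_unitization_def)
    ultimately show "norm u = 0" by (simp add: norm_unitization_def onorm_zero) (simp add: zero_unitization_def)
  qed
  show "norm (u + v) \<le> norm u + norm v"
  proof -
    have "onorm (unitz_act (u + v)) \<le> onorm (unitz_act u) + onorm (unitz_act v)"
      unfolding act_add by (rule onorm_triangle) (rule bounded_linear_unitz_act)+
    moreover have "cmod (scl (u + v)) \<le> cmod (scl u) + cmod (scl v)"
      by (simp add: plus_unitization_def norm_triangle_ineq)
    ultimately show ?thesis unfolding norm_unitization_def by linarith
  qed
  show "norm (r *\<^sub>R u) = \<bar>r\<bar> * norm u"
    unfolding norm_unitization_def act_scaleR onorm_scaleR[OF bounded_linear_unitz_act]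
    by (simp add: scaleR_unitization_def norm_mult max_mult_distrib_left)
  show "norm (u * v) \<le> norm u * norm v"
  proof -
    have "onorm (unitz_act (u * v)) \<le> onorm (unitz_act u) * onorm (unitz_act v)"
      unfolding act_mult by (rule onorm_compose) (rule bounded_linear_unitz_act)+
    also have "\<dots> \<le> norm u * norm v"
      unfolding norm_unitization_def
      by (intro mult_mono max.cobounded2 onorm_pos_le bounded_linear_unitz_act) (simp add: le_max_iff_disj)
    moreover have "cmod (scl (u * v)) \<le> norm u * norm v"
      unfolding norm_unitization_def times_unitization_def unitization.sel norm_mult
      by (intro mult_mono max.cobounded1) (simp_all add: le_max_iff_disj)
    ultimately show ?thesis by (simp add: norm_unitization_def[of "u * v"])
  qed
qed
end

lemma norm_unitz_le: "norm (Unitz l a) \<le> cmod l + norm a"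
proof -
  have "norm (unitz_act (Unitz l a) x) \<le> (cmod l + norm a) * norm x" for x
    using norm_triangle_ineq[of "scaleC l x" "a * x"] norm_mult_ineq[of a x]
    by (simp add: unitz_act_def norm_scaleC algebra_simps)
  then have "onorm (unitz_act (Unitz l a)) \<le> cmod l + norm a" by (rule onorm_bound[rotated]) simp
  then show ?thesis by (simp add: norm_unitization_def)
qed

lemma norm_unitz_embed: "norm (Unitz 0 a) = norm a"
proof (rule antisym)
  show "norm (Unitz 0 a) \<le> norm a" using norm_unitz_le[of 0 a] by simp
  show "norm a \<le> norm (Unitz 0 a)"
  proof (cases "a = 0")
    case False
    have "norm a * norm a = norm (unitz_act (Unitz 0 a) (star a))"
      using cstar_identity[of "star a"] by (simp add: unitz_act_def star_star norm_star power2_eq_square)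
    also have "\<dots> \<le> norm (Unitz 0 a) * norm (star a)"
      by (rule order_trans[OF norm_unitz_act]) (intro mult_right_mono, auto simp: norm_unitization_def)
    finally show ?thesis using False by (simp add: norm_star)
  qed simp
qed

instance unitization :: (cstar_algebra) banach
proof
  fix X :: "nat \<Rightarrow> 'a unitization" assume X: "Cauchy X"
  have split: "Unitz 0 (elt u) = u - scaleR 1 (Unitz (scl u) 0)" for u :: "'a unitization"
    by (simp add: minus_unitization_def)
  have le1: "cmod (scl u) \<le> norm u" for u :: "'a unitization" by (simp add: norm_unitization_def)
  have le2: "norm (elt u) \<le> 2 * norm u" for u :: "'a unitization"
    using norm_triangle_ineq4[of u "Unitz (scl u) 0"] norm_unitz_le[of "scl u" "0::'a"] le1[of u] norm_unitz_embed[of "0::'a"]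
    unfolding norm_unitz_embed[of "elt u", symmetric] by (simp add: split)
  have "Cauchy (\<lambda>n. scl (X n))"
  proof (rule CauchyI)
    fix e :: real assume "0 < e"
    then obtain M where "\<And>m n. m \<ge> M \<Longrightarrow> n \<ge> M \<Longrightarrow> norm (X m - X n) < e" using X by (meson CauchyD)
    then show "\<exists>M. \<forall>m\<ge>M. \<forall>n\<ge>M. norm (scl (X m) - scl (X n)) < e"
      by (intro exI[of _ M]) (metis le1 le_less_trans minus_unitization_def unitization.sel(1))
  qed
  then obtain l where l: "(\<lambda>n. scl (X n)) \<longlonglongrightarrow> l" using Cauchy_convergent convergent_def by blast
  have "Cauchy (\<lambda>n. elt (X n))"
  proof (rule CauchyI)
    fix e :: real assume "0 < e"
    then obtain M where M: "\<And>m n. m \<ge> M \<Longrightarrow> n \<ge> M \<Longrightarrow> norm (X m - X n) < e / 2" using X by (meson CauchyD half_gt_zero)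
    have "norm (elt (X m) - elt (X n)) < e" if "m \<ge> M" "n \<ge> M" for m n
      using M[OF that] le2[of "X m - X n"] by (simp add: minus_unitization_def)
    then show "\<exists>M. \<forall>m\<ge>M. \<forall>n\<ge>M. norm (elt (X m) - elt (X n)) < e" by blast
  qed
  then obtain a where a: "(\<lambda>n. elt (X n)) \<longlonglongrightarrow> a" using Cauchy_convergent convergent_def by blast
  have lim: "(\<lambda>n. cmod (scl (X n) - l) + norm (elt (X n) - a)) \<longlonglongrightarrow> 0"
    by (intro tendsto_add_zero tendsto_norm_zero LIM_zero l a)
  have "(\<lambda>n. norm (X n - Unitz l a)) \<longlonglongrightarrow> 0"
    by (rule Lim_null_comparison[OF _ lim]) (simp add: minus_unitization_def norm_unitz_le)
  then have "X \<longlonglongrightarrow> Unitz l a" using LIM_zero_cancel tendsto_norm_zero_iff by blast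
  then show "convergent X" by (auto simp: convergent_def)
qed

instantiation unitization :: (cstar_algebra) unital_cstar_algebra
begin
definition "scaleC c (u::'a unitization) = Unitz (c * scl u) (scaleC c (elt u))"
definition "star (u::'a unitization) = Unitz (cnj (scl u)) (star (elt u))"

instance
proof
  fix u v :: "'a unitization" and c d :: complex and r :: real
  show "scaleC c (u + v) = scaleC c u + scaleC c v" "scaleC (c + d) u = scaleC c u + scaleC d u"
    "scaleC c (scaleC d u) = scaleC (c * d) u" "scaleC 1 u = u"
    by (simp_all add: scaleC_unitization_def plus_unitization_def scaleC_add_left scaleC_add_right scaleC_scaleC scaleC_one algebra_simps)
  show "r *\<^sub>R u = scaleC (complex_of_real r) u"
    by (simp add: scaleC_unitization_def scaleR_unitization_def scaleR_eq_scaleC)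
  show "star (star u) = u" by (simp add: star_unitization_def star_star)
  show "star (u + v) = star u + star v" by (simp add: star_unitization_def plus_unitization_def star_add)
  show "star (scaleC c u) = scaleC (cnj c) (star u)"
    by (simp add: star_unitization_def scaleC_unitization_def star_scaleC)
  show sm: "star (u * v) = star v * star u" for u v :: "'a unitization"
    by (simp add: star_unitization_def times_unitization_def star_add star_scaleC star_mult add.commute add.left_commute)
  show "scaleC c u * v = scaleC c (u * v)" "u * scaleC c v = scaleC c (u * v)"
    by (simp_all add: scaleC_unitization_def times_unitization_def scaleC_add_right scaleC_scaleC scaleC_mult_left scaleC_mult_right mult.commute mult.left_commute)
  have acts: "unitz_act (scaleC c u) x = scaleC c (unitz_act u x)" for c and u :: "'a unitization" and x
    by (simp add: unitz_act_def scaleC_unitization_def scaleC_add_right scaleC_scaleC scaleC_mult_left)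
  show "norm (scaleC c u) = cmod c * norm u"
  proof -
    have *: "norm (unitz_act (scaleC c u) x) = norm (unitz_act (scaleR (cmod c) u) x)" for x
      by (simp add: acts norm_scaleC act_scaleR)
    have "onorm (unitz_act (scaleC c u)) = onorm (unitz_act (scaleR (cmod c) u))"
      unfolding onorm_def * ..
    then have "norm (scaleC c u) = norm (scaleR (cmod c) u)"
      by (simp add: norm_unitization_def) (simp add: scaleC_unitization_def scaleR_unitization_def norm_mult)
    then show ?thesis by simp
  qed
  have ss: "star (star u) = u" for u :: "'a unitization" by (simp add: star_unitization_def star_star)
  have le: "(norm u)\<^sup>2 \<le> norm (star u * u)" for u :: "'a unitization"
  proof -
    have "norm (unitz_act u x) \<le> sqrt (norm (star u * u)) * norm x" for x
    proof -
      have "star (unitz_act u x) * unitz_act u x = star x * unitz_act (star u) (unitz_act u x)"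
        by (simp add: unitz_act_def star_unitization_def star_add star_scaleC star_mult scaleC_mult_left scaleC_mult_right scaleC_add_right scaleC_scaleC algebra_simps)
      also have "\<dots> = star x * unitz_act (star u * u) x" by (simp add: act_mult)
      finally have "(norm (unitz_act u x))\<^sup>2 = norm (star x * unitz_act (star u * u) x)"
        by (simp add: cstar_identity[symmetric])
      also have "\<dots> \<le> norm x * (norm (star u * u) * norm x)"
        by (intro order_trans[OF norm_mult_ineq] mult_mono order_trans[OF norm_unitz_act mult_right_mono])
          (auto simp: norm_star norm_unitization_def[of "star u * u"])
      finally have "sqrt ((norm (unitz_act u x))\<^sup>2) \<le> sqrt (norm (star u * u) * (norm x)\<^sup>2)"
        by (intro real_sqrt_le_mono) (simp add: power2_eq_square algebra_simps)
      then show ?thesis by (simp add: real_sqrt_mult)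
    qed
    then have "onorm (unitz_act u) \<le> sqrt (norm (star u * u))" by (rule onorm_bound[rotated]) simp
    moreover have "cmod (scl u) \<le> sqrt (norm (star u * u))"
    proof (rule real_le_rsqrt)
      have "(cmod (scl u))\<^sup>2 = cmod (scl (star u * u))"
        by (simp add: star_unitization_def times_unitization_def norm_mult power2_eq_square)
      then show "(cmod (scl u))\<^sup>2 \<le> norm (star u * u)" by (simp add: norm_unitization_def)
    qed
    ultimately have "norm u \<le> sqrt (norm (star u * u))" by (simp add: norm_unitization_def[of u])
    then have "(norm u)\<^sup>2 \<le> (sqrt (norm (star u * u)))\<^sup>2" by (intro power_mono) auto
    then show ?thesis by simp
  qed
  have le': "norm u \<le> norm (star u)" for u :: "'a unitization"
  proof (cases "norm u = 0")
    case False
    have "(norm u)\<^sup>2 \<le> norm (star u) * norm u" using le[of u] norm_mult_ineq[of "star u" u] by linarith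
    then show ?thesis using False by (simp add: power2_eq_square)
  qed simp
  have "norm (star u) = norm u" using le'[of u] le'[of "star u"] by (simp add: ss)
  then show "norm (star u * u) = (norm u)\<^sup>2"
    using le[of u] norm_mult_ineq[of "star u" u] by (simp add: power2_eq_square)
qed
end

text \<open>If the square of $\lambda+k$ lies in $A$ then $\lambda=0$, so square roots of
  positive elements of $A$ formed in the unitization lie in $A$. All order properties of the
  cone now come from the unital case.\<close>

lemma positive_cone_iff: "a \<in> positive_cone \<longleftrightarrow> pos_elem (Unitz 0 a)"
proof
  assume "a \<in> positive_cone"
  then obtain b where "a = star b * b" unfolding positive_cone_def by blast
  then have "Unitz 0 a = star (Unitz 0 b) * Unitz 0 b"
    by (simp add: times_unitization_def star_unitization_def)
  then show "pos_elem (Unitz 0 a)" by (simp add: pos_elem_star_mult)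
next
  assume "pos_elem (Unitz 0 a)"
  then obtain k where k: "pos_elem k" "k * k = Unitz 0 a" using pos_elem_sqrt by metis
  have "scl (k * k) = 0" using k(2) by simp
  then have "scl k = 0" by (simp add: times_unitization_def)
  then have "elt (star k * k) = star (elt k) * elt k" by (simp add: times_unitization_def star_unitization_def)
  then have "a = star (elt k) * elt k" using pos_elem_star[OF k(1)] k(2) by simp
  then show "a \<in> positive_cone" by (simp add: positive_cone_def)
qed

lemma star_mult_positive [simp]: "star b * b \<in> positive_cone"
  by (simp add: positive_cone_def)

lemma positive_cone_zero [simp]: "0 \<in> positive_cone"
  using star_mult_positive[of 0] by simp

lemma positive_cone_add: "a \<in> positive_cone \<Longrightarrow> b \<in> positive_cone \<Longrightarrow> a + b \<in> positive_cone"
  using pos_elem_add[of "Unitz 0 a" "Unitz 0 b"] by (simp add: positive_cone_iff plus_unitization_def)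

lemma positive_cone_scaleR: "a \<in> positive_cone \<Longrightarrow> r \<ge> 0 \<Longrightarrow> scaleR r a \<in> positive_cone"
  using pos_elem_scaleR[of "Unitz 0 a" r] by (simp add: positive_cone_iff scaleR_unitization_def)

lemma positive_cone_norm_mono: "a \<in> positive_cone \<Longrightarrow> b \<in> positive_cone \<Longrightarrow> norm a \<le> norm (a + b)"
  using pos_elem_norm_mono[of "Unitz 0 a" "Unitz 0 b"] by (simp add: positive_cone_iff plus_unitization_def norm_unitz_embed)

lemma positive_cone_star: "a \<in> positive_cone \<Longrightarrow> star a = a"
  by (auto simp: positive_cone_def star_mult star_star)

lemma positive_cone_closed:
  assumes "s \<longlonglongrightarrow> l" "\<And>n::nat. s n \<in> positive_cone" shows "l \<in> positive_cone"
proof -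
  have "(\<lambda>n. norm (s n - l)) \<longlonglongrightarrow> 0" using assms(1) LIM_zero tendsto_norm_zero by blast
  then have "(\<lambda>n. norm (Unitz 0 (s n) - Unitz 0 l)) \<longlonglongrightarrow> 0"
    by (simp add: minus_unitization_def norm_unitz_embed)
  then have "(\<lambda>n. Unitz 0 (s n)) \<longlonglongrightarrow> Unitz 0 l" using LIM_zero_cancel tendsto_norm_zero_iff by blast
  then show ?thesis using assms(2) pos_elem_closed unfolding positive_cone_iff by blast
qed

section \<open>Hilbert modules\<close>

lemma selfadjoint_conj_le:
  fixes c :: "'a::cstar_algebra"
  assumes "star c = c" "norm c \<le> s" "s > 0"
  shows "\<exists>y. star y = y \<and> y + y = scaleR (1/s) c + y * y"
proof -
  have "norm (scaleR (1/s) c) \<le> 1" using assms by (simp add: field_simps)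
  moreover have "star (scaleR (1/s) c) = scaleR (1/s) c" by (simp add: star_scaleR assms(1))
  ultimately obtain y where "star y = y" "y + y = scaleR (1/s) c + y * y"
    using ex_root_complement_star[of "scaleR (1/s) c"] by metis
  then show ?thesis by blast
qed

text \<open>With $(1-y)^2=1-c/s$, the difference is $s$ times the square of $x-yx$.\<close>

lemma conj_le_norm:
  fixes c :: "'a::cstar_algebra"
  assumes "star c = c" "norm c \<le> s" "s > 0"
  shows "scaleR s (star x * x) - star x * c * x \<in> positive_cone"
proof -
  obtain y where y: "star y = y" "y + y = scaleR (1/s) c + y * y"
    using selfadjoint_conj_le[OF assms] by blast
  have yy: "scaleR (1/s) c = y + y - y * y" by (simp add: y(2))
  have "star (x - y * x) * (x - y * x) = star x * x - star x * (y + y - y * y) * x"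
    by (simp add: star_diff star_mult y(1) algebra_simps)
  also have "\<dots> = star x * x - scaleR (1/s) (star x * c * x)" by (simp add: yy[symmetric])
  finally have "scaleR s (star x * x - scaleR (1/s) (star x * c * x)) \<in> positive_cone"
    using assms(3) star_mult_positive[of "x - y * x"] by (metis positive_cone_scaleR less_imp_le)
  then show ?thesis using assms(3) by (simp add: scaleR_diff_right)
qed

lemma sum_list_positive: "(\<And>x. x \<in> set xs \<Longrightarrow> f x \<in> positive_cone) \<Longrightarrow> (\<Sum>x\<leftarrow>xs. f x) \<in> positive_cone"
  by (induction xs) (auto intro: positive_cone_add)

context hilbert_module begin

abbreviation nn where "nn \<equiv> mod_norm E"

lemma minus_mem: "\<xi> \<in> carrier E \<Longrightarrow> - \<xi> \<in> carrier E"
  using scaleC_mem[of \<xi> "-1"] by (simp add: scaleC_minus_left scaleC_one)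

lemma diff_mem: "\<xi> \<in> carrier E \<Longrightarrow> \<eta> \<in> carrier E \<Longrightarrow> \<xi> - \<eta> \<in> carrier E"
  using add_mem[OF _ minus_mem] by simp

lemma sum_list_mem: "(\<And>x. x \<in> set xs \<Longrightarrow> f x \<in> carrier E) \<Longrightarrow> (\<Sum>x\<leftarrow>xs. f x) \<in> carrier E"
  by (induction xs) (auto intro: add_mem zero_mem)

lemmas mem = zero_mem add_mem scaleC_mem ract_mem minus_mem diff_mem

lemma ip_zero [simp]: "\<xi> \<in> carrier E \<Longrightarrow> ip E \<xi> 0 = 0"
  using ip_add[of \<xi> 0 0] zero_mem by simp

lemma ip_minus: "\<xi> \<in> carrier E \<Longrightarrow> \<eta> \<in> carrier E \<Longrightarrow> ip E \<xi> (- \<eta>) = - ip E \<xi> \<eta>"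
  using ip_scaleC[of \<xi> \<eta> "-1"] by (simp add: scaleC_minus_left scaleC_one)

lemma ip_diff: "\<xi> \<in> carrier E \<Longrightarrow> \<eta> \<in> carrier E \<Longrightarrow> \<zeta> \<in> carrier E \<Longrightarrow> ip E \<xi> (\<eta> - \<zeta>) = ip E \<xi> \<eta> - ip E \<xi> \<zeta>"
  using ip_add[of \<xi> \<eta> "- \<zeta>"] by (simp add: ip_minus minus_mem)

lemma ip_add_left:
  assumes "\<xi> \<in> carrier E" "\<eta> \<in> carrier E" "\<zeta> \<in> carrier E"
  shows "ip E (\<xi> + \<eta>) \<zeta> = ip E \<xi> \<zeta> + ip E \<eta> \<zeta>"
proof -
  have "star (ip E \<zeta> (\<xi> + \<eta>)) = star (ip E \<zeta> \<xi>) + star (ip E \<zeta> \<eta>)"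
    by (simp add: ip_add star_add assms)
  then show ?thesis by (simp add: ip_star add_mem assms)
qed

lemma ip_flip: "\<xi> \<in> carrier E \<Longrightarrow> \<eta> \<in> carrier E \<Longrightarrow> ip E \<xi> \<eta> = star (ip E \<eta> \<xi>)"
  by (simp add: ip_star)

lemma ip_zero_left [simp]: "\<xi> \<in> carrier E \<Longrightarrow> ip E 0 \<xi> = 0"
  by (subst ip_flip) (simp_all add: zero_mem)

lemma ip_minus_left: "\<xi> \<in> carrier E \<Longrightarrow> \<eta> \<in> carrier E \<Longrightarrow> ip E (- \<xi>) \<eta> = - ip E \<xi> \<eta>"
  by (subst ip_flip) (simp_all add: minus_mem ip_minus star_minus ip_star)

lemma ip_diff_left: "\<xi> \<in> carrier E \<Longrightarrow> \<eta> \<in> carrier E \<Longrightarrow> \<zeta> \<in> carrier E \<Longrightarrow> ip E (\<xi> - \<eta>) \<zeta> = ip E \<xi> \<zeta> - ip E \<eta> \<zeta>"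
  using ip_add_left[of \<xi> "- \<eta>" \<zeta>] by (simp add: ip_minus_left minus_mem)

lemma ip_scaleC_left: "\<xi> \<in> carrier E \<Longrightarrow> \<eta> \<in> carrier E \<Longrightarrow> ip E (scaleC c \<xi>) \<eta> = scaleC (cnj c) (ip E \<xi> \<eta>)"
  by (subst ip_flip) (simp_all add: scaleC_mem ip_scaleC star_scaleC ip_star)

lemma ip_ract_left: "\<xi> \<in> carrier E \<Longrightarrow> \<eta> \<in> carrier E \<Longrightarrow> ip E (ract E \<xi> a) \<eta> = star a * ip E \<xi> \<eta>"
  by (subst ip_flip) (simp_all add: ract_mem ip_ract star_mult ip_star)

lemmas ip_simps = ip_add ip_add_left ip_diff ip_diff_left ip_minus ip_minus_left ip_scaleC ip_scaleC_left
  ip_ract ip_ract_left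

lemma ip_sum_list:
  assumes "\<xi> \<in> carrier E" "\<And>x. x \<in> set xs \<Longrightarrow> f x \<in> carrier E"
  shows "ip E \<xi> (\<Sum>x\<leftarrow>xs. f x) = (\<Sum>x\<leftarrow>xs. ip E \<xi> (f x))"
  using assms(2) by (induction xs) (auto simp: ip_add assms(1) sum_list_mem)

lemma ip_sum_list_left:
  assumes "\<xi> \<in> carrier E" "\<And>x. x \<in> set xs \<Longrightarrow> f x \<in> carrier E"
  shows "ip E (\<Sum>x\<leftarrow>xs. f x) \<xi> = (\<Sum>x\<leftarrow>xs. ip E (f x) \<xi>)"
  using assms(2) by (induction xs) (auto simp: ip_add_left assms(1) sum_list_mem)

lemma ip_ext:
  assumes "\<xi> \<in> carrier E" "\<eta> \<in> carrier E" "\<And>\<zeta>. \<zeta> \<in> carrier E \<Longrightarrow> ip E \<zeta> \<xi> = ip E \<zeta> \<eta>"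
  shows "\<xi> = \<eta>"
proof -
  have "ip E (\<xi> - \<eta>) (\<xi> - \<eta>) = 0"
    using assms(1,2) assms(3)[of "\<xi> - \<eta>"] by (simp add: ip_diff diff_mem)
  then show ?thesis using ip_definite[of "\<xi> - \<eta>"] assms by (simp add: diff_mem)
qed

lemma nn_ge_zero [simp]: "0 \<le> nn \<xi>" by (simp add: mod_norm_def)

lemma nn_square: "(nn \<xi>)\<^sup>2 = norm (ip E \<xi> \<xi>)" by (simp add: mod_norm_def)

text \<open>Positivity of the square of $\xi\langle\xi,\eta\rangle-t\eta$, together with
  $\langle\eta,\xi\rangle\langle\xi,\xi\rangle\langle\xi,\eta\rangle\le
  t\langle\eta,\xi\rangle\langle\xi,\eta\rangle$ for $t>\|\langle\xi,\xi\rangle\|$, gives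
  $\langle\eta,\xi\rangle\langle\xi,\eta\rangle\le t\langle\eta,\eta\rangle$.\<close>

lemma Cauchy_Schwarz:
  assumes "\<xi> \<in> carrier E" "\<eta> \<in> carrier E" shows "norm (ip E \<xi> \<eta>) \<le> nn \<xi> * nn \<eta>"
proof -
  define a where "a = ip E \<xi> \<eta>"
  have "(norm a)\<^sup>2 \<le> t * (nn \<eta>)\<^sup>2" if t: "norm (ip E \<xi> \<xi>) < t" for t
  proof -
    have "t > 0" using t norm_ge_zero[of "ip E \<xi> \<xi>"] by linarith
    have sa: "ip E \<eta> \<xi> = star a" by (simp add: a_def ip_star assms)
    have "scaleR t (star a * a) - star a * ip E \<xi> \<xi> * a \<in> positive_cone"
      using conj_le_norm[of "ip E \<xi> \<xi>" t a] t \<open>t > 0\<close> assms by (simp add: ip_star)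
    moreover have "ip E (ract E \<xi> a - scaleC (of_real t) \<eta>) (ract E \<xi> a - scaleC (of_real t) \<eta>) \<in> positive_cone"
      by (intro ip_positive mem assms)
    moreover have "ip E (ract E \<xi> a - scaleC (of_real t) \<eta>) (ract E \<xi> a - scaleC (of_real t) \<eta>)
       = star a * ip E \<xi> \<xi> * a - scaleR t (star a * a) - scaleR t (star a * a) + scaleR (t * t) (ip E \<eta> \<eta>)"
      using assms
      by (simp add: ip_simps mem sa a_def[symmetric] scaleR_eq_scaleC[symmetric] scaleC_mult_left[symmetric] algebra_simps)
    ultimately have "(scaleR t (star a * a) - star a * ip E \<xi> \<xi> * a) +
       (star a * ip E \<xi> \<xi> * a - scaleR t (star a * a) - scaleR t (star a * a) + scaleR (t * t) (ip E \<eta> \<eta>)) \<in> positive_cone"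
      by (metis positive_cone_add)
    then have "scaleR (t * t) (ip E \<eta> \<eta>) - scaleR t (star a * a) \<in> positive_cone"
      by (simp add: algebra_simps)
    then have "norm (scaleR t (star a * a)) \<le> norm (scaleR t (star a * a) + (scaleR (t * t) (ip E \<eta> \<eta>) - scaleR t (star a * a)))"
      using \<open>t > 0\<close> by (intro positive_cone_norm_mono positive_cone_scaleR) auto
    then have "t * (norm a)\<^sup>2 \<le> t * (t * (nn \<eta>)\<^sup>2)"
      using \<open>t > 0\<close> by (simp add: cstar_identity nn_square)
    then show ?thesis using \<open>t > 0\<close> by simp
  qed
  then have "(norm a)\<^sup>2 \<le> norm (ip E \<xi> \<xi>) * (nn \<eta>)\<^sup>2 + e" if "e > 0" for e
  proof -
    define d where "d = e / ((nn \<eta>)\<^sup>2 + 1)"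
    have "d > 0" using that by (simp add: d_def add_nonneg_pos)
    moreover have "d * (nn \<eta>)\<^sup>2 \<le> e" using that unfolding d_def
      by (simp add: divide_le_eq add_nonneg_pos mult_left_mono) 
    ultimately show ?thesis using \<open>\<And>t. norm (ip E \<xi> \<xi>) < t \<Longrightarrow> (norm a)\<^sup>2 \<le> t * (nn \<eta>)\<^sup>2\<close>[of "norm (ip E \<xi> \<xi>) + d"]
      by (simp add: distrib_right)
  qed
  then have "(norm a)\<^sup>2 \<le> (nn \<xi> * nn \<eta>)\<^sup>2"
    unfolding power_mult_distrib nn_square[of \<xi>] by (rule field_le_epsilon)
  then show ?thesis unfolding a_def by (rule power2_le_imp_le) simp
qed

lemma nn_zero [simp]: "nn 0 = 0" by (simp add: mod_norm_def zero_mem)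

lemma nn_eq_zero: "\<xi> \<in> carrier E \<Longrightarrow> nn \<xi> = 0 \<Longrightarrow> \<xi> = 0"
  using ip_definite[of \<xi>] by (simp add: mod_norm_def)

lemma nn_triangle:
  assumes "\<xi> \<in> carrier E" "\<eta> \<in> carrier E" shows "nn (\<xi> + \<eta>) \<le> nn \<xi> + nn \<eta>"
proof (rule power2_le_imp_le)
  have "norm (ip E (\<xi> + \<eta>) (\<xi> + \<eta>)) = norm ((ip E \<xi> \<xi> + ip E \<xi> \<eta>) + (ip E \<eta> \<xi> + ip E \<eta> \<eta>))"
    using assms by (simp add: ip_simps mem algebra_simps)
  also have "\<dots> \<le> (norm (ip E \<xi> \<xi>) + norm (ip E \<xi> \<eta>)) + (norm (ip E \<eta> \<xi>) + norm (ip E \<eta> \<eta>))"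
    by (intro norm_triangle_mono order_refl norm_triangle_ineq)
  also have "\<dots> \<le> ((nn \<xi>)\<^sup>2 + nn \<xi> * nn \<eta>) + (nn \<eta> * nn \<xi> + (nn \<eta>)\<^sup>2)"
    by (intro add_mono Cauchy_Schwarz assms) (simp_all add: nn_square)
  finally show "(nn (\<xi> + \<eta>))\<^sup>2 \<le> (nn \<xi> + nn \<eta>)\<^sup>2"
    unfolding power2_sum nn_square by (simp add: algebra_simps)
qed simp

lemma nn_scaleC: "\<xi> \<in> carrier E \<Longrightarrow> nn (scaleC c \<xi>) = cmod c * nn \<xi>"
  by (simp add: mod_norm_def ip_simps mem norm_scaleC real_sqrt_mult mult.assoc[symmetric])

lemma nn_minus: "\<xi> \<in> carrier E \<Longrightarrow> nn (- \<xi>) = nn \<xi>"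
  by (simp add: mod_norm_def ip_simps mem)

lemma nn_diff_commute: "\<xi> \<in> carrier E \<Longrightarrow> \<eta> \<in> carrier E \<Longrightarrow> nn (\<xi> - \<eta>) = nn (\<eta> - \<xi>)"
  using nn_minus[of "\<xi> - \<eta>"] by (simp add: diff_mem)

lemma nn_triangle_diff:
  assumes "\<xi> \<in> carrier E" "\<eta> \<in> carrier E" "\<zeta> \<in> carrier E" shows "nn (\<xi> - \<zeta>) \<le> nn (\<xi> - \<eta>) + nn (\<eta> - \<zeta>)"
  using nn_triangle[of "\<xi> - \<eta>" "\<eta> - \<zeta>"] assms by (simp add: diff_mem)

lemma nn_triangle_minus:
  assumes "\<xi> \<in> carrier E" "\<eta> \<in> carrier E" shows "nn (\<xi> - \<eta>) \<le> nn \<xi> + nn \<eta>"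
  using nn_triangle[of \<xi> "- \<eta>"] assms by (simp add: nn_minus minus_mem)

lemma nn_ract: assumes "\<xi> \<in> carrier E" shows "nn (ract E \<xi> a) \<le> nn \<xi> * norm a"
proof (rule power2_le_imp_le)
  have "norm (star a * ip E \<xi> \<xi> * a) \<le> norm a * norm (ip E \<xi> \<xi>) * norm a"
    by (intro order_trans[OF norm_mult_ineq] mult_mono order_trans[OF norm_mult_ineq]) (auto simp: norm_star)
  then show "(nn (ract E \<xi> a))\<^sup>2 \<le> (nn \<xi> * norm a)\<^sup>2"
    using assms by (simp add: nn_square ip_simps mem power_mult_distrib mult.assoc) (simp add: power2_eq_square algebra_simps)
qed simp

lemma nn_sum_list:
  assumes "\<And>x. x \<in> set xs \<Longrightarrow> f x \<in> carrier E" shows "nn (\<Sum>x\<leftarrow>xs. f x) \<le> (\<Sum>x\<leftarrow>xs. nn (f x))"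
  using assms
proof (induction xs)
  case (Cons x xs)
  then show ?case using nn_triangle[of "f x" "\<Sum>x\<leftarrow>xs. f x"] by (auto simp: sum_list_mem intro: order_trans)
qed simp

section \<open>Adjointable operators\<close>

text \<open>In contrast to the extensional elements of $\mathcal L(E)$, these operators compose
  as ordinary functions.\<close>

definition adj where
  "adj R R' \<longleftrightarrow> R ` carrier E \<subseteq> carrier E \<and> R' ` carrier E \<subseteq> carrier E \<and> adjoint_pair E R R'"

lemma adj_mem: "adj R R' \<Longrightarrow> x \<in> carrier E \<Longrightarrow> R x \<in> carrier E"
  "adj R R' \<Longrightarrow> x \<in> carrier E \<Longrightarrow> R' x \<in> carrier E"
  by (auto simp: adj_def)

lemma adj_ip: "adj R R' \<Longrightarrow> x \<in> carrier E \<Longrightarrow> y \<in> carrier E \<Longrightarrow> ip E (R x) y = ip E x (R' y)"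
  by (auto simp: adj_def adjoint_pair_def)

lemma adj_ip': "adj R R' \<Longrightarrow> x \<in> carrier E \<Longrightarrow> y \<in> carrier E \<Longrightarrow> ip E (R' x) y = ip E x (R y)"
  by (subst ip_flip) (simp_all add: adj_mem adj_ip[symmetric] ip_star)

lemma adj_sym: "adj R R' \<Longrightarrow> adj R' R"
  using adj_ip'[of R R'] by (simp add: adj_def adjoint_pair_def)

lemma adj_add: "adj R R' \<Longrightarrow> x \<in> carrier E \<Longrightarrow> y \<in> carrier E \<Longrightarrow> R (x + y) = R x + R y"
  by (rule ip_ext) (simp_all add: adj_mem mem ip_simps adj_ip'[symmetric])

lemma adj_scaleC: "adj R R' \<Longrightarrow> x \<in> carrier E \<Longrightarrow> R (scaleC c x) = scaleC c (R x)"
  by (rule ip_ext) (simp_all add: adj_mem mem ip_simps adj_ip'[symmetric])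

lemma adj_ract: "adj R R' \<Longrightarrow> x \<in> carrier E \<Longrightarrow> R (ract E x a) = ract E (R x) a"
  by (rule ip_ext) (simp_all add: adj_mem mem ip_simps adj_ip'[symmetric])

lemma adj_diff: "adj R R' \<Longrightarrow> x \<in> carrier E \<Longrightarrow> y \<in> carrier E \<Longrightarrow> R (x - y) = R x - R y"
  by (rule ip_ext) (simp_all add: adj_mem mem ip_simps adj_ip'[symmetric])

lemma adj_zero: "adj R R' \<Longrightarrow> R 0 = 0"
  by (rule ip_ext) (simp_all add: adj_mem mem adj_ip'[symmetric])

lemma adj_sum_list: "adj R R' \<Longrightarrow> (\<And>x. x \<in> set xs \<Longrightarrow> f x \<in> carrier E) \<Longrightarrow> R (\<Sum>x\<leftarrow>xs. f x) = (\<Sum>x\<leftarrow>xs. R (f x))"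
  by (induction xs) (auto simp: adj_zero adj_add sum_list_mem)

lemma adj_funpow: "adj r r \<Longrightarrow> adj (r ^^ n) (r ^^ n)"
proof (induction n)
  case (Suc n)
  have m: "(r ^^ n) x \<in> carrier E" if "x \<in> carrier E" for x using Suc that adj_mem by blast
  show ?case unfolding adj_def adjoint_pair_def
    using Suc m by (auto simp: adj_mem adj_ip adj_ip' funpow_swap1[symmetric])
qed (simp add: adj_def adjoint_pair_def)

end

section \<open>Square roots of operators on Hilbert modules\<close>

context hilbert_module begin

fun op_root_seq :: "('x \<Rightarrow> 'x) \<Rightarrow> nat \<Rightarrow> 'x \<Rightarrow> 'x" where
  "op_root_seq T 0 x = 0"
| "op_root_seq T (Suc n) x = scaleC (1/2) (T x + op_root_seq T n (op_root_seq T n x))"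

lemma half_sum: "scaleC (1/2) (x::'x) + scaleC (1/2) x = x"
  by (simp add: scaleC_add_left[symmetric] scaleC_one)

lemma adj_op_root_seq: assumes "adj T T" shows "adj (op_root_seq T n) (op_root_seq T n)"
proof (induction n)
  case 0 show ?case by (auto simp: adj_def adjoint_pair_def zero_mem)
next
  case (Suc n)
  show ?case unfolding adj_def adjoint_pair_def
    using adj_mem[OF assms] adj_mem[OF Suc] adj_ip[OF assms] adj_ip[OF Suc]
    by (auto simp: mem ip_simps)
qed

lemma op_root_seq_mem: "adj T T \<Longrightarrow> x \<in> carrier E \<Longrightarrow> op_root_seq T n x \<in> carrier E"
  using adj_op_root_seq adj_mem by blast

lemma op_root_seq_commute:
  assumes "adj T T" "adj D D'" "\<And>x. x \<in> carrier E \<Longrightarrow> D (T x) = T (D x)" "x \<in> carrier E"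
  shows "D (op_root_seq T n x) = op_root_seq T n (D x)"
  using assms(4)
proof (induction n arbitrary: x)
  case 0 show ?case using assms(2) by (simp add: adj_zero)
next
  case (Suc n)
  note m = op_root_seq_mem[OF assms(1)] adj_mem[OF assms(1)] adj_mem[OF assms(2)]
  have "D (op_root_seq T n (op_root_seq T n x)) = op_root_seq T n (op_root_seq T n (D x))"
    using Suc m by simp
  then show ?case using Suc.prems m assms(3) by (simp add: adj_scaleC[OF assms(2)] adj_add[OF assms(2)] mem)
qed

lemma op_root_seq_commute2:
  assumes "adj T T" "x \<in> carrier E"
  shows "op_root_seq T m (op_root_seq T n x) = op_root_seq T n (op_root_seq T m x)"
proof -
  have "T (op_root_seq T m x) = op_root_seq T m (T x)" if "x \<in> carrier E" for x
    using op_root_seq_commute[OF assms(1) assms(1)] that by simp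
  then show ?thesis
    by (intro op_root_seq_commute[OF assms(1) adj_op_root_seq[OF assms(1)] _ assms(2)]) simp
qed

lemma op_root_seq_norm:
  assumes "adj T T" "\<And>x. x \<in> carrier E \<Longrightarrow> nn (T x) \<le> nn x" "x \<in> carrier E"
  shows "nn (op_root_seq T n x) \<le> root_bound n * nn x"
  using assms(3)
proof (induction n arbitrary: x)
  case (Suc n)
  note m = op_root_seq_mem[OF assms(1)] adj_mem[OF assms(1)]
  have "nn (op_root_seq T n (op_root_seq T n x)) \<le> root_bound n * (root_bound n * nn x)"
    using Suc m root_bound_range[of n] by (meson mult_left_mono order_trans)
  then have "nn (T x + op_root_seq T n (op_root_seq T n x)) \<le> nn x + root_bound n * (root_bound n * nn x)"
    using nn_triangle[of "T x" "op_root_seq T n (op_root_seq T n x)"] assms(2)[OF Suc.prems] Suc.prems m by force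
  then show ?case using Suc.prems m by (simp add: nn_scaleC mem power2_eq_square algebra_simps)
qed simp

lemma op_root_seq_step:
  assumes "adj T T" "\<And>x. x \<in> carrier E \<Longrightarrow> nn (T x) \<le> nn x" "x \<in> carrier E"
  shows "nn (op_root_seq T (Suc n) x - op_root_seq T n x) \<le> (root_bound (Suc n) - root_bound n) * nn x"
  using assms(3)
proof (induction n arbitrary: x)
  case 0 then show ?case using assms(2) adj_mem[OF assms(1)] by (simp add: nn_scaleC)
next
  case (Suc n)
  note m = op_root_seq_mem[OF assms(1)] adj_mem[OF assms(1)]
  let ?p = "op_root_seq T (Suc n)" and ?q = "op_root_seq T n"
  note A = adj_add[OF adj_op_root_seq[OF assms(1)]] adj_diff[OF adj_op_root_seq[OF assms(1)]]
  define d where "d = ?p x - ?q x"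
  have d: "d \<in> carrier E" using Suc.prems m by (simp add: d_def mem del: op_root_seq.simps)
  have "?p d + ?q d = ?p (?p x) - ?q (?q x)"
    using op_root_seq_commute2[OF assms(1) Suc.prems, of "Suc n" n] Suc.prems m
    by (simp add: d_def A del: op_root_seq.simps)
  moreover have "op_root_seq T (Suc (Suc n)) x - ?p x = scaleC (1/2) (?p (?p x) - ?q (?q x))"
    by (simp only: op_root_seq.simps(2)[of T "Suc n"], subst (3) op_root_seq.simps(2))
       (simp add: scaleC_diff_right[symmetric] del: op_root_seq.simps)
  ultimately have eq: "op_root_seq T (Suc (Suc n)) x - ?p x = scaleC (1/2) (?p d + ?q d)" by (simp only:)
  have "nn (op_root_seq T (Suc (Suc n)) x - ?p x) = nn (?p d + ?q d) / 2"
    unfolding eq using nn_scaleC[of "?p d + ?q d" "1/2"] d m by (simp add: mem del: op_root_seq.simps)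
  also have "\<dots> \<le> (root_bound (Suc n) * nn d + root_bound n * nn d) / 2"
    using nn_triangle[of "?p d" "?q d"] op_root_seq_norm[OF assms(1,2) d, of "Suc n"]
      op_root_seq_norm[OF assms(1,2) d, of n] d m by (simp del: op_root_seq.simps root_bound.simps)
  also have "\<dots> = (root_bound (Suc n) + root_bound n) / 2 * nn d" by (simp add: algebra_simps del: root_bound.simps)
  also have "\<dots> \<le> (root_bound (Suc n) + root_bound n) / 2 * ((root_bound (Suc n) - root_bound n) * nn x)"
    unfolding d_def by (intro mult_left_mono Suc) (use root_bound_range[of n] root_bound_range[of "Suc n"] in auto)
  also have "\<dots> = (root_bound (Suc (Suc n)) - root_bound (Suc n)) * nn x"
  proof -
    have *: "(a + b) / 2 * ((a - b) * z) = (c - a) * z" if "2 * c = 1 + a\<^sup>2" "2 * a = 1 + b\<^sup>2" for a b c z :: real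
    proof -
      have "(a + b) / 2 * (a - b) = (a\<^sup>2 - b\<^sup>2) / 2" by (simp add: algebra_simps power2_eq_square)
      also have "\<dots> = (2 * c - 2 * a) / 2" unfolding that by simp
      finally have "(a + b) / 2 * (a - b) = c - a" by simp
      then show ?thesis by (simp only: mult.assoc[symmetric])
    qed
    have "2 * root_bound (Suc k) = 1 + (root_bound k)\<^sup>2" for k by simp
    then show ?thesis by (intro *)
  qed
  finally show ?case .
qed

text \<open>The iteration for square roots in algebras, applied vector by vector: on each vector
  it is dominated by the scalar iteration, and the pointwise limit inherits selfadjointness
  because inner products converge.\<close>

lemma op_root:
  assumes T: "adj T T" "\<And>x. x \<in> carrier E \<Longrightarrow> nn (T x) \<le> nn x"
  shows "\<exists>r. adj r r \<and> (\<forall>x\<in>carrier E. r (r x) = x - T x)"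
proof -
  note m = op_root_seq_mem[OF T(1)] adj_mem[OF T(1)]
  let ?s = "op_root_seq T"
  have diff: "nn (?s (n + k) x - ?s n x) \<le> (root_bound (n + k) - root_bound n) * nn x" if x: "x \<in> carrier E" for n k x
  proof (induction k)
    case (Suc k)
    have "nn (?s (n + Suc k) x - ?s n x) \<le> nn (?s (Suc (n + k)) x - ?s (n + k) x) + nn (?s (n + k) x - ?s n x)"
      using nn_triangle_diff[of "?s (Suc (n + k)) x" "?s (n + k) x" "?s n x"] m x by (simp del: op_root_seq.simps)
    then show ?case using Suc op_root_seq_step[OF T x, of "n + k"]
      by (simp add: algebra_simps del: op_root_seq.simps root_bound.simps)
  qed simp
  have "\<exists>l\<in>carrier E. (\<lambda>n. nn (?s n x - l)) \<longlonglongrightarrow> 0" if x: "x \<in> carrier E" for x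
  proof (rule complete)
    show "?s n x \<in> carrier E" for n using m x by blast
    show "\<forall>\<epsilon>>0. \<exists>M. \<forall>i\<ge>M. \<forall>j\<ge>M. nn (?s i x - ?s j x) < \<epsilon>"
    proof (intro allI impI)
      fix e :: real assume "0 < e"
      then have "0 < e / (nn x + 1)" by (simp add: add_nonneg_pos)
      then obtain M where M: "\<And>m n. m \<ge> M \<Longrightarrow> n \<ge> M \<Longrightarrow> norm (root_bound m - root_bound n) < e / (nn x + 1)"
        using root_bound_Cauchy by (meson CauchyD)
      have le: "nn (?s i x - ?s j x) < e" if "M \<le> j" "j \<le> i" for i j
      proof -
        have "root_bound i - root_bound j \<le> e / (nn x + 1)" using M[of i j] that by simp
        then have "(root_bound i - root_bound j) * nn x \<le> e / (nn x + 1) * nn x" by (intro mult_right_mono) auto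
        also have "\<dots> < e" 
        proof -
          have "nn x + 1 > 0" using nn_ge_zero[of x] by linarith
          then show ?thesis using \<open>0 < e\<close> by (simp add: pos_divide_less_eq)
        qed
        finally show ?thesis using diff[OF x, of j "i - j"] that by simp
      qed
      have "nn (?s i x - ?s j x) < e" if "M \<le> j" "M \<le> i" for i j
        using that le[of i j] le[of j i] nn_diff_commute[of "?s i x" "?s j x"] m x by (cases "j \<le> i") auto
      then show "\<exists>M. \<forall>i\<ge>M. \<forall>j\<ge>M. nn (?s i x - ?s j x) < e" by blast
    qed
  qed
  then obtain y where y: "\<And>x. x \<in> carrier E \<Longrightarrow> y x \<in> carrier E" "\<And>x. x \<in> carrier E \<Longrightarrow> (\<lambda>n. nn (?s n x - y x)) \<longlonglongrightarrow> 0"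
    by metis
  have ip_lim: "(\<lambda>n. ip E (?s n x) z) \<longlonglongrightarrow> ip E (y x) z" if "x \<in> carrier E" "z \<in> carrier E" for x z
  proof (rule LIM_zero_cancel, rule Lim_null_comparison)
    show "\<forall>\<^sub>F n in sequentially. norm (ip E (?s n x) z - ip E (y x) z) \<le> nn (?s n x - y x) * nn z"
      using Cauchy_Schwarz that m y by (intro always_eventually) (simp add: ip_diff_left[symmetric] mem)
    show "(\<lambda>n. nn (?s n x - y x) * nn z) \<longlonglongrightarrow> 0" using tendsto_mult_left_zero[OF y(2)] that by blast
  qed
  have ip_lim': "(\<lambda>n. ip E z (?s n x)) \<longlonglongrightarrow> ip E z (y x)" if "x \<in> carrier E" "z \<in> carrier E" for x z
    using bounded_linear.tendsto[OF bounded_linear_star ip_lim[OF that]] that m y by (simp add: ip_star)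
  have ya: "adj y y"
    unfolding adj_def adjoint_pair_def
  proof (intro conjI ballI)
    fix x z assume xz: "x \<in> carrier E" "z \<in> carrier E"
    have "(\<lambda>n. ip E (?s n x) z) \<longlonglongrightarrow> ip E x (y z)"
      using ip_lim'[of z x] xz by (simp add: adj_ip[OF adj_op_root_seq[OF T(1)]])
    then show "ip E (y x) z = ip E x (y z)" using ip_lim xz LIMSEQ_unique by blast
  qed (use y in auto)
  have s_le: "nn (?s n x) \<le> nn x" if "x \<in> carrier E" for n x
    using op_root_seq_norm[OF T that, of n] root_bound_range[of n] mult_left_le_one_le[of "nn x" "root_bound n"] by simp
  have yy: "y x + y x = T x + y (y x)" if x: "x \<in> carrier E" for x
  proof (rule ip_ext)
    fix z assume z: "z \<in> carrier E"
    have a: "(\<lambda>n. ip E z (?s (Suc n) x + ?s (Suc n) x)) \<longlonglongrightarrow> ip E z (y x + y x)"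
      using tendsto_add[OF LIMSEQ_Suc[OF ip_lim'[OF x z]] LIMSEQ_Suc[OF ip_lim'[OF x z]]] x z m y
      by (simp add: ip_add del: op_root_seq.simps)
    have "ip E z (?s (Suc n) x + ?s (Suc n) x) = ip E z (T x) + ip E (?s n z) (?s n x)" for n
      using x z m by (simp add: half_sum ip_add mem adj_ip[OF adj_op_root_seq[OF T(1)]])
    moreover have "(\<lambda>n. ip E (?s n z) (?s n x)) \<longlonglongrightarrow> ip E (y z) (y x)"
    proof (rule LIM_zero_cancel, rule Lim_null_comparison)
      show "\<forall>\<^sub>F n in sequentially. norm (ip E (?s n z) (?s n x) - ip E (y z) (y x))
          \<le> nn z * nn (?s n x - y x) + nn (?s n z - y z) * nn (y x)"
      proof (intro always_eventually allI)
        fix n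
        have "ip E (?s n z) (?s n x) - ip E (y z) (y x) = ip E (?s n z) (?s n x - y x) + ip E (?s n z - y z) (y x)"
          using x z m y by (simp add: ip_simps mem)
        also have "norm \<dots> \<le> nn (?s n z) * nn (?s n x - y x) + nn (?s n z - y z) * nn (y x)"
          using x z m y by (intro norm_triangle_mono Cauchy_Schwarz) (auto simp: mem)
        also have "\<dots> \<le> nn z * nn (?s n x - y x) + nn (?s n z - y z) * nn (y x)"
          using s_le z by (intro add_mono mult_right_mono) auto
        finally show "norm (ip E (?s n z) (?s n x) - ip E (y z) (y x)) \<le> nn z * nn (?s n x - y x) + nn (?s n z - y z) * nn (y x)" .
      qed
      show "(\<lambda>n. nn z * nn (?s n x - y x) + nn (?s n z - y z) * nn (y x)) \<longlonglongrightarrow> 0"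
        using x z by (intro tendsto_add_zero tendsto_mult_left_zero tendsto_mult_right_zero y)
    qed
    ultimately have "(\<lambda>n. ip E z (?s (Suc n) x + ?s (Suc n) x)) \<longlonglongrightarrow> ip E z (T x) + ip E (y z) (y x)"
      by (simp only: tendsto_add[OF tendsto_const])
    then have "ip E z (y x + y x) = ip E z (T x) + ip E (y z) (y x)" using a LIMSEQ_unique by blast
    then show "ip E z (y x + y x) = ip E z (T x + y (y x))"
      using x z m y by (simp add: ip_add mem adj_ip[OF ya])
  qed (use x m y in \<open>auto simp: mem\<close>)
  define r where "r x = x - y x" for x
  have "adj r r" unfolding adj_def adjoint_pair_def r_def
    using y(1) adj_ip[OF ya] by (auto simp: mem ip_simps)
  moreover have "r (r x) = x - T x" if x: "x \<in> carrier E" for x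
  proof -
    have "r (r x) = x - (y x + y x) + y (y x)"
      using adj_diff[OF ya, of x "y x"] x y by (simp add: r_def)
    then show ?thesis by (simp add: yy[OF x])
  qed
  ultimately show ?thesis by blast
qed

text \<open>Scale $S$ by a bound $K$ to a contraction $T$ and write $T=k^2$. The two
  inequalities for the quadratic form of $S$ give $K\|kx\|^2\le\|x\|^2$, and $\|Sx\|=K\|k^2x\|$
  uses this estimate twice.\<close>

lemma positive_contraction:
  assumes S: "adj S S" "\<And>x. x \<in> carrier E \<Longrightarrow> ip E x (S x) \<in> positive_cone"
    "\<And>x. x \<in> carrier E \<Longrightarrow> ip E x x - ip E x (S x) \<in> positive_cone"
    and M: "\<And>x. x \<in> carrier E \<Longrightarrow> nn (S x) \<le> M * nn x" and x: "x \<in> carrier E"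
  shows "nn (S x) \<le> nn x"
proof -
  define K where "K = max M 1"
  have K: "K > 0" "\<And>x. x \<in> carrier E \<Longrightarrow> nn (S x) \<le> K * nn x"
    using M order_trans[OF M mult_right_mono] by (auto simp: K_def)
  define T where "T x = scaleC (of_real (1 / K)) (S x)" for x
  note m = adj_mem[OF S(1)]
  have cK: "cmod (of_real (1 / K)) = 1 / K" using K(1) by (simp only: norm_of_real abs_of_pos divide_pos_pos zero_less_one)
  have ipT: "ip E x (T x) = scaleR (1/K) (ip E x (S x))" if "x \<in> carrier E" for x
    using that m by (simp add: T_def ip_simps scaleR_eq_scaleC)
  have T: "adj T T" unfolding adj_def adjoint_pair_def T_def using m adj_ip[OF S(1)] by (auto simp: mem ip_simps)
  have "nn (T x) \<le> nn x" if "x \<in> carrier E" for x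
    using K(2)[OF that] K(1) that m unfolding T_def by (simp only: nn_scaleC cK) (simp add: field_simps)
  then obtain r where r: "adj r r" "\<And>x. x \<in> carrier E \<Longrightarrow> r (r x) = x - T x" using op_root[OF T] by blast
  have nr: "nn (r x) \<le> nn x" if x: "x \<in> carrier E" for x
  proof (rule power2_le_imp_le)
    have e: "ip E (r x) (r x) = ip E x x - ip E x (T x)"
      using adj_ip[OF r(1), of x "r x"] x adj_mem[OF r(1)] adj_mem[OF T] by (simp add: r ip_diff)
    have "norm (ip E (r x) (r x)) \<le> norm (ip E (r x) (r x) + ip E x (T x))"
      by (intro positive_cone_norm_mono ip_positive) (use x adj_mem[OF r(1)] ipT[OF x] S(2)[OF x] K(1) in \<open>auto intro: positive_cone_scaleR\<close>)
    then show "(nn (r x))\<^sup>2 \<le> (nn x)\<^sup>2" unfolding nn_square by (simp add: e)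
  qed simp
  define Q where "Q x = r (r x)" for x
  have Q: "adj Q Q" unfolding adj_def adjoint_pair_def Q_def using adj_mem[OF r(1)] adj_ip[OF r(1)] by auto
  have "nn (Q x) \<le> nn x" if "x \<in> carrier E" for x
    unfolding Q_def using nr[OF that] nr[OF adj_mem(1)[OF r(1) that]] by linarith
  then obtain k where k: "adj k k" "\<And>x. x \<in> carrier E \<Longrightarrow> k (k x) = x - Q x" using op_root[OF Q] by blast
  have kk: "k (k x) = T x" if "x \<in> carrier E" for x using that by (simp add: k Q_def r)
  have nk: "K * (nn (k x))\<^sup>2 \<le> (nn x)\<^sup>2" if x: "x \<in> carrier E" for x
  proof -
    have e: "ip E (k x) (k x) = scaleR (1/K) (ip E x (S x))"
      using adj_ip[OF k(1), of x "k x"] x adj_mem[OF k(1)] by (simp add: kk ipT)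
    have "norm (ip E x (S x)) \<le> norm (ip E x (S x) + (ip E x x - ip E x (S x)))"
      by (intro positive_cone_norm_mono S x)
    then show ?thesis unfolding nn_square e using K(1) by simp
  qed
  have "K * (nn (T x))\<^sup>2 \<le> (nn (k x))\<^sup>2" using nk[OF adj_mem(1)[OF k(1) x]] by (simp add: kk x)
  then have "K * (K * (nn (T x))\<^sup>2) \<le> K * (nn (k x))\<^sup>2" using K(1) by (intro mult_left_mono) auto
  then have "K * (K * (nn (T x))\<^sup>2) \<le> (nn x)\<^sup>2" using nk[OF x] by linarith
  moreover have "nn (S x) = K * nn (T x)"
    unfolding T_def using K(1) m x by (simp only: nn_scaleC cK) simp
  ultimately have "(nn (S x))\<^sup>2 \<le> (nn x)\<^sup>2" by (simp add: power2_eq_square algebra_simps)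
  then show ?thesis by (rule power2_le_imp_le) simp
qed

end

section \<open>Finite frames\<close>

context hilbert_module begin

text \<open>The operator $\sum_{\xi\in H}\theta_{\xi,\xi}$. Lists admit repeated vectors, which
  arise when frames are concatenated or tensored.\<close>

definition frame_op where
  "frame_op H x = (\<Sum>\<xi>\<leftarrow>H. ract E \<xi> (ip E \<xi> x))"

definition subunital where
  "subunital H \<longleftrightarrow> set H \<subseteq> carrier E \<and> (\<forall>x\<in>carrier E. ip E x x - ip E x (frame_op H x) \<in> positive_cone)"

lemma frame_op_mem: "set H \<subseteq> carrier E \<Longrightarrow> frame_op H x \<in> carrier E"
  unfolding frame_op_def by (intro sum_list_mem) (auto intro: mem)

lemma ip_frame_op:
  "set H \<subseteq> carrier E \<Longrightarrow> x \<in> carrier E \<Longrightarrow> ip E x (frame_op H y) = (\<Sum>\<xi>\<leftarrow>H. ip E x \<xi> * ip E \<xi> y)"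
  unfolding frame_op_def
  by (subst ip_sum_list) (auto simp: ip_ract subset_iff intro!: mem arg_cong[of _ _ sum_list])

lemma ip_frame_op_square:
  "set H \<subseteq> carrier E \<Longrightarrow> x \<in> carrier E \<Longrightarrow> ip E x (frame_op H x) = (\<Sum>\<xi>\<leftarrow>H. star (ip E \<xi> x) * ip E \<xi> x)"
  by (subst ip_frame_op) (auto simp: ip_star subset_iff intro!: arg_cong[of _ _ sum_list])

lemma ip_frame_op_positive:
  "set H \<subseteq> carrier E \<Longrightarrow> x \<in> carrier E \<Longrightarrow> ip E x (frame_op H x) \<in> positive_cone"
  by (simp add: ip_frame_op_square sum_list_positive)

lemma adj_frame_op: assumes "set H \<subseteq> carrier E" shows "adj (frame_op H) (frame_op H)"
  unfolding adj_def adjoint_pair_def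
proof (intro conjI ballI)
  fix x y assume xy: "x \<in> carrier E" "y \<in> carrier E"
  have "ip E (frame_op H x) y = star (ip E y (frame_op H x))"
    using xy assms by (simp add: ip_star frame_op_mem)
  also have "\<dots> = (\<Sum>\<xi>\<leftarrow>H. ip E x \<xi> * ip E \<xi> y)"
    unfolding ip_frame_op[OF assms xy(2)] using assms
    by (induction H) (simp_all add: star_add star_mult ip_star xy)
  finally show "ip E (frame_op H x) y = ip E x (frame_op H y)" by (simp add: ip_frame_op assms xy)
qed (use assms frame_op_mem in auto)

lemma nn_frame_op: 
  assumes "set H \<subseteq> carrier E" "x \<in> carrier E" shows "nn (frame_op H x) \<le> (\<Sum>\<xi>\<leftarrow>H. (nn \<xi>)\<^sup>2) * nn x"
proof -
  have "nn (ract E \<xi> (ip E \<xi> x)) \<le> (nn \<xi>)\<^sup>2 * nn x" if "\<xi> \<in> set H" for \<xi>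
  proof -
    have "\<xi> \<in> carrier E" using assms that by auto
    then have "nn (ract E \<xi> (ip E \<xi> x)) \<le> nn \<xi> * (nn \<xi> * nn x)"
      by (intro order_trans[OF nn_ract] mult_left_mono Cauchy_Schwarz assms) auto
    then show ?thesis by (simp add: power2_eq_square mult.assoc)
  qed
  then have "(\<Sum>\<xi>\<leftarrow>H. nn (ract E \<xi> (ip E \<xi> x))) \<le> (\<Sum>\<xi>\<leftarrow>H. (nn \<xi>)\<^sup>2 * nn x)" by (rule sum_list_mono)
  moreover have "nn (frame_op H x) \<le> (\<Sum>\<xi>\<leftarrow>H. nn (ract E \<xi> (ip E \<xi> x)))"
    unfolding frame_op_def using assms by (intro nn_sum_list) (auto intro: mem)
  ultimately show ?thesis by (simp add: sum_list_mult_const)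
qed

lemma subunital_contraction:
  assumes "subunital H" "x \<in> carrier E" shows "nn (frame_op H x) \<le> nn x"
  using assms unfolding subunital_def
  by (intro positive_contraction[OF adj_frame_op ip_frame_op_positive _ nn_frame_op]) auto

text \<open>The quadratic form bound makes the frame operator a contraction, so that its
  complement is the square of a selfadjoint operator.\<close>

lemma subunital_iff_positive_op:
  assumes "set H \<subseteq> carrier E"
  shows "subunital H \<longleftrightarrow> (\<lambda>\<eta>\<in>carrier E. \<eta> - frame_op H \<eta>) \<in> positive_op E"
proof
  assume H: "subunital H"
  obtain r where r: "adj r r" "\<And>x. x \<in> carrier E \<Longrightarrow> r (r x) = x - frame_op H x"
    using op_root[OF adj_frame_op[OF assms] subunital_contraction[OF H]] by blast
  define R where "R = (\<lambda>x\<in>carrier E. r x)"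
  have R: "R \<in> carrier E \<rightarrow>\<^sub>E carrier E" "adjoint_pair E R R"
    using adj_mem[OF r(1)] adj_ip[OF r(1)] by (auto simp: R_def adjoint_pair_def)
  then have "R \<in> adjointable E" unfolding adjointable_def by auto
  moreover have "(\<lambda>\<eta>\<in>carrier E. \<eta> - frame_op H \<eta>) = compose (carrier E) R R"
    unfolding compose_def R_def by (rule restrict_ext) (simp add: adj_mem[OF r(1)] r(2))
  ultimately show "(\<lambda>\<eta>\<in>carrier E. \<eta> - frame_op H \<eta>) \<in> positive_op E"
    using R unfolding positive_op_def by blast
next
  assume "(\<lambda>\<eta>\<in>carrier E. \<eta> - frame_op H \<eta>) \<in> positive_op E"
  then obtain S S' where S: "S \<in> adjointable E" "S' \<in> adjointable E" "adjoint_pair E S S'"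
    "(\<lambda>\<eta>\<in>carrier E. \<eta> - frame_op H \<eta>) = compose (carrier E) S' S" unfolding positive_op_def by blast
  show "subunital H" unfolding subunital_def
  proof (intro conjI ballI assms)
    fix x assume x: "x \<in> carrier E"
    have Sx: "S x \<in> carrier E" using S(1) x unfolding adjointable_def by blast
    have "S' (S x) = x - frame_op H x" using fun_cong[OF S(4), of x] x by (simp add: compose_def)
    then have "ip E x x - ip E x (frame_op H x) = ip E x (S' (S x))"
      using x assms by (simp add: ip_diff frame_op_mem)
    also have "\<dots> = ip E (S x) (S x)" using S(3) x Sx by (simp add: adjoint_pair_def)
    finally show "ip E x x - ip E x (frame_op H x) \<in> positive_cone" using Sx ip_positive by simp
  qed
qed

section \<open>Approximate units made of frames\<close>

text \<open>The filter of frames along which $\sum_{\xi\in H}\theta_{\xi,\xi}$ converges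
  strongly to the identity while staying below it.\<close>

definition approx_unit where
  "approx_unit = (INF (G, \<delta>)\<in>{(G, \<delta>::real). finite G \<and> G \<subseteq> carrier E \<and> \<delta> > 0}.
     principal {H. subunital H \<and> (\<forall>\<xi>\<in>G. nn (frame_op H \<xi> - \<xi>) < \<delta>)})"

lemma eventually_approx_unit:
  "eventually P approx_unit \<longleftrightarrow> (\<exists>G \<delta>. finite G \<and> G \<subseteq> carrier E \<and> \<delta> > 0 \<and>
     (\<forall>H. subunital H \<and> (\<forall>\<xi>\<in>G. nn (frame_op H \<xi> - \<xi>) < \<delta>) \<longrightarrow> P H))"
  unfolding approx_unit_def
  apply (subst eventually_INF_base)
  subgoal by (auto intro!: exI[of _ 1])
  subgoal for a b
    apply (cases a, cases b)
    subgoal for G d G' d' by (intro bexI[of _ "(G \<union> G', min d d')"]) auto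
    done
  apply (auto simp: eventually_principal)
  done

lemma eventually_approx_unit_subunital: "eventually subunital approx_unit"
  unfolding eventually_approx_unit by (intro exI[of _ "{}"] exI[of _ 1]) simp

lemma eventually_approx_unit_near:
  "\<xi> \<in> carrier E \<Longrightarrow> \<delta> > 0 \<Longrightarrow> eventually (\<lambda>H. nn (frame_op H \<xi> - \<xi>) < \<delta>) approx_unit"
  unfolding eventually_approx_unit by (intro exI[of _ "{\<xi>}"] exI[of _ \<delta>]) simp

lemma frame_op_map:
  assumes "adj R R'" "set H \<subseteq> carrier E" "x \<in> carrier E"
  shows "frame_op (map R H) x = R (frame_op H (R' x))"
  unfolding frame_op_def using assms(2)
  by (subst adj_sum_list[OF assms(1)])
     (auto simp: o_def adj_ip[OF assms(1)] adj_ract[OF assms(1)] assms(3) subset_iff intro!: mem arg_cong[of _ _ sum_list])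

lemma frame_op_append: "frame_op (H @ K) x = frame_op H x + frame_op K x"
  by (simp add: frame_op_def)

text \<open>Scale the vectors of $G$ so that $S=\sum_v\theta_{v,v}$ is a contraction, and let
  $r^2=1-S$. The frame of all $r^kv$ with $k<m$ has the operator $\sum_{k<m}r^kSr^k=1-r^{2m}$,
  which lies below the identity. It remains to see that $r^mv$ tends to zero; this is the
  estimate $(m+1)\|r^mv\|^2\le1$.\<close>

lemma ex_approx_unit:
  assumes G: "finite G" "G \<subseteq> carrier E" and d: "\<delta> > 0"
  shows "\<exists>H. subunital H \<and> (\<forall>\<xi>\<in>G. nn (frame_op H \<xi> - \<xi>) < \<delta>)"
proof -
  obtain gs where gs: "set gs = G" using finite_list[OF G(1)] by blast
  define c where "c = 1 / sqrt (1 + (\<Sum>\<xi>\<leftarrow>gs. (nn \<xi>)\<^sup>2))"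
  have s0: "0 \<le> (\<Sum>\<xi>\<leftarrow>gs. (nn \<xi>)\<^sup>2)" by (intro sum_list_nonneg) auto
  then have c0: "c > 0" by (simp add: c_def add_pos_nonneg)
  define vs where "vs = map (scaleC (of_real c)) gs"
  have vs: "set vs \<subseteq> carrier E" using G gs by (auto simp: vs_def intro: mem)
  define S where "S = frame_op vs"
  have S: "adj S S" unfolding S_def by (rule adj_frame_op[OF vs])
  have Sm: "S x \<in> carrier E" for x unfolding S_def by (rule frame_op_mem[OF vs])
  have "(\<Sum>\<xi>\<leftarrow>vs. (nn \<xi>)\<^sup>2) = c\<^sup>2 * (\<Sum>\<xi>\<leftarrow>gs. (nn \<xi>)\<^sup>2)"
  proof -
    have "(\<Sum>\<xi>\<leftarrow>vs. (nn \<xi>)\<^sup>2) = (\<Sum>\<xi>\<leftarrow>gs. c\<^sup>2 * (nn \<xi>)\<^sup>2)"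
      unfolding vs_def map_map
      using G gs c0 by (intro arg_cong[of _ _ sum_list] map_cong) (auto simp: nn_scaleC power_mult_distrib subset_iff)
    then show ?thesis by (simp add: sum_list_const_mult)
  qed
  also have "\<dots> \<le> 1" using s0 by (simp add: c_def power_divide)
  finally have v1: "(\<Sum>\<xi>\<leftarrow>vs. (nn \<xi>)\<^sup>2) \<le> 1" .
  have "nn (S x) \<le> nn x" if "x \<in> carrier E" for x
    using nn_frame_op[OF vs that] v1 mult_right_mono[OF v1 nn_ge_zero[of x]] unfolding S_def by linarith
  then obtain r where r: "adj r r" "\<And>x. x \<in> carrier E \<Longrightarrow> r (r x) = x - S x" using op_root[OF S] by blast
  note rk = adj_funpow[OF r(1)]
  note rm = adj_mem(1)[OF rk] adj_mem(1)[OF r(1)]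
  have Sr: "S x = x - r (r x)" if "x \<in> carrier E" for x using r(2)[OF that] by simp
  have Spos: "ip E x (S x) \<in> positive_cone" if "x \<in> carrier E" for x
    unfolding S_def by (rule ip_frame_op_positive[OF vs that])
  have nr: "nn (r x) \<le> nn x" if x: "x \<in> carrier E" for x
  proof (rule power2_le_imp_le)
    have e: "ip E (r x) (r x) = ip E x x - ip E x (S x)"
      using adj_ip[OF r(1), of x "r x"] x rm Sm by (simp add: r ip_diff)
    have "norm (ip E (r x) (r x)) \<le> norm (ip E (r x) (r x) + ip E x (S x))"
      by (intro positive_cone_norm_mono ip_positive Spos rm x)
    then show "(nn (r x))\<^sup>2 \<le> (nn x)\<^sup>2" unfolding nn_square by (simp add: e)
  qed simp
  have nrk: "nn ((r ^^ n) x) \<le> nn x" if x: "x \<in> carrier E" for n x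
    by (induction n) (use x nr rm in \<open>auto intro: order_trans\<close>)
  define H where "H m = concat (map (\<lambda>k. map (r ^^ k) vs) [0..<m])" for m
  have H_mem: "set (H m) \<subseteq> carrier E" for m using vs rm by (auto simp: H_def)
  have frH: "frame_op (H m) x = x - (r ^^ m) ((r ^^ m) x)" if x: "x \<in> carrier E" for m x
  proof (induction m)
    case 0 show ?case by (simp add: H_def frame_op_def)
  next
    case (Suc m)
    have "frame_op (H (Suc m)) x = frame_op (H m) x + (r ^^ m) (S ((r ^^ m) x))"
      using frame_op_map[OF rk vs x] by (simp add: H_def frame_op_append S_def)
    also have "(r ^^ m) (S ((r ^^ m) x)) = (r ^^ m) ((r ^^ m) x) - (r ^^ m) (r (r ((r ^^ m) x)))"
      using x rm by (simp add: Sr adj_diff[OF rk])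
    also have "(r ^^ m) (r (r ((r ^^ m) x))) = (r ^^ Suc m) ((r ^^ Suc m) x)"
      by (simp add: funpow_swap1)
    finally show ?case by (simp only: Suc) simp
  qed
  have subH: "subunital (H m)" for m unfolding subunital_def
  proof (intro conjI ballI H_mem)
    fix x assume x: "x \<in> carrier E"
    have "ip E x x - ip E x (frame_op (H m) x) = ip E ((r ^^ m) x) ((r ^^ m) x)"
      using x rm by (simp add: frH ip_diff mem adj_ip[OF rk])
    then show "ip E x x - ip E x (frame_op (H m) x) \<in> positive_cone" using ip_positive rm x by simp
  qed
  \<comment> \<open>The elements $b_k=\langle r^ky,Sr^ky\rangle$ decrease in $k$ and have sums
    below $\langle y,y\rangle$, so $(m+1)b_m\le\langle y,y\rangle$; and $\langle y,y\rangle^2\le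
    b_m$ because $\theta_{v,v}\le S$.\<close>
  have decay: "(nn ((r ^^ m) v))\<^sup>2 * (real m + 1) \<le> 1" if v: "v \<in> set vs" for m v
  proof -
    have vm: "v \<in> carrier E" using v vs by auto
    define y where "y = (r ^^ m) v"
    have y: "y \<in> carrier E" using vm rm by (simp add: y_def)
    define b where "b k = ip E ((r ^^ k) y) (S ((r ^^ k) y))" for k
    have b_diff: "b k - b (Suc k) \<in> positive_cone" for k
    proof -
      define x where "x = (r ^^ k) y"
      have x: "x \<in> carrier E" using y rm by (simp add: x_def)
      have "b k - b (Suc k) = ip E x (S x) - ip E (r x) (S (r x))" by (simp add: b_def x_def)
      also have "\<dots> = ip E (S x) (S x)"
      proof -
        have "S (r x) = r (S x)" using x rm Sm by (simp add: Sr adj_diff[OF r(1)])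
        then have "ip E (r x) (S (r x)) = ip E (r (r x)) (S x)" using x rm Sm adj_ip[OF r(1), of "r x" "S x"] by simp
        then show ?thesis using x rm Sm by (simp add: r(2) ip_diff_left)
      qed
      finally show ?thesis using ip_positive Sm by simp
    qed
    have b_le: "b k - b m \<in> positive_cone" if "k \<le> m" for k
      using that
    proof (induction rule: inc_induct)
      case (step n)
      then show ?case using positive_cone_add[OF b_diff[of n] step.IH] by simp
    qed simp
    have bm: "b m \<in> positive_cone" unfolding b_def by (intro Spos rm y)
    have sums: "(\<Sum>k\<leftarrow>[0..<n]. b k) = ip E y y - ip E ((r ^^ n) y) ((r ^^ n) y)" for n
    proof (induction n)
      case (Suc n)
      have "b n = ip E ((r ^^ n) y) ((r ^^ n) y) - ip E ((r ^^ Suc n) y) ((r ^^ Suc n) y)"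
        using y rm by (simp add: b_def Sr ip_diff adj_ip[OF r(1)])
      then show ?case using Suc by simp
    qed simp
    have "(\<Sum>k\<leftarrow>[0..<n]. b k - b m) = (\<Sum>k\<leftarrow>[0..<n]. b k) - scaleR (real n) (b m)" for n
      by (induction n) (simp_all add: algebra_simps)
    moreover have "(\<Sum>k\<leftarrow>[0..<Suc m]. b k - b m) \<in> positive_cone"
      by (rule sum_list_positive) (use b_le in auto)
    ultimately have "ip E y y - ip E ((r ^^ Suc m) y) ((r ^^ Suc m) y) - scaleR (real (Suc m)) (b m) \<in> positive_cone"
      by (metis sums)
    then have "(ip E y y - ip E ((r ^^ Suc m) y) ((r ^^ Suc m) y) - scaleR (real (Suc m)) (b m)) + ip E ((r ^^ Suc m) y) ((r ^^ Suc m) y) \<in> positive_cone"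
      by (intro positive_cone_add ip_positive rm y)
    then have "ip E y y - scaleR (real (Suc m)) (b m) \<in> positive_cone" by simp
    then have "norm (scaleR (real (Suc m)) (b m)) \<le> norm (scaleR (real (Suc m)) (b m) + (ip E y y - scaleR (real (Suc m)) (b m)))"
      by (intro positive_cone_norm_mono positive_cone_scaleR bm) auto
    then have 1: "(real m + 1) * norm (b m) \<le> (nn y)\<^sup>2" by (simp add: nn_square add.commute)
    have 2: "((nn y)\<^sup>2)\<^sup>2 \<le> norm (b m)"
    proof -
      define z where "z = (r ^^ m) y"
      have z: "z \<in> carrier E" using y rm by (simp add: z_def)
      have vz: "ip E v z = ip E y y" using vm y rm by (simp add: z_def y_def adj_ip[OF rk])
      obtain us ws where uw: "vs = us @ v # ws" using v by (meson split_list)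
      have "b m = star (ip E v z) * ip E v z +
          ((\<Sum>\<xi>\<leftarrow>us. star (ip E \<xi> z) * ip E \<xi> z) + (\<Sum>\<xi>\<leftarrow>ws. star (ip E \<xi> z) * ip E \<xi> z))"
        unfolding b_def z_def[symmetric] S_def ip_frame_op_square[OF vs z] by (simp add: uw algebra_simps)
      then have "norm (star (ip E v z) * ip E v z) \<le> norm (b m)"
        by (simp only:) (intro positive_cone_norm_mono positive_cone_add sum_list_positive star_mult_positive)
      then show ?thesis by (simp add: cstar_identity vz nn_square)
    qed
    have "((nn y)\<^sup>2 * (real m + 1)) * (nn y)\<^sup>2 \<le> 1 * (nn y)\<^sup>2"
      using mult_left_mono[OF 2, of "real m + 1"] 1 by (simp add: power2_eq_square algebra_simps)
    then show ?thesis
    proof (cases "nn y = 0")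
      case False
      then have "(nn y)\<^sup>2 > 0" by simp
      with \<open>((nn y)\<^sup>2 * (real m + 1)) * (nn y)\<^sup>2 \<le> 1 * (nn y)\<^sup>2\<close> show ?thesis
        unfolding y_def[symmetric] by (simp only: mult_le_cancel_right_pos)
    qed (simp add: y_def[symmetric])
  qed
  have "0 < (\<delta> * c)\<^sup>2" using d c0 by simp
  then obtain m :: nat where m: "1 < real m * (\<delta> * c)\<^sup>2" using reals_Archimedean3[of "(\<delta> * c)\<^sup>2"] by auto
  have "nn (frame_op (H m) \<xi> - \<xi>) < \<delta>" if xi: "\<xi> \<in> G" for \<xi>
  proof -
    have xm: "\<xi> \<in> carrier E" using xi G by auto
    define v where "v = scaleC (of_real c) \<xi>"
    have v: "v \<in> set vs" "v \<in> carrier E" using xi gs xm by (auto simp: vs_def v_def intro: mem)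
    have "(nn ((r ^^ m) v))\<^sup>2 * (real m + 1) < (\<delta> * c)\<^sup>2 * (real m + 1)"
      using decay[OF v(1), of m] m \<open>0 < (\<delta> * c)\<^sup>2\<close> by (simp add: algebra_simps)
    then have "(nn ((r ^^ m) v))\<^sup>2 < (\<delta> * c)\<^sup>2"
      by (simp only: mult_less_cancel_right)
    then have "nn ((r ^^ m) v) < \<delta> * c" by (rule power2_less_imp_less) (use d c0 in simp)
    moreover have "nn ((r ^^ m) v) = c * nn ((r ^^ m) \<xi>)"
      using xm rm c0 by (simp add: v_def adj_scaleC[OF rk] nn_scaleC)
    ultimately have "nn ((r ^^ m) \<xi>) < \<delta>" using c0 by (simp add: mult.commute)
    moreover have "nn (frame_op (H m) \<xi> - \<xi>) = nn ((r ^^ m) ((r ^^ m) \<xi>))"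
      using xm rm by (simp add: frH nn_minus)
    ultimately show ?thesis using nrk[OF rm(1)[OF xm], of m m] by simp
  qed
  then show ?thesis using subH by blast
qed

lemma approx_unit_neq_bot: "approx_unit \<noteq> bot"
proof
  assume "approx_unit = bot"
  then have "eventually (\<lambda>H. False) approx_unit" by simp
  then show False unfolding eventually_approx_unit using ex_approx_unit by blast
qed

end

section \<open>Induced traces as limits\<close>

lemma tracial_state_simps:
  assumes "tracial_state \<tau>"
  shows "\<tau> (a + b) = \<tau> a + \<tau> b" "\<tau> (a - b) = \<tau> a - \<tau> b" "\<tau> 0 = 0" "\<tau> (a * b) = \<tau> (b * a)"
    "a \<in> positive_cone \<Longrightarrow> 0 \<le> Re (\<tau> a)" "norm (\<tau> a) \<le> norm a"
proof -
  have bl: "bounded_linear \<tau>" using assms by (simp add: tracial_state_def)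
  then interpret bounded_linear \<tau> .
  show "\<tau> (a + b) = \<tau> a + \<tau> b" "\<tau> (a - b) = \<tau> a - \<tau> b" "\<tau> 0 = 0" by (rule add diff zero)+
  show "norm (\<tau> a) \<le> norm a" using onorm[OF bl, of a] assms by (simp add: tracial_state_def)
  show "\<tau> (a * b) = \<tau> (b * a)" "a \<in> positive_cone \<Longrightarrow> 0 \<le> Re (\<tau> a)"
    using assms by (auto simp: tracial_state_def complex_nonneg_Reals_iff)
qed

lemma tracial_state_sum_list: "tracial_state \<tau> \<Longrightarrow> \<tau> (\<Sum>x\<leftarrow>xs. f x) = (\<Sum>x\<leftarrow>xs. \<tau> (f x))"
  by (induction xs) (auto simp: tracial_state_simps)

lemma sum_list_sum_list_swap:
  fixes f :: "'b \<Rightarrow> 'c \<Rightarrow> 'd::comm_monoid_add"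
  shows "(\<Sum>x\<leftarrow>xs. \<Sum>y\<leftarrow>ys. f x y) = (\<Sum>y\<leftarrow>ys. \<Sum>x\<leftarrow>xs. f x y)"
  by (induction xs) (simp_all add: sum_list_addf)

lemma Re_sum_list: "Re (\<Sum>x\<leftarrow>xs. f x) = (\<Sum>x\<leftarrow>xs. Re (f x))"
  by (induction xs) auto

lemma infinite_unit_complex: "infinite {c. cmod c = 1}"
proof
  assume "finite {c. cmod c = 1}"
  then have "finite (cis ` {0..1::real})" by (rule finite_subset[rotated]) auto
  moreover have "inj_on cis {0..1::real}"
  proof (rule inj_onI)
    fix x y :: real assume xy: "x \<in> {0..1}" "y \<in> {0..1}" "cis x = cis y"
    have "sin x = sin y" using arg_cong[OF xy(3), of Im] by simp
    moreover have "- (pi / 2) \<le> z \<and> z \<le> pi / 2" if "z \<in> {0..1}" for z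
      using that pi_ge_two by (simp add: field_simps)
    ultimately show "x = y" using xy(1,2) sin_inj_pi by blast
  qed
  ultimately have "finite {0..1::real}" by (rule finite_imageD)
  then show False using infinite_Icc[of 0 "1::real"] by simp
qed

context hilbert_module begin

definition trace_sum :: "('a \<Rightarrow> complex) \<Rightarrow> ('x \<Rightarrow> 'x) \<Rightarrow> 'x list \<Rightarrow> real" where
  "trace_sum \<tau> R H = (\<Sum>\<xi>\<leftarrow>H. Re (\<tau> (ip E (R \<xi>) (R \<xi>))))"

text \<open>A scalar of modulus one in front of $\xi$ does not change $\theta_{\xi,\xi}$, so the
  repetitions in a list can be removed without changing its operator.\<close>

lemma ex_distinct_phases:
  assumes "set H \<subseteq> carrier E" "0 \<notin> set H"
  shows "\<exists>cs. length cs = length H \<and> (\<forall>c\<in>set cs. cmod c = 1) \<and> distinct (map2 scaleC cs H)"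
  using assms
proof (induction H)
  case (Cons x H)
  then obtain cs where cs: "length cs = length H" "\<forall>c\<in>set cs. cmod c = 1" "distinct (map2 scaleC cs H)" by auto
  have "inj_on (\<lambda>c. scaleC c x) {c. cmod c = 1}"
  proof (rule inj_onI)
    fix c d assume "scaleC c x = scaleC d x"
    then have "scaleC (c - d) x = 0" using scaleC_add_left[of "c - d" d x] by simp
    then have "cmod (c - d) * nn x = 0" using nn_scaleC[of x "c - d"] Cons.prems by simp
    then show "c = d" using nn_eq_zero[of x] Cons.prems by auto
  qed
  then have "infinite ((\<lambda>c. scaleC c x) ` {c. cmod c = 1})"
    using infinite_unit_complex finite_imageD by blast
  then obtain c where c: "cmod c = 1" "scaleC c x \<notin> set (map2 scaleC cs H)"
    by (metis (mono_tags, lifting) List.finite_set finite_subset image_subsetI mem_Collect_eq)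
  then show ?case using cs by (intro exI[of _ "c # cs"]) auto
qed simp

lemma frame_op_phases:
  "length cs = length H \<Longrightarrow> \<forall>c\<in>set cs. cmod c = 1 \<Longrightarrow> set H \<subseteq> carrier E \<Longrightarrow> x \<in> carrier E \<Longrightarrow>
   frame_op (map2 scaleC cs H) x = frame_op H x"
proof (induction cs H rule: list_induct2)
  case (Cons c cs \<xi> H)
  have "c * cnj c = 1" "cnj c * c = 1" using Cons.prems(1) by (simp_all add: complex_norm_square[symmetric] mult.commute)
  then have "ract E (scaleC c \<xi>) (ip E (scaleC c \<xi>) x) = ract E \<xi> (ip E \<xi> x)"
    using Cons.prems by (simp add: ip_scaleC_left ract_scaleC_left ract_scaleC_right mem scaleC_scaleC scaleC_one)
  then show ?case using Cons by (simp add: frame_op_def)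
qed simp

lemma trace_sum_phases:
  "length cs = length H \<Longrightarrow> \<forall>c\<in>set cs. cmod c = 1 \<Longrightarrow> set H \<subseteq> carrier E \<Longrightarrow> adj R R' \<Longrightarrow>
   trace_sum \<tau> R (map2 scaleC cs H) = trace_sum \<tau> R H"
proof (induction cs H rule: list_induct2)
  case (Cons c cs \<xi> H)
  have "c * cnj c = 1" "cnj c * c = 1" using Cons.prems(1) by (simp_all add: complex_norm_square[symmetric] mult.commute)
  then have "ip E (R (scaleC c \<xi>)) (R (scaleC c \<xi>)) = ip E (R \<xi>) (R \<xi>)"
    using Cons.prems by (simp add: ip_scaleC_left ip_scaleC adj_scaleC adj_mem mem scaleC_scaleC scaleC_one)
  then show ?case using Cons by (simp add: trace_sum_def)
qed simp

text \<open>The definition uses finite sets instead of lists. A list is turned into a set of the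
  same size by dropping zeros and choosing phases that make its entries distinct.\<close>

lemma induced_trace_eq:
  assumes \<tau>: "tracial_state \<tau>" and R: "adj R' R" and T: "\<And>x. x \<in> carrier E \<Longrightarrow> T x = R' (R x)"
  shows "induced_trace \<tau> E T = (SUP H \<in> {H. subunital H}. ereal (trace_sum \<tau> R H))"
proof -
  have ipT: "ip E \<xi> (T \<xi>) = ip E (R \<xi>) (R \<xi>)" if "\<xi> \<in> carrier E" for \<xi>
    using that adj_mem[OF R] adj_ip'[OF R] by (simp add: T)
  have fr: "(\<lambda>\<eta>\<in>carrier E. \<eta> - (\<Sum>\<xi>\<in>set xs. theta E \<xi> \<xi> \<eta>)) = (\<lambda>\<eta>\<in>carrier E. \<eta> - frame_op xs \<eta>)"
    if "distinct xs" for xs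
    by (rule restrict_ext) (simp add: theta_def frame_op_def sum_list_distinct_conv_sum_set that)
  have ts: "(\<Sum>\<xi>\<in>set xs. ereal (Re (\<tau> (ip E \<xi> (T \<xi>))))) = ereal (trace_sum \<tau> R xs)"
    if "distinct xs" "set xs \<subseteq> carrier E" for xs
    using that by (auto simp: trace_sum_def sum_list_distinct_conv_sum_set ipT subset_iff intro!: sum.cong)
  show ?thesis unfolding induced_trace_def
  proof (rule antisym; rule SUP_least)
    fix H assume "H \<in> {H. finite H \<and> H \<subseteq> carrier E \<and>
        (\<lambda>\<eta>\<in>carrier E. \<eta> - (\<Sum>\<xi>\<in>H. theta E \<xi> \<xi> \<eta>)) \<in> positive_op E}"
    then have H: "finite H" "H \<subseteq> carrier E" "(\<lambda>\<eta>\<in>carrier E. \<eta> - (\<Sum>\<xi>\<in>H. theta E \<xi> \<xi> \<eta>)) \<in> positive_op E" by auto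
    obtain xs where xs: "set xs = H" "distinct xs" using finite_distinct_list[OF H(1)] by blast
    have "subunital xs" using H xs fr[OF xs(2)] by (simp add: subunital_iff_positive_op)
    moreover have "(\<Sum>\<xi>\<in>H. ereal (Re (\<tau> (ip E \<xi> (T \<xi>))))) = ereal (trace_sum \<tau> R xs)"
      using ts[OF xs(2)] xs H by simp
    ultimately show "(\<Sum>\<xi>\<in>H. ereal (Re (\<tau> (ip E \<xi> (T \<xi>))))) \<le> (SUP H \<in> {H. subunital H}. ereal (trace_sum \<tau> R H))"
      by (auto intro: SUP_upper2)
  next
    fix H assume "H \<in> {H. subunital H}"
    then have H: "subunital H" "set H \<subseteq> carrier E" by (auto simp: subunital_def)
    define H0 where "H0 = filter (\<lambda>\<xi>. \<xi> \<noteq> 0) H"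
    have H0: "set H0 \<subseteq> carrier E" "0 \<notin> set H0" using H by (auto simp: H0_def)
    have f0: "frame_op H0 x = frame_op H x" if "x \<in> carrier E" for x
    proof -
      have "ract E 0 (ip E 0 x) = 0" using ract_scaleC_left[OF zero_mem, of 0 "ip E 0 x"] by simp
      then show ?thesis unfolding H0_def frame_op_def by (induction H) auto
    qed
    have t0: "trace_sum \<tau> R H0 = trace_sum \<tau> R H"
      using tracial_state_simps(3)[OF \<tau>] adj_zero[OF adj_sym[OF R]] unfolding H0_def trace_sum_def by (induction H) (auto simp: zero_mem)
    obtain cs where cs: "length cs = length H0" "\<forall>c\<in>set cs. cmod c = 1" "distinct (map2 scaleC cs H0)"
      using ex_distinct_phases[OF H0] by blast
    define K where "K = map2 scaleC cs H0"
    have K: "set K \<subseteq> carrier E" using H0 by (auto simp: K_def dest: set_zip_rightD intro: mem)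
    have fK: "frame_op K x = frame_op H x" if "x \<in> carrier E" for x
      using frame_op_phases[OF cs(1,2) H0(1) that] f0[OF that] by (simp add: K_def)
    have "subunital K" using H K fK by (simp add: subunital_def)
    then have "(\<lambda>\<eta>\<in>carrier E. \<eta> - (\<Sum>\<xi>\<in>set K. theta E \<xi> \<xi> \<eta>)) \<in> positive_op E"
      using fr[of K] cs K by (simp add: subunital_iff_positive_op K_def)
    moreover have "ereal (trace_sum \<tau> R H0) = (\<Sum>\<xi>\<in>set K. ereal (Re (\<tau> (ip E \<xi> (T \<xi>)))))"
      using ts[of K] cs K trace_sum_phases[OF cs(1,2) H0(1) adj_sym[OF R]] by (simp add: K_def)
    ultimately show "ereal (trace_sum \<tau> R H) \<le> (SUP H \<in> {H. finite H \<and> H \<subseteq> carrier E \<and>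
        (\<lambda>\<eta>\<in>carrier E. \<eta> - (\<Sum>\<xi>\<in>H. theta E \<xi> \<xi> \<eta>)) \<in> positive_op E}.
      \<Sum>\<xi>\<in>H. ereal (Re (\<tau> (ip E \<xi> (T \<xi>)))))"
      using K t0 by (auto intro!: SUP_upper2[of "set K"])
  qed
qed

text \<open>By the trace property $\tau\langle
  R\zeta,\theta_{\kappa,\kappa}R\zeta\rangle=\tau\langle
  R'\kappa,\theta_{\zeta,\zeta}R'\kappa\rangle$, and summing over $\zeta\in H$ gives at most
  $\tau\langle R'\kappa,R'\kappa\rangle$.\<close>

lemma trace_swap:
  assumes \<tau>: "tracial_state \<tau>" and R: "adj R R'" and H: "subunital H" and K: "set K \<subseteq> carrier E"
  shows "(\<Sum>\<zeta>\<leftarrow>H. Re (\<tau> (ip E (R \<zeta>) (frame_op K (R \<zeta>))))) \<le> trace_sum \<tau> R' K"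
proof -
  note m = adj_mem[OF R]
  have Hm: "set H \<subseteq> carrier E" using H by (simp add: subunital_def)
  have "(\<Sum>\<zeta>\<leftarrow>H. \<tau> (ip E (R \<zeta>) (frame_op K (R \<zeta>)))) = (\<Sum>\<zeta>\<leftarrow>H. \<Sum>\<kappa>\<leftarrow>K. \<tau> (ip E \<kappa> (R \<zeta>) * ip E (R \<zeta>) \<kappa>))"
    using Hm m K by (intro arg_cong[of _ _ sum_list] map_cong HOL.refl)
      (auto simp: ip_frame_op tracial_state_sum_list[OF \<tau>] tracial_state_simps(4)[OF \<tau>, of "ip E (R _) _"] subset_iff)
  also have "\<dots> = (\<Sum>\<kappa>\<leftarrow>K. \<Sum>\<zeta>\<leftarrow>H. \<tau> (ip E \<kappa> (R \<zeta>) * ip E (R \<zeta>) \<kappa>))" by (rule sum_list_sum_list_swap)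
  also have "\<dots> = (\<Sum>\<kappa>\<leftarrow>K. \<tau> (ip E (R' \<kappa>) (frame_op H (R' \<kappa>))))"
    using Hm m K by (intro arg_cong[of _ _ sum_list] map_cong HOL.refl)
      (auto simp: ip_frame_op tracial_state_sum_list[OF \<tau>] adj_ip[OF R] adj_ip'[OF R] subset_iff intro!: arg_cong[of _ _ sum_list])
  finally have "(\<Sum>\<zeta>\<leftarrow>H. Re (\<tau> (ip E (R \<zeta>) (frame_op K (R \<zeta>))))) = (\<Sum>\<kappa>\<leftarrow>K. Re (\<tau> (ip E (R' \<kappa>) (frame_op H (R' \<kappa>)))))"
    by (simp only: Re_sum_list[symmetric])
  also have "\<dots> \<le> trace_sum \<tau> R' K" unfolding trace_sum_def
  proof (rule sum_list_mono)
    fix \<kappa> assume "\<kappa> \<in> set K"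
    then have "R' \<kappa> \<in> carrier E" using K m by auto
    then have "ip E (R' \<kappa>) (R' \<kappa>) - ip E (R' \<kappa>) (frame_op H (R' \<kappa>)) \<in> positive_cone"
      using H by (simp add: subunital_def)
    from tracial_state_simps(5)[OF \<tau> this]
    show "Re (\<tau> (ip E (R' \<kappa>) (frame_op H (R' \<kappa>)))) \<le> Re (\<tau> (ip E (R' \<kappa>) (R' \<kappa>)))"
      by (simp add: tracial_state_simps(2)[OF \<tau>])
  qed
  finally show ?thesis .
qed

lemma near_trace:
  assumes \<tau>: "tracial_state \<tau>" and m: "\<And>\<zeta>. \<zeta> \<in> set H \<Longrightarrow> R \<zeta> \<in> carrier E" and K: "set K \<subseteq> carrier E"
    and near: "\<And>\<zeta>. \<zeta> \<in> set H \<Longrightarrow> nn (frame_op K (R \<zeta>) - R \<zeta>) \<le> \<delta>"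
  shows "trace_sum \<tau> R H - \<delta> * (\<Sum>\<zeta>\<leftarrow>H. nn (R \<zeta>)) \<le> (\<Sum>\<zeta>\<leftarrow>H. Re (\<tau> (ip E (R \<zeta>) (frame_op K (R \<zeta>)))))"
proof -
  have "Re (\<tau> (ip E (R \<zeta>) (R \<zeta>))) \<le> Re (\<tau> (ip E (R \<zeta>) (frame_op K (R \<zeta>)))) + nn (R \<zeta>) * \<delta>" if z: "\<zeta> \<in> set H" for \<zeta>
  proof -
    let ?d = "\<tau> (ip E (R \<zeta>) (frame_op K (R \<zeta>))) - \<tau> (ip E (R \<zeta>) (R \<zeta>))"
    have "norm ?d \<le> norm (ip E (R \<zeta>) (frame_op K (R \<zeta>) - R \<zeta>))"
      using m[OF z] K tracial_state_simps(6)[OF \<tau>] by (simp add: tracial_state_simps(2)[OF \<tau>, symmetric] ip_diff frame_op_mem)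
    also have "\<dots> \<le> nn (R \<zeta>) * nn (frame_op K (R \<zeta>) - R \<zeta>)"
      using m[OF z] K by (intro Cauchy_Schwarz) (auto intro: mem frame_op_mem)
    also have "\<dots> \<le> nn (R \<zeta>) * \<delta>" using near[OF z] by (intro mult_left_mono) auto
    finally have "\<bar>Re ?d\<bar> \<le> nn (R \<zeta>) * \<delta>" using abs_Re_le_cmod[of ?d] by linarith
    then show ?thesis by simp
  qed
  then have "trace_sum \<tau> R H \<le> (\<Sum>\<zeta>\<leftarrow>H. Re (\<tau> (ip E (R \<zeta>) (frame_op K (R \<zeta>)))) + nn (R \<zeta>) * \<delta>)"
    unfolding trace_sum_def by (rule sum_list_mono)
  then show ?thesis by (simp add: sum_list_addf sum_list_mult_const sum_list_const_mult algebra_simps)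
qed

lemma ex_good_delta: "0 < e \<Longrightarrow> 0 \<le> s \<Longrightarrow> \<exists>d>0. d * s < (e::real)"
  by (intro exI[of _ "e / (s + 1)"]) (auto simp: field_simps add_nonneg_pos)

text \<open>If $\theta_K=\sum_{\kappa\in K}\theta_{\kappa,\kappa}$ nearly fixes the vectors
  $R\zeta$ with $\zeta\in H$, the sum for $R$ over $H$ is close to $\sum_\zeta\tau\langle
  R\zeta,\theta_KR\zeta\rangle$, which is bounded by the sum for $R'$ over $K$.\<close>

lemma eventually_trace_ge:
  assumes \<tau>: "tracial_state \<tau>" and R: "adj R R'" and H: "subunital H" and l: "l < trace_sum \<tau> R H"
  shows "eventually (\<lambda>K. l < trace_sum \<tau> R' K) approx_unit"
proof -
  note m = adj_mem[OF R]
  have Hm: "set H \<subseteq> carrier E" using H by (simp add: subunital_def)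
  obtain d where d: "d > 0" "d * (\<Sum>\<zeta>\<leftarrow>H. nn (R \<zeta>)) < trace_sum \<tau> R H - l"
    using ex_good_delta[of "trace_sum \<tau> R H - l" "\<Sum>\<zeta>\<leftarrow>H. nn (R \<zeta>)"] l
      sum_list_nonneg[of "map (\<lambda>\<zeta>. nn (R \<zeta>)) H"] by fastforce
  show ?thesis unfolding eventually_approx_unit
  proof (intro exI[of _ "R ` set H"] exI[of _ d] conjI allI impI d)
    show "R ` set H \<subseteq> carrier E" using m Hm by auto
    fix K assume K: "subunital K \<and> (\<forall>\<xi>\<in>R ` set H. nn (frame_op K \<xi> - \<xi>) < d)"
    then have Km: "set K \<subseteq> carrier E" by (simp add: subunital_def)
    have "trace_sum \<tau> R H - d * (\<Sum>\<zeta>\<leftarrow>H. nn (R \<zeta>)) \<le> (\<Sum>\<zeta>\<leftarrow>H. Re (\<tau> (ip E (R \<zeta>) (frame_op K (R \<zeta>)))))"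
      using Hm m K Km by (intro near_trace[OF \<tau>]) (auto simp: less_imp_le)
    also have "\<dots> \<le> trace_sum \<tau> R' K" by (rule trace_swap[OF \<tau> R H Km])
    finally show "l < trace_sum \<tau> R' K" using d by linarith
  qed simp
qed

text \<open>The induced trace does not distinguish $RR'$ from $R'R$.\<close>

lemma induced_trace_swap:
  assumes \<tau>: "tracial_state \<tau>" and R: "adj R R'"
  shows "(SUP H \<in> {H. subunital H}. ereal (trace_sum \<tau> R H)) = (SUP H \<in> {H. subunital H}. ereal (trace_sum \<tau> R' H))"
proof -
  have "(SUP H \<in> {H. subunital H}. ereal (trace_sum \<tau> R H)) \<le> (SUP H \<in> {H. subunital H}. ereal (trace_sum \<tau> R' H))"
    if R: "adj R R'" for R R'
  proof (rule SUP_least)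
    fix H assume "H \<in> {H. subunital H}"
    then have H: "subunital H" by simp
    show "ereal (trace_sum \<tau> R H) \<le> (SUP H \<in> {H. subunital H}. ereal (trace_sum \<tau> R' H))"
    proof (rule ereal_le_epsilon2)
      fix e :: real assume "0 < e"
      then have "eventually (\<lambda>K. trace_sum \<tau> R H - e < trace_sum \<tau> R' K) approx_unit"
        by (intro eventually_trace_ge[OF \<tau> R H]) simp
      then have "eventually (\<lambda>K. trace_sum \<tau> R H - e < trace_sum \<tau> R' K \<and> subunital K) approx_unit"
        using eventually_approx_unit_subunital by (rule eventually_conj)
      then obtain K where K: "trace_sum \<tau> R H - e < trace_sum \<tau> R' K" "subunital K"
        using eventually_happens'[OF approx_unit_neq_bot] by blast
      have "ereal (trace_sum \<tau> R' K) \<le> (SUP H \<in> {H. subunital H}. ereal (trace_sum \<tau> R' H))"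
        using K(2) by (auto intro: SUP_upper)
      moreover have "ereal (trace_sum \<tau> R H) \<le> ereal (trace_sum \<tau> R' K) + ereal e" using K(1) by simp
      ultimately show "ereal (trace_sum \<tau> R H) \<le> (SUP H \<in> {H. subunital H}. ereal (trace_sum \<tau> R' H)) + ereal e"
        by (meson add_right_mono order_trans)
    qed
  qed
  then show ?thesis using R adj_sym[OF R] by (intro antisym) blast+
qed

text \<open>The supremum is a limit along one filter that is the same for all operators. This is
  what allows linear combinations of induced traces with coefficients of both signs to be
  treated as limits.\<close>

lemma trace_sum_tendsto:
  assumes \<tau>: "tracial_state \<tau>" and R: "adj R' R" and T: "\<And>x. x \<in> carrier E \<Longrightarrow> T x = R' (R x)"
  shows "((\<lambda>H. ereal (trace_sum \<tau> R H)) \<longlongrightarrow> induced_trace \<tau> E T) approx_unit"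
proof (rule order_tendstoI)
  fix l assume "l < induced_trace \<tau> E T"
  then have "l < (SUP H \<in> {H. subunital H}. ereal (trace_sum \<tau> R' H))"
    using induced_trace_eq[OF \<tau> R T] induced_trace_swap[OF \<tau> R] by simp
  then obtain H where H: "subunital H" "l < ereal (trace_sum \<tau> R' H)" unfolding less_SUP_iff by auto
  show "\<forall>\<^sub>F H in approx_unit. l < ereal (trace_sum \<tau> R H)"
  proof (cases l)
    case (real r)
    then show ?thesis using eventually_trace_ge[OF \<tau> R H(1), of r] H(2) by simp
  qed (use H in auto)
next
  fix l assume l: "induced_trace \<tau> E T < l"
  have eq: "induced_trace \<tau> E T = (SUP H \<in> {H. subunital H}. ereal (trace_sum \<tau> R H))"
    by (rule induced_trace_eq[OF \<tau> R T])
  have "ereal (trace_sum \<tau> R H) \<le> induced_trace \<tau> E T" if "subunital H" for H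
    unfolding eq using that by (auto intro: SUP_upper)
  then have "ereal (trace_sum \<tau> R H) < l" if "subunital H" for H
    using that l le_less_trans by blast
  then show "\<forall>\<^sub>F H in approx_unit. ereal (trace_sum \<tau> R H) < l"
    using eventually_approx_unit_subunital by (auto elim: eventually_mono)
qed

end

section \<open>Induced traces of tensor products\<close>

context cstar_correspondence begin

lemma lact_mem: "\<xi> \<in> carrier E \<Longrightarrow> lact E a \<xi> \<in> carrier E"
  using lact_adjointable[of a] unfolding adjointable_def left_action_op_def by (force simp: PiE_iff extensional_def)

lemma adj_lact: "adj (lact E a) (lact E (star a))"
  unfolding adj_def using lact_star lact_mem by auto

lemma adj_lact': "adj (lact E (star a)) (lact E a)"
  by (rule adj_sym[OF adj_lact])

lemma lact_zero: "\<xi> \<in> carrier E \<Longrightarrow> lact E 0 \<xi> = 0"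
  using lact_add[of \<xi> 0 0] by simp

lemma lact_diff: "\<xi> \<in> carrier E \<Longrightarrow> lact E (a - b) \<xi> = lact E a \<xi> - lact E b \<xi>"
  using lact_add[of \<xi> "a - b" b] by (simp add: eq_diff_eq)

lemma lact_sum_list: "\<xi> \<in> carrier E \<Longrightarrow> lact E (\<Sum>x\<leftarrow>xs. f x) \<xi> = (\<Sum>x\<leftarrow>xs. lact E (f x) \<xi>)"
  by (induction xs) (auto simp: lact_zero lact_add)

lemma ip_lact: "\<xi> \<in> carrier E \<Longrightarrow> \<eta> \<in> carrier E \<Longrightarrow> ip E (lact E a \<xi>) \<eta> = ip E \<xi> (lact E (star a) \<eta>)"
  by (rule adj_ip[OF adj_lact])

lemma ip_lact_square: "\<xi> \<in> carrier E \<Longrightarrow> ip E \<xi> (lact E (star b * b) \<xi>) = ip E (lact E b \<xi>) (lact E b \<xi>)"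
  by (simp add: ip_lact lact_mult lact_mem)

lemma ip_lact_positive: "c \<in> positive_cone \<Longrightarrow> \<xi> \<in> carrier E \<Longrightarrow> ip E \<xi> (lact E c \<xi>) \<in> positive_cone"
  by (auto simp: positive_cone_def[where 'a='a] ip_lact_square intro!: ip_positive[unfolded positive_cone_def] lact_mem)

lemma norm_ip_lact_le:
  assumes c: "c \<in> positive_cone" and x: "\<xi> \<in> carrier E"
  shows "norm (ip E \<xi> (lact E c \<xi>)) \<le> norm c * (nn \<xi>)\<^sup>2"
proof (cases "c = 0")
  case False
  then have s: "norm c > 0" by simp
  obtain y where y: "star y = y" "y + y = scaleR (1 / norm c) c + y * y"
    using selfadjoint_conj_le[OF positive_cone_star[OF c] order_refl s] by blast
  have c_eq: "c = scaleR (norm c) (y + y - y * y)" using s by (simp add: y(2))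
  have m: "lact E y \<xi> \<in> carrier E" "lact E c \<xi> \<in> carrier E" using x lact_mem by auto
  have "ip E (\<xi> - lact E y \<xi>) (\<xi> - lact E y \<xi>) = ip E \<xi> \<xi> - ip E \<xi> (lact E (y + y - y * y) \<xi>)"
    using x m by (simp add: ip_simps mem lact_diff lact_add lact_mult ip_lact y(1) lact_mem)
  then have "ip E \<xi> \<xi> - ip E \<xi> (lact E (y + y - y * y) \<xi>) \<in> positive_cone"
    using ip_positive[OF diff_mem[OF x m(1)]] by simp
  then have "scaleR (norm c) (ip E \<xi> \<xi> - ip E \<xi> (lact E (y + y - y * y) \<xi>)) \<in> positive_cone"
    by (rule positive_cone_scaleR) simp
  moreover have "ip E \<xi> (lact E c \<xi>) = scaleR (norm c) (ip E \<xi> (lact E (y + y - y * y) \<xi>))"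
    by (subst c_eq) (simp add: scaleR_eq_scaleC lact_scaleC x ip_scaleC lact_mem)
  ultimately have "scaleR (norm c) (ip E \<xi> \<xi>) - ip E \<xi> (lact E c \<xi>) \<in> positive_cone"
    by (simp add: scaleR_diff_right)
  then have "norm (ip E \<xi> (lact E c \<xi>)) \<le> norm (ip E \<xi> (lact E c \<xi>) + (scaleR (norm c) (ip E \<xi> \<xi>) - ip E \<xi> (lact E c \<xi>)))"
    by (intro positive_cone_norm_mono ip_lact_positive c x)
  then show ?thesis by (simp add: nn_square)
qed (simp add: lact_zero x)

lemma induced_trace_nonneg: "0 \<le> induced_trace \<tau> E T"
proof -
  have "subunital []" by (simp add: subunital_def frame_op_def ip_positive)
  then have "(\<lambda>\<eta>\<in>carrier E. \<eta> - (\<Sum>\<xi>\<in>{}. theta E \<xi> \<xi> \<eta>)) \<in> positive_op E"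
    using subunital_iff_positive_op[of "[]"] by (simp add: frame_op_def)
  then show ?thesis unfolding induced_trace_def by (intro SUP_upper2[of "{}"]) auto
qed

lemma trace_sum_lact_tendsto:
  assumes "tracial_state \<tau>"
  shows "((\<lambda>H. ereal (trace_sum \<tau> (lact E b) H)) \<longlongrightarrow> induced_trace \<tau> E (left_action_op E (star b * b))) approx_unit"
  by (rule trace_sum_tendsto[OF assms adj_lact']) (simp add: left_action_op_def lact_mult)

lemma trace_sum_le_induced_trace:
  assumes "tracial_state \<tau>" "subunital H"
  shows "ereal (trace_sum \<tau> (lact E b) H) \<le> induced_trace \<tau> E (left_action_op E (star b * b))"
proof -
  have "induced_trace \<tau> E (left_action_op E (star b * b)) = (SUP H \<in> {H. subunital H}. ereal (trace_sum \<tau> (lact E b) H))"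
    by (rule induced_trace_eq[OF assms(1) adj_lact']) (simp add: left_action_op_def lact_mult)
  then show ?thesis using assms(2) by (auto intro: SUP_upper)
qed

end

lemma tendsto_sum_list_ereal:
  fixes f :: "'b \<Rightarrow> 'c \<Rightarrow> ereal"
  assumes "\<And>x. x \<in> set xs \<Longrightarrow> (f x \<longlongrightarrow> l x) F" "\<And>x. x \<in> set xs \<Longrightarrow> 0 \<le> l x"
  shows "((\<lambda>y. \<Sum>x\<leftarrow>xs. f x y) \<longlongrightarrow> (\<Sum>x\<leftarrow>xs. l x)) F"
  using assms
proof (induction xs)
  case (Cons x xs)
  have "0 \<le> (\<Sum>x\<leftarrow>xs. l x)" using Cons.prems by (intro sum_list_nonneg) auto
  then have "l x \<noteq> -\<infinity>" "(\<Sum>x\<leftarrow>xs. l x) \<noteq> -\<infinity>" using Cons.prems(2)[of x] by auto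
  then show ?case using Cons by (simp add: tendsto_add_ereal_nonneg)
qed simp

locale tensor_factorization = E: cstar_correspondence E + F: cstar_correspondence F + Z: cstar_correspondence Z
  for E :: "('a::cstar_algebra, 'x::complex_vector) correspondence"
    and F :: "('a, 'y::complex_vector) correspondence" and Z :: "('a, 'z::complex_vector) correspondence" +
  fixes \<mu> :: "'x \<Rightarrow> 'y \<Rightarrow> 'z"
  assumes \<mu>_mem: "\<xi> \<in> carrier E \<Longrightarrow> \<eta> \<in> carrier F \<Longrightarrow> \<mu> \<xi> \<eta> \<in> carrier Z"
    and iso: "tensor_iso E F Z \<mu>"
    and \<mu>_lact: "\<xi> \<in> carrier E \<Longrightarrow> \<eta> \<in> carrier F \<Longrightarrow> lact Z a (\<mu> \<xi> \<eta>) = \<mu> (lact E a \<xi>) \<eta>"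
begin

definition tsum where "tsum us = (\<Sum>p\<leftarrow>us. \<mu> (fst p) (snd p))"

definition tensor_list where "tensor_list H K = concat (map (\<lambda>\<xi>. map (\<mu> \<xi>) K) H)"

text \<open>The image of a finite sum of elementary tensors under the adjoint of the operator
  $\eta\mapsto\xi\otimes\eta$.\<close>

definition contract where "contract \<xi> us = (\<Sum>p\<leftarrow>us. lact F (ip E \<xi> (fst p)) (snd p))"

abbreviation "pairs \<equiv> lists (carrier E \<times> carrier F)"

lemma ip_tsum: "us \<in> pairs \<Longrightarrow> vs \<in> pairs \<Longrightarrow>
  ip Z (tsum us) (tsum vs) = (\<Sum>p\<leftarrow>us. \<Sum>q\<leftarrow>vs. ip F (snd p) (lact F (ip E (fst p) (fst q)) (snd q)))"
  using iso unfolding tensor_iso_def tensor_ip_def tsum_def case_prod_beta' by blast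

lemma dense: "z \<in> carrier Z \<Longrightarrow> \<epsilon> > 0 \<Longrightarrow> \<exists>us\<in>pairs. Z.nn (z - tsum us) < \<epsilon>"
  using iso unfolding tensor_iso_def tsum_def case_prod_beta' by blast

lemma tsum_mem: "us \<in> pairs \<Longrightarrow> tsum us \<in> carrier Z"
  unfolding tsum_def by (intro Z.sum_list_mem \<mu>_mem) (auto simp: in_lists_conv_set)

lemma ip_\<mu>:
  assumes "\<xi> \<in> carrier E" "\<eta> \<in> carrier F" "\<xi>' \<in> carrier E" "\<eta>' \<in> carrier F"
  shows "ip Z (\<mu> \<xi> \<eta>) (\<mu> \<xi>' \<eta>') = ip F \<eta> (lact F (ip E \<xi> \<xi>') \<eta>')"
  using ip_tsum[of "[(\<xi>, \<eta>)]" "[(\<xi>', \<eta>')]"] assms by (simp add: tsum_def)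

lemma contract_mem: "us \<in> pairs \<Longrightarrow> contract \<xi> us \<in> carrier F"
  unfolding contract_def by (intro F.sum_list_mem F.lact_mem) (auto simp: in_lists_conv_set)

lemma ip_\<mu>_tsum:
  assumes "\<xi> \<in> carrier E" "\<eta> \<in> carrier F" "us \<in> pairs"
  shows "ip Z (\<mu> \<xi> \<eta>) (tsum us) = ip F \<eta> (contract \<xi> us)"
  using ip_tsum[of "[(\<xi>, \<eta>)]" us] assms
  by (simp add: tsum_def contract_def F.ip_sum_list in_lists_conv_set F.lact_mem split_beta mem_Times_iff)

text \<open>Inner products between values of $\mu$ are known, so bilinearity and balancedness of
  $\mu$ are proved by comparing the inner products of both sides with each other.\<close>

lemma \<mu>_eqI:
  assumes "x \<in> carrier Z" "y \<in> carrier Z" "ip Z x x = ip Z x y" "ip Z y x = ip Z y y" shows "x = y"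
  using Z.ip_definite[of "x - y"] assms by (simp add: Z.ip_diff Z.ip_diff_left Z.diff_mem)

lemma \<mu>_add_right:
  assumes "\<xi> \<in> carrier E" "\<eta> \<in> carrier F" "\<eta>' \<in> carrier F"
  shows "\<mu> \<xi> (\<eta> + \<eta>') = \<mu> \<xi> \<eta> + \<mu> \<xi> \<eta>'"
  by (rule \<mu>_eqI) (use assms in \<open>simp_all add: \<mu>_mem F.mem Z.mem Z.ip_simps F.ip_simps ip_\<mu> F.lact_mem F.adj_add[OF F.adj_lact]\<close>)

lemma \<mu>_add_left:
  assumes "\<xi> \<in> carrier E" "\<xi>' \<in> carrier E" "\<eta> \<in> carrier F"
  shows "\<mu> (\<xi> + \<xi>') \<eta> = \<mu> \<xi> \<eta> + \<mu> \<xi>' \<eta>"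
  by (rule \<mu>_eqI) (use assms in \<open>simp_all add: \<mu>_mem F.mem E.mem Z.mem Z.ip_simps E.ip_simps F.ip_simps ip_\<mu> F.lact_mem F.lact_add\<close>)

lemma \<mu>_ract_right:
  assumes "\<xi> \<in> carrier E" "\<eta> \<in> carrier F"
  shows "\<mu> \<xi> (ract F \<eta> a) = ract Z (\<mu> \<xi> \<eta>) a"
  by (rule \<mu>_eqI) (use assms in \<open>simp_all add: \<mu>_mem F.mem Z.mem Z.ip_simps F.ip_simps ip_\<mu> F.lact_mem F.adj_ract[OF F.adj_lact] mult.assoc\<close>)

lemma \<mu>_balanced:
  assumes "\<xi> \<in> carrier E" "\<eta> \<in> carrier F"
  shows "\<mu> (ract E \<xi> a) \<eta> = \<mu> \<xi> (lact F a \<eta>)"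
  by (rule \<mu>_eqI) (use assms in \<open>simp_all add: \<mu>_mem F.mem E.mem Z.mem E.ip_simps ip_\<mu> F.lact_mem F.lact_mult F.ip_lact mult.assoc\<close>)

lemma \<mu>_diff_right:
  assumes "\<xi> \<in> carrier E" "\<eta> \<in> carrier F" "\<eta>' \<in> carrier F"
  shows "\<mu> \<xi> (\<eta> - \<eta>') = \<mu> \<xi> \<eta> - \<mu> \<xi> \<eta>'"
  using \<mu>_add_right[of \<xi> "\<eta> - \<eta>'" \<eta>'] assms by (simp add: F.mem)

lemma \<mu>_diff_left:
  assumes "\<xi> \<in> carrier E" "\<xi>' \<in> carrier E" "\<eta> \<in> carrier F"
  shows "\<mu> (\<xi> - \<xi>') \<eta> = \<mu> \<xi> \<eta> - \<mu> \<xi>' \<eta>"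
  using \<mu>_add_left[of "\<xi> - \<xi>'" \<xi>' \<eta>] assms by (simp add: E.mem)

lemma \<mu>_zero: "\<xi> \<in> carrier E \<Longrightarrow> \<mu> \<xi> 0 = 0" "\<eta> \<in> carrier F \<Longrightarrow> \<mu> 0 \<eta> = 0"
  using \<mu>_add_right[of \<xi> 0 0] \<mu>_add_left[of 0 0 \<eta>] by (simp_all add: F.mem E.mem)

lemma \<mu>_sum_right: "\<xi> \<in> carrier E \<Longrightarrow> (\<And>x. x \<in> set xs \<Longrightarrow> f x \<in> carrier F) \<Longrightarrow> \<mu> \<xi> (\<Sum>x\<leftarrow>xs. f x) = (\<Sum>x\<leftarrow>xs. \<mu> \<xi> (f x))"
  by (induction xs) (auto simp: \<mu>_zero \<mu>_add_right F.sum_list_mem)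

lemma \<mu>_sum_left: "\<eta> \<in> carrier F \<Longrightarrow> (\<And>x. x \<in> set xs \<Longrightarrow> f x \<in> carrier E) \<Longrightarrow> \<mu> (\<Sum>x\<leftarrow>xs. f x) \<eta> = (\<Sum>x\<leftarrow>xs. \<mu> (f x) \<eta>)"
  by (induction xs) (auto simp: \<mu>_zero \<mu>_add_left E.sum_list_mem)

lemma nn_\<mu>:
  assumes "\<xi> \<in> carrier E" "\<eta> \<in> carrier F" shows "Z.nn (\<mu> \<xi> \<eta>) \<le> E.nn \<xi> * F.nn \<eta>"
proof (rule power2_le_imp_le)
  show "(Z.nn (\<mu> \<xi> \<eta>))\<^sup>2 \<le> (E.nn \<xi> * F.nn \<eta>)\<^sup>2"
    using F.norm_ip_lact_le[OF E.ip_positive[OF assms(1)] assms(2)] assms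
    unfolding Z.nn_square power_mult_distrib E.nn_square by (simp add: ip_\<mu>)
qed simp

lemma tensor_list_mem: "set H \<subseteq> carrier E \<Longrightarrow> set K \<subseteq> carrier F \<Longrightarrow> set (tensor_list H K) \<subseteq> carrier Z"
  unfolding tensor_list_def using \<mu>_mem by auto

lemma sum_list_tensor_list: "(\<Sum>z\<leftarrow>tensor_list H K. f z) = (\<Sum>\<xi>\<leftarrow>H. \<Sum>\<eta>\<leftarrow>K. f (\<mu> \<xi> \<eta>))"
  unfolding tensor_list_def by (induction H) (simp_all add: o_def)

lemma sum_contract:
  assumes H: "set H \<subseteq> carrier E" and us: "us \<in> pairs"
  shows "(\<Sum>\<xi>\<leftarrow>H. ip F (contract \<xi> us) (contract \<xi> us)) =
    (\<Sum>p\<leftarrow>us. \<Sum>q\<leftarrow>us. ip F (snd p) (lact F (ip E (fst p) (E.frame_op H (fst q))) (snd q)))"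
proof -
  have u: "fst p \<in> carrier E" "snd p \<in> carrier F" if "p \<in> set us" for p
    using us that by (auto simp: in_lists_conv_set)
  have h: "\<xi> \<in> carrier E" if "\<xi> \<in> set H" for \<xi> using H that by auto
  have "(\<Sum>\<xi>\<leftarrow>H. ip F (contract \<xi> us) (contract \<xi> us)) =
     (\<Sum>\<xi>\<leftarrow>H. \<Sum>p\<leftarrow>us. \<Sum>q\<leftarrow>us. ip F (snd p) (lact F (ip E (fst p) \<xi> * ip E \<xi> (fst q)) (snd q)))"
  proof (intro arg_cong[of _ _ sum_list] map_cong HOL.refl)
    fix \<xi> assume \<xi>: "\<xi> \<in> set H"
    have "ip F (contract \<xi> us) (contract \<xi> us) = (\<Sum>p\<leftarrow>us. \<Sum>q\<leftarrow>us. ip F (lact F (ip E \<xi> (fst p)) (snd p)) (lact F (ip E \<xi> (fst q)) (snd q)))"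
    proof -
      let ?f = "\<lambda>p. lact F (ip E \<xi> (fst p)) (snd p)"
      have f: "?f p \<in> carrier F" if "p \<in> set us" for p using u[OF that] F.lact_mem by blast
      have "ip F (contract \<xi> us) (contract \<xi> us) = (\<Sum>p\<leftarrow>us. ip F (?f p) (contract \<xi> us))"
        using F.ip_sum_list_left[OF contract_mem[OF us, of \<xi>], of us ?f] f by (simp add: contract_def)
      also have "\<dots> = (\<Sum>p\<leftarrow>us. \<Sum>q\<leftarrow>us. ip F (?f p) (?f q))"
        unfolding contract_def using f by (intro arg_cong[of _ _ sum_list] map_cong HOL.refl F.ip_sum_list) auto
      finally show ?thesis .
    qed
    also have "\<dots> = (\<Sum>p\<leftarrow>us. \<Sum>q\<leftarrow>us. ip F (snd p) (lact F (ip E (fst p) \<xi> * ip E \<xi> (fst q)) (snd q)))"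
      using u h[OF \<xi>] by (intro arg_cong[of _ _ sum_list] map_cong HOL.refl) (simp add: F.ip_lact F.lact_mem E.ip_star F.lact_mult)
    finally show "ip F (contract \<xi> us) (contract \<xi> us) = \<dots>" .
  qed
  also have "\<dots> = (\<Sum>p\<leftarrow>us. \<Sum>q\<leftarrow>us. \<Sum>\<xi>\<leftarrow>H. ip F (snd p) (lact F (ip E (fst p) \<xi> * ip E \<xi> (fst q)) (snd q)))"
    by (subst sum_list_sum_list_swap, subst (2) sum_list_sum_list_swap) simp
  also have "\<dots> = (\<Sum>p\<leftarrow>us. \<Sum>q\<leftarrow>us. ip F (snd p) (lact F (ip E (fst p) (E.frame_op H (fst q))) (snd q)))"
    using u H by (intro arg_cong[of _ _ sum_list] map_cong HOL.refl)
       (simp add: E.ip_frame_op F.lact_sum_list F.ip_sum_list F.lact_mem)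
  finally show ?thesis .
qed

text \<open>Let $u$ be a finite sum of elementary tensors and $c_\xi$ its contraction with
  $\xi\in H$. The form of the product frame at $u$ is $\sum_\xi\langle
  c_\xi,\theta_Kc_\xi\rangle\le\sum_\xi\langle c_\xi,c_\xi\rangle$. With $r^2=1-\theta_H$, the
  difference $\langle u,u\rangle-\sum_\xi\langle c_\xi,c_\xi\rangle$ is the square of the image
  of $u$ under $r\otimes1$. Density of such $u$ and closedness of the cone do the rest.\<close>

lemma subunital_tensor_list:
  assumes H: "E.subunital H" and K: "F.subunital K"
  shows "Z.subunital (tensor_list H K)"
proof -
  have Hm: "set H \<subseteq> carrier E" and Km: "set K \<subseteq> carrier F" using H K by (auto simp: E.subunital_def F.subunital_def)
  note Pm = tensor_list_mem[OF Hm Km]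
  let ?S = "Z.frame_op (tensor_list H K)"
  obtain r where r: "E.adj r r" "\<And>x. x \<in> carrier E \<Longrightarrow> r (r x) = x - E.frame_op H x"
    using E.op_root[OF E.adj_frame_op[OF Hm] E.subunital_contraction[OF H]] by blast
  have on_sums: "ip Z (tsum us) (tsum us) - ip Z (tsum us) (?S (tsum us)) \<in> positive_cone" if us: "us \<in> pairs" for us
  proof -
    have u: "fst p \<in> carrier E" "snd p \<in> carrier F" if "p \<in> set us" for p
      using us that by (auto simp: in_lists_conv_set)
    have "ip Z (tsum us) (?S (tsum us)) = (\<Sum>\<xi>\<leftarrow>H. \<Sum>\<eta>\<leftarrow>K. star (ip F \<eta> (contract \<xi> us)) * ip F \<eta> (contract \<xi> us))"
      unfolding Z.ip_frame_op_square[OF Pm tsum_mem[OF us]] sum_list_tensor_list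
      using Hm Km us by (intro arg_cong[of _ _ sum_list] map_cong HOL.refl) (simp add: ip_\<mu>_tsum[OF _ _ us] subset_iff)
    also have "\<dots> = (\<Sum>\<xi>\<leftarrow>H. ip F (contract \<xi> us) (F.frame_op K (contract \<xi> us)))"
      by (simp add: F.ip_frame_op_square[OF Km contract_mem[OF us]])
    finally have 1: "ip Z (tsum us) (?S (tsum us)) = (\<Sum>\<xi>\<leftarrow>H. ip F (contract \<xi> us) (F.frame_op K (contract \<xi> us)))" .
    have 2: "(\<Sum>\<xi>\<leftarrow>H. ip F (contract \<xi> us) (contract \<xi> us) - ip F (contract \<xi> us) (F.frame_op K (contract \<xi> us))) \<in> positive_cone"
      using K contract_mem[OF us] by (intro sum_list_positive) (auto simp: F.subunital_def)
    define vs where "vs = map (\<lambda>p. (r (fst p), snd p)) us"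
    have vs: "vs \<in> pairs" using u E.adj_mem[OF r(1)] by (auto simp: vs_def in_lists_conv_set)
    have "ip Z (tsum vs) (tsum vs) = (\<Sum>p\<leftarrow>us. \<Sum>q\<leftarrow>us. ip F (snd p) (lact F (ip E (r (fst p)) (r (fst q))) (snd q)))"
      unfolding ip_tsum[OF vs vs] by (simp add: vs_def o_def)
    also have "\<dots> = (\<Sum>p\<leftarrow>us. \<Sum>q\<leftarrow>us. ip F (snd p) (lact F (ip E (fst p) (fst q)) (snd q))
        - ip F (snd p) (lact F (ip E (fst p) (E.frame_op H (fst q))) (snd q)))"
      using u E.adj_mem[OF r(1)] by (intro arg_cong[of _ _ sum_list] map_cong HOL.refl)
        (simp add: E.adj_ip[OF r(1)] r(2) E.ip_diff E.frame_op_mem[OF Hm] F.lact_diff F.ip_diff F.lact_mem)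
    also have "\<dots> = ip Z (tsum us) (tsum us) - (\<Sum>\<xi>\<leftarrow>H. ip F (contract \<xi> us) (contract \<xi> us))"
      unfolding ip_tsum[OF us us] sum_contract[OF Hm us] by (simp add: sum_list_subtractf)
    finally have 3: "ip Z (tsum us) (tsum us) - (\<Sum>\<xi>\<leftarrow>H. ip F (contract \<xi> us) (contract \<xi> us)) \<in> positive_cone"
      using Z.ip_positive[OF tsum_mem[OF vs]] by simp
    show ?thesis using positive_cone_add[OF 3 2] by (simp add: 1 sum_list_subtractf)
  qed
  show ?thesis unfolding Z.subunital_def
  proof (intro conjI ballI Pm)
    fix z assume z: "z \<in> carrier Z"
    have "\<exists>us\<in>pairs. Z.nn (z - tsum us) < 1 / real (Suc n)" for n by (rule dense[OF z]) simp
    then obtain us where us: "\<And>n. us n \<in> pairs" "\<And>n. Z.nn (z - tsum (us n)) < 1 / real (Suc n)" by metis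
    define M where "M = (\<Sum>\<xi>\<leftarrow>tensor_list H K. (Z.nn \<xi>)\<^sup>2)"
    have M0: "0 \<le> M" unfolding M_def by (intro sum_list_nonneg) auto
    let ?q = "\<lambda>x. ip Z x x - ip Z x (?S x)"
    have S_mem: "?S x \<in> carrier Z" for x by (rule Z.frame_op_mem[OF Pm])
    define C where "C = (1 + M) * (2 * Z.nn z + 1)"
    have "norm (?q (tsum (us n)) - ?q z) \<le> C * (1 / real (Suc n))" for n
    proof -
      let ?x = "tsum (us n)"
      have x: "?x \<in> carrier Z" using us tsum_mem by blast
      let ?D = "\<lambda>x. x - ?S x"
      have Dm: "?D y \<in> carrier Z" if "y \<in> carrier Z" for y using that S_mem by (simp add: Z.mem)
      have Dn: "Z.nn (?D y) \<le> (1 + M) * Z.nn y" if "y \<in> carrier Z" for y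
        using Z.nn_triangle_minus[OF that S_mem[of y]] Z.nn_frame_op[OF Pm that] unfolding M_def[symmetric] by (simp add: algebra_simps)
      have Dd: "?D ?x - ?D z = ?D (?x - z)" using Z.adj_diff[OF Z.adj_frame_op[OF Pm] x z] by simp
      have "?q ?x - ?q z = ip Z (?x - z) (?D ?x) + ip Z z (?D ?x - ?D z)"
        using x z S_mem by (simp add: Z.ip_simps Z.mem)
      also have "norm \<dots> \<le> Z.nn (?x - z) * Z.nn (?D ?x) + Z.nn z * Z.nn (?D (?x - z))"
        unfolding Dd using x z S_mem by (intro norm_triangle_mono Z.Cauchy_Schwarz) (auto simp: Z.mem)
      also have "\<dots> \<le> Z.nn (?x - z) * ((1 + M) * Z.nn ?x) + Z.nn z * ((1 + M) * Z.nn (?x - z))"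
        using x z by (intro add_mono mult_left_mono Dn) (auto simp: Z.mem)
      also have "\<dots> = (1 + M) * (Z.nn ?x + Z.nn z) * Z.nn (?x - z)" by (simp add: algebra_simps)
      also have "\<dots> \<le> (1 + M) * ((Z.nn z + 1) + Z.nn z) * Z.nn (?x - z)"
      proof -
        have "Z.nn ?x \<le> Z.nn z + Z.nn (?x - z)" using Z.nn_triangle[of z "?x - z"] x z by (simp add: Z.mem)
        moreover have "1 / real (Suc n) \<le> 1" by simp
        ultimately have "Z.nn ?x \<le> Z.nn z + 1" using us(2)[of n] Z.nn_diff_commute[OF x z] by linarith
        then show ?thesis using M0 by (intro mult_right_mono mult_left_mono) auto
      qed
      also have "\<dots> \<le> C * (1 / real (Suc n))"
        unfolding C_def using us(2)[of n] Z.nn_diff_commute[OF x z] M0 by (intro mult_mono) (auto simp: algebra_simps)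
      finally show ?thesis .
    qed
    then have "\<forall>\<^sub>F n in sequentially. norm (?q (tsum (us n)) - ?q z) \<le> C * (1 / real (Suc n))"
      by (intro always_eventually allI)
    moreover have "(\<lambda>n. C * (1 / real (Suc n))) \<longlonglongrightarrow> 0"
      by (intro tendsto_mult_right_zero LIMSEQ_Suc[OF lim_1_over_n])
    ultimately have "(\<lambda>n. ?q (tsum (us n)) - ?q z) \<longlonglongrightarrow> 0" by (rule Lim_null_comparison)
    then have "(\<lambda>n. ?q (tsum (us n))) \<longlonglongrightarrow> ?q z" by (rule LIM_zero_cancel)
    then show "?q z \<in> positive_cone" by (rule positive_cone_closed) (rule on_sums[OF us(1)])
  qed
qed

lemma frame_op_tensor_list:
  assumes "set H \<subseteq> carrier E" "set K \<subseteq> carrier F" "\<xi>\<^sub>0 \<in> carrier E" "\<eta>\<^sub>0 \<in> carrier F"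
  shows "Z.frame_op (tensor_list H K) (\<mu> \<xi>\<^sub>0 \<eta>\<^sub>0) = (\<Sum>\<xi>\<leftarrow>H. \<mu> \<xi> (F.frame_op K (lact F (ip E \<xi> \<xi>\<^sub>0) \<eta>\<^sub>0)))"
  unfolding Z.frame_op_def sum_list_tensor_list F.frame_op_def
proof (intro arg_cong[of _ _ sum_list] map_cong HOL.refl)
  fix \<xi> assume "\<xi> \<in> set H"
  then have x: "\<xi> \<in> carrier E" using assms by auto
  have k: "\<eta> \<in> carrier F" if "\<eta> \<in> set K" for \<eta> using assms that by auto
  let ?u = "lact F (ip E \<xi> \<xi>\<^sub>0) \<eta>\<^sub>0"
  have "(\<Sum>\<eta>\<leftarrow>K. ract Z (\<mu> \<xi> \<eta>) (ip Z (\<mu> \<xi> \<eta>) (\<mu> \<xi>\<^sub>0 \<eta>\<^sub>0))) = (\<Sum>\<eta>\<leftarrow>K. \<mu> \<xi> (ract F \<eta> (ip F \<eta> ?u)))"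
    using k x assms by (intro arg_cong[of _ _ sum_list] map_cong HOL.refl) (simp add: ip_\<mu> \<mu>_ract_right)
  also have "\<dots> = \<mu> \<xi> (\<Sum>\<eta>\<leftarrow>K. ract F \<eta> (ip F \<eta> ?u))"
    using k x by (intro \<mu>_sum_right[symmetric]) (auto intro: F.ract_mem)
  finally show "(\<Sum>\<eta>\<leftarrow>K. ract Z (\<mu> \<xi> \<eta>) (ip Z (\<mu> \<xi> \<eta>) (\<mu> \<xi>\<^sub>0 \<eta>\<^sub>0))) = \<mu> \<xi> (\<Sum>\<eta>\<leftarrow>K. ract F \<eta> (ip F \<eta> ?u))" .
qed

lemma eventually_prod_near_elementary:
  assumes x: "\<xi>\<^sub>0 \<in> carrier E" "\<eta>\<^sub>0 \<in> carrier F" and e: "\<epsilon> > 0"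
  shows "eventually (\<lambda>H. eventually (\<lambda>K. Z.nn (Z.frame_op (tensor_list H K) (\<mu> \<xi>\<^sub>0 \<eta>\<^sub>0) - \<mu> \<xi>\<^sub>0 \<eta>\<^sub>0) < \<epsilon>) F.approx_unit) E.approx_unit"
proof -
  obtain d where d: "d > 0" "d * F.nn \<eta>\<^sub>0 < \<epsilon> / 2" using F.ex_good_delta[of "\<epsilon>/2" "F.nn \<eta>\<^sub>0"] e by auto
  have "eventually (\<lambda>H. E.subunital H \<and> E.nn (E.frame_op H \<xi>\<^sub>0 - \<xi>\<^sub>0) < d) E.approx_unit"
    by (intro eventually_conj E.eventually_approx_unit_subunital E.eventually_approx_unit_near x d)
  then show ?thesis
  proof (rule eventually_mono)
    fix H assume H: "E.subunital H \<and> E.nn (E.frame_op H \<xi>\<^sub>0 - \<xi>\<^sub>0) < d"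
    then have Hm: "set H \<subseteq> carrier E" by (simp add: E.subunital_def)
    define u where "u \<xi> = lact F (ip E \<xi> \<xi>\<^sub>0) \<eta>\<^sub>0" for \<xi>
    have u: "u \<xi> \<in> carrier F" for \<xi> using F.lact_mem x by (simp add: u_def)
    have "0 \<le> (\<Sum>\<xi>\<leftarrow>H. E.nn \<xi>)" by (intro sum_list_nonneg) auto
    then obtain d' where d': "d' > 0" "d' * (\<Sum>\<xi>\<leftarrow>H. E.nn \<xi>) < \<epsilon> / 2"
      using F.ex_good_delta[of "\<epsilon>/2" "\<Sum>\<xi>\<leftarrow>H. E.nn \<xi>"] e by auto
    have "eventually (\<lambda>K. F.subunital K \<and> (\<forall>\<xi>\<in>set H. F.nn (F.frame_op K (u \<xi>) - u \<xi>) < d')) F.approx_unit"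
      by (intro eventually_conj F.eventually_approx_unit_subunital eventually_ball_finite ballI F.eventually_approx_unit_near u d') auto
    then show "eventually (\<lambda>K. Z.nn (Z.frame_op (tensor_list H K) (\<mu> \<xi>\<^sub>0 \<eta>\<^sub>0) - \<mu> \<xi>\<^sub>0 \<eta>\<^sub>0) < \<epsilon>) F.approx_unit"
    proof (rule eventually_mono)
      fix K assume K: "F.subunital K \<and> (\<forall>\<xi>\<in>set H. F.nn (F.frame_op K (u \<xi>) - u \<xi>) < d')"
      then have Km: "set K \<subseteq> carrier F" by (simp add: F.subunital_def)
      have hm: "\<xi> \<in> carrier E" if "\<xi> \<in> set H" for \<xi> using that Hm by auto
      have fm: "F.frame_op K y \<in> carrier F" for y by (rule F.frame_op_mem[OF Km])
      have "(\<Sum>\<xi>\<leftarrow>H. \<mu> \<xi> (u \<xi>)) = \<mu> (E.frame_op H \<xi>\<^sub>0) \<eta>\<^sub>0"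
        unfolding E.frame_op_def u_def using hm x
        by (subst \<mu>_sum_left) (auto simp: \<mu>_balanced E.ract_mem intro!: arg_cong[of _ _ sum_list])
      then have "Z.frame_op (tensor_list H K) (\<mu> \<xi>\<^sub>0 \<eta>\<^sub>0) - \<mu> \<xi>\<^sub>0 \<eta>\<^sub>0 =
         (\<Sum>\<xi>\<leftarrow>H. \<mu> \<xi> (F.frame_op K (u \<xi>))) - (\<Sum>\<xi>\<leftarrow>H. \<mu> \<xi> (u \<xi>)) + (\<mu> (E.frame_op H \<xi>\<^sub>0) \<eta>\<^sub>0 - \<mu> \<xi>\<^sub>0 \<eta>\<^sub>0)"
        unfolding frame_op_tensor_list[OF Hm Km x] u_def[symmetric] by simp
      also have "\<dots> = (\<Sum>\<xi>\<leftarrow>H. \<mu> \<xi> (F.frame_op K (u \<xi>)) - \<mu> \<xi> (u \<xi>)) + (\<mu> (E.frame_op H \<xi>\<^sub>0) \<eta>\<^sub>0 - \<mu> \<xi>\<^sub>0 \<eta>\<^sub>0)"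
        by (simp only: sum_list_subtractf)
      also have "\<dots> = (\<Sum>\<xi>\<leftarrow>H. \<mu> \<xi> (F.frame_op K (u \<xi>) - u \<xi>)) + \<mu> (E.frame_op H \<xi>\<^sub>0 - \<xi>\<^sub>0) \<eta>\<^sub>0"
        using hm x u fm E.frame_op_mem[OF Hm] by (simp add: \<mu>_diff_right \<mu>_diff_left cong: map_cong)
      finally have eq: "Z.frame_op (tensor_list H K) (\<mu> \<xi>\<^sub>0 \<eta>\<^sub>0) - \<mu> \<xi>\<^sub>0 \<eta>\<^sub>0 = \<dots>" .
      have "Z.nn (\<Sum>\<xi>\<leftarrow>H. \<mu> \<xi> (F.frame_op K (u \<xi>) - u \<xi>)) \<le> (\<Sum>\<xi>\<leftarrow>H. Z.nn (\<mu> \<xi> (F.frame_op K (u \<xi>) - u \<xi>)))"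
        using hm u fm by (intro Z.nn_sum_list \<mu>_mem F.mem)
      also have "\<dots> \<le> (\<Sum>\<xi>\<leftarrow>H. d' * E.nn \<xi>)"
      proof (rule sum_list_mono)
        fix \<xi> assume xi: "\<xi> \<in> set H"
        have "Z.nn (\<mu> \<xi> (F.frame_op K (u \<xi>) - u \<xi>)) \<le> E.nn \<xi> * F.nn (F.frame_op K (u \<xi>) - u \<xi>)"
          using hm[OF xi] u fm by (intro nn_\<mu> F.mem)
        also have "\<dots> \<le> E.nn \<xi> * d'" using K xi by (intro mult_left_mono) (auto simp: less_imp_le)
        finally show "Z.nn (\<mu> \<xi> (F.frame_op K (u \<xi>) - u \<xi>)) \<le> d' * E.nn \<xi>" by (simp add: mult.commute)
      qed
      also have "\<dots> < \<epsilon> / 2" using d' by (simp add: sum_list_const_mult)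
      finally have 1: "Z.nn (\<Sum>\<xi>\<leftarrow>H. \<mu> \<xi> (F.frame_op K (u \<xi>) - u \<xi>)) < \<epsilon> / 2" .
      have "Z.nn (\<mu> (E.frame_op H \<xi>\<^sub>0 - \<xi>\<^sub>0) \<eta>\<^sub>0) \<le> E.nn (E.frame_op H \<xi>\<^sub>0 - \<xi>\<^sub>0) * F.nn \<eta>\<^sub>0"
        using x E.frame_op_mem[OF Hm] by (intro nn_\<mu>) (auto simp: E.mem)
      also have "\<dots> \<le> d * F.nn \<eta>\<^sub>0" using H by (intro mult_right_mono) auto
      finally have 2: "Z.nn (\<mu> (E.frame_op H \<xi>\<^sub>0 - \<xi>\<^sub>0) \<eta>\<^sub>0) < \<epsilon> / 2" using d by simp
      have "Z.nn ((\<Sum>\<xi>\<leftarrow>H. \<mu> \<xi> (F.frame_op K (u \<xi>) - u \<xi>)) + \<mu> (E.frame_op H \<xi>\<^sub>0 - \<xi>\<^sub>0) \<eta>\<^sub>0)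
         \<le> Z.nn (\<Sum>\<xi>\<leftarrow>H. \<mu> \<xi> (F.frame_op K (u \<xi>) - u \<xi>)) + Z.nn (\<mu> (E.frame_op H \<xi>\<^sub>0 - \<xi>\<^sub>0) \<eta>\<^sub>0)"
        using hm u fm x E.frame_op_mem[OF Hm] by (intro Z.nn_triangle Z.sum_list_mem \<mu>_mem F.mem E.mem)
      then show "Z.nn (Z.frame_op (tensor_list H K) (\<mu> \<xi>\<^sub>0 \<eta>\<^sub>0) - \<mu> \<xi>\<^sub>0 \<eta>\<^sub>0) < \<epsilon>" unfolding eq using 1 2 by simp
    qed
  qed
qed

lemma eventually_prod_near_tsum:
  assumes "us \<in> pairs" "\<epsilon> > 0"
  shows "eventually (\<lambda>H. eventually (\<lambda>K. Z.nn (Z.frame_op (tensor_list H K) (tsum us) - tsum us) < \<epsilon>) F.approx_unit) E.approx_unit"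
  using assms
proof (induction us arbitrary: \<epsilon>)
  case Nil
  have "eventually (\<lambda>H. eventually (\<lambda>K. E.subunital H \<and> F.subunital K) F.approx_unit) E.approx_unit"
    using E.eventually_approx_unit_subunital F.eventually_approx_unit_subunital
    by (simp add: eventually_conj_iff F.approx_unit_neq_bot)
  then show ?case
    by (elim eventually_mono) (use Nil Z.adj_zero[OF Z.adj_frame_op[OF tensor_list_mem]] in \<open>simp add: tsum_def E.subunital_def F.subunital_def\<close>)
next
  case (Cons p us)
  have p: "fst p \<in> carrier E" "snd p \<in> carrier F" and us: "us \<in> pairs"
    using Cons.hyps by (auto simp: mem_Times_iff)
  have e: "\<epsilon> / 2 > 0" using Cons.prems by simp
  have "eventually (\<lambda>H. eventually (\<lambda>K. Z.nn (Z.frame_op (tensor_list H K) (tsum us) - tsum us) < \<epsilon> / 2 \<and>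
      Z.nn (Z.frame_op (tensor_list H K) (\<mu> (fst p) (snd p)) - \<mu> (fst p) (snd p)) < \<epsilon> / 2 \<and> E.subunital H \<and> F.subunital K) F.approx_unit) E.approx_unit"
    using Cons.IH[OF e] eventually_prod_near_elementary[OF p e] E.eventually_approx_unit_subunital F.eventually_approx_unit_subunital
    by (simp add: eventually_conj_iff F.approx_unit_neq_bot)
  then show ?case
  proof (elim eventually_mono)
    fix H K
    assume a: "Z.nn (Z.frame_op (tensor_list H K) (tsum us) - tsum us) < \<epsilon> / 2 \<and>
      Z.nn (Z.frame_op (tensor_list H K) (\<mu> (fst p) (snd p)) - \<mu> (fst p) (snd p)) < \<epsilon> / 2 \<and> E.subunital H \<and> F.subunital K"
    then have m: "set (tensor_list H K) \<subseteq> carrier Z" by (intro tensor_list_mem) (auto simp: E.subunital_def F.subunital_def)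
    note fm = Z.frame_op_mem[OF m]
    have "tsum (p # us) = \<mu> (fst p) (snd p) + tsum us" by (simp add: tsum_def)
    then have "Z.frame_op (tensor_list H K) (tsum (p # us)) - tsum (p # us) =
      (Z.frame_op (tensor_list H K) (\<mu> (fst p) (snd p)) - \<mu> (fst p) (snd p)) + (Z.frame_op (tensor_list H K) (tsum us) - tsum us)"
      using Z.adj_add[OF Z.adj_frame_op[OF m]] p us by (simp add: \<mu>_mem tsum_mem)
    then show "Z.nn (Z.frame_op (tensor_list H K) (tsum (p # us)) - tsum (p # us)) < \<epsilon>"
      using a Z.nn_triangle[of "Z.frame_op (tensor_list H K) (\<mu> (fst p) (snd p)) - \<mu> (fst p) (snd p)" "Z.frame_op (tensor_list H K) (tsum us) - tsum us"]
        p us fm by (simp add: Z.mem \<mu>_mem tsum_mem)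
  qed
qed

text \<open>The product frames form an approximate unit in the sense of an iterated limit: first
  over $K$ with $H$ fixed, then over $H$.\<close>

lemma eventually_prod_near:
  assumes z: "z \<in> carrier Z" and e: "\<epsilon> > 0"
  shows "eventually (\<lambda>H. eventually (\<lambda>K. Z.nn (Z.frame_op (tensor_list H K) z - z) < \<epsilon>) F.approx_unit) E.approx_unit"
proof -
  obtain us where us: "us \<in> pairs" "Z.nn (z - tsum us) < \<epsilon> / 3" using dense[OF z, of "\<epsilon> / 3"] e by auto
  have "\<epsilon> / 3 > 0" using e by simp
  then have "eventually (\<lambda>H. eventually (\<lambda>K. Z.nn (Z.frame_op (tensor_list H K) (tsum us) - tsum us) < \<epsilon> / 3 \<and> E.subunital H \<and> F.subunital K) F.approx_unit) E.approx_unit"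
    using eventually_prod_near_tsum[OF us(1), of "\<epsilon> / 3"] E.eventually_approx_unit_subunital F.eventually_approx_unit_subunital
    by (simp add: eventually_conj_iff F.approx_unit_neq_bot)
  then show ?thesis
  proof (elim eventually_mono)
    fix H K
    assume a: "Z.nn (Z.frame_op (tensor_list H K) (tsum us) - tsum us) < \<epsilon> / 3 \<and> E.subunital H \<and> F.subunital K"
    then have sub: "Z.subunital (tensor_list H K)" using subunital_tensor_list by blast
    then have m: "set (tensor_list H K) \<subseteq> carrier Z" by (simp add: Z.subunital_def)
    let ?S = "Z.frame_op (tensor_list H K)" and ?t = "tsum us"
    note mm = Z.frame_op_mem[OF m] tsum_mem[OF us(1)] z
    have "?S z - z = ?S (z - ?t) + ((?S ?t - ?t) + (?t - z))"
      using Z.adj_diff[OF Z.adj_frame_op[OF m] z mm(2)] by simp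
    also have "Z.nn \<dots> \<le> Z.nn (?S (z - ?t)) + (Z.nn (?S ?t - ?t) + Z.nn (?t - z))"
      using mm by (intro order_trans[OF Z.nn_triangle] add_left_mono Z.nn_triangle) (auto simp: Z.mem)
    also have "\<dots> < \<epsilon>"
      using a us(2) Z.subunital_contraction[OF sub, of "z - ?t"] Z.nn_diff_commute[OF z mm(2)] mm by (simp add: Z.mem)
    finally show "Z.nn (?S z - z) < \<epsilon>" .
  qed
qed

lemma trace_sum_tensor_list:
  assumes H: "set H \<subseteq> carrier E" and K: "set K \<subseteq> carrier F"
    and d: "\<And>\<xi>. \<xi> \<in> set H \<Longrightarrow> ip E (lact E b \<xi>) (lact E b \<xi>) = star (d \<xi>) * d \<xi>"
  shows "Z.trace_sum \<tau> (lact Z b) (tensor_list H K) = (\<Sum>\<xi>\<leftarrow>H. F.trace_sum \<tau> (lact F (d \<xi>)) K)"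
  unfolding Z.trace_sum_def F.trace_sum_def sum_list_tensor_list
  using H K by (intro arg_cong[of _ _ sum_list] map_cong HOL.refl)
    (auto simp: \<mu>_lact ip_\<mu> E.lact_mem d F.ip_lact_square subset_iff)

text \<open>For fixed $H$, the sum is the limit over $K$ of the sums over the frames of all
  $\xi\otimes\eta$. It is therefore at most the induced trace on $Z$, since product frames lie
  below the identity, and in the limit over $H$ at least that, since they approximate the
  identity.\<close>

theorem induced_trace_tensor:
  assumes \<tau>: "tracial_state \<tau>"
  shows "((\<lambda>H. \<Sum>\<xi>\<leftarrow>H. induced_trace \<tau> F (left_action_op F (ip E (lact E b \<xi>) (lact E b \<xi>))))
     \<longlongrightarrow> induced_trace \<tau> Z (left_action_op Z (star b * b))) E.approx_unit"
    (is "(?g \<longlongrightarrow> ?T) _")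
proof -
  have "\<exists>d. ip E (lact E b \<xi>) (lact E b \<xi>) = star d * d" if "\<xi> \<in> carrier E" for \<xi>
    using E.ip_positive[OF E.lact_mem[OF that, of b]] by (auto simp: positive_cone_def)
  then obtain d where d: "\<And>\<xi>. \<xi> \<in> carrier E \<Longrightarrow> ip E (lact E b \<xi>) (lact E b \<xi>) = star (d \<xi>) * d \<xi>" by metis
  have inner: "((\<lambda>K. ereal (Z.trace_sum \<tau> (lact Z b) (tensor_list H K))) \<longlongrightarrow> ?g H) F.approx_unit" if H: "E.subunital H" for H
  proof -
    have Hm: "set H \<subseteq> carrier E" using H by (simp add: E.subunital_def)
    have "((\<lambda>K. \<Sum>\<xi>\<leftarrow>H. ereal (F.trace_sum \<tau> (lact F (d \<xi>)) K)) \<longlongrightarrow> ?g H) F.approx_unit"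
      by (rule tendsto_sum_list_ereal) (use F.trace_sum_lact_tendsto[OF \<tau>] Hm d in \<open>auto simp: subset_iff F.induced_trace_nonneg\<close>)
    moreover have "eventually (\<lambda>K. (\<Sum>\<xi>\<leftarrow>H. ereal (F.trace_sum \<tau> (lact F (d \<xi>)) K)) = ereal (Z.trace_sum \<tau> (lact Z b) (tensor_list H K))) F.approx_unit"
      using F.eventually_approx_unit_subunital
    proof (rule eventually_mono)
      fix K assume "F.subunital K"
      then have "Z.trace_sum \<tau> (lact Z b) (tensor_list H K) = (\<Sum>\<xi>\<leftarrow>H. F.trace_sum \<tau> (lact F (d \<xi>)) K)"
        using Hm d by (intro trace_sum_tensor_list) (auto simp: F.subunital_def)
      moreover have "(\<Sum>\<xi>\<leftarrow>H. ereal (f \<xi>)) = ereal (\<Sum>\<xi>\<leftarrow>H. f \<xi>)" for f by (induction H) auto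
      ultimately show "(\<Sum>\<xi>\<leftarrow>H. ereal (F.trace_sum \<tau> (lact F (d \<xi>)) K)) = ereal (Z.trace_sum \<tau> (lact Z b) (tensor_list H K))" by simp
    qed
    ultimately show ?thesis by (rule Lim_transform_eventually)
  qed
  have upper: "?g H \<le> ?T" if H: "E.subunital H" for H
  proof (rule tendsto_upperbound[OF inner[OF H] _ F.approx_unit_neq_bot])
    show "\<forall>\<^sub>F K in F.approx_unit. ereal (Z.trace_sum \<tau> (lact Z b) (tensor_list H K)) \<le> ?T"
      using F.eventually_approx_unit_subunital
      by (rule eventually_mono) (intro Z.trace_sum_le_induced_trace \<tau> subunital_tensor_list H)
  qed
  show ?thesis
  proof (rule order_tendstoI)
    fix l assume "?T < l"
    then show "\<forall>\<^sub>F H in E.approx_unit. ?g H < l"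
      using E.eventually_approx_unit_subunital upper by (auto elim!: eventually_mono intro: le_less_trans)
  next
    fix l assume l: "l < ?T"
    have T_eq: "?T = (SUP H \<in> {H. Z.subunital H}. ereal (Z.trace_sum \<tau> (lact Z (star b)) H))"
      unfolding Z.induced_trace_swap[OF \<tau> Z.adj_lact']
      by (rule Z.induced_trace_eq[OF \<tau> Z.adj_lact']) (simp add: left_action_op_def Z.lact_mult)
    obtain G where G: "Z.subunital G" "l < ereal (Z.trace_sum \<tau> (lact Z (star b)) G)"
      using l unfolding T_eq less_SUP_iff by auto
    have Gm: "\<zeta> \<in> carrier Z" if "\<zeta> \<in> set G" for \<zeta> using G that by (auto simp: Z.subunital_def)
    obtain l' where l': "l < ereal l'" "l' < Z.trace_sum \<tau> (lact Z (star b)) G"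
      using ereal_dense2[OF G(2)] by (metis ereal_less_eq(3) less_ereal.simps(1) linorder_not_less)
    let ?s = "\<Sum>\<zeta>\<leftarrow>G. Z.nn (lact Z (star b) \<zeta>)"
    obtain \<delta> where \<delta>: "\<delta> > 0" "\<delta> * ?s < Z.trace_sum \<tau> (lact Z (star b)) G - l'"
      using Z.ex_good_delta[of "Z.trace_sum \<tau> (lact Z (star b)) G - l'" ?s] l'
        sum_list_nonneg[of "map (\<lambda>\<zeta>. Z.nn (lact Z (star b) \<zeta>)) G"] by fastforce
    have "eventually (\<lambda>H. \<forall>\<zeta>\<in>set G. eventually (\<lambda>K. Z.nn (Z.frame_op (tensor_list H K) (lact Z (star b) \<zeta>) - lact Z (star b) \<zeta>) < \<delta>) F.approx_unit) E.approx_unit"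
      by (intro eventually_ball_finite ballI eventually_prod_near \<delta> Z.lact_mem Gm) auto
    then have "eventually (\<lambda>H. E.subunital H \<and> (\<forall>\<zeta>\<in>set G. eventually (\<lambda>K. Z.nn (Z.frame_op (tensor_list H K) (lact Z (star b) \<zeta>) - lact Z (star b) \<zeta>) < \<delta>) F.approx_unit)) E.approx_unit"
      by (intro eventually_conj E.eventually_approx_unit_subunital)
    then show "\<forall>\<^sub>F H in E.approx_unit. l < ?g H"
    proof (rule eventually_mono)
      fix H assume H: "E.subunital H \<and> (\<forall>\<zeta>\<in>set G. eventually (\<lambda>K. Z.nn (Z.frame_op (tensor_list H K) (lact Z (star b) \<zeta>) - lact Z (star b) \<zeta>) < \<delta>) F.approx_unit)"
      then have "eventually (\<lambda>K. \<forall>\<zeta>\<in>set G. Z.nn (Z.frame_op (tensor_list H K) (lact Z (star b) \<zeta>) - lact Z (star b) \<zeta>) < \<delta>) F.approx_unit"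
        by (intro eventually_ball_finite) auto
      then have "eventually (\<lambda>K. F.subunital K \<and> (\<forall>\<zeta>\<in>set G. Z.nn (Z.frame_op (tensor_list H K) (lact Z (star b) \<zeta>) - lact Z (star b) \<zeta>) < \<delta>)) F.approx_unit"
        by (intro eventually_conj F.eventually_approx_unit_subunital)
      then have "eventually (\<lambda>K. ereal l' \<le> ereal (Z.trace_sum \<tau> (lact Z b) (tensor_list H K))) F.approx_unit"
      proof (rule eventually_mono)
        fix K assume K: "F.subunital K \<and> (\<forall>\<zeta>\<in>set G. Z.nn (Z.frame_op (tensor_list H K) (lact Z (star b) \<zeta>) - lact Z (star b) \<zeta>) < \<delta>)"
        have Pm: "set (tensor_list H K) \<subseteq> carrier Z"
          using H K by (intro tensor_list_mem) (auto simp: E.subunital_def F.subunital_def)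
        have "Z.trace_sum \<tau> (lact Z (star b)) G - \<delta> * ?s \<le>
           (\<Sum>\<zeta>\<leftarrow>G. Re (\<tau> (ip Z (lact Z (star b) \<zeta>) (Z.frame_op (tensor_list H K) (lact Z (star b) \<zeta>)))))"
          using K Gm by (intro Z.near_trace[OF \<tau> _ Pm]) (auto simp: Z.lact_mem less_imp_le)
        also have "\<dots> \<le> Z.trace_sum \<tau> (lact Z b) (tensor_list H K)"
          by (rule Z.trace_swap[OF \<tau> Z.adj_lact' G(1) Pm])
        finally show "ereal l' \<le> ereal (Z.trace_sum \<tau> (lact Z b) (tensor_list H K))" using \<delta> by simp
      qed
      then have "ereal l' \<le> ?g H"
        using tendsto_lowerbound[OF inner _ F.approx_unit_neq_bot] H by blast
      then show "l < ?g H" using l'(1) less_le_trans by blast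
    qed
  qed
qed

end

section \<open>Right LCM monoids\<close>

locale right_lcm_monoid = monoid P for P (structure) +
  assumes l_cancel_monoid: "\<lbrakk>x \<in> carrier P; y \<in> carrier P; z \<in> carrier P; x \<otimes> y = x \<otimes> z\<rbrakk> \<Longrightarrow> y = z"
    and no_units: "\<lbrakk>x \<in> carrier P; y \<in> carrier P; x \<otimes> y = \<one>\<rbrakk> \<Longrightarrow> x = \<one>"
    and inter_ideals: "\<lbrakk>p \<in> carrier P; q \<in> carrier P; right_ideal P p \<inter> right_ideal P q \<noteq> {}\<rbrakk>
      \<Longrightarrow> \<exists>r\<in>carrier P. right_ideal P p \<inter> right_ideal P q = right_ideal P r"
begin

abbreviation "rid \<equiv> right_ideal P"

lemma rid_subset: "p \<in> carrier P \<Longrightarrow> rid p \<subseteq> carrier P"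
  by (auto simp: right_ideal_def)

lemma rid_self: "p \<in> carrier P \<Longrightarrow> p \<in> rid p"
  unfolding right_ideal_def by (intro image_eqI[of _ _ \<one>]) auto

lemma rid_one: "rid \<one> = carrier P"
  unfolding right_ideal_def by simp

lemma rid_mono: "p \<in> carrier P \<Longrightarrow> q \<in> rid p \<Longrightarrow> rid q \<subseteq> rid p"
  unfolding right_ideal_def by (auto simp: m_assoc)

lemma rid_antisym:
  assumes "p \<in> carrier P" "q \<in> carrier P" "p \<in> rid q" "q \<in> rid p" shows "p = q"
proof -
  obtain x where x: "x \<in> carrier P" "p = q \<otimes> x" using assms(3) by (auto simp: right_ideal_def)
  obtain y where y: "y \<in> carrier P" "q = p \<otimes> y" using assms(4) by (auto simp: right_ideal_def)
  have "p \<otimes> (y \<otimes> x) = p \<otimes> \<one>" 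
    using assms(1) x(1) y(1) by (simp add: m_assoc[symmetric] y(2)[symmetric] x(2)[symmetric])
  then have "y \<otimes> x = \<one>" using assms(1) x(1) y(1) by (intro l_cancel_monoid[of p "y \<otimes> x" \<one>]) auto
  then have "y = \<one>" using no_units x(1) y(1) by blast
  then show ?thesis using y(2) assms(1) by simp
qed

lemma rid_inject: "p \<in> carrier P \<Longrightarrow> q \<in> carrier P \<Longrightarrow> rid p = rid q \<Longrightarrow> p = q"
  using rid_antisym rid_self by blast

lemma rid_cancel:
  "q \<in> carrier P \<Longrightarrow> r \<in> carrier P \<Longrightarrow> y \<in> carrier P \<Longrightarrow> q \<otimes> y \<in> rid (q \<otimes> r) \<longleftrightarrow> y \<in> rid r"
  unfolding right_ideal_def by (auto simp: m_assoc dest!: l_cancel_monoid[rotated 3])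

text \<open>Intersections of right ideals are the empty set or a principal right ideal, by
  induction from the case of two ideals.\<close>

lemma INT_ideals:
  assumes "finite K" "K \<noteq> {}" "K \<subseteq> carrier P"
  shows "(\<Inter>k\<in>K. rid k) = {} \<or> (\<exists>r\<in>carrier P. (\<Inter>k\<in>K. rid k) = rid r)"
  using assms
proof (induction K rule: finite_ne_induct)
  case (insert k K)
  show ?case
  proof (cases "(\<Inter>k\<in>K. rid k) = {}")
    case False
    then obtain r where r: "r \<in> carrier P" "(\<Inter>k\<in>K. rid k) = rid r" using insert by auto
    then show ?thesis using inter_ideals[of k r] insert.prems by auto
  qed auto
qed auto

text \<open>The convention $\vee\emptyset=e$ makes $\tau$ the term of the empty set in the
  positivity condition.\<close>

definition join' where "join' K = (if K = {} then Some \<one> else join P K)"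

lemma join'_props:
  assumes "finite K" "K \<subseteq> carrier P"
  shows "case join' K of None \<Rightarrow> (\<forall>x\<in>carrier P. \<not> (\<forall>k\<in>K. x \<in> rid k))
    | Some r \<Rightarrow> r \<in> carrier P \<and> (\<forall>x\<in>carrier P. (\<forall>k\<in>K. x \<in> rid k) \<longleftrightarrow> x \<in> rid r)"
proof (cases "K = {}")
  case False
  show ?thesis
  proof (cases "(\<Inter>k\<in>K. rid k) = {}")
    case True
    then show ?thesis using False by (auto simp: join'_def join_def)
  next
    case ne: False
    then obtain r where r: "r \<in> carrier P" "(\<Inter>k\<in>K. rid k) = rid r" using INT_ideals[OF assms(1) False assms(2)] by auto
    have "(THE p. p \<in> carrier P \<and> (\<Inter>k\<in>K. rid k) = rid p) = r"
      using r rid_inject by (intro the_equality) auto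
    then have "join' K = Some r" using ne False by (simp add: join'_def join_def)
    then show ?thesis using r by auto
  qed
qed (simp add: join'_def rid_one)

lemma join'_Some: "finite K \<Longrightarrow> K \<subseteq> carrier P \<Longrightarrow> join' K = Some r \<Longrightarrow> r \<in> carrier P"
  using join'_props[of K] by simp

lemma join'_singleton: "s \<in> carrier P \<Longrightarrow> join' {s} = Some s"
proof -
  assume s: "s \<in> carrier P"
  have ne: "rid s \<noteq> {}" using rid_self[OF s] by blast
  have "(THE p. p \<in> carrier P \<and> rid s = rid p) = s" using s rid_inject by (intro the_equality) auto
  then show ?thesis using ne by (simp add: join'_def join_def)
qed

section \<open>Linear relations between right ideals\<close>

definition ind :: "'a \<Rightarrow> 'a \<Rightarrow> real" where "ind p x = of_bool (x \<in> rid p)"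

text \<open>Let $s$ be an index with nonzero coefficient that lies in the fewest ideals of such
  indices. Then $s$ lies in no other of these ideals, and the relation at the point $s$ says
  that its coefficient vanishes. The conclusion is phrased with an arbitrary function $f$
  because the $p_i$ may repeat.\<close>

lemma indicators_independent:
  assumes I: "finite I" and p: "\<And>i. i \<in> I \<Longrightarrow> p i \<in> carrier P"
    and z: "\<And>x. x \<in> carrier P \<Longrightarrow> (\<Sum>i\<in>I. c i * ind (p i) x) = 0"
  shows "(\<Sum>i\<in>I. c i * f (p i)) = (0::real)"
proof -
  define S where "S = p ` I"
  define C where "C s = (\<Sum>i\<in>{i\<in>I. p i = s}. c i)" for s
  have grp: "(\<Sum>i\<in>I. c i * g (p i)) = (\<Sum>s\<in>S. C s * g s)" for g :: "'a \<Rightarrow> real"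
  proof -
    have "(\<Sum>i\<in>I. c i * g (p i)) = (\<Sum>s\<in>S. \<Sum>i\<in>{i\<in>I. p i = s}. c i * g (p i))"
      unfolding S_def by (rule sum.image_gen[OF I])
    also have "\<dots> = (\<Sum>s\<in>S. C s * g s)" unfolding C_def sum_distrib_right by (intro sum.cong) auto
    finally show ?thesis .
  qed
  have S: "finite S" "S \<subseteq> carrier P" using I p by (auto simp: S_def)
  have "C s = 0" if "s \<in> S" for s
  proof (rule ccontr)
    assume "C s \<noteq> 0"
    define T where "T = {s \<in> S. C s \<noteq> 0}"
    have T: "finite T" "T \<noteq> {}" "T \<subseteq> carrier P" using S that \<open>C s \<noteq> 0\<close> by (auto simp: T_def)
    define m where "m s = card {t\<in>T. s \<in> rid t}" for s
    obtain s0 where s0: "s0 \<in> T" "\<And>t. t \<in> T \<Longrightarrow> m s0 \<le> m t"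
    proof -
      have "Min (m ` T) \<in> m ` T" using T by (intro Min_in) auto
      then obtain s0 where "s0 \<in> T" "m s0 = Min (m ` T)" by force
      then show ?thesis using that T Min_le[of "m ` T"] by force
    qed
    have min: "t = s0" if t: "t \<in> T" "s0 \<in> rid t" for t
    proof (rule ccontr)
      assume "t \<noteq> s0"
      have "t \<notin> rid s0" using rid_antisym[of t s0] t s0 T \<open>t \<noteq> s0\<close> by auto
      moreover have "{u\<in>T. t \<in> rid u} \<subseteq> {u\<in>T. s0 \<in> rid u}" using rid_mono[of _ t] t T by auto
      ultimately have "{u\<in>T. t \<in> rid u} \<subset> {u\<in>T. s0 \<in> rid u}" using s0 T rid_self[of s0] by auto
      then have "m t < m s0" unfolding m_def using T by (intro psubset_card_mono) auto
      then show False using s0(2)[OF t(1)] by simp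
    qed
    have "(\<Sum>s\<in>S. C s * ind s s0) = C s0"
    proof -
      have "(\<Sum>s\<in>S. C s * ind s s0) = (\<Sum>s\<in>S. if s = s0 then C s0 else 0)"
      proof (rule sum.cong)
        fix t assume t: "t \<in> S"
        show "C t * ind t s0 = (if t = s0 then C s0 else 0)"
          using min[of t] t s0(1) T rid_self[of s0] by (auto simp: ind_def T_def)
      qed simp
      also have "\<dots> = C s0" using s0 S by (simp add: T_def)
      finally show ?thesis .
    qed
    moreover have "(\<Sum>s\<in>S. C s * ind s s0) = 0" using z[of s0] grp[of "\<lambda>p. ind p s0"] s0 T by auto
    ultimately show False using s0 by (simp add: T_def)
  qed
  then show ?thesis using grp[of f] by simp
qed

text \<open>The expression $\sum_{L\subset K}(-1)^{|L|}f(q(\vee L))$, with zero summands where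
  $\vee L=\infty$.\<close>

definition jsum :: "('a \<Rightarrow> real) \<Rightarrow> 'a \<Rightarrow> 'a set \<Rightarrow> real" where
  "jsum f q K = (\<Sum>L\<in>Pow K. (-1) ^ card L * (case join' L of None \<Rightarrow> 0 | Some r \<Rightarrow> f (q \<otimes> r)))"

lemma sum_Pow_alternating:
  "finite K \<Longrightarrow> (\<Sum>L\<in>Pow K. (-1) ^ card L * of_bool (\<forall>k\<in>L. Q k)) = (of_bool (\<forall>k\<in>K. \<not> Q k) :: real)"
proof (induction K rule: finite_induct)
  case (insert k K)
  have "(\<Sum>L\<in>Pow (insert k K). (-1) ^ card L * of_bool (\<forall>k\<in>L. Q k)) =
    (\<Sum>L\<in>Pow K. (-1) ^ card L * of_bool (\<forall>k\<in>L. Q k)) + (\<Sum>L\<in>insert k ` Pow K. (-1) ^ card L * of_bool (\<forall>k\<in>L. Q k) :: real)"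
    unfolding Pow_insert using insert by (intro sum.union_disjoint) auto
  also have "(\<Sum>L\<in>insert k ` Pow K. (-1) ^ card L * of_bool (\<forall>k\<in>L. Q k) :: real) =
     (\<Sum>L\<in>Pow K. - of_bool (Q k) * ((-1) ^ card L * of_bool (\<forall>k\<in>L. Q k)))"
  proof (subst sum.reindex)
    show "inj_on (insert k) (Pow K)" using insert by (auto simp: inj_on_def)
    show "sum ((\<lambda>L. (-1) ^ card L * of_bool (\<forall>k\<in>L. Q k) :: real) \<circ> insert k) (Pow K) =
     (\<Sum>L\<in>Pow K. - of_bool (Q k) * ((-1) ^ card L * of_bool (\<forall>k\<in>L. Q k)))"
    proof (rule sum.cong)
      fix L assume "L \<in> Pow K"
      then have "k \<notin> L" "finite L" using insert finite_subset by auto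
      then show "((\<lambda>L. (-1) ^ card L * of_bool (\<forall>k\<in>L. Q k) :: real) \<circ> insert k) L =
         - of_bool (Q k) * ((-1) ^ card L * of_bool (\<forall>k\<in>L. Q k))" by simp
    qed simp
  qed
  also have "\<dots> = - of_bool (Q k) * (\<Sum>L\<in>Pow K. (-1) ^ card L * of_bool (\<forall>k\<in>L. Q k))"
    by (simp only: sum_distrib_left)
  finally show ?case using insert by (auto simp: of_bool_def)
qed simp

text \<open>Inclusion-exclusion: the indicator functions of the ideals $q(\vee L)P$ combine to
  the one of $q\Omega_K$.\<close>

lemma jsum_ind:
  assumes K: "finite K" "K \<subseteq> carrier P" and q: "q \<in> carrier P" and x: "x \<in> carrier P"
  shows "jsum (\<lambda>p. ind p x) q K = of_bool (x \<in> (\<lambda>y. q \<otimes> y) ` Omega_set P K)"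
proof (cases "x \<in> rid q")
  case True
  then obtain y where y: "y \<in> carrier P" "x = q \<otimes> y" by (auto simp: right_ideal_def)
  have "jsum (\<lambda>p. ind p x) q K = (\<Sum>L\<in>Pow K. (-1) ^ card L * of_bool (\<forall>k\<in>L. y \<in> rid k))"
    unfolding jsum_def
  proof (rule sum.cong)
    fix L assume "L \<in> Pow K"
    then have L: "finite L" "L \<subseteq> carrier P" using K finite_subset by auto
    show "(-1) ^ card L * (case join' L of None \<Rightarrow> 0 | Some r \<Rightarrow> ind (q \<otimes> r) x) = (-1) ^ card L * of_bool (\<forall>k\<in>L. y \<in> rid k)"
      using join'_props[OF L] y q by (auto simp: ind_def rid_cancel split: option.splits)
  qed simp
  also have "\<dots> = of_bool (\<forall>k\<in>K. y \<notin> rid k)" by (rule sum_Pow_alternating[OF K(1)])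
  also have "(\<forall>k\<in>K. y \<notin> rid k) \<longleftrightarrow> x \<in> (\<lambda>y. q \<otimes> y) ` Omega_set P K"
    using y q l_cancel_monoid[of q y] by (auto simp: Omega_set_def)
  finally show ?thesis .
next
  case False
  have "ind (q \<otimes> r) x = 0" if "r \<in> carrier P" for r
    using False rid_mono[of q "q \<otimes> r"] q that by (auto simp: ind_def right_ideal_def)
  then have "jsum (\<lambda>p. ind p x) q K = 0"
    unfolding jsum_def
  proof (intro sum.neutral ballI)
    fix L assume "L \<in> Pow K"
    then have "finite L" "L \<subseteq> carrier P" using K finite_subset by auto
    then have "join' L = Some r \<Longrightarrow> ind (q \<otimes> r) x = 0" for r using join'_Some \<open>\<And>r. r \<in> carrier P \<Longrightarrow> ind (q \<otimes> r) x = 0\<close> by blast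
    then show "(-1) ^ card L * (case join' L of None \<Rightarrow> 0 | Some r \<Rightarrow> ind (q \<otimes> r) x) = 0" by (simp split: option.split)
  qed
  moreover have "x \<notin> (\<lambda>y. q \<otimes> y) ` Omega_set P K" using False by (auto simp: right_ideal_def Omega_set_def)
  ultimately show ?thesis by simp
qed

text \<open>A decomposition of $\Omega_J$ is a linear relation between indicator functions of
  right ideals. Such a relation is formal, by linear independence, and so holds for every
  function on the monoid.\<close>

lemma jsum_decompose:
  assumes J: "finite J" "J \<subseteq> carrier P" and Pa: "Pa \<subseteq> carrier P"
    and om: "Omega_set P J \<in> atom_family P Pa"
  shows "\<exists>T. finite T \<and> (\<forall>(q, K)\<in>T. q \<in> carrier P \<and> finite K \<and> K \<subseteq> Pa) \<and>
    (\<forall>f. jsum f \<one> J = (\<Sum>(q, K)\<in>T. jsum f q K))"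
proof -
  let ?m = "\<lambda>q K. (\<lambda>y. q \<otimes> y) ` Omega_set P K"
  obtain \<C> where \<C>: "finite \<C>" "disjoint \<C>" "Omega_set P J = \<Union>\<C>"
    "\<C> \<subseteq> {?m q K | q K. q \<in> carrier P \<and> finite K \<and> K \<subseteq> Pa}"
    using om unfolding atom_family_def by (elim CollectE exE conjE) (rule that)
  have "\<exists>t. ?m (fst t) (snd t) = D \<and> fst t \<in> carrier P \<and> finite (snd t) \<and> snd t \<subseteq> Pa" if "D \<in> \<C>" for D
  proof -
    obtain q K where "D = ?m q K" "q \<in> carrier P" "finite K" "K \<subseteq> Pa" using \<C>(4) \<open>D \<in> \<C>\<close> by blast
    then show ?thesis by (intro exI[of _ "(q, K)"]) simp
  qed
  then obtain t where t: "\<And>D. D \<in> \<C> \<Longrightarrow> ?m (fst (t D)) (snd (t D)) = D \<and> fst (t D) \<in> carrier P \<and> finite (snd (t D)) \<and> snd (t D) \<subseteq> Pa"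
    by metis
  have inj: "inj_on t \<C>"
  proof (rule inj_onI)
    fix D D' assume D: "D \<in> \<C>" "D' \<in> \<C>" "t D = t D'"
    have "D = ?m (fst (t D)) (snd (t D))" using t[OF D(1)] by blast
    also have "\<dots> = D'" unfolding D(3) using t[OF D(2)] by blast
    finally show "D = D'" .
  qed
  define cf where "cf L = (if join' L = None then 0 else (-1) ^ card L :: real)" for L
  define jn where "jn L = (case join' L of None \<Rightarrow> \<one> | Some r \<Rightarrow> r)" for L
  have jsum_alt: "jsum f q K = (\<Sum>L\<in>Pow K. cf L * f (q \<otimes> jn L))" for f q K
    unfolding jsum_def cf_def jn_def by (intro sum.cong) (auto split: option.splits)
  have jn: "jn L \<in> carrier P" if "finite L" "L \<subseteq> carrier P" for L
    using join'_Some[OF that] by (auto simp: jn_def split: option.splits)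
  have eq: "jsum f \<one> J = (\<Sum>D\<in>\<C>. jsum f (fst (t D)) (snd (t D)))" for f
  proof -
    \<comment> \<open>All terms of both sides are collected in one linear combination.\<close>
    define I where "I = Pow J <+> Sigma \<C> (\<lambda>D. Pow (snd (t D)))"
    define c :: "'a set + 'a set \<times> 'a set \<Rightarrow> real" where "c = case_sum cf (\<lambda>(D, L). - cf L)"
    define p where "p = case_sum (\<lambda>L. \<one> \<otimes> jn L) (\<lambda>(D, L). fst (t D) \<otimes> jn L)"
    have fin: "finite (Pow J)" "finite (Sigma \<C> (\<lambda>D. Pow (snd (t D))))" using J \<C> t by auto
    have split: "(\<Sum>i\<in>I. c i * g (p i)) = jsum g \<one> J - (\<Sum>D\<in>\<C>. jsum g (fst (t D)) (snd (t D)))" for g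
    proof -
      have "(\<Sum>i\<in>I. c i * g (p i)) = (\<Sum>L\<in>Pow J. cf L * g (\<one> \<otimes> jn L)) + (\<Sum>(D, L)\<in>Sigma \<C> (\<lambda>D. Pow (snd (t D))). - (cf L * g (fst (t D) \<otimes> jn L)))"
        unfolding I_def sum.Plus[OF fin] by (intro arg_cong2[of _ _ _ _ "(+)"] sum.cong) (auto simp: c_def p_def)
      also have "(\<Sum>(D, L)\<in>Sigma \<C> (\<lambda>D. Pow (snd (t D))). - (cf L * g (fst (t D) \<otimes> jn L))) = (\<Sum>D\<in>\<C>. \<Sum>L\<in>Pow (snd (t D)). - (cf L * g (fst (t D) \<otimes> jn L)))"
        using \<C> t by (subst sum.Sigma) auto
      finally show ?thesis by (simp add: jsum_alt sum_negf)
    qed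
    have "(\<Sum>i\<in>I. c i * f (p i)) = 0"
    proof (rule indicators_independent)
      show "finite I" using fin by (simp add: I_def)
      show "p i \<in> carrier P" if "i \<in> I" for i
      proof (cases i)
        case (Inl L)
        then have "L \<subseteq> J" using that by (auto simp: I_def)
        then show ?thesis using jn[of L] J Inl finite_subset by (auto simp: p_def)
      next
        case (Inr a)
        obtain D L where a: "a = (D, L)" by (cases a)
        then have "i = Inr (D, L)" "D \<in> \<C>" "L \<subseteq> snd (t D)" using that Inr by (auto simp: I_def)
        then show ?thesis using jn[of L] t[of D] Pa finite_subset[of L "snd (t D)"] by (auto simp: p_def)
      qed
      fix x assume x: "x \<in> carrier P"
      have "(\<Sum>D\<in>\<C>. jsum (\<lambda>p. ind p x) (fst (t D)) (snd (t D))) = (\<Sum>D\<in>\<C>. of_bool (x \<in> D))"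
      proof (rule sum.cong)
        fix D assume D: "D \<in> \<C>"
        have "jsum (\<lambda>p. ind p x) (fst (t D)) (snd (t D)) = of_bool (x \<in> ?m (fst (t D)) (snd (t D)))"
          using t[OF D] Pa x by (intro jsum_ind) auto
        then show "jsum (\<lambda>p. ind p x) (fst (t D)) (snd (t D)) = of_bool (x \<in> D)" using t[OF D] by simp
      qed simp
      also have "\<dots> = of_bool (x \<in> \<Union>\<C>)"
      proof (cases "x \<in> \<Union>\<C>")
        case True
        then obtain D where D: "D \<in> \<C>" "x \<in> D" by blast
        have "x \<in> D' \<longleftrightarrow> D' = D" if "D' \<in> \<C>" for D' using D that \<C>(2) by (auto simp: disjoint_def)
        then have "(\<Sum>D\<in>\<C>. of_bool (x \<in> D)) = (\<Sum>D'\<in>\<C>. if D' = D then 1 else (0::real))" by (intro sum.cong) auto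
        then show ?thesis using D True \<C>(1) by simp
      qed (auto intro!: sum.neutral)
      also have "\<dots> = jsum (\<lambda>p. ind p x) \<one> J"
      proof -
        have "(\<lambda>y. \<one> \<otimes> y) ` Omega_set P J = Omega_set P J" by (auto simp: Omega_set_def image_iff)
        then show ?thesis using jsum_ind[OF J one_closed x] \<C>(3) by simp
      qed
      finally show "(\<Sum>i\<in>I. c i * ind (p i) x) = 0" using split[of "\<lambda>p. ind p x"] by simp
    qed
    then show ?thesis using split[of f] by simp
  qed
  show ?thesis
  proof (intro exI[of _ "t ` \<C>"] conjI allI)
    show "\<forall>(q, K)\<in>t ` \<C>. q \<in> carrier P \<and> finite K \<and> K \<subseteq> Pa" using t by (auto simp: split_beta)
    show "jsum f \<one> J = (\<Sum>(q, K)\<in>t ` \<C>. jsum f q K)" for f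
      unfolding eq[of f] sum.reindex[OF inj] by (simp add: split_beta o_def)
  qed (use \<C> in simp)
qed

end

section \<open>Positivity from decompositions\<close>

lemma minus_one_power_ereal: "(-1::ereal) ^ n = ereal ((-1) ^ n)"
  by (induction n) (simp_all add: one_ereal_def)

locale lcm_product_system = right_lcm_monoid P + product_system P X \<mu> j
  for P :: "('p, 'k) monoid_scheme" (structure)
    and X :: "'p \<Rightarrow> ('a::cstar_algebra, 'x::complex_vector) correspondence"
    and \<mu> and j +
  fixes N :: "'p \<Rightarrow> real" and \<beta> :: real and \<tau> :: "'a \<Rightarrow> complex" and Pa :: "'p set"
  assumes N_hom: "N \<in> hom P positive_reals"
    and trace: "tracial_state \<tau>"
    and Pa: "Pa \<subseteq> carrier P - {\<one>}"
    and generated: "\<And>Q p. \<lbrakk>Q \<one>; \<And>p s. \<lbrakk>p \<in> carrier P; s \<in> Pa; Q p\<rbrakk> \<Longrightarrow> Q (p \<otimes> s); p \<in> carrier P\<rbrakk> \<Longrightarrow> Q p"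
begin

lemma N_pos: "p \<in> carrier P \<Longrightarrow> N p > 0"
  using N_hom by (auto simp: hom_def positive_reals_def)

lemma N_mult: "p \<in> carrier P \<Longrightarrow> q \<in> carrier P \<Longrightarrow> N (p \<otimes> q) = N p * N q"
  using N_hom by (auto simp: hom_def positive_reals_def)

lemma N_one: "N \<one> = 1"
  using N_mult[of \<one> \<one>] N_pos[of \<one>] by simp

lemma N_powr_mult: "p \<in> carrier P \<Longrightarrow> q \<in> carrier P \<Longrightarrow> N (p \<otimes> q) powr (-\<beta>) = N p powr (-\<beta>) * N q powr (-\<beta>)"
  by (simp add: N_mult powr_mult N_pos less_imp_le)

definition Tr :: "'p \<Rightarrow> 'a \<Rightarrow> ereal" where
  "Tr p a = induced_trace \<tau> (X p) (left_action_op (X p) a)"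

lemma Tr_nonneg: "p \<in> carrier P \<Longrightarrow> 0 \<le> Tr p a"
  unfolding Tr_def by (rule cstar_correspondence.induced_trace_nonneg[OF fibre])

lemma mult_lact:
  assumes p: "p \<in> carrier P" "q \<in> carrier P" and x: "\<xi> \<in> carrier (X p)" "\<eta> \<in> carrier (X q)"
  shows "lact (X (p \<otimes> q)) a (\<mu> p q \<xi> \<eta>) = \<mu> p q (lact (X p) a \<xi>) \<eta>"
proof -
  have j: "j a \<in> carrier (X \<one>)" using unit_bij by (auto simp: bij_betw_def)
  have "lact (X (p \<otimes> q)) a (\<mu> p q \<xi> \<eta>) = \<mu> \<one> (p \<otimes> q) (j a) (\<mu> p q \<xi> \<eta>)"
    using p x mult_mem by (simp add: mult_left_unit)
  also have "\<dots> = \<mu> (\<one> \<otimes> p) q (\<mu> \<one> p (j a) \<xi>) \<eta>"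
    by (rule mult_assoc[symmetric]) (use p x j in auto)
  also have "\<dots> = \<mu> p q (lact (X p) a \<xi>) \<eta>" using p x by (simp add: mult_left_unit)
  finally show ?thesis .
qed

lemma tensor_factorization:
  "p \<in> carrier P \<Longrightarrow> q \<in> carrier P \<Longrightarrow> p \<noteq> \<one> \<Longrightarrow> tensor_factorization (X p) (X q) (X (p \<otimes> q)) (\<mu> p q)"
  unfolding tensor_factorization_def tensor_factorization_axioms_def
  using fibre mult_mem mult_tensor mult_lact by simp

lemma Tr_tensor:
  assumes "p \<in> carrier P" "q \<in> carrier P" "p \<noteq> \<one>"
  shows "((\<lambda>H. \<Sum>\<xi>\<leftarrow>H. Tr q (ip (X p) (lact (X p) b \<xi>) (lact (X p) b \<xi>))) \<longlongrightarrow> Tr (p \<otimes> q) (star b * b))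
    (hilbert_module.approx_unit (X p))"
proof -
  interpret T: tensor_factorization "X p" "X q" "X (p \<otimes> q)" "\<mu> p q" by (rule tensor_factorization[OF assms])
  show ?thesis unfolding Tr_def by (rule T.induced_trace_tensor[OF trace])
qed

text \<open>On the fibre $A$ the trace property turns $\sum_\xi\tau\langle b\xi,b\xi\rangle$
  into $\tau\langle b^*,\theta_Hb^*\rangle$, which converges to $\tau(bb^*)=\tau(b^*b)$.\<close>

lemma Tr_one: "a \<in> positive_cone \<Longrightarrow> Tr \<one> a = ereal (Re (\<tau> a))"
proof -
  assume "a \<in> positive_cone"
  then obtain b where b: "a = star b * b" by (auto simp: positive_cone_def)
  interpret E: cstar_correspondence "X \<one>" by (rule fibre) simp
  have jm: "j x \<in> carrier (X \<one>)" for x using unit_bij by (auto simp: bij_betw_def)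
  have js: "\<exists>x. \<xi> = j x" if "\<xi> \<in> carrier (X \<one>)" for \<xi> using unit_bij that by (auto simp: bij_betw_def)
  define v where "v = j (star b)"
  have v: "v \<in> carrier (X \<one>)" by (simp add: v_def jm)
  have ts: "E.trace_sum \<tau> (lact (X \<one>) b) H = Re (\<tau> (ip (X \<one>) v (E.frame_op H v)))" if H: "E.subunital H" for H
  proof -
    have Hm: "set H \<subseteq> carrier (X \<one>)" using H by (simp add: E.subunital_def)
    have "\<tau> (ip (X \<one>) v (E.frame_op H v)) = (\<Sum>\<xi>\<leftarrow>H. \<tau> (ip (X \<one>) v \<xi> * ip (X \<one>) \<xi> v))"
      by (simp add: E.ip_frame_op[OF Hm v] tracial_state_sum_list[OF trace])
    also have "\<dots> = (\<Sum>\<xi>\<leftarrow>H. \<tau> (ip (X \<one>) (lact (X \<one>) b \<xi>) (lact (X \<one>) b \<xi>)))"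
    proof (intro arg_cong[of _ _ sum_list] map_cong HOL.refl)
      fix \<xi> assume "\<xi> \<in> set H"
      then obtain x where x: "\<xi> = j x" using Hm js by blast
      have "\<tau> ((b * x) * (star x * star b)) = \<tau> ((star x * star b) * (b * x))"
        by (rule tracial_state_simps(4)[OF trace])
      then show "\<tau> (ip (X \<one>) v \<xi> * ip (X \<one>) \<xi> v) = \<tau> (ip (X \<one>) (lact (X \<one>) b \<xi>) (lact (X \<one>) b \<xi>))"
        by (simp add: x v_def unit_ip unit_lact star_star star_mult)
    qed
    finally show ?thesis by (simp add: E.trace_sum_def Re_sum_list)
  qed
  have "((\<lambda>H. ereal (E.trace_sum \<tau> (lact (X \<one>) b) H)) \<longlongrightarrow> ereal (Re (\<tau> a))) E.approx_unit"
  proof (rule tendsto_ereal, rule tendstoI)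
    fix e :: real assume e: "0 < e"
    obtain d where d: "d > 0" "d * E.nn v < e" using E.ex_good_delta[OF e] E.nn_ge_zero by blast
    show "\<forall>\<^sub>F H in E.approx_unit. dist (E.trace_sum \<tau> (lact (X \<one>) b) H) (Re (\<tau> a)) < e"
      using eventually_conj[OF E.eventually_approx_unit_subunital E.eventually_approx_unit_near[OF v d(1)]]
    proof (rule eventually_mono)
      fix H assume H: "E.subunital H \<and> E.nn (E.frame_op H v - v) < d"
      then have Hm: "set H \<subseteq> carrier (X \<one>)" by (simp add: E.subunital_def)
      have "\<tau> a = \<tau> (ip (X \<one>) v v)"
        by (simp add: b v_def unit_ip star_star tracial_state_simps(4)[OF trace, of "star b"])
      then have "\<tau> (ip (X \<one>) v (E.frame_op H v)) - \<tau> a = \<tau> (ip (X \<one>) v (E.frame_op H v - v))"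
        using v Hm by (simp add: E.ip_diff E.frame_op_mem tracial_state_simps(2)[OF trace])
      also have "norm \<dots> \<le> norm (ip (X \<one>) v (E.frame_op H v - v))" by (rule tracial_state_simps(6)[OF trace])
      also have "\<dots> \<le> E.nn v * E.nn (E.frame_op H v - v)"
        using v Hm by (intro E.Cauchy_Schwarz) (auto intro: E.mem E.frame_op_mem)
      also have "\<dots> \<le> E.nn v * d" using H by (intro mult_left_mono) auto
      also have "\<dots> < e" using d by (simp add: mult.commute)
      finally have "\<bar>Re (\<tau> (ip (X \<one>) v (E.frame_op H v)) - \<tau> a)\<bar> < e"
        using abs_Re_le_cmod order_le_less_trans by blast
      then show "dist (E.trace_sum \<tau> (lact (X \<one>) b) H) (Re (\<tau> a)) < e"
        using ts H by (simp add: dist_real_def)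
    qed
  qed
  moreover have "((\<lambda>H. ereal (E.trace_sum \<tau> (lact (X \<one>) b) H)) \<longlongrightarrow> Tr \<one> a) E.approx_unit"
    unfolding Tr_def b by (rule E.trace_sum_lact_tendsto[OF trace])
  ultimately show ?thesis using tendsto_unique[OF E.approx_unit_neq_bot] by blast
qed

definition F :: "'a \<Rightarrow> 'p \<Rightarrow> real" where
  "F a p = N p powr (-\<beta>) * real_of_ereal (Tr p a)"

lemma positivity_iff:
  assumes J: "finite J" "J \<subseteq> carrier P" and a: "a \<in> positive_cone"
    and fin: "\<And>p. p \<in> carrier P \<Longrightarrow> Tr p a \<noteq> \<infinity>"
  shows "positivity_ineq P X N \<beta> \<tau> J a \<longleftrightarrow> 0 \<le> jsum (F a) \<one> J"
proof -
  have summand: "(case join P K of None \<Rightarrow> 0 | Some q \<Rightarrow> (-1) ^ card K * ereal (N q powr (-\<beta>)) * induced_trace \<tau> (X q) (left_action_op (X q) a))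
      = ereal ((-1) ^ card K * (case join' K of None \<Rightarrow> 0 | Some r \<Rightarrow> F a (\<one> \<otimes> r)))" if K: "K \<in> Pow J - {{}}" for K
  proof -
    have K': "finite K" "K \<subseteq> carrier P" "K \<noteq> {}" using K J finite_subset by auto
    have jj: "join P K = join' K" using K' by (simp add: join'_def)
    show ?thesis
    proof (cases "join' K")
      case (Some r)
      then have r: "r \<in> carrier P" using join'_Some K' by blast
      obtain t where t: "Tr r a = ereal t" using fin[OF r] Tr_nonneg[OF r, of a] by (cases "Tr r a") auto
      show ?thesis unfolding jj Some using r
        by (simp add: F_def Tr_def[symmetric] minus_one_power_ereal t mult.assoc)
    qed (simp add: jj)
  qed
  have "ereal (Re (\<tau> a)) + (\<Sum>K \<in> Pow J - {{}}. case join P K of None \<Rightarrow> 0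
      | Some q \<Rightarrow> (-1) ^ card K * ereal (N q powr (-\<beta>)) * induced_trace \<tau> (X q) (left_action_op (X q) a))
    = ereal (Re (\<tau> a) + (\<Sum>K \<in> Pow J - {{}}. (-1) ^ card K * (case join' K of None \<Rightarrow> 0 | Some r \<Rightarrow> F a (\<one> \<otimes> r))))"
    unfolding plus_ereal.simps(1)[symmetric] sum_ereal[symmetric] using summand by (intro arg_cong2[of _ _ _ _ "(+)"] sum.cong) auto
  also have "Re (\<tau> a) + (\<Sum>K \<in> Pow J - {{}}. (-1) ^ card K * (case join' K of None \<Rightarrow> 0 | Some r \<Rightarrow> F a (\<one> \<otimes> r))) = jsum (F a) \<one> J"
  proof -
    have "(-1) ^ card {} * (case join' {} of None \<Rightarrow> 0 | Some r \<Rightarrow> F a (\<one> \<otimes> r)) = Re (\<tau> a)"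
      using Tr_one[OF a] by (simp add: join'_def F_def N_one)
    then show ?thesis unfolding jsum_def using J
      by (subst sum.remove[of "Pow J" "{}"]) auto
  qed
  finally show ?thesis unfolding positivity_ineq_def by simp
qed

context
  assumes gen: "\<And>a J. a \<in> positive_cone \<Longrightarrow> finite J \<Longrightarrow> J \<subseteq> Pa \<Longrightarrow> positivity_ineq P X N \<beta> \<tau> J a"
begin

lemma Tr_generator:
  assumes s: "s \<in> Pa" and a: "a \<in> positive_cone"
  shows "Tr s a \<le> ereal (N s powr \<beta>) * ereal (Re (\<tau> a))"
proof -
  have sP: "s \<in> carrier P" using s Pa by auto
  have "join P {s} = Some s" using join'_singleton[OF sP] by (simp add: join'_def)
  moreover have "Pow {s} - {{}} = {{s}}" by auto
  ultimately have "0 \<le> ereal (Re (\<tau> a)) + - 1 * ereal (N s powr (-\<beta>)) * Tr s a"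
    using gen[OF a, of "{s}"] s by (simp add: positivity_ineq_def Tr_def)
  moreover have N: "N s powr (-\<beta>) > 0" "N s powr \<beta> * N s powr (-\<beta>) = 1" using N_pos[OF sP] by (auto simp: powr_add[symmetric])
  ultimately show ?thesis
  proof (cases "Tr s a")
    case (real t)
    then have "N s powr (-\<beta>) * t \<le> Re (\<tau> a)" using \<open>0 \<le> _\<close> by (simp add: zero_ereal_def[symmetric])
    then have "N s powr \<beta> * (N s powr (-\<beta>) * t) \<le> N s powr \<beta> * Re (\<tau> a)" by (intro mult_left_mono) auto
    then show ?thesis using real N(2) by (simp add: mult.assoc[symmetric])
  qed (use Tr_nonneg[OF sP, of a] in auto)
qed

text \<open>Appending a generator $s$ multiplies the trace at most by $N(s)^\beta$, by the
  tensor product formula and the inequality for $J=\{s\}$.\<close>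

lemma Tr_finite:
  assumes p: "p \<in> carrier P" and "a \<in> positive_cone" shows "Tr p a \<noteq> \<infinity>"
proof -
  have "\<forall>a\<in>positive_cone. Tr p a \<noteq> \<infinity>"
  proof (rule generated[OF _ _ p, where Q="\<lambda>p. \<forall>a\<in>positive_cone. Tr p a \<noteq> \<infinity>"]; intro ballI)
    fix a :: 'a assume "a \<in> positive_cone" then show "Tr \<one> a \<noteq> \<infinity>" by (simp add: Tr_one)
  next
    fix p s and a :: 'a
    assume 2: "p \<in> carrier P" "s \<in> Pa" "\<forall>a\<in>positive_cone. Tr p a \<noteq> \<infinity>" "a \<in> positive_cone"
  have sP: "s \<in> carrier P" using 2 Pa by auto
  show "Tr (p \<otimes> s) a \<noteq> \<infinity>"
  proof (cases "p = \<one>")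
    case True
    then show ?thesis using Tr_generator[OF 2(2) 2(4)] sP by auto
  next
    case False
    obtain b where b: "a = star b * b" using 2(4) by (auto simp: positive_cone_def)
    interpret E: cstar_correspondence "X p" by (rule fibre) (rule 2)
    let ?q = "\<lambda>\<xi>. ip (X p) (lact (X p) b \<xi>) (lact (X p) b \<xi>)"
    have "(\<Sum>\<xi>\<leftarrow>H. Tr s (?q \<xi>)) \<le> ereal (N s powr \<beta>) * Tr p a" if H: "E.subunital H" for H
    proof -
      have hm: "\<xi> \<in> carrier (X p)" if "\<xi> \<in> set H" for \<xi> using H that by (auto simp: E.subunital_def)
      have "(\<Sum>\<xi>\<leftarrow>H. Tr s (?q \<xi>)) \<le> (\<Sum>\<xi>\<leftarrow>H. ereal (N s powr \<beta>) * ereal (Re (\<tau> (?q \<xi>))))"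
        by (intro sum_list_mono Tr_generator 2 E.ip_positive E.lact_mem hm)
      also have "\<dots> = ereal (N s powr \<beta>) * ereal (E.trace_sum \<tau> (lact (X p) b) H)"
        unfolding E.trace_sum_def by (induction H) (auto simp: algebra_simps)
      also have "\<dots> \<le> ereal (N s powr \<beta>) * Tr p a"
        unfolding Tr_def b by (intro ereal_mult_left_mono E.trace_sum_le_induced_trace trace H) auto
      finally show ?thesis .
    qed
    then have "Tr (p \<otimes> s) a \<le> ereal (N s powr \<beta>) * Tr p a"
      unfolding b by (intro tendsto_upperbound[OF Tr_tensor[OF 2(1) sP False] _ E.approx_unit_neq_bot])
        (auto intro: eventually_mono[OF E.eventually_approx_unit_subunital])
    moreover have "ereal (N s powr \<beta>) * Tr p a \<noteq> \<infinity>" using 2(3)[rule_format, OF 2(4)] Tr_nonneg[OF 2(1), of a] by (cases "Tr p a") auto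
    ultimately show ?thesis by auto
  qed
  qed
  then show ?thesis using assms(2) by blast
qed

lemma jsum_one_nonneg: "a \<in> positive_cone \<Longrightarrow> finite K \<Longrightarrow> K \<subseteq> Pa \<Longrightarrow> 0 \<le> jsum (F a) \<one> K"
  using positivity_iff[of K a] gen Tr_finite Pa by blast

text \<open>By the tensor product formula, the traces at all $q(\vee L)$ are limits, along the
  same frames of $X_q$, of sums over $\xi\in H$ of the traces at $\vee L$ of the positive
  elements $\langle b\xi,b\xi\rangle$ with $a=b^*b$. Taking the alternating sum before the limit
  leaves, for each $\xi$, the assumed inequality for $K$.\<close>

lemma jsum_nonneg:
  assumes q: "q \<in> carrier P" and K: "finite K" "K \<subseteq> Pa" and a: "a \<in> positive_cone"
  shows "0 \<le> jsum (F a) q K"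
proof (cases "q = \<one>")
  case True then show ?thesis using jsum_one_nonneg a K by simp
next
  case False
  obtain b where b: "a = star b * b" using a by (auto simp: positive_cone_def)
  interpret E: cstar_correspondence "X q" by (rule fibre) (rule q)
  let ?q = "\<lambda>\<xi>. ip (X q) (lact (X q) b \<xi>) (lact (X q) b \<xi>)"
  have KP: "K \<subseteq> carrier P" using K Pa by auto
  have qpos: "?q \<xi> \<in> positive_cone" if "\<xi> \<in> carrier (X q)" for \<xi> using that by (intro E.ip_positive E.lact_mem)
  define t where "t r c = real_of_ereal (Tr r c)" for r c
  have t: "Tr r c = ereal (t r c)" if "r \<in> carrier P" "c \<in> positive_cone" for r c
    using Tr_finite[OF that] Tr_nonneg[OF that(1), of c] by (cases "Tr r c") (auto simp: t_def)
  have lim: "((\<lambda>H. \<Sum>\<xi>\<leftarrow>H. t r (?q \<xi>)) \<longlongrightarrow> t (q \<otimes> r) a) E.approx_unit" if r: "r \<in> carrier P" for r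
  proof -
    have "eventually (\<lambda>H. (\<Sum>\<xi>\<leftarrow>H. Tr r (?q \<xi>)) = ereal (\<Sum>\<xi>\<leftarrow>H. t r (?q \<xi>))) E.approx_unit"
      using E.eventually_approx_unit_subunital
    proof (rule eventually_mono)
      fix H assume "E.subunital H"
      then have "set H \<subseteq> carrier (X q)" by (simp add: E.subunital_def)
      then show "(\<Sum>\<xi>\<leftarrow>H. Tr r (?q \<xi>)) = ereal (\<Sum>\<xi>\<leftarrow>H. t r (?q \<xi>))"
        by (induction H) (auto simp: t[OF r] qpos)
    qed
    then have "((\<lambda>H. ereal (\<Sum>\<xi>\<leftarrow>H. t r (?q \<xi>))) \<longlongrightarrow> Tr (q \<otimes> r) a) E.approx_unit"
      unfolding b by (rule Lim_transform_eventually[OF Tr_tensor[OF q r False]])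
    then show ?thesis using t[of "q \<otimes> r" a] q r a by simp
  qed
  define c where "c L = (case join' L of None \<Rightarrow> 0 | Some r \<Rightarrow> (-1) ^ card L * N r powr (-\<beta>))" for L
  define jn where "jn L = (case join' L of None \<Rightarrow> \<one> | Some r \<Rightarrow> r)" for L
  have jn: "jn L \<in> carrier P" if "L \<in> Pow K" for L
    using join'_Some[of L] that K KP finite_subset[of L K] by (auto simp: jn_def split: option.splits)
  have js: "jsum (F d) p K = N p powr (-\<beta>) * (\<Sum>L\<in>Pow K. c L * t (p \<otimes> jn L) d)" if p: "p \<in> carrier P" for d p
    unfolding jsum_def sum_distrib_left
  proof (rule sum.cong)
    fix L assume L: "L \<in> Pow K"
    show "(-1) ^ card L * (case join' L of None \<Rightarrow> 0 | Some r \<Rightarrow> F d (p \<otimes> r)) = N p powr (-\<beta>) * (c L * t (p \<otimes> jn L) d)"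
      using jn[OF L] p by (auto simp: c_def jn_def F_def t_def N_powr_mult split: option.splits)
  qed simp
  have "0 \<le> (\<Sum>L\<in>Pow K. c L * t (q \<otimes> jn L) a)"
  proof (rule tendsto_lowerbound[OF _ _ E.approx_unit_neq_bot])
    show "((\<lambda>H. \<Sum>L\<in>Pow K. c L * (\<Sum>\<xi>\<leftarrow>H. t (jn L) (?q \<xi>))) \<longlongrightarrow> (\<Sum>L\<in>Pow K. c L * t (q \<otimes> jn L) a)) E.approx_unit"
      by (intro tendsto_sum tendsto_mult tendsto_const lim jn)
    show "\<forall>\<^sub>F H in E.approx_unit. 0 \<le> (\<Sum>L\<in>Pow K. c L * (\<Sum>\<xi>\<leftarrow>H. t (jn L) (?q \<xi>)))"
      using E.eventually_approx_unit_subunital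
    proof (rule eventually_mono)
      fix H assume "E.subunital H"
      then have Hm: "set H \<subseteq> carrier (X q)" by (simp add: E.subunital_def)
      have "(\<Sum>L\<in>Pow K. c L * (\<Sum>\<xi>\<leftarrow>H. t (jn L) (?q \<xi>))) = (\<Sum>\<xi>\<leftarrow>H. \<Sum>L\<in>Pow K. c L * t (jn L) (?q \<xi>))"
        by (induction H) (simp_all add: sum.distrib distrib_left)
      moreover have "0 \<le> (\<Sum>L\<in>Pow K. c L * t (jn L) (?q \<xi>))" if "\<xi> \<in> set H" for \<xi>
      proof -
        have "0 \<le> jsum (F (?q \<xi>)) \<one> K" using that Hm K by (intro jsum_one_nonneg qpos) auto
        then have "0 \<le> (\<Sum>L\<in>Pow K. c L * t (\<one> \<otimes> jn L) (?q \<xi>))" using js[OF one_closed, of "?q \<xi>"] by (simp add: N_one)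
        also have "\<dots> = (\<Sum>L\<in>Pow K. c L * t (jn L) (?q \<xi>))" using jn by (intro sum.cong) auto
        finally show ?thesis .
      qed
      ultimately show "0 \<le> (\<Sum>L\<in>Pow K. c L * (\<Sum>\<xi>\<leftarrow>H. t (jn L) (?q \<xi>)))"
        by (auto intro!: sum_list_nonneg)
    qed
  qed
  then show ?thesis unfolding js[OF q] by simp
qed

lemma positivity_all:
  assumes om: "\<And>J. finite J \<Longrightarrow> J \<subseteq> carrier P \<Longrightarrow> Omega_set P J \<in> atom_family P Pa"
    and J: "finite J" "J \<subseteq> carrier P" and a: "a \<in> positive_cone"
  shows "positivity_ineq P X N \<beta> \<tau> J a"
proof -
  have PaP: "Pa \<subseteq> carrier P" using Pa by auto
  obtain T where T: "finite T" "\<forall>(q, K)\<in>T. q \<in> carrier P \<and> finite K \<and> K \<subseteq> Pa"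
    "\<And>f. jsum f \<one> J = (\<Sum>(q, K)\<in>T. jsum f q K)"
    using jsum_decompose[OF J PaP om[OF J]] by blast
  have "0 \<le> jsum (F a) \<one> J" unfolding T(3)
    using T(2) jsum_nonneg a by (intro sum_nonneg) auto
  then show ?thesis using positivity_iff[OF J a] Tr_finite a by blast
qed

end

end

text \<open>The inequality for $J$ is the sum of those for the pieces $q\Omega_K$ of
  $\Omega_J$.\<close>

theorem reduction_to_generators_criterion:
  fixes P :: "('p, 'k) monoid_scheme"
    and X :: "'p \<Rightarrow> ('a::cstar_algebra, 'x::complex_vector) correspondence"
  assumes lcm: "right_lcm_monoid P" and ps: "product_system P X \<mu> j"
    and N: "N \<in> hom P positive_reals" and Pa: "Pa \<subseteq> carrier P - {\<one>\<^bsub>P\<^esub>}"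
    and gen: "\<And>Q p. \<lbrakk>Q \<one>\<^bsub>P\<^esub>; \<And>p s. \<lbrakk>p \<in> carrier P; s \<in> Pa; Q p\<rbrakk> \<Longrightarrow> Q (p \<otimes>\<^bsub>P\<^esub> s); p \<in> carrier P\<rbrakk> \<Longrightarrow> Q p"
    and om: "\<And>J. finite J \<Longrightarrow> J \<subseteq> carrier P \<Longrightarrow> Omega_set P J \<in> atom_family P Pa"
  shows "reduction_to_generators P Pa X N \<beta>"
  unfolding reduction_to_generators_def
proof (intro allI impI iffI ballI)
  fix \<tau> and a :: 'a and J assume \<tau>: "tracial_state \<tau>"
    and h: "\<forall>a\<in>positive_cone. \<forall>J. finite J \<and> J \<subseteq> Pa \<longrightarrow> positivity_ineq P X N \<beta> \<tau> J a"
    and a: "a \<in> positive_cone" and J: "finite J \<and> J \<subseteq> carrier P - {\<one>\<^bsub>P\<^esub>}"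
  have "lcm_product_system P X \<mu> j N \<tau> Pa"
    unfolding lcm_product_system_def lcm_product_system_axioms_def using lcm ps N \<tau> Pa gen by blast
  then show "positivity_ineq P X N \<beta> \<tau> J a"
    by (rule lcm_product_system.positivity_all) (use h J a om in auto)
qed (use Pa in blast)

section \<open>Words and congruences\<close>

lemma word_cong_context: "word_cong R u v \<Longrightarrow> word_cong R (x @ u @ y) (x @ v @ y)"
proof (induction rule: word_cong.induct)
  case (rel u v x' y')
  then show ?case using word_cong.rel[of u v R "x @ x'" "y' @ y"] by simp
qed (auto intro: word_cong.intros)

declare word_cong.trans [trans]

lemma word_cong_append: "word_cong R u v \<Longrightarrow> word_cong R u' v' \<Longrightarrow> word_cong R (u @ u') (v @ v')"
  using word_cong_context[of R u v "[]" u'] word_cong_context[of R u' v' v "[]"] by (auto intro: word_cong.trans)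

lemma word_cong_mono: "word_cong R u v \<Longrightarrow> R \<subseteq> R' \<Longrightarrow> word_cong R' u v"
  by (induction rule: word_cong.induct) (auto intro: word_cong.intros)

lemma word_cong_lists:
  "word_cong R u v \<Longrightarrow> R \<subseteq> lists S \<times> lists S \<Longrightarrow> u \<in> lists S \<longleftrightarrow> v \<in> lists S"
  by (induction rule: word_cong.induct) auto

lemma word_cong_invariant:
  "word_cong R u v \<Longrightarrow> (\<And>u v x y. (u, v) \<in> R \<Longrightarrow> f (x @ u @ y) = f (x @ v @ y)) \<Longrightarrow> f u = f v"
  by (induction rule: word_cong.induct) auto

lemma length_alternating [simp]: "length (alternating s t n) = n"
  by (induction n arbitrary: s t) auto

definition alt_letter :: "'s \<Rightarrow> 's \<Rightarrow> nat \<Rightarrow> 's" where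
  "alt_letter s t k = (if even k then s else t)"

lemma alternating_snoc: "alternating s t (Suc n) = alternating s t n @ [alt_letter s t n]"
  by (induction n arbitrary: s t) (auto simp: alt_letter_def)

lemma rev_alternating: "rev (alternating s t n) = (if even n then alternating t s n else alternating s t n)"
proof (induction n arbitrary: s t)
  case (Suc n)
  have "rev (alternating s t (Suc n)) = rev (alternating t s n) @ [s]" by simp
  then show ?case unfolding Suc[of t s] alternating_snoc by (simp add: alt_letter_def)
qed simp

lemma alternating_append: "alternating s t (n + k) = alternating s t n @ (if even n then alternating s t k else alternating t s k)"
  by (induction n arbitrary: s t) auto

lemma alternating_lists: "s \<in> S \<Longrightarrow> t \<in> S \<Longrightarrow> alternating s t n \<in> lists S"
  by (induction n arbitrary: s t) auto

section \<open>Chebyshev polynomials\<close>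

text \<open>The Chebyshev polynomials of the second kind, normalized so that the value at
  $2\cos\theta$ is $\sin(k\theta)/\sin\theta$.\<close>

fun cheb :: "real \<Rightarrow> nat \<Rightarrow> real" where
  "cheb c 0 = 0"
| "cheb c (Suc 0) = 1"
| "cheb c (Suc (Suc k)) = c * cheb c (Suc k) - cheb c k"

lemma cheb_sin: "cheb (2 * cos \<theta>) k * sin \<theta> = sin (real k * \<theta>)"
proof (induction k rule: less_induct)
  case (less k)
  consider "k = 0" | "k = 1" | j where "k = Suc (Suc j)" by (metis One_nat_def not0_implies_Suc)
  then show ?case
  proof cases
    case 3
    have "sin (real (Suc (Suc j)) * \<theta>) = sin (real (Suc j) * \<theta> + \<theta>)" by (simp add: algebra_simps)
    moreover have "sin (real j * \<theta>) = sin (real (Suc j) * \<theta> - \<theta>)" by (simp add: algebra_simps)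
    ultimately have "sin (real (Suc (Suc j)) * \<theta>) = 2 * cos \<theta> * sin (real (Suc j) * \<theta>) - sin (real j * \<theta>)"
      by (simp only: sin_add sin_diff) (simp add: algebra_simps)
    moreover have "cheb (2 * cos \<theta>) (Suc j) * sin \<theta> = sin (real (Suc j) * \<theta>)" "cheb (2 * cos \<theta>) j * sin \<theta> = sin (real j * \<theta>)"
      using less[of "Suc j"] less[of j] 3 by auto
    ultimately show ?thesis using 3
      by (simp only: cheb.simps left_diff_distrib mult.assoc)
  qed auto
qed

lemma cheb_two: "cheb 2 k = real k"
  by (induction k rule: induct_nat_012) auto

section \<open>Coxeter groups\<close>

locale coxeter =
  fixes S :: "'s set" and m :: "'s \<Rightarrow> 's \<Rightarrow> enat"
  assumes cox: "coxeter_matrix S m"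
begin

abbreviation "R \<equiv> artin_relations S m"
text \<open>Adding the relations $s^2=1$ presents the Coxeter group as a monoid.\<close>

definition "RW = R \<union> {([s, s], []) | s. s \<in> S}"
abbreviation eqM (infix "\<doteq>" 50) where "u \<doteq> v \<equiv> word_cong R u v"
abbreviation eqW (infix "\<simeq>" 50) where "u \<simeq> v \<equiv> word_cong RW u v"

lemma R_lists: "R \<subseteq> lists S \<times> lists S"
  unfolding artin_relations_def using alternating_lists by fastforce

lemma RW_lists: "RW \<subseteq> lists S \<times> lists S"
  using R_lists by (auto simp: RW_def)

lemma eqM_lists: "u \<doteq> v \<Longrightarrow> u \<in> lists S \<longleftrightarrow> v \<in> lists S" by (rule word_cong_lists[OF _ R_lists])
lemma eqW_lists: "u \<simeq> v \<Longrightarrow> u \<in> lists S \<longleftrightarrow> v \<in> lists S" by (rule word_cong_lists[OF _ RW_lists])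

lemma eqM_length: "u \<doteq> v \<Longrightarrow> length u = length v"
  by (rule word_cong_invariant) (auto simp: artin_relations_def)

lemma eqM_eqW: "u \<doteq> v \<Longrightarrow> u \<simeq> v"
  by (rule word_cong_mono) (auto simp: RW_def)

lemma eqW_parity: "u \<simeq> v \<Longrightarrow> even (length u) \<longleftrightarrow> even (length v)"
  by (rule word_cong_invariant[where f="\<lambda>u. even (length u)"]) (auto simp: RW_def artin_relations_def)

lemmas eq_intros = word_cong.refl word_cong.sym word_cong.trans word_cong_append

lemma braid: "s \<in> S \<Longrightarrow> t \<in> S \<Longrightarrow> s \<noteq> t \<Longrightarrow> m s t = enat n \<Longrightarrow> alternating s t n \<doteq> alternating t s n"
  using word_cong.rel[of "alternating s t n" "alternating t s n" R "[]" "[]"] by (auto simp: artin_relations_def)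

lemma cancel_pair: "s \<in> S \<Longrightarrow> x @ [s, s] @ y \<simeq> x @ y"
  using word_cong.rel[of "[s,s]" "[]" RW x y] by (simp add: RW_def)

lemma m_sym: "s \<in> S \<Longrightarrow> t \<in> S \<Longrightarrow> m s t = m t s"
  using cox by (simp add: coxeter_matrix_def)

lemma m_ge2: "s \<in> S \<Longrightarrow> t \<in> S \<Longrightarrow> s \<noteq> t \<Longrightarrow> m s t = enat n \<Longrightarrow> 2 \<le> n"
  using cox by (force simp: coxeter_matrix_def numeral_eq_enat)

subsection \<open>The geometric representation\<close>

text \<open>This is $-2B(\alpha_s,\alpha_t)$ for the canonical bilinear form $B$ on the span of
  the simple roots.\<close>

definition coef :: "'s \<Rightarrow> 's \<Rightarrow> real" where
  "coef s t = (if s = t then -2 else case m s t of enat n \<Rightarrow> 2 * cos (pi / real n) | \<infinity> \<Rightarrow> 2)"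

text \<open>A function $f$ on $S$ stands for the linear form with value $f(s)$ at the simple
  root $\alpha_s$, and words act by the representation contragredient to the geometric
  one.\<close>

definition reflect :: "('s \<Rightarrow> real) \<Rightarrow> 's \<Rightarrow> 's \<Rightarrow> real" where
  "reflect f s = (\<lambda>r. if r \<in> S then f r + coef r s * f s else 0)"

definition act :: "('s \<Rightarrow> real) \<Rightarrow> 's list \<Rightarrow> 's \<Rightarrow> real" where
  "act = foldl reflect"

lemma act_simps [simp]: "act f [] = f" "act f (s # w) = act (reflect f s) w" "act f (u @ v) = act (act f u) v"
  by (simp_all add: act_def)

lemma coef_sym: "s \<in> S \<Longrightarrow> t \<in> S \<Longrightarrow> coef s t = coef t s"
  by (simp add: coef_def m_sym)

abbreviation "U s t \<equiv> cheb (coef s t)"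

lemma U_pos: "s \<in> S \<Longrightarrow> t \<in> S \<Longrightarrow> s \<noteq> t \<Longrightarrow> 0 < k \<Longrightarrow> enat k < m s t \<Longrightarrow> 0 < U s t k"
proof (cases "m s t")
  case (enat n)
  assume a: "s \<in> S" "t \<in> S" "s \<noteq> t" "0 < k" "enat k < m s t"
  then have n: "2 \<le> n" "k < n" using m_ge2 enat by auto
  have "0 < sin (pi / real n)" using n by (intro sin_gt_zero) (auto simp: field_simps)
  moreover have "0 < sin (real k * (pi / real n))" using n a by (intro sin_gt_zero) (auto simp: field_simps)
  ultimately show ?thesis using cheb_sin[of "pi / real n" k] zero_less_mult_pos2[of "cheb (2 * cos (pi / real n)) k" "sin (pi / real n)"] a enat
    by (simp add: coef_def)
qed (simp add: coef_def cheb_two)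

lemma U_zero: "s \<in> S \<Longrightarrow> t \<in> S \<Longrightarrow> s \<noteq> t \<Longrightarrow> m s t = enat n \<Longrightarrow> U s t n = 0"
proof -
  assume a: "s \<in> S" "t \<in> S" "s \<noteq> t" "m s t = enat n"
  then have n: "2 \<le> n" using m_ge2 by auto
  have "0 < sin (pi / real n)" using n by (intro sin_gt_zero) (auto simp: field_simps)
  then show ?thesis using cheb_sin[of "pi / real n" n] a n by (simp add: coef_def)
qed

lemma U_nonneg: "s \<in> S \<Longrightarrow> t \<in> S \<Longrightarrow> s \<noteq> t \<Longrightarrow> enat k \<le> m s t \<Longrightarrow> 0 \<le> U s t k"
  using U_pos[of s t k] U_zero[of s t k] by (cases "k = 0"; cases "enat k = m s t") (auto simp: order.order_iff_strict)

lemma act_alternating_pair: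
  assumes st: "s \<in> S" "t \<in> S" "s \<noteq> t"
  shows "act f (alternating s t (Suc k)) (alt_letter s t (Suc k)) = U s t (Suc (Suc k)) * f s + U s t (Suc k) * f t \<and>
    act f (alternating s t (Suc k)) (alt_letter s t k) = - (U s t (Suc k) * f s + U s t k * f t)"
proof (induction k)
  case 0
  show ?case using st by (simp add: alt_letter_def reflect_def coef_sym[of t s]) (simp add: coef_def)
next
  case (Suc k)
  have l: "alt_letter s t (Suc (Suc k)) = alt_letter s t k" "alt_letter s t k \<in> S" "alt_letter s t (Suc k) \<in> S"
    using st by (auto simp: alt_letter_def)
  have c: "coef (alt_letter s t k) (alt_letter s t (Suc k)) = coef s t" "coef (alt_letter s t (Suc k)) (alt_letter s t (Suc k)) = -2"
    using coef_sym[of t s] st by (auto simp: alt_letter_def) (auto simp: coef_def)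
  show ?case unfolding alternating_snoc[of s t "Suc k"]
    using l by (simp add: reflect_def c Suc[THEN conjunct1] Suc[THEN conjunct2] del: alternating.simps) (simp add: algebra_simps)
qed

lemma act_alternating_next:
  assumes st: "s \<in> S" "t \<in> S" "s \<noteq> t"
  shows "act f (alternating s t k) (alt_letter s t k) = U s t (Suc k) * f s + U s t k * f t"
  using act_alternating_pair[OF st, of f "k - 1"] by (cases k) (auto simp: alt_letter_def)

text \<open>The coefficients of the two simple roots that accumulate when an alternating word
  acts; their symmetry under exchange of the letters gives the braid relations.\<close>

fun alt_sums :: "real \<Rightarrow> nat \<Rightarrow> real \<Rightarrow> real \<Rightarrow> real \<times> real" where
  "alt_sums c 0 x y = (0, 0)"
| "alt_sums c (Suc k) x y = (let (a, b) = alt_sums c k x y; z = cheb c (Suc k) * x + cheb c k * y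
     in if even k then (a + z, b) else (a, b + z))"

lemma act_alternating_sums:
  assumes st: "s \<in> S" "t \<in> S" "s \<noteq> t" and r: "r \<in> S"
  shows "act f (alternating s t k) r = f r + coef r s * fst (alt_sums (coef s t) k (f s) (f t)) + coef r t * snd (alt_sums (coef s t) k (f s) (f t))"
proof (induction k)
  case (Suc k)
  then show ?case unfolding alternating_snoc
    using act_alternating_next[OF st, of f k] r
    by (simp add: reflect_def alt_letter_def split_beta Let_def algebra_simps del: alternating.simps)
qed simp

lemma alt_sums_swap:
  "fst (alt_sums c k x y) - snd (alt_sums c k y x) = cheb c k * (if odd k then x else - y)"
proof -
  have "fst (alt_sums c k x y) - snd (alt_sums c k y x) = cheb c k * (if odd k then x else - y) \<and>
     fst (alt_sums c k y x) - snd (alt_sums c k x y) = cheb c k * (if odd k then y else - x)" for x y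
    by (induction k) (auto simp: split_beta Let_def algebra_simps)
  then show ?thesis by blast
qed

lemma act_support: "w \<noteq> [] \<Longrightarrow> r \<notin> S \<Longrightarrow> act f w r = 0"
  by (induction w rule: rev_induct) (auto simp: reflect_def)

lemma act_braid:
  assumes "s \<in> S" "t \<in> S" "s \<noteq> t" "m s t = enat n"
  shows "act f (alternating s t n) = act f (alternating t s n)"
proof
  fix r
  have n: "n \<noteq> 0" using m_ge2[OF assms] by auto
  show "act f (alternating s t n) r = act f (alternating t s n) r"
  proof (cases "r \<in> S")
    case True
    have "fst (alt_sums (coef s t) n (f s) (f t)) = snd (alt_sums (coef s t) n (f t) (f s))"
      "fst (alt_sums (coef s t) n (f t) (f s)) = snd (alt_sums (coef s t) n (f s) (f t))"
      using alt_sums_swap[of "coef s t" n "f s" "f t"] alt_sums_swap[of "coef s t" n "f t" "f s"] U_zero[OF assms] by auto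
    then show ?thesis
      using act_alternating_sums[OF assms(1,2,3) True] act_alternating_sums[OF assms(2,1) assms(3)[symmetric] True] coef_sym[OF assms(2,1)]
      by simp
  next
    case False
    moreover have "alternating s t n \<noteq> []" "alternating t s n \<noteq> []" using n by (cases n; simp)+
    ultimately show ?thesis by (simp add: act_support)
  qed
qed

text \<open>A point in the interior of the fundamental chamber.\<close>

definition base :: "'s \<Rightarrow> real" where "base r = of_bool (r \<in> S)"

definition supp :: "('s \<Rightarrow> real) \<Rightarrow> bool" where "supp f \<longleftrightarrow> (\<forall>r. r \<notin> S \<longrightarrow> f r = 0)"

lemma supp_act: "supp f \<Longrightarrow> supp (act f w)"
  by (cases "w = []") (auto simp: supp_def act_support)

lemma reflect_reflect: "s \<in> S \<Longrightarrow> supp f \<Longrightarrow> reflect (reflect f s) s = f"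
  by (rule ext) (auto simp: reflect_def supp_def coef_def)

lemma act_eqW: "u \<simeq> v \<Longrightarrow> supp f \<Longrightarrow> act f u = act f v"
proof (rule word_cong_invariant[where f="act f"])
  fix u v x y assume "supp f" "(u, v) \<in> RW"
  then consider s t n where "u = alternating s t n" "v = alternating t s n" "s \<in> S" "t \<in> S" "s \<noteq> t" "m s t = enat n"
    | s where "u = [s, s]" "v = []" "s \<in> S" by (auto simp: RW_def artin_relations_def)
  then have "act (act f x) u = act (act f x) v"
    by cases (use act_braid supp_act[OF \<open>supp f\<close>] in \<open>auto simp: reflect_reflect\<close>)
  then show "act f (x @ u @ y) = act f (x @ v @ y)" by simp
qed

abbreviation "pt \<equiv> act base"

lemma pt_eqW: "u \<simeq> v \<Longrightarrow> pt u = pt v"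
  by (rule act_eqW) (auto simp: supp_def base_def)

subsection \<open>Length and descents\<close>

definition len :: "'s list \<Rightarrow> nat" where "len w = (LEAST n. \<exists>v. w \<simeq> v \<and> length v = n)"

lemma len_witness: "\<exists>v. w \<simeq> v \<and> length v = len w"
  unfolding len_def by (rule LeastI_ex) (auto intro: word_cong.refl)

lemma len_le: "w \<simeq> v \<Longrightarrow> len w \<le> length v"
  unfolding len_def by (rule Least_le) auto

lemma len_le_length: "len w \<le> length w" by (rule len_le) (rule word_cong.refl)

lemma len_eqW: "u \<simeq> v \<Longrightarrow> len u = len v"
  by (metis antisym eq_intros(2,3) len_le len_witness)

lemma len_append: "len (u @ v) \<le> len u + len v"
proof -
  obtain u' v' where "u \<simeq> u'" "length u' = len u" "v \<simeq> v'" "length v' = len v" using len_witness by metis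
  then show ?thesis using len_le[OF word_cong_append[of RW u u' v v']] by simp
qed

lemma len_Nil [simp]: "len [] = 0" using len_le_length[of "[]"] by simp

lemma len_parity: "even (len w) \<longleftrightarrow> even (length w)"
  using len_witness[of w] eqW_parity by metis

lemma len_snoc_cases:
  assumes "s \<in> S" shows "len (w @ [s]) = Suc (len w) \<or> Suc (len (w @ [s])) = len w"
proof -
  have "len [s] \<le> 1" using len_le_length[of "[s]"] by simp
  then have "len (w @ [s]) \<le> Suc (len w)" using len_append[of w "[s]"] by simp
  moreover have "len w \<le> Suc (len (w @ [s]))"
    using len_append[of "w @ [s]" "[s]"] \<open>len [s] \<le> 1\<close> len_eqW[OF cancel_pair[OF assms, of w "[]"]] by simp
  moreover have "len (w @ [s]) \<noteq> len w"
    using len_parity[of w] len_parity[of "w @ [s]"] by auto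
  ultimately show ?thesis by linarith
qed

lemma len_prefix: "len (u @ v) = length (u @ v) \<Longrightarrow> len u = length u \<and> len v = length v"
  using len_append[of u v] len_le_length[of u] len_le_length[of v] by simp

lemma alternating_too_long:
  assumes st: "s \<in> S" "t \<in> S" "s \<noteq> t" "m s t = enat n" and k: "n < k"
  shows "len (alternating s t k) < k"
proof -
  obtain j where j: "k = Suc n + j" using k less_iff_Suc_add[of n k] by auto
  obtain n' where n': "n = Suc n'" using m_ge2[OF st] by (cases n) auto
  have "alternating s t (Suc n) = alternating s t n @ [alt_letter s t n]" by (rule alternating_snoc)
  also have "\<dots> \<simeq> alternating t s n @ [alt_letter s t n]"
    by (intro word_cong_append eqM_eqW braid st word_cong.refl)
  also have "alternating t s n @ [alt_letter s t n] = alternating t s n' @ [alt_letter t s n', alt_letter t s n'] @ []"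
    unfolding n' by (subst alternating_snoc) (simp add: alt_letter_def)
  also have "\<dots> \<simeq> alternating t s n' @ []"
    by (rule cancel_pair) (use st in \<open>simp add: alt_letter_def\<close>)
  finally have "len (alternating s t (Suc n)) \<le> n'" using len_le by fastforce
  moreover have "len (alternating s t k) \<le> len (alternating s t (Suc n)) + j"
    unfolding j alternating_append[of s t "Suc n" j]
    by (rule order_trans[OF len_append]) (auto intro: order_trans[OF len_le_length])
  ultimately show ?thesis using j n' by simp
qed

definition alts :: "'s \<Rightarrow> 's \<Rightarrow> 's list set" where
  "alts s t = {y. \<exists>k. y = alternating s t k \<or> y = alternating t s k}"

lemma alts_sym: "alts s t = alts t s" by (auto simp: alts_def)

text \<open>Take $v$ of least length among all factorizations $w=vy$ with lengths adding up and
  $y$ in the dihedral subgroup; a descent of $v$ in $s$ or $t$ could be moved into $y$.\<close>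

lemma dihedral_decomposition:
  assumes w: "w \<in> lists S" and st: "s \<in> S" "t \<in> S" "s \<noteq> t"
  shows "\<exists>v y. v \<in> lists S \<and> y \<in> alts s t \<and> w \<simeq> v @ y \<and> len w = len v + length y \<and>
    len (v @ [s]) = Suc (len v) \<and> len (v @ [t]) = Suc (len v)"
proof -
  define D where "D v \<longleftrightarrow> v \<in> lists S \<and> (\<exists>y\<in>alts s t. w \<simeq> v @ y \<and> len w = len v + length y)" for v
  have "[] \<in> alts s t" by (auto simp: alts_def intro: exI[of _ 0])
  then have "D w" using w by (auto simp: D_def intro!: bexI[of _ "[]"] word_cong.refl)
  then obtain v where v: "D v" "\<And>v'. D v' \<Longrightarrow> len v \<le> len v'"
    using ex_has_least_nat[of D w len] by blast
  obtain y where y: "v \<in> lists S" "y \<in> alts s t" "w \<simeq> v @ y" "len w = len v + length y" using v(1) by (auto simp: D_def)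
  have asc: "len (v @ [a]) = Suc (len v)" if ab: "a \<in> S" "b \<in> S" "a \<noteq> b" "alts a b = alts s t" for a b
  proof (rule ccontr)
    assume "len (v @ [a]) \<noteq> Suc (len v)"
    then have l: "Suc (len (v @ [a])) = len v" using len_snoc_cases[OF ab(1), of v] by blast
    have wv: "w \<simeq> (v @ [a]) @ (a # y)"
      using y(3) cancel_pair[OF ab(1), of v y] by (auto intro: word_cong.trans word_cong.sym)
    have "y \<in> alts a b" using y(2) ab(4) by simp
    then obtain k where "y = alternating a b k \<or> y = alternating b a k" by (auto simp: alts_def)
    moreover have "y = alternating a b k \<Longrightarrow> k \<noteq> 0 \<Longrightarrow> False"
    proof -
      assume yk: "y = alternating a b k" "k \<noteq> 0"
      then obtain k' where k': "k = Suc k'" by (cases k) auto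
      have "(v @ [a]) @ (a # y) = (v @ [a]) @ [a, a] @ alternating b a k'" by (simp add: yk k')
      then have "w \<simeq> (v @ [a]) @ alternating b a k'"
        using wv cancel_pair[OF ab(1), of "v @ [a]" "alternating b a k'"] by (metis word_cong.trans)
      then have "len w \<le> len (v @ [a]) + k'"
        using len_append[of "v @ [a]" "alternating b a k'"] len_le_length[of "alternating b a k'"] len_eqW by force
      then show False using l y(4) yk k' by simp
    qed
    moreover have False if "y = alternating b a k"
    proof -
      have ay: "a # y = alternating a b (Suc k)" using that by simp
      have "D (v @ [a])" unfolding D_def
      proof (intro conjI bexI[of _ "a # y"])
        have "alternating a b (Suc k) \<in> alts a b" unfolding alts_def by blast
        then show "a # y \<in> alts s t" unfolding ay ab(4) .
      qed (use wv y l ab in auto)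
      then show False using v(2) l by force
    qed
    ultimately show False by (cases "k = 0") auto
  qed
  show ?thesis using y asc[of s t] asc[of t s] st alts_sym[of t s] by blast
qed

lemma alts_length_le:
  assumes "y \<in> alts s t" "s \<in> S" "t \<in> S" "s \<noteq> t" "len y = length y" shows "enat (length y) \<le> m s t"
proof (rule ccontr)
  assume "\<not> enat (length y) \<le> m s t"
  then obtain n where n: "m s t = enat n" "n < length y" by (cases "m s t") auto
  then have mt: "m t s = enat n" using m_sym assms by simp
  obtain k where "y = alternating s t k \<or> y = alternating t s k" using assms(1) by (auto simp: alts_def)
  then show False
    using alternating_too_long[OF assms(2,3,4) n(1), of k] alternating_too_long[OF assms(3,2) assms(4)[symmetric] mt, of k] assms(5) n(2)
    by auto
qed

lemma act_alts_pos:
  assumes y: "y \<in> alts s t" and st: "s \<in> S" "t \<in> S" "s \<noteq> t" and k: "enat (length y) < m s t"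
    and f: "0 < f s" "0 < f t"
  shows "\<exists>a\<in>{s, t}. 0 < act f y a \<and> (y \<noteq> [] \<longrightarrow> last y \<noteq> a)"
proof -
  have main: "0 < act f (alternating a b k) (alt_letter a b k) \<and> (alternating a b k \<noteq> [] \<longrightarrow> last (alternating a b k) \<noteq> alt_letter a b k)"
    if "a \<in> S" "b \<in> S" "a \<noteq> b" "enat k < m a b" "0 < f a" "0 < f b" for a b k
  proof -
    have "enat (Suc k) \<le> m a b" using that(4) by (metis eSuc_enat ileI1)
    then have U: "0 \<le> U a b (Suc k)" "0 \<le> U a b k" using U_nonneg[of a b] that by (auto simp: less_imp_le)
    have "0 < U a b (Suc k) * f a + U a b k * f b"
    proof (cases "k = 0")
      case False
      then have "0 < U a b k" using U_pos that by blast
      then show ?thesis using U that by (intro add_nonneg_pos) auto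
    qed (use that in simp)
    moreover have "last (alternating a b k) \<noteq> alt_letter a b k" if ne: "alternating a b k \<noteq> []"
    proof -
      obtain k' where "k = Suc k'" using ne by (cases k) auto
      then show ?thesis using \<open>a \<noteq> b\<close> by (simp only: alternating_snoc last_snoc) (auto simp: alt_letter_def)
    qed
    ultimately show ?thesis using act_alternating_next[OF that(1-3)] by simp
  qed
  obtain k where yk: "y = alternating s t k \<or> y = alternating t s k" using y by (auto simp: alts_def)
  then show ?thesis
  proof
    assume "y = alternating s t k"
    then show ?thesis using main[OF st, of k] k f by (intro bexI[of _ "alt_letter s t k"]) (simp_all add: alt_letter_def)
  next
    assume "y = alternating t s k"
    then show ?thesis using main[OF st(2,1) st(3)[symmetric], of k] k f m_sym[OF st(1,2)]
      by (intro bexI[of _ "alt_letter t s k"]) (simp_all add: alt_letter_def)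
  qed
qed

text \<open>Induction on the length. Split off from $w$ its part $y$ in the dihedral group
  generated by $s$ and a descent $t$ of $w$. The rest $v$ is shorter and ascends in both
  letters, so both values at $v$ are positive. Inside the dihedral group the values are
  combinations of these two with Chebyshev coefficients, which are positive as long as the
  length of $y$ is below $m_{st}$.\<close>

theorem ascent_positive:
  assumes "w \<in> lists S" "s \<in> S" "len (w @ [s]) = Suc (len w)" shows "0 < pt w s"
  using assms
proof (induction "len w" arbitrary: w s rule: less_induct)
  case less
  show ?case
  proof (cases "len w = 0")
    case True
    then have "w \<simeq> []" using len_witness[of w] by auto
    then show ?thesis using pt_eqW[of w "[]"] less.prems by (simp add: base_def)
  next
    case False
    obtain v0 where v0: "w \<simeq> v0" "length v0 = len w" using len_witness by blast
    then obtain v1 t where v1: "v0 = v1 @ [t]" using False by (cases v0 rule: rev_cases) auto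
    have tS: "t \<in> S" using eqW_lists[OF v0(1)] less.prems v1 by simp
    have "w @ [t] \<simeq> v1 @ [t, t] @ []" using word_cong_append[OF v0(1), of "[t]" "[t]"] v1 by (simp add: word_cong.refl)
    then have "w @ [t] \<simeq> v1" using cancel_pair[OF tS, of v1 "[]"] by (auto intro: word_cong.trans)
    then have "len (w @ [t]) < len w" using len_le[of "w @ [t]" v1] v0 v1 False by simp
    then have "s \<noteq> t" using less.prems by auto
    obtain v y where vy: "v \<in> lists S" "y \<in> alts s t" "w \<simeq> v @ y" "len w = len v + length y"
      "len (v @ [s]) = Suc (len v)" "len (v @ [t]) = Suc (len v)"
      using dihedral_decomposition[OF less.prems(1,2) tS \<open>s \<noteq> t\<close>] by blast
    have "y \<noteq> []"
    proof
      assume "y = []"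
      then have "len (w @ [t]) = len (v @ [t])" using len_eqW[OF word_cong_append[OF vy(3) word_cong.refl[of RW "[t]"]]] by simp
      then show False using vy \<open>y = []\<close> \<open>len (w @ [t]) < len w\<close> by simp
    qed
    then have "len v < len w" using vy by simp
    then have pos: "0 < pt v s" "0 < pt v t" using less.hyps vy tS less.prems by auto
    have ly: "len y = length y" using vy(3,4) len_eqW[OF vy(3)] len_append[of v y] len_le_length[of y] by simp
    have last: "last y \<noteq> s"
    proof
      assume "last y = s"
      then obtain y' where y': "y = y' @ [s]" using \<open>y \<noteq> []\<close> by (metis append_butlast_last_id)
      have "w @ [s] \<simeq> (v @ y') @ [s, s] @ []" using word_cong_append[OF vy(3), of "[s]" "[s]"] y' by (simp add: word_cong.refl)
      then have "w @ [s] \<simeq> v @ y'" using cancel_pair[OF less.prems(2), of "v @ y'" "[]"] by (auto intro: word_cong.trans)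
      then have "len (w @ [s]) \<le> len v + length y'"
        using len_eqW len_append[of v y'] len_le_length[of y'] by fastforce
      then show False using less.prems vy y' by simp
    qed
    have ys: "y @ [s] \<in> alts s t"
    proof -
      obtain k where k: "y = alternating s t k \<or> y = alternating t s k" using vy(2) by (auto simp: alts_def)
      have "k \<noteq> 0" using k \<open>y \<noteq> []\<close> by (cases k) auto
      then obtain k' where k': "k = Suc k'" by (cases k) auto
      have "alt_letter a b k = s" if "y = alternating a b k" "{a, b} = {s, t}" "a \<noteq> b" for a b
        using last that unfolding that(1) k' alternating_snoc by (auto simp: alt_letter_def doubleton_eq_iff split: if_splits)
      then have "y = alternating s t k \<Longrightarrow> y @ [s] = alternating s t (Suc k)"
         "y = alternating t s k \<Longrightarrow> y @ [s] = alternating t s (Suc k)"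
        using \<open>s \<noteq> t\<close> insert_commute[of t s "{}"] by (simp_all add: alternating_snoc del: alternating.simps)
      then show ?thesis using k unfolding alts_def by blast
    qed
    have "len (y @ [s]) = length (y @ [s])"
    proof -
      have "len (w @ [s]) \<le> len v + len (y @ [s])"
        using len_eqW[OF word_cong_append[OF vy(3) word_cong.refl[of RW "[s]"]]] len_append[of v "y @ [s]"] by simp
      then show ?thesis using less.prems vy len_le_length[of "y @ [s]"] by simp
    qed
    then have "enat (Suc (length y)) \<le> m s t" using alts_length_le[OF ys less.prems(2) tS \<open>s \<noteq> t\<close>] by simp
    then have "enat (length y) < m s t" by (metis enat_ord_simps(2) lessI less_le_trans)
    then obtain a where a: "a \<in> {s, t}" "0 < act (pt v) y a" "last y \<noteq> a"
      using act_alts_pos[OF vy(2) less.prems(2) tS \<open>s \<noteq> t\<close> _ pos] \<open>y \<noteq> []\<close> by blast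
    have "last y = t"
    proof -
      have "set y \<subseteq> {s, t}" using vy(2) unfolding alts_def using alternating_lists[of s "{s,t}" t] alternating_lists[of t "{s,t}" s] by (auto simp: in_lists_conv_set)
      then show ?thesis using last last_in_set[OF \<open>y \<noteq> []\<close>] by auto
    qed
    then have "a = s" using a by auto
    then show ?thesis using a pt_eqW[OF vy(3)] by simp
  qed
qed

lemma descent_negative:
  assumes "w \<in> lists S" "s \<in> S" "Suc (len (w @ [s])) = len w" shows "pt w s < 0"
proof -
  have "len ((w @ [s]) @ [s]) = len w" using len_eqW[OF cancel_pair[OF assms(2), of w "[]"]] by simp
  then have "0 < pt (w @ [s]) s" using assms by (intro ascent_positive) auto
  then show ?thesis using assms by (simp add: reflect_def coef_def)
qed

lemma ascent_iff: "w \<in> lists S \<Longrightarrow> s \<in> S \<Longrightarrow> len (w @ [s]) = Suc (len w) \<longleftrightarrow> 0 < pt w s"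
  using ascent_positive descent_negative len_snoc_cases by (metis less_asym)

lemma len_dihedral_coset:
  assumes w: "w \<in> lists S" and st: "s \<in> S" "t \<in> S" "s \<noteq> t"
    and a: "len (w @ [s]) = Suc (len w)" "len (w @ [t]) = Suc (len w)" and k: "enat k \<le> m s t"
  shows "len (w @ alternating s t k) = len w + k"
  using k
proof (induction k)
  case (Suc k)
  have lt: "enat k < m s t" using Suc.prems by (metis enat_ord_simps(2) lessI less_le_trans)
  have pos: "0 < pt w s" "0 < pt w t" using ascent_positive w st a by auto
  have "0 < U s t (Suc k) * pt w s + U s t k * pt w t"
  proof (cases "k = 0")
    case False
    then have "0 < U s t k" using U_pos st lt by blast
    then show ?thesis using U_nonneg[OF st Suc.prems] pos by (intro add_nonneg_pos) auto
  qed (use pos in simp)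
  then have "0 < pt (w @ alternating s t k) (alt_letter s t k)" using act_alternating_next[OF st] by simp
  moreover have "alt_letter s t k \<in> S" "w @ alternating s t k \<in> lists S"
    using st w alternating_lists[of s S t] by (auto simp: alt_letter_def)
  ultimately have "len ((w @ alternating s t k) @ [alt_letter s t k]) = Suc (len (w @ alternating s t k))"
    using ascent_iff by blast
  then show ?case using Suc.IH lt by (simp add: alternating_snoc del: alternating.simps)
qed simp

text \<open>If the dihedral part $y$ of $w$ were shorter than $m_{st}$, one of $s$ and $t$ would
  be an ascent of $w$.\<close>

lemma two_descents:
  assumes w: "w \<in> lists S" and st: "s \<in> S" "t \<in> S" "s \<noteq> t"
    and d: "Suc (len (w @ [s])) = len w" "Suc (len (w @ [t])) = len w"
  shows "\<exists>n v. m s t = enat n \<and> v \<in> lists S \<and> w \<simeq> v @ alternating s t n \<and> len w = len v + n"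
proof -
  obtain v y where vy: "v \<in> lists S" "y \<in> alts s t" "w \<simeq> v @ y" "len w = len v + length y"
      "len (v @ [s]) = Suc (len v)" "len (v @ [t]) = Suc (len v)"
    using dihedral_decomposition[OF w st] by blast
  have pos: "0 < pt v s" "0 < pt v t" using ascent_positive vy st by auto
  have ly: "len y = length y" using vy(3,4) len_eqW[OF vy(3)] len_append[of v y] len_le_length[of y] by simp
  have le: "enat (length y) \<le> m s t" by (rule alts_length_le[OF vy(2) st ly])
  have "\<not> enat (length y) < m s t"
  proof
    assume "enat (length y) < m s t"
    then obtain a where "a \<in> {s, t}" "0 < act (pt v) y a" using act_alts_pos[OF vy(2) st _ pos] by blast
    then show False using descent_negative[OF w st(1) d(1)] descent_negative[OF w st(2) d(2)] pt_eqW[OF vy(3)] by auto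
  qed
  then have m: "m s t = enat (length y)" using le by simp
  have "y = alternating s t (length y) \<or> y = alternating t s (length y)" using vy(2) by (auto simp: alts_def)
  then have "v @ y \<simeq> v @ alternating s t (length y)"
    using braid[OF st m] by (metis eqM_eqW word_cong.refl word_cong.sym word_cong_append)
  then show ?thesis using m vy word_cong.trans by blast
qed

text \<open>Two reduced words of the same element that end in different letters $s$ and $t$ are
  compared with reduced words ending in the two alternating words of length $m_{st}$, which a
  single braid relation connects. All other comparisons concern words with the same last letter,
  where induction applies.\<close>

theorem Matsumoto:
  assumes "u \<in> lists S" "len u = length u" "len v = length v" "u \<simeq> v" shows "u \<doteq> v"
  using assms
proof (induction "length u" arbitrary: u v)
  case 0
  then show ?case using len_eqW[OF 0(5)] by (simp add: word_cong.refl)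
next
  case (Suc n)
  have lv: "length v = Suc n" using Suc len_eqW[OF Suc.prems(4)] by simp
  have vS: "v \<in> lists S" using Suc eqW_lists by blast
  obtain u' s where u: "u = u' @ [s]" using Suc(2) by (cases u rule: rev_cases) auto
  obtain v' t where v: "v = v' @ [t]" using lv by (cases v rule: rev_cases) auto
  have S: "s \<in> S" "t \<in> S" "u' \<in> lists S" "v' \<in> lists S" using Suc.prems u v vS by auto
  have ru: "len u' = n" "len v' = n" using len_prefix[of u' "[s]"] len_prefix[of v' "[t]"] Suc u v lv by auto
  have drop: "x' \<simeq> y'" if "x' @ [a] \<simeq> y' @ [a]" "a \<in> S" for x' y' a
  proof -
    have "x' @ [a, a] @ [] \<simeq> y' @ [a, a] @ []" using word_cong_append[OF that(1) word_cong.refl[of RW "[a]"]] by simp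
    then show ?thesis using cancel_pair[OF that(2), of x' "[]"] cancel_pair[OF that(2), of y' "[]"]
      by (simp) (metis word_cong.sym word_cong.trans)
  qed
  show ?case
  proof (cases "s = t")
    case True
    then have "u' \<simeq> v'" using drop Suc.prems u v S by blast
    moreover have "n = length u'" "len u' = length u'" "len v' = length v'" using ru Suc(2) u v lv by simp_all
    ultimately have "u' \<doteq> v'" using Suc.hyps(1) S(3) by blast
    then show ?thesis using u v True by (auto intro: word_cong_append word_cong.refl)
  next
    case False
    have snoc_desc: "Suc (len (x @ [a])) = len x" if "x = x' @ [a]" "a \<in> S" "len x = Suc n" "len x' = n" for x x' a
      using that len_eqW[OF cancel_pair[OF that(2), of x' "[]"]] by simp
    have lu: "len u = Suc n" using Suc by simp
    have d: "Suc (len (u @ [s])) = len u" using snoc_desc[OF u S(1) lu ru(1)] .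
    have "len (u @ [t]) = len (v @ [t])" by (rule len_eqW[OF word_cong_append[OF Suc.prems(4) word_cong.refl]])
    then have d': "Suc (len (u @ [t])) = len u" using snoc_desc[OF v S(2) _ ru(2)] len_eqW[OF Suc.prems(4)] lu by simp
    obtain k x where x: "m s t = enat k" "x \<in> lists S" "u \<simeq> x @ alternating s t k" "len u = len x + k"
      using two_descents[OF Suc.prems(1) S(1,2) False d d'] by blast
    obtain x' where x': "x \<simeq> x'" "length x' = len x" using len_witness by blast
    have b: "alternating s t k \<doteq> alternating t s k" by (rule braid[OF S(1,2) False x(1)])
    have k0: "k \<noteq> 0" using m_ge2[OF S(1,2) False x(1)] by auto
    then obtain k' where k': "k = Suc k'" by (cases k) auto
    have ux: "u \<simeq> x' @ alternating s t k"
      using x(3) word_cong_append[OF x'(1) word_cong.refl[of RW "alternating s t k"]] by (rule word_cong.trans)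
    have fin: "w \<doteq> x' @ alternating s t k"
      if w: "w = w' @ [a]" "a \<in> {s, t}" "u \<simeq> w" "w' \<in> lists S" "len w' = n" "length w' = n" for w w' a
    proof -
      obtain y where y: "y = alternating s t k \<or> y = alternating t s k" "last y = a" "y \<noteq> []" "length y = k"
      proof -
        have "last (alternating s t k) = alt_letter s t k'" "last (alternating t s k) = alt_letter t s k'"
          unfolding k' alternating_snoc by simp_all
        moreover have "alternating s t k \<noteq> []" "alternating t s k \<noteq> []" unfolding k' by simp_all
        ultimately show ?thesis using that[of "alternating s t k"] that[of "alternating t s k"] w(2)
          by (cases "alt_letter s t k' = a") (auto simp: alt_letter_def split: if_splits)
      qed
      have yM: "x' @ alternating s t k \<doteq> x' @ y" using y(1) b by (auto intro: word_cong_append word_cong.refl)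
      obtain y' where y': "y = y' @ [a]" using y by (metis append_butlast_last_id)
      have "w' @ [a] \<simeq> (x' @ y') @ [a]"
        using w(1,3) ux eqM_eqW[OF yM] y' by simp (metis word_cong.sym word_cong.trans)
      then have eqw: "w' \<simeq> x' @ y'" using drop w(2) S by blast
      moreover have "length (x' @ y') = n" using x'(2) x(4) lu y y' by simp
      ultimately have "w' \<doteq> x' @ y'" using Suc.hyps(1)[of w' "x' @ y'"] w len_eqW[OF eqw] Suc(2) u by auto
      then have "w \<doteq> x' @ y" using w(1) y' word_cong_append[of R w' "x' @ y'" "[a]" "[a]"] by (simp add: word_cong.refl)
      then show ?thesis using yM by (metis word_cong.sym word_cong.trans)
    qed
    have "u \<doteq> x' @ alternating s t k"
      using fin[OF u _ word_cong.refl S(3) ru(1)] Suc(2) u by simp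
    moreover have "v \<doteq> x' @ alternating s t k"
      using fin[OF v _ Suc.prems(4) S(4) ru(2)] lv v by simp
    ultimately show ?thesis by (metis word_cong.sym word_cong.trans)
  qed
qed

end

section \<open>Cancellation and least common multiples in Artin monoids\<close>

context coxeter begin

lemma R_rev: "(u, v) \<in> R \<Longrightarrow> (rev u, rev v) \<in> R"
proof -
  assume "(u, v) \<in> R"
  then obtain s t n where a: "u = alternating s t n" "v = alternating t s n" "s \<in> S" "t \<in> S" "s \<noteq> t" "m s t = enat n"
    by (auto simp: artin_relations_def)
  then have "m t s = enat n" using m_sym by simp
  then show ?thesis using a unfolding artin_relations_def by (auto simp: rev_alternating)
qed

lemma eqW_rev: "u \<simeq> v \<Longrightarrow> rev u \<simeq> rev v"
proof (induction rule: word_cong.induct)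
  case (rel u v x y)
  then have "(rev u, rev v) \<in> RW" using R_rev by (auto simp: RW_def)
  then show ?case using word_cong.rel[of "rev u" "rev v" RW "rev y" "rev x"] by simp
qed (auto intro: word_cong.intros)

lemma len_rev: "len (rev w) = len w"
proof -
  have "len (rev w) \<le> len w" for w
    using len_witness[of w] eqW_rev len_le by (metis length_rev)
  from this[of w] this[of "rev w"] show ?thesis by simp
qed

lemma two_left_descents:
  assumes w: "w \<in> lists S" and st: "s \<in> S" "t \<in> S" "s \<noteq> t"
    and d: "Suc (len (s # w)) = len w" "Suc (len (t # w)) = len w"
  shows "\<exists>n v. m s t = enat n \<and> v \<in> lists S \<and> w \<simeq> alternating s t n @ v \<and> len w = n + length v"
proof -
  have "Suc (len (rev w @ [a])) = len (rev w)" if "Suc (len (a # w)) = len w" for a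
    using that len_rev[of "a # w"] len_rev[of w] by simp
  then obtain n v where v: "m s t = enat n" "v \<in> lists S" "rev w \<simeq> v @ alternating s t n" "len w = len v + n"
    using two_descents[of "rev w" s t] w st d len_rev[of w] by (auto simp: in_lists_conv_set)
  obtain v' where v': "v \<simeq> v'" "length v' = len v" using len_witness by blast
  have b: "rev (alternating s t n) \<simeq> alternating s t n"
    using braid[OF st v(1), THEN eqM_eqW] by (auto simp: rev_alternating intro: word_cong.refl word_cong.sym)
  have "w \<simeq> rev (alternating s t n) @ rev v" using eqW_rev[OF v(3)] by simp
  also have "\<dots> \<simeq> alternating s t n @ rev v'" by (intro word_cong_append b eqW_rev v')
  finally show ?thesis using v v' eqW_lists[OF v'(1)] by (intro exI[of _ n] exI[of _ "rev v'"]) (auto simp: in_lists_conv_set)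
qed

definition alt1 :: "'s \<Rightarrow> 's \<Rightarrow> nat \<Rightarrow> 's list" where "alt1 s t n = tl (alternating s t n)"

lemma alternating_Cons: "s \<in> S \<Longrightarrow> t \<in> S \<Longrightarrow> s \<noteq> t \<Longrightarrow> m s t = enat n \<Longrightarrow> alternating s t n = s # alt1 s t n"
  using m_ge2[of s t n] by (cases n) (auto simp: alt1_def)

text \<open>What equality in the Artin monoid implies for first letters. The content is that
  this relation is transitive; left cancellation is then the case $s=t$, and common multiples of
  $s$ and $t$ are multiples of their alternating word.\<close>

definition first_letters :: "'s list \<Rightarrow> 's list \<Rightarrow> bool" where
  "first_letters a b \<longleftrightarrow> (\<exists>s t X Y. a = s # X \<and> b = t # Y \<and>
     (s = t \<and> X \<doteq> Y \<or> s \<noteq> t \<and> (\<exists>k W. m s t = enat k \<and> X \<doteq> alt1 s t k @ W \<and> Y \<doteq> alt1 t s k @ W)))"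

lemma first_letters_sym: "a \<in> lists S \<Longrightarrow> b \<in> lists S \<Longrightarrow> first_letters a b \<Longrightarrow> first_letters b a"
  unfolding first_letters_def using m_sym by (auto intro: word_cong.sym)

lemma first_letters_refl: "a \<noteq> [] \<Longrightarrow> first_letters a a"
  unfolding first_letters_def by (cases a) (auto intro: word_cong.refl)

lemma first_letters_rel:
  assumes "(u, v) \<in> R" "x @ u @ y \<noteq> []" shows "first_letters (x @ u @ y) (x @ v @ y)"
proof (cases x)
  case Nil
  obtain s t n where a: "u = alternating s t n" "v = alternating t s n" "s \<in> S" "t \<in> S" "s \<noteq> t" "m s t = enat n"
    using assms(1) by (auto simp: artin_relations_def)
  then have "m t s = enat n" using m_sym by simp
  then show ?thesis using a Nil alternating_Cons[of s t n] alternating_Cons[of t s n]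
    unfolding first_letters_def
    by (intro exI[of _ s] exI[of _ t] exI[of _ "alt1 s t n @ y"] exI[of _ "alt1 t s n @ y"]) (auto intro: word_cong.refl)
next
  case (Cons c x')
  have "x' @ u @ y \<doteq> x' @ v @ y" using assms(1) by (rule word_cong.rel)
  then show ?thesis using Cons unfolding first_letters_def by auto
qed

text \<open>Transitivity of \<open>first_letters\<close> at a given length uses left
  cancellation for shorter words, so both are proved together by induction on the
  length.\<close>

definition cancellative_below :: "nat \<Rightarrow> bool" where
  "cancellative_below n \<longleftrightarrow> (\<forall>a b. a \<in> lists S \<and> a \<noteq> [] \<and> length a < n \<and> a \<doteq> b \<longrightarrow> first_letters a b)"

lemma cancel_below:
  "cancellative_below n \<Longrightarrow> p @ X \<in> lists S \<Longrightarrow> length (p @ X) < n \<Longrightarrow> p @ X \<doteq> p @ Y \<Longrightarrow> X \<doteq> Y"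
proof (induction p)
  case (Cons c p)
  have "first_letters (c # (p @ X)) (c # (p @ Y))"
    using Cons.prems unfolding cancellative_below_def by (metis append_Cons list.distinct(1))
  then have "p @ X \<doteq> p @ Y" unfolding first_letters_def by auto
  then show ?case using Cons by simp
qed simp

text \<open>The left divisors $x$ of $Z$ in the monoid for which $ux$ is a reduced word of the
  Coxeter group.\<close>

definition reduced_divisors :: "'s \<Rightarrow> 's list \<Rightarrow> 's list \<Rightarrow> bool" where
  "reduced_divisors u Z x \<longleftrightarrow> x \<in> lists S \<and> len (u # x) = Suc (length x) \<and> (\<exists>Z'. Z \<doteq> x @ Z')"

lemma reduced_divisors_prefix:
  assumes "reduced_divisors u Z (x @ y)" shows "reduced_divisors u Z x"
  using assms len_prefix[of "u # x" y] by (auto simp: reduced_divisors_def)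

lemma reduced_divisors_cong:
  assumes "reduced_divisors u Z x" "x \<doteq> y" shows "reduced_divisors u Z y"
proof -
  have "u # x \<simeq> u # y" using word_cong_append[OF word_cong.refl[of RW "[u]"] eqM_eqW[OF assms(2)]] by simp
  then show ?thesis using assms eqM_length[OF assms(2)] eqM_lists[OF assms(2)] len_eqW[of "u # x" "u # y"]
    unfolding reduced_divisors_def by (metis word_cong.refl word_cong.trans word_cong_append)
qed

text \<open>A confluence argument as for rewriting systems. Two letters $a\ne b$ that extend $x$
  can both be continued to the alternating word of length $m_{ab}$, which remains a divisor of
  $Z$ by the property for shorter words and remains reduced after $ux$ by the ascents at $a$ and
  $b$. The lengths are bounded by that of $Z$, so local confluence suffices.\<close>

lemma reduced_divisors_confluent:
  assumes n: "cancellative_below n" and u: "u \<in> S" and Z: "Z \<in> lists S" "length Z < n"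
    and x: "reduced_divisors u Z (x @ p)" "reduced_divisors u Z (x @ q)"
  shows "\<exists>r r'. reduced_divisors u Z (x @ p @ r) \<and> x @ p @ r \<doteq> x @ q @ r'"
  using x
proof (induction "length Z - length x" arbitrary: x p q rule: less_induct)
  case less
  show ?case
  proof (cases "p = [] \<or> q = []")
    case True
    then show ?thesis
    proof
      assume "p = []" then show ?thesis using less.prems by (intro exI[of _ q] exI[of _ "[]"]) (simp add: word_cong.refl)
    next
      assume "q = []" then show ?thesis using less.prems by (intro exI[of _ "[]"] exI[of _ p]) (simp add: word_cong.refl)
    qed
  next
    case False
    then obtain a p' b q' where pq: "p = a # p'" "q = b # q'" by (meson neq_Nil_conv)
    have shorter: "length Z - length (x @ a # y) < length Z - length x" if rd: "reduced_divisors u Z (x @ a # y)" for a y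
    proof -
      obtain Z' where "Z \<doteq> (x @ a # y) @ Z'" using rd by (auto simp: reduced_divisors_def)
      then have "length Z = length ((x @ a # y) @ Z')" by (rule eqM_length)
      then show ?thesis by simp
    qed
    have step: "length Z - length (x @ [a]) < length Z - length x" if "reduced_divisors u Z (x @ a # y)" for a y
      using shorter[of a "[]"] reduced_divisors_prefix[of u Z "x @ [a]" y] that by simp
    show ?thesis
    proof (cases "a = b")
      case True
      show ?thesis using less.hyps[OF step, of a p' p' q'] less.prems pq True by simp
    next
      case ab: False
      have S: "a \<in> S" "b \<in> S" using less.prems pq by (auto simp: reduced_divisors_def)
      have xa: "reduced_divisors u Z (x @ [a])" "reduced_divisors u Z (x @ [b])"
        using reduced_divisors_prefix[of u Z "x @ [a]" p'] reduced_divisors_prefix[of u Z "x @ [b]" q'] less.prems pq by simp_all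
      have x0: "reduced_divisors u Z x" using reduced_divisors_prefix[OF xa(1)] .
      obtain Z1 where Z1: "Z \<doteq> x @ a # Z1" using xa(1) by (auto simp: reduced_divisors_def)
      obtain Z2 where Z2: "Z \<doteq> x @ b # Z2" using xa(2) by (auto simp: reduced_divisors_def)
      have ZL: "x @ a # Z1 \<in> lists S" "length (x @ a # Z1) < n" using Z eqM_lists[OF Z1] eqM_length[OF Z1] by auto
      have "x @ a # Z1 \<doteq> x @ b # Z2" using Z1 Z2 by (metis word_cong.sym word_cong.trans)
      then have "a # Z1 \<doteq> b # Z2" using cancel_below[OF n ZL] by blast
      then have "first_letters (a # Z1) (b # Z2)" using n ZL unfolding cancellative_below_def by auto
      then obtain k W where k: "m a b = enat k" "Z1 \<doteq> alt1 a b k @ W" using ab unfolding first_letters_def by auto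
      have kb: "m b a = enat k" using k m_sym S by simp
      note br = braid[OF S ab k(1)]
      have y0: "reduced_divisors u Z (x @ alternating a b k)"
      proof -
        have "Z \<doteq> x @ a # (alt1 a b k @ W)"
          using Z1 word_cong_append[OF word_cong.refl[of R "x @ [a]"] k(2)] by simp (metis word_cong.trans)
        then have "Z \<doteq> (x @ alternating a b k) @ W" using alternating_Cons[OF S ab k(1)] by simp
        moreover have "len ((u # x) @ alternating a b k) = len (u # x) + k"
          using xa x0 u by (intro len_dihedral_coset S ab) (auto simp: reduced_divisors_def k)
        ultimately show ?thesis using x0 alternating_lists[OF S] by (auto simp: reduced_divisors_def)
      qed
      have br': "x @ alternating a b k \<doteq> x @ alternating b a k" by (intro word_cong_append word_cong.refl br)
      have y0': "reduced_divisors u Z (x @ alternating b a k)" by (rule reduced_divisors_cong[OF y0 br'])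
      have ya: "x @ alternating a b k = (x @ [a]) @ alt1 a b k" "x @ alternating b a k = (x @ [b]) @ alt1 b a k"
        using alternating_Cons[OF S ab k(1)] alternating_Cons[OF S(2,1) ab[symmetric] kb] by auto
      obtain r r1 where r: "reduced_divisors u Z ((x @ [a]) @ p' @ r)" "(x @ [a]) @ p' @ r \<doteq> (x @ [a]) @ alt1 a b k @ r1"
        using less.hyps[of "x @ [a]" p' "alt1 a b k"] step[of a p'] less.prems(1) y0 pq ya(1) by auto
      obtain r' r2 where r': "reduced_divisors u Z ((x @ [b]) @ q' @ r')" "(x @ [b]) @ q' @ r' \<doteq> (x @ [b]) @ alt1 b a k @ r2"
        using less.hyps[of "x @ [b]" q' "alt1 b a k"] step[of b q'] less.prems(2) y0' pq ya(2) by auto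
      let ?y = "x @ alternating a b k"
      have z1: "x @ p @ r \<doteq> ?y @ r1" using r(2) ya(1) pq by simp
      have z2: "x @ q @ r' \<doteq> ?y @ r2"
      proof -
        have "x @ q @ r' \<doteq> (x @ alternating b a k) @ r2" using r'(2) ya(2) pq by simp
        also have "\<dots> \<doteq> ?y @ r2" by (intro word_cong_append word_cong.refl word_cong.sym[OF br'])
        finally show ?thesis .
      qed
      have d1: "reduced_divisors u Z (?y @ r1)" using reduced_divisors_cong[OF _ z1] r(1) pq by simp
      have d2: "reduced_divisors u Z (?y @ r2)" using reduced_divisors_cong[OF _ z2] r'(1) pq by simp
      have "length Z - length ?y < length Z - length x"
        using shorter[of a "alt1 a b k"] y0 ya(1) by simp
      then obtain r3 r4 where r34: "reduced_divisors u Z (?y @ r1 @ r3)" "?y @ r1 @ r3 \<doteq> ?y @ r2 @ r4"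
        using less.hyps[of ?y r1 r2] d1 d2 by blast
      have e1: "x @ p @ r @ r3 \<doteq> ?y @ r1 @ r3" using word_cong_append[OF z1 word_cong.refl[of R r3]] by simp
      have e2: "x @ q @ r' @ r4 \<doteq> ?y @ r2 @ r4" using word_cong_append[OF z2 word_cong.refl[of R r4]] by simp
      have "reduced_divisors u Z (x @ p @ r @ r3)" using reduced_divisors_cong[OF r34(1) word_cong.sym[OF e1]] .
      moreover have "x @ p @ r @ r3 \<doteq> x @ q @ r' @ r4"
        using e1 r34(2) e2 by (metis word_cong.sym word_cong.trans)
      ultimately show ?thesis by blast
    qed
  qed
qed

lemma left_descent:
  assumes "s \<in> S" "w \<simeq> s # v" "len w = Suc (length v)" shows "Suc (len (s # w)) = len w"
proof -
  have "s # w \<simeq> [] @ [s, s] @ v" using word_cong_append[OF word_cong.refl[of RW "[s]"] assms(2)] by simp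
  then have "s # w \<simeq> v" using cancel_pair[OF assms(1), of "[]" v] by (simp) (metis word_cong.trans)
  then have "len (s # w) \<le> length v" by (rule len_le)
  moreover have "len (rev w @ [s]) = len (s # w)" using len_rev[of "s # w"] by simp
  ultimately show ?thesis using len_snoc_cases[OF assms(1), of "rev w"] assms(3) len_rev[of w] by auto
qed

lemma eqW_Cons_cancel: "s \<in> S \<Longrightarrow> s # x \<simeq> s # y \<Longrightarrow> x \<simeq> y"
proof -
  assume s: "s \<in> S" "s # x \<simeq> s # y"
  have "[] @ [s, s] @ x \<simeq> [] @ [s, s] @ y" using word_cong_append[OF word_cong.refl[of RW "[s]"] s(2)] by simp
  then show ?thesis using cancel_pair[OF s(1), of "[]" x] cancel_pair[OF s(1), of "[]" y]
    by simp (metis word_cong.sym word_cong.trans)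
qed

text \<open>The tails of the alternating words of $u,s$ and of $u,t$ both divide $Z$ and are
  reduced after $u$. By confluence they have a common multiple $z$ dividing $Z$ with $uz$
  reduced. In the Coxeter group $uz$ has the left descents $s$ and $t$, so it begins with their
  alternating word of length $m_{st}$. Matsumoto's theorem lifts this factorization to the
  monoid.\<close>

lemma first_letters_core:
  assumes n: "cancellative_below n" and S: "u \<in> S" "s \<in> S" "t \<in> S" and d: "u \<noteq> s" "u \<noteq> t" "s \<noteq> t"
    and Z: "Z \<in> lists S" "length Z < n"
    and k: "m s u = enat k" "X \<doteq> alt1 s u k @ A" "Z \<doteq> alt1 u s k @ A"
    and l: "m u t = enat l" "Z \<doteq> alt1 u t l @ V" "Y \<doteq> alt1 t u l @ V"
  shows "\<exists>h W. m s t = enat h \<and> X \<doteq> alt1 s t h @ W \<and> Y \<doteq> alt1 t s h @ W"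
proof -
  have k': "m u s = enat k" and l': "m t u = enat l" using k l m_sym S by auto
  have len1: "len [a] = 1" if "a \<in> S" for a using len_snoc_cases[OF that, of "[]"] by simp
  have red: "reduced_divisors u Z (alt1 u a j)" if "a \<in> S" "u \<noteq> a" "m u a = enat j" "Z \<doteq> alt1 u a j @ W" for a j W
  proof -
    have "len ([] @ alternating u a j) = len [] + j"
      using that S len1 by (intro len_dihedral_coset) auto
    then have "len (u # alt1 u a j) = Suc (length (alt1 u a j))"
      using alternating_Cons[OF S(1) that(1,2,3)] by (metis append_Nil len_Nil length_Cons length_alternating add_0)
    moreover have "alt1 u a j \<in> lists S" using alternating_lists[OF S(1) that(1), of j] alternating_Cons[OF S(1) that(1,2,3)]
      by (metis Cons_in_lists_iff)
    ultimately show ?thesis using that(4) unfolding reduced_divisors_def by blast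
  qed
  obtain r r' where r: "reduced_divisors u Z ([] @ alt1 u s k @ r)" "[] @ alt1 u s k @ r \<doteq> [] @ alt1 u t l @ r'"
    using reduced_divisors_confluent[OF n S(1) Z, of "[]" "alt1 u s k" "alt1 u t l"] red[OF S(2) d(1) k' k(3)] red[OF S(3) d(2) l(1,2)] by auto
  define z where "z = alt1 u s k @ r"
  have z: "reduced_divisors u Z z" "z \<doteq> alt1 u t l @ r'" using r by (simp_all add: z_def)
  obtain Z' where Z': "Z \<doteq> z @ Z'" using z by (auto simp: reduced_divisors_def)
  have uz: "len (u # z) = Suc (length z)" "u # z \<in> lists S" using z S by (auto simp: reduced_divisors_def)
  have es: "s # (alt1 s u k @ r) \<doteq> u # z"
  proof -
    have "alternating s u k @ r \<doteq> alternating u s k @ r"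
      by (intro word_cong_append word_cong.refl braid S k d(1)[symmetric])
    then show ?thesis using alternating_Cons[OF S(1,2) d(1) k'] alternating_Cons[OF S(2,1) d(1)[symmetric] k(1)] by (simp add: z_def)
  qed
  have et: "t # (alt1 t u l @ r') \<doteq> u # z"
  proof -
    have "alternating t u l @ r' \<doteq> alternating u t l @ r'"
      by (intro word_cong_append word_cong.refl braid S l' d(2)[symmetric])
    then have "t # (alt1 t u l @ r') \<doteq> [u] @ (alt1 u t l @ r')"
      using alternating_Cons[OF S(1,3) d(2) l(1)] alternating_Cons[OF S(3,1) d(2)[symmetric] l'] by simp
    also have "\<dots> \<doteq> [u] @ z" by (intro word_cong_append word_cong.refl word_cong.sym[OF z(2)])
    finally show ?thesis by simp
  qed
  have ds: "Suc (len (s # u # z)) = len (u # z)"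
    using left_descent[OF S(2) word_cong.sym[OF eqM_eqW[OF es]]] eqM_length[OF es] uz by simp
  have dt: "Suc (len (t # u # z)) = len (u # z)"
    using left_descent[OF S(3) word_cong.sym[OF eqM_eqW[OF et]]] eqM_length[OF et] uz by simp
  obtain h v where h: "m s t = enat h" "v \<in> lists S" "u # z \<simeq> alternating s t h @ v" "len (u # z) = h + length v"
    using two_left_descents[OF uz(2) S(2,3) d(3) ds dt] by blast
  have h': "m t s = enat h" using h m_sym S by simp
  have fin: "X' \<doteq> alt1 a b h @ v @ Z'"
    if ab: "a \<in> S" "b \<in> S" "a \<noteq> b" "m a b = enat h" and c: "u # z \<simeq> alternating a b h @ v"
      and e: "a # (q @ y) \<doteq> u # z" and X': "X' \<doteq> q @ Q" and Q: "Z \<doteq> q' @ Q" "z \<doteq> q' @ y" for X' a b q y q' Q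
  proof -
    have "q' @ Q \<doteq> q' @ (y @ Z')"
    proof -
      have "q' @ Q \<doteq> z @ Z'" using Q(1) Z' by (metis word_cong.sym word_cong.trans)
      also have "\<dots> \<doteq> (q' @ y) @ Z'" by (intro word_cong_append word_cong.refl Q)
      finally show ?thesis by simp
    qed
    then have Qy: "Q \<doteq> y @ Z'" using cancel_below[OF n] Z eqM_lists[OF Q(1)] eqM_length[OF Q(1)] by metis
    have ac: "alternating a b h = a # alt1 a b h" by (rule alternating_Cons[OF ab])
    have "a # (q @ y) \<simeq> a # (alt1 a b h @ v)" using eqM_eqW[OF e] c ac by simp (metis word_cong.trans)
    then have eqw: "q @ y \<simeq> alt1 a b h @ v" by (rule eqW_Cons_cancel[OF ab(1)])
    have la: "len (a # (q @ y)) = length (a # (q @ y))"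
      using len_eqW[OF eqM_eqW[OF e]] eqM_length[OF e] uz by simp
    have lb: "len (a # (alt1 a b h @ v)) = length (a # (alt1 a b h @ v))"
    proof -
      have "len (alternating a b h @ v) = len (u # z)" using len_eqW[OF c] by simp
      also have "\<dots> = length (alternating a b h @ v)" using h(4) by simp
      finally show ?thesis using ac by simp
    qed
    have "q @ y \<in> lists S" using eqM_lists[OF e] uz by simp
    then have "q @ y \<doteq> alt1 a b h @ v"
      using Matsumoto[OF _ _ _ eqw] len_prefix[of "[a]" "q @ y"] len_prefix[of "[a]" "alt1 a b h @ v"] la lb by simp
    then have "(q @ y) @ Z' \<doteq> (alt1 a b h @ v) @ Z'" using word_cong.refl by (rule word_cong_append)
    moreover have "X' \<doteq> q @ (y @ Z')"
      using X' word_cong_append[OF word_cong.refl[of R q] Qy] by (rule word_cong.trans)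
    ultimately show ?thesis by simp (metis word_cong.trans)
  qed
  have c': "u # z \<simeq> alternating t s h @ v"
    using h(3) word_cong_append[OF eqM_eqW[OF braid[OF S(2,3) d(3) h(1)]] word_cong.refl[of RW v]] by (rule word_cong.trans)
  have "X \<doteq> alt1 s t h @ v @ Z'"
    by (rule fin[OF S(2,3) d(3) h(1) h(3) es k(2) k(3)]) (simp add: z_def word_cong.refl)
  moreover have "Y \<doteq> alt1 t s h @ v @ Z'"
    by (rule fin[OF S(3,2) d(3)[symmetric] h' c' et l(3) l(2) z(2)])
  ultimately show ?thesis using h(1) by blast
qed

lemma first_letters_trans:
  assumes n: "cancellative_below n" and a: "a \<in> lists S" "b \<in> lists S" "c \<in> lists S" "length b \<le> n"
    and ab: "first_letters a b" and bc: "first_letters b c"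
  shows "first_letters a c"
proof -
  obtain s X u Z where 1: "a = s # X" "b = u # Z"
    "s = u \<and> X \<doteq> Z \<or> s \<noteq> u \<and> (\<exists>k W. m s u = enat k \<and> X \<doteq> alt1 s u k @ W \<and> Z \<doteq> alt1 u s k @ W)"
    using ab unfolding first_letters_def by blast
  obtain t Y where 2: "c = t # Y"
    "u = t \<and> Z \<doteq> Y \<or> u \<noteq> t \<and> (\<exists>k W. m u t = enat k \<and> Z \<doteq> alt1 u t k @ W \<and> Y \<doteq> alt1 t u k @ W)"
    using bc 1(2) unfolding first_letters_def by auto
  have S: "s \<in> S" "u \<in> S" "t \<in> S" "Z \<in> lists S" "length Z < n" using a 1 2 by auto
  consider "s = u" "X \<doteq> Z" | "u = t" "Z \<doteq> Y" | "s \<noteq> u" "u \<noteq> t" using 1 2 by blast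
  then show ?thesis
  proof cases
    case 1
    then show ?thesis using 2 \<open>a = s # X\<close> unfolding first_letters_def
      by (auto intro: word_cong.trans)
  next
    case 2
    have YZ: "Y \<doteq> w" if "Z \<doteq> w" for w using 2(2) that by (metis word_cong.sym word_cong.trans)
    have "s = t \<and> X \<doteq> Y \<or> s \<noteq> t \<and> (\<exists>k W. m s t = enat k \<and> X \<doteq> alt1 s t k @ W \<and> Y \<doteq> alt1 t s k @ W)"
      using 1(3) 2 YZ word_cong.trans[of R X Z Y] by blast
    then show ?thesis using 1(1) \<open>c = t # Y\<close> unfolding first_letters_def by blast
  next
    case 3
    obtain k A where k: "m s u = enat k" "X \<doteq> alt1 s u k @ A" "Z \<doteq> alt1 u s k @ A" using 1 3 by auto
    obtain l V where l: "m u t = enat l" "Z \<doteq> alt1 u t l @ V" "Y \<doteq> alt1 t u l @ V" using 2 3 by auto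
    show ?thesis
    proof (cases "s = t")
      case True
      have kl: "k = l" using k l True m_sym[of s u] S by simp
      have "alt1 u s k @ A \<doteq> alt1 u s k @ V" using k(3) l(2) True kl by (metis word_cong.sym word_cong.trans)
      then have "A \<doteq> V" using cancel_below[OF n] S eqM_lists[OF k(3)] eqM_length[OF k(3)] by metis
      then have "alt1 s u k @ A \<doteq> alt1 s u k @ V" by (intro word_cong_append word_cong.refl)
      then have "X \<doteq> Y" using k(2) l(3) True kl by (metis word_cong.sym word_cong.trans)
      then show ?thesis using 1(1) 2(1) True unfolding first_letters_def by auto
    next
      case False
      then show ?thesis
        using first_letters_core[OF n S(2,1,3) 3(1)[symmetric] 3(2) False S(4,5) k l] 1(1) 2(1)
        unfolding first_letters_def by blast
    qed
  qed
qed

lemma cancellative: "cancellative_below n"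
proof (induction n)
  case 0 show ?case by (simp add: cancellative_below_def)
next
  case (Suc n)
  have "a \<doteq> b \<Longrightarrow> a \<in> lists S \<and> a \<noteq> [] \<and> length a \<le> n \<longrightarrow> first_letters a b" for a b
  proof (induction rule: word_cong.induct)
    case (rel u v x y) then show ?case using first_letters_rel by blast
  next
    case (refl u) then show ?case using first_letters_refl by blast
  next
    case (sym u v)
    show ?case
    proof
      assume v: "v \<in> lists S \<and> v \<noteq> [] \<and> length v \<le> n"
      have "u \<in> lists S \<and> u \<noteq> [] \<and> length u \<le> n" using v eqM_length[OF sym(1)] eqM_lists[OF sym(1)] by force
      then show "first_letters v u" using sym(2) first_letters_sym v by blast
    qed
  next
    case (trans u v w)
    show ?case
    proof
      assume u: "u \<in> lists S \<and> u \<noteq> [] \<and> length u \<le> n"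
      have v: "v \<in> lists S \<and> v \<noteq> [] \<and> length v \<le> n" using u eqM_length[OF trans(1)] eqM_lists[OF trans(1)] by force
      have w: "w \<in> lists S" using v eqM_lists[OF trans(2)] by blast
      show "first_letters u w" using first_letters_trans[OF Suc, of u v w] u v w trans by blast
    qed
  qed
  then show ?case unfolding cancellative_below_def by auto
qed

theorem first_letters_eqM: "a \<in> lists S \<Longrightarrow> a \<noteq> [] \<Longrightarrow> a \<doteq> b \<Longrightarrow> first_letters a b"
  using cancellative[of "Suc (length a)"] unfolding cancellative_below_def by blast

lemma left_cancel: "p @ X \<in> lists S \<Longrightarrow> p @ X \<doteq> p @ Y \<Longrightarrow> X \<doteq> Y"
  using cancel_below[OF cancellative, of p X "Suc (length (p @ X))"] by simp

definition divides :: "'s list \<Rightarrow> 's list \<Rightarrow> bool" where "divides x z \<longleftrightarrow> (\<exists>r. z \<doteq> x @ r)"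

lemma divides_refl: "divides x (x @ r)" by (auto simp: divides_def intro: word_cong.refl)

lemma divides_lists: "z \<in> lists S \<Longrightarrow> divides x z \<Longrightarrow> x \<in> lists S"
proof -
  assume z: "z \<in> lists S" "divides x z"
  then obtain r where r: "z \<doteq> x @ r" by (auto simp: divides_def)
  have "x @ r \<in> lists S" using eqM_lists[OF r] z(1) by blast
  then show ?thesis by simp
qed

lemma divides_trans_cong: "z' \<doteq> z \<Longrightarrow> divides x z \<Longrightarrow> divides x z'"
  unfolding divides_def using word_cong.trans by blast

lemma divides_trans: "divides x y \<Longrightarrow> divides y z \<Longrightarrow> divides x z"
proof -
  assume "divides x y" "divides y z"
  then obtain r r' where "y \<doteq> x @ r" "z \<doteq> y @ r'" by (auto simp: divides_def)
  then have "z \<doteq> (x @ r) @ r'" using word_cong_append[of R y "x @ r" r' r'] word_cong.refl word_cong.trans by blast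
  then show ?thesis by (auto simp: divides_def)
qed

lemma divides_append: "divides x y \<Longrightarrow> divides (p @ x) (p @ y)"
  unfolding divides_def by (metis append.assoc word_cong.refl word_cong_append)

lemma divides_cancel: "p @ y \<in> lists S \<Longrightarrow> divides (p @ x) (p @ y) \<Longrightarrow> divides x y"
  unfolding divides_def using left_cancel by auto

definition is_lcm :: "'s list \<Rightarrow> 's list \<Rightarrow> 's list \<Rightarrow> bool" where
  "is_lcm x y L \<longleftrightarrow> L \<in> lists S \<and> divides x L \<and> divides y L \<and> (\<forall>z\<in>lists S. divides x z \<and> divides y z \<longrightarrow> divides L z)"

text \<open>Induction on the length of a common multiple $z$. If the first letters $s$ and $t$
  differ, $z$ begins with their alternating word $\Delta$. Least common multiples of $x$ and of
  $y$ with $\Delta$ arise after cancelling $s$ and $t$ respectively, and their least common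
  multiple after cancelling $\Delta$.\<close>

theorem ex_lcm:
  assumes "z \<in> lists S" "divides x z" "divides y z" shows "\<exists>L. is_lcm x y L"
  using assms
proof (induction "length z" arbitrary: x y z rule: less_induct)
  case less
  have S: "x \<in> lists S" "y \<in> lists S" using less.prems divides_lists by blast+
  show ?case
  proof (cases "x = [] \<or> y = []")
    case True
    have nil: "divides [] v" for v using divides_refl[of "[]" v] by simp
    have self: "divides v v" for v using divides_refl[of v "[]"] by simp
    show ?thesis using True S nil self unfolding is_lcm_def by auto
  next
    case False
    then obtain s x' t y' where xy: "x = s # x'" "y = t # y'" by (meson neq_Nil_conv)
    obtain a b where ab: "z \<doteq> s # (x' @ a)" "z \<doteq> t # (y' @ b)" using less.prems xy by (auto simp: divides_def)
    have zS: "s # (x' @ a) \<in> lists S" "t # (y' @ b) \<in> lists S" using less.prems eqM_lists ab by blast+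
    have len: "length z = Suc (length (x' @ a))" "length z = Suc (length (y' @ b))" using eqM_length ab by fastforce+
    have fl: "first_letters (s # (x' @ c)) (t # (y' @ d))" if "w \<in> lists S" "w \<doteq> s # (x' @ c)" "w \<doteq> t # (y' @ d)" for w c d
      using that first_letters_eqM[of "s # (x' @ c)" "t # (y' @ d)"] eqM_lists by (metis list.distinct(1) word_cong.sym word_cong.trans)
    show ?thesis
    proof (cases "s = t")
      case True
      have "x' @ a \<doteq> y' @ b" using fl[OF less.prems(1) ab] True unfolding first_letters_def by auto
      then have "divides x' (x' @ a)" "divides y' (x' @ a)" by (auto simp: divides_def intro: word_cong.refl)
      then obtain L where L: "is_lcm x' y' L" using less.hyps[of "x' @ a" x' y'] len zS by auto
      have "is_lcm x y (s # L)" unfolding is_lcm_def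
      proof (intro conjI ballI impI)
        show "s # L \<in> lists S" using L zS by (auto simp: is_lcm_def)
        show "divides x (s # L)" "divides y (s # L)"
          using L divides_append[of _ L "[s]"] xy True by (auto simp: is_lcm_def)
        fix w assume w: "w \<in> lists S" "divides x w \<and> divides y w"
        then obtain c d where cd: "w \<doteq> s # (x' @ c)" "w \<doteq> t # (y' @ d)" using xy by (auto simp: divides_def)
        have "x' @ c \<doteq> y' @ d" using fl[OF w(1) cd] True unfolding first_letters_def by auto
        then have "divides x' (x' @ c)" "divides y' (x' @ c)" by (auto simp: divides_def intro: word_cong.refl)
        moreover have "x' @ c \<in> lists S" using eqM_lists[OF cd(1)] w by simp
        ultimately have "divides L (x' @ c)" using L unfolding is_lcm_def by blast
        then show "divides (s # L) w" using divides_append[of L "x' @ c" "[s]"] divides_trans_cong[OF cd(1)] by simp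
      qed
      then show ?thesis by blast
    next
      case st: False
      have SS: "s \<in> S" "t \<in> S" using S xy by auto
      obtain k W where k: "m s t = enat k" "x' @ a \<doteq> alt1 s t k @ W" "y' @ b \<doteq> alt1 t s k @ W"
        using fl[OF less.prems(1) ab] st unfolding first_letters_def by auto
      have kt: "m t s = enat k" using k m_sym SS by simp
      let ?p = "alt1 s t k" and ?q = "alt1 t s k"
      have cons: "alternating s t k = s # ?p" "alternating t s k = t # ?q"
        using alternating_Cons[OF SS st k(1)] alternating_Cons[OF SS(2,1) st[symmetric] kt] .
      note br = braid[OF SS st k(1)]
      obtain L1 where L1: "is_lcm x' ?p L1"
        using less.hyps[of "x' @ a" x' ?p] k(2) len zS divides_refl by (auto simp: divides_def)
      obtain L2 where L2: "is_lcm y' ?q L2"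
        using less.hyps[of "y' @ b" y' ?q] k(3) len zS divides_refl by (auto simp: divides_def)
      obtain v where v: "L1 \<doteq> ?p @ v" using L1 by (auto simp: is_lcm_def divides_def)
      obtain v' where v': "L2 \<doteq> ?q @ v'" using L2 by (auto simp: is_lcm_def divides_def)
      have univ: "divides v W' \<and> divides v' W'"
        if "x' @ c \<doteq> ?p @ W'" "y' @ d \<doteq> ?q @ W'" "x' @ c \<in> lists S" "y' @ d \<in> lists S" for c d W'
      proof
        have "divides L1 (x' @ c)" using L1 that divides_refl[of x' c] unfolding is_lcm_def divides_def by blast
        then have "divides (?p @ v) (?p @ W')"
          using that(1) v divides_trans[of "?p @ v" L1] divides_trans_cong word_cong.sym by (metis append_Nil2 divides_def)
        then show "divides v W'" using divides_cancel that(1,3) eqM_lists by blast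
        have "divides L2 (y' @ d)" using L2 that divides_refl[of y' d] unfolding is_lcm_def divides_def by blast
        then have "divides (?q @ v') (?q @ W')"
          using that(2) v' divides_trans[of "?q @ v'" L2] divides_trans_cong word_cong.sym by (metis append_Nil2 divides_def)
        then show "divides v' W'" using divides_cancel that(2,4) eqM_lists by blast
      qed
      have WS: "W \<in> lists S" "length W < length z" using eqM_lists[OF k(2)] zS eqM_length[OF k(2)] len by auto
      have "divides v W" "divides v' W" using univ[OF k(2,3)] zS by auto
      then obtain L3 where L3: "is_lcm v v' L3" using less.hyps[OF WS(2,1)] by blast
      let ?L = "alternating s t k @ L3"
      have L: "is_lcm x y ?L" unfolding is_lcm_def
      proof (intro conjI ballI impI)
        show "?L \<in> lists S" using L3 alternating_lists[OF SS] by (auto simp: is_lcm_def)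
        have "divides x' (?p @ v)" using L1 v divides_trans_cong word_cong.sym unfolding is_lcm_def by blast
        then have "divides x (s # ?p @ v)" using divides_append[of x' "?p @ v" "[s]"] xy by simp
        moreover have "divides (s # ?p @ v) ?L" using divides_append[of v L3 "s # ?p"] L3 cons by (simp add: is_lcm_def)
        ultimately show "divides x ?L" by (rule divides_trans)
        have "divides y' (?q @ v')" using L2 v' divides_trans_cong word_cong.sym unfolding is_lcm_def by blast
        then have "divides y (t # ?q @ v')" using divides_append[of y' "?q @ v'" "[t]"] xy by simp
        moreover have "divides (t # ?q @ v') (alternating t s k @ L3)" using divides_append[of v' L3 "t # ?q"] L3 cons by (simp add: is_lcm_def)
        ultimately have "divides y (alternating t s k @ L3)" by (rule divides_trans)
        then show "divides y ?L" by (rule divides_trans_cong[rotated]) (intro word_cong_append br word_cong.refl)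
        fix w assume w: "w \<in> lists S" "divides x w \<and> divides y w"
        then obtain c d where cd: "w \<doteq> s # (x' @ c)" "w \<doteq> t # (y' @ d)" using xy by (auto simp: divides_def)
        obtain W' where W': "x' @ c \<doteq> ?p @ W'" "y' @ d \<doteq> ?q @ W'"
          using fl[OF w(1) cd] st k(1) unfolding first_letters_def by auto
        have "x' @ c \<in> lists S" "y' @ d \<in> lists S" using eqM_lists[OF cd(1)] eqM_lists[OF cd(2)] w by auto
        then have "divides v W'" "divides v' W'" using univ[OF W'] by auto
        moreover have "W' \<in> lists S" using eqM_lists[OF W'(1)] \<open>x' @ c \<in> lists S\<close> by simp
        ultimately have "divides L3 W'" using L3 by (simp add: is_lcm_def)
        then have "divides ?L (s # ?p @ W')" using divides_append[of L3 W' "s # ?p"] cons by simp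
        moreover have "w \<doteq> s # ?p @ W'"
          using cd(1) word_cong_append[OF word_cong.refl[of R "[s]"] W'(1)] by simp (metis word_cong.trans)
        ultimately show "divides ?L w" using divides_trans_cong by blast
      qed
      then show ?thesis by blast
    qed
  qed
qed

end

section \<open>The family of sets attached to the generators\<close>

definition omega_property :: "('p, 'k) monoid_scheme \<Rightarrow> 'p set \<Rightarrow> bool" where
  "omega_property P Pa \<longleftrightarrow> (\<forall>J. finite J \<and> J \<subseteq> carrier P \<longrightarrow> Omega_set P J \<in> atom_family P Pa)"

text \<open>Every principal right ideal is a translate $q\Omega_\emptyset$, and $\Omega_J$ is
  the complement of a finite union of them.\<close>

lemma omega_property_if_algebra:
  assumes "Sigma_Algebra.algebra (carrier P) (atom_family P Pa)"
  shows "omega_property P Pa"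
  unfolding omega_property_def
proof (intro allI impI)
  fix J assume J: "finite J \<and> J \<subseteq> carrier P"
  interpret A: Sigma_Algebra.algebra "carrier P" "atom_family P Pa" by (rule assms)
  have pi: "right_ideal P j \<in> atom_family P Pa" if "j \<in> carrier P" for j
  proof -
    have "right_ideal P j = \<Union>{(\<lambda>x. j \<otimes>\<^bsub>P\<^esub> x) ` Omega_set P {}}" by (simp add: right_ideal_def Omega_set_def)
    moreover have "{(\<lambda>x. j \<otimes>\<^bsub>P\<^esub> x) ` Omega_set P {}} \<subseteq> {(\<lambda>x. q \<otimes>\<^bsub>P\<^esub> x) ` Omega_set P K | q K. q \<in> carrier P \<and> finite K \<and> K \<subseteq> Pa}"
      using that by blast
    ultimately show ?thesis unfolding atom_family_def by (intro CollectI exI[of _ "{(\<lambda>x. j \<otimes>\<^bsub>P\<^esub> x) ` Omega_set P {}}"]) (auto simp: disjoint_def)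
  qed
  have "(\<Union>j\<in>J. right_ideal P j) \<in> atom_family P Pa"
    using J pi by (intro A.finite_UN) auto
  then have "carrier P - (\<Union>j\<in>J. right_ideal P j) \<in> atom_family P Pa" by (rule A.compl_sets)
  moreover have "Omega_set P J = carrier P - (\<Union>j\<in>J. right_ideal P j)" by (auto simp: Omega_set_def)
  ultimately show "Omega_set P J \<in> atom_family P Pa" by simp
qed

lemma atom_familyI: "q \<in> carrier P \<Longrightarrow> finite K \<Longrightarrow> K \<subseteq> Pa \<Longrightarrow> (\<lambda>x. q \<otimes>\<^bsub>P\<^esub> x) ` Omega_set P K \<in> atom_family P Pa"
  unfolding atom_family_def
  by (intro CollectI exI[of _ "{(\<lambda>x. q \<otimes>\<^bsub>P\<^esub> x) ` Omega_set P K}"]) (auto simp: disjoint_def)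

lemma atom_family_empty: "{} \<in> atom_family P Pa"
  unfolding atom_family_def by (intro CollectI exI[of _ "{}"]) auto

lemma atom_family_Un:
  assumes "A \<in> atom_family P Pa" "B \<in> atom_family P Pa" "A \<inter> B = {}" shows "A \<union> B \<in> atom_family P Pa"
proof -
  let ?S = "{(\<lambda>x. q \<otimes>\<^bsub>P\<^esub> x) ` Omega_set P K | q K. q \<in> carrier P \<and> finite K \<and> K \<subseteq> Pa}"
  obtain \<C> where C: "A = \<Union>\<C>" "finite \<C>" "disjoint \<C>" "\<C> \<subseteq> ?S"
    using assms(1) unfolding atom_family_def by (elim CollectE exE conjE) (rule that)
  obtain \<D> where D: "B = \<Union>\<D>" "finite \<D>" "disjoint \<D>" "\<D> \<subseteq> ?S"
    using assms(2) unfolding atom_family_def by (elim CollectE exE conjE) (rule that)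
  have "disjoint (\<C> \<union> \<D>)"
    by (rule disjoint_union[OF C(3) D(3)]) (use assms(3) C(1) D(1) in blast)
  then show ?thesis unfolding atom_family_def using C D by (intro CollectI exI[of _ "\<C> \<union> \<D>"]) auto
qed

lemma atom_family_UN:
  assumes "finite I" "\<And>i. i \<in> I \<Longrightarrow> f i \<in> atom_family P Pa" "\<And>i j. i \<in> I \<Longrightarrow> j \<in> I \<Longrightarrow> i \<noteq> j \<Longrightarrow> f i \<inter> f j = {}"
  shows "(\<Union>i\<in>I. f i) \<in> atom_family P Pa"
  using assms
proof (induction I rule: finite_induct)
  case (insert i I)
  have "f i \<inter> f j = {}" if "j \<in> I" for j using insert.prems(2)[of i j] that insert.hyps(2) by blast
  then have "f i \<inter> (\<Union>j\<in>I. f j) = {}" by blast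
  moreover have "(\<Union>j\<in>I. f j) \<in> atom_family P Pa" by (rule insert.IH) (use insert.prems in auto)
  ultimately have "f i \<union> (\<Union>j\<in>I. f j) \<in> atom_family P Pa" using insert.prems by (intro atom_family_Un) auto
  then show ?case by simp
qed (simp add: atom_family_empty)

text \<open>The pieces serve as their own indices, which keeps them distinct.\<close>

lemma atom_familyE:
  assumes "A \<in> atom_family P Pa"
  shows "\<exists>\<C> q K. finite \<C> \<and> disjoint \<C> \<and> A = \<Union>\<C> \<and>
    (\<forall>C\<in>\<C>. q C \<in> carrier P \<and> finite (K C) \<and> K C \<subseteq> Pa \<and> C = (\<lambda>x. q C \<otimes>\<^bsub>P\<^esub> x) ` Omega_set P (K C))"
proof -
  let ?m = "\<lambda>q K. (\<lambda>x. q \<otimes>\<^bsub>P\<^esub> x) ` Omega_set P K"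
  obtain \<C> where C: "A = \<Union>\<C>" "finite \<C>" "disjoint \<C>" "\<C> \<subseteq> {?m q K | q K. q \<in> carrier P \<and> finite K \<and> K \<subseteq> Pa}"
    using assms unfolding atom_family_def by (elim CollectE exE conjE) (rule that)
  have "\<exists>t. fst t \<in> carrier P \<and> finite (snd t) \<and> snd t \<subseteq> Pa \<and> ?m (fst t) (snd t) = D" if D: "D \<in> \<C>" for D
  proof -
    obtain q K where "D = ?m q K" "q \<in> carrier P" "finite K" "K \<subseteq> Pa"
      using subsetD[OF C(4) D] by (elim CollectE exE conjE) (rule that)
    then show ?thesis by (intro exI[of _ "(q, K)"]) simp
  qed
  then obtain t where t: "\<And>D. D \<in> \<C> \<Longrightarrow> fst (t D) \<in> carrier P \<and> finite (snd (t D)) \<and> snd (t D) \<subseteq> Pa \<and> ?m (fst (t D)) (snd (t D)) = D"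
    by metis
  show ?thesis
  proof (intro exI[of _ \<C>] exI[of _ "\<lambda>D. fst (t D)"] exI[of _ "\<lambda>D. snd (t D)"] conjI ballI)
    fix D assume D: "D \<in> \<C>"
    show "D = ?m (fst (t D)) (snd (t D))" by (rule HOL.sym) (use t[OF D] in blast)
  qed (use C(1-3) t in blast)+
qed

lemma atom_family_translate:
  assumes P: "right_lcm_monoid P" and q: "q \<in> carrier P" and Pa: "Pa \<subseteq> carrier P" and A: "A \<in> atom_family P Pa"
  shows "(\<lambda>x. q \<otimes>\<^bsub>P\<^esub> x) ` A \<in> atom_family P Pa"
proof -
  interpret right_lcm_monoid P by (rule P)
  obtain \<C> r K where C: "finite \<C>" "disjoint \<C>" "A = \<Union>\<C>"
    and rK: "\<And>C. C \<in> \<C> \<Longrightarrow> r C \<in> carrier P \<and> finite (K C) \<and> K C \<subseteq> Pa \<and> C = (\<lambda>x. r C \<otimes>\<^bsub>P\<^esub> x) ` Omega_set P (K C)"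
    using atom_familyE[OF A] by blast
  have sub: "C \<subseteq> carrier P" if "C \<in> \<C>" for C
  proof -
    have "r C \<in> carrier P" using rK[OF that] by blast
    then have "(\<lambda>x. r C \<otimes>\<^bsub>P\<^esub> x) ` Omega_set P (K C) \<subseteq> carrier P" by (auto simp: Omega_set_def)
    then show ?thesis using rK[OF that] by argo
  qed
  have "(\<Union>C\<in>\<C>. (\<lambda>x. q \<otimes>\<^bsub>P\<^esub> x) ` C) \<in> atom_family P Pa"
  proof (rule atom_family_UN[OF C(1)])
    fix C assume c: "C \<in> \<C>"
    have "(\<lambda>x. q \<otimes>\<^bsub>P\<^esub> x) ` ((\<lambda>x. r C \<otimes>\<^bsub>P\<^esub> x) ` Omega_set P (K C)) = (\<lambda>x. (q \<otimes>\<^bsub>P\<^esub> r C) \<otimes>\<^bsub>P\<^esub> x) ` Omega_set P (K C)"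
      using rK[OF c] q unfolding image_image by (intro image_cong) (auto simp: Omega_set_def m_assoc)
    then have "(\<lambda>x. q \<otimes>\<^bsub>P\<^esub> x) ` C = (\<lambda>x. (q \<otimes>\<^bsub>P\<^esub> r C) \<otimes>\<^bsub>P\<^esub> x) ` Omega_set P (K C)" using rK[OF c] by argo
    moreover have "(\<lambda>x. (q \<otimes>\<^bsub>P\<^esub> r C) \<otimes>\<^bsub>P\<^esub> x) ` Omega_set P (K C) \<in> atom_family P Pa"
      by (rule atom_familyI) (use rK[OF c] q in auto)
    ultimately show "(\<lambda>x. q \<otimes>\<^bsub>P\<^esub> x) ` C \<in> atom_family P Pa" by simp
  next
    fix C D assume cd: "C \<in> \<C>" "D \<in> \<C>" "C \<noteq> D"
    then have "C \<inter> D = {}" using C(2) by (auto simp: disjoint_def)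
    then show "(\<lambda>x. q \<otimes>\<^bsub>P\<^esub> x) ` C \<inter> (\<lambda>x. q \<otimes>\<^bsub>P\<^esub> x) ` D = {}"
    proof (intro equals0I)
      fix y assume "y \<in> (\<lambda>x. q \<otimes>\<^bsub>P\<^esub> x) ` C \<inter> (\<lambda>x. q \<otimes>\<^bsub>P\<^esub> x) ` D"
      then obtain a b where ab: "a \<in> C" "b \<in> D" "q \<otimes>\<^bsub>P\<^esub> a = q \<otimes>\<^bsub>P\<^esub> b" by auto
      then have "a = b" using l_cancel_monoid[of q a b] q sub[OF cd(1)] sub[OF cd(2)] by blast
      then show False using ab \<open>C \<inter> D = {}\<close> by blast
    qed
  qed
  then show ?thesis by (simp add: C(3) image_Union)
qed

section \<open>Transport along isomorphisms\<close>

locale monoid_iso =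
  fixes A :: "('p, 'k) monoid_scheme" and B :: "('q, 'l) monoid_scheme" and h
  assumes A: "right_lcm_monoid A" and bij: "bij_betw h (carrier A) (carrier B)"
    and hom: "\<And>x y. x \<in> carrier A \<Longrightarrow> y \<in> carrier A \<Longrightarrow> h (x \<otimes>\<^bsub>A\<^esub> y) = h x \<otimes>\<^bsub>B\<^esub> h y"
    and h_one: "h \<one>\<^bsub>A\<^esub> = \<one>\<^bsub>B\<^esub>"
begin

sublocale A: right_lcm_monoid A by (rule A)

lemma inj: "inj_on h (carrier A)" and surj: "h ` carrier A = carrier B"
  using bij by (auto simp: bij_betw_def)

lemma h_mem: "x \<in> carrier A \<Longrightarrow> h x \<in> carrier B" using surj by blast

lemma h_eq: "x \<in> carrier A \<Longrightarrow> y \<in> carrier A \<Longrightarrow> h x = h y \<longleftrightarrow> x = y" using inj by (auto dest: inj_onD)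

lemma ideal: "p \<in> carrier A \<Longrightarrow> right_ideal B (h p) = h ` right_ideal A p"
proof -
  assume p: "p \<in> carrier A"
  have "right_ideal B (h p) = (\<lambda>x. h p \<otimes>\<^bsub>B\<^esub> h x) ` carrier A" by (simp add: right_ideal_def surj[symmetric] image_image)
  also have "\<dots> = (\<lambda>x. h (p \<otimes>\<^bsub>A\<^esub> x)) ` carrier A" using p hom by (intro image_cong) auto
  finally show ?thesis by (simp add: right_ideal_def image_image)
qed

lemma right_lcm: "right_lcm_monoid B"
proof
  fix x y z assume xyz: "x \<in> carrier B" "y \<in> carrier B" "z \<in> carrier B"
  then obtain x' y' z' where e: "x = h x'" "y = h y'" "z = h z'" "x' \<in> carrier A" "y' \<in> carrier A" "z' \<in> carrier A"
    unfolding surj[symmetric] by blast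
  show "x \<otimes>\<^bsub>B\<^esub> y \<in> carrier B" using e hom h_mem[of "x' \<otimes>\<^bsub>A\<^esub> y'"] by simp
  show "x \<otimes>\<^bsub>B\<^esub> y \<otimes>\<^bsub>B\<^esub> z = x \<otimes>\<^bsub>B\<^esub> (y \<otimes>\<^bsub>B\<^esub> z)"
    using e by (simp add: hom[symmetric] A.m_assoc)
  show "x \<otimes>\<^bsub>B\<^esub> y = x \<otimes>\<^bsub>B\<^esub> z \<Longrightarrow> y = z"
    using e A.l_cancel_monoid[of x' y' z'] by (simp add: hom[symmetric] h_eq)
  show "x \<otimes>\<^bsub>B\<^esub> y = \<one>\<^bsub>B\<^esub> \<Longrightarrow> x = \<one>\<^bsub>B\<^esub>"
    using e A.no_units[of x' y'] by (simp add: hom[symmetric] h_one[symmetric] h_eq)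
  show "\<one>\<^bsub>B\<^esub> \<otimes>\<^bsub>B\<^esub> x = x" "x \<otimes>\<^bsub>B\<^esub> \<one>\<^bsub>B\<^esub> = x"
    using e by (simp_all add: hom[symmetric] h_one[symmetric])
  assume ne: "right_ideal B x \<inter> right_ideal B y \<noteq> {}"
  have i: "right_ideal B x \<inter> right_ideal B y = h ` (right_ideal A x' \<inter> right_ideal A y')"
    unfolding e ideal[OF e(4)] ideal[OF e(5)]
    by (rule inj_on_image_Int[OF inj, symmetric]) (use e A.rid_subset in auto)
  then have "right_ideal A x' \<inter> right_ideal A y' \<noteq> {}" using ne by auto
  then obtain r where "r \<in> carrier A" "right_ideal A x' \<inter> right_ideal A y' = right_ideal A r"
    using A.inter_ideals e by blast
  then show "\<exists>r\<in>carrier B. right_ideal B x \<inter> right_ideal B y = right_ideal B r"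
    using i ideal h_mem by (intro bexI[of _ "h r"]) auto
qed (use h_mem[OF A.one_closed] h_one in simp)

lemma Omega: "K \<subseteq> carrier A \<Longrightarrow> Omega_set B (h ` K) = h ` Omega_set A K"
proof -
  assume K: "K \<subseteq> carrier A"
  have "h x \<in> right_ideal B (h k) \<longleftrightarrow> x \<in> right_ideal A k" if "x \<in> carrier A" "k \<in> carrier A" for x k
    using ideal[OF that(2)] A.rid_subset[OF that(2)] that h_eq by (auto simp: image_iff)
  then have iff: "h x \<in> right_ideal B (h k) \<longleftrightarrow> x \<in> right_ideal A k" if "x \<in> carrier A" "k \<in> K" for x k
    using that K by blast
  have "Omega_set B (h ` K) = {y \<in> h ` carrier A. \<forall>k\<in>K. y \<notin> right_ideal B (h k)}"
    unfolding surj by (auto simp: Omega_set_def)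
  also have "\<dots> = h ` {x \<in> carrier A. \<forall>k\<in>K. x \<notin> right_ideal A k}" using iff by blast
  also have "{x \<in> carrier A. \<forall>k\<in>K. x \<notin> right_ideal A k} = Omega_set A K" by (auto simp: Omega_set_def)
  finally show ?thesis .
qed

lemma family:
  assumes Pa: "Pa \<subseteq> carrier A" and C: "C \<in> atom_family A Pa" shows "h ` C \<in> atom_family B (h ` Pa)"
proof -
  obtain \<C> r K where C: "finite \<C>" "disjoint \<C>" "C = \<Union>\<C>"
    and rK: "\<And>D. D \<in> \<C> \<Longrightarrow> r D \<in> carrier A \<and> finite (K D) \<and> K D \<subseteq> Pa \<and> D = (\<lambda>x. r D \<otimes>\<^bsub>A\<^esub> x) ` Omega_set A (K D)"
    using atom_familyE[OF C] by blast
  have sub: "D \<subseteq> carrier A" if "D \<in> \<C>" for D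
  proof -
    have "r D \<in> carrier A" using rK[OF that] by blast
    then have "(\<lambda>x. r D \<otimes>\<^bsub>A\<^esub> x) ` Omega_set A (K D) \<subseteq> carrier A" by (auto simp: Omega_set_def)
    then show ?thesis using rK[OF that] by argo
  qed
  have "(\<Union>D\<in>\<C>. h ` D) \<in> atom_family B (h ` Pa)"
  proof (rule atom_family_UN[OF C(1)])
    fix D assume d: "D \<in> \<C>"
    have "h ` ((\<lambda>x. r D \<otimes>\<^bsub>A\<^esub> x) ` Omega_set A (K D)) = (\<lambda>x. h (r D) \<otimes>\<^bsub>B\<^esub> x) ` (h ` Omega_set A (K D))"
      using rK[OF d] unfolding image_image by (intro image_cong) (auto simp: Omega_set_def hom)
    also have "\<dots> = (\<lambda>x. h (r D) \<otimes>\<^bsub>B\<^esub> x) ` (Omega_set B (h ` K D))" using rK[OF d] Pa by (subst Omega) auto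
    finally have "h ` D = (\<lambda>x. h (r D) \<otimes>\<^bsub>B\<^esub> x) ` (Omega_set B (h ` K D))" using rK[OF d] by argo
    then show "h ` D \<in> atom_family B (h ` Pa)" using rK[OF d] h_mem by (simp add: atom_familyI image_mono)
  next
    fix D D' assume "D \<in> \<C>" "D' \<in> \<C>" "D \<noteq> D'"
    then show "h ` D \<inter> h ` D' = {}" using C(2) sub inj_on_image_Int[OF inj, of D D'] by (auto simp: disjoint_def)
  qed
  then show ?thesis by (simp add: C(3) image_Union)
qed

lemma omega_property:
  assumes "Pa \<subseteq> carrier A" "omega_property A Pa" shows "omega_property B (h ` Pa)"
  unfolding omega_property_def
proof (intro allI impI)
  fix J assume J: "finite J \<and> J \<subseteq> carrier B"
  then obtain J' where J': "J' \<subseteq> carrier A" "J = h ` J'" unfolding surj[symmetric] by (meson subset_imageE)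
  have "finite J'" using J J' inj_on_subset[OF inj J'(1)] finite_imageD by blast
  then show "Omega_set B J \<in> atom_family B (h ` Pa)"
    using assms J' family by (simp add: omega_property_def Omega)
qed

end

section \<open>Presented monoids\<close>

locale presentation =
  fixes S :: "'g set" and R :: "('g list \<times> 'g list) set"
  assumes R_words: "R \<subseteq> lists S \<times> lists S"
begin

abbreviation "cls \<equiv> word_class S R"
abbreviation "PM \<equiv> presented_monoid S R"

lemma cls_eq: "u \<in> lists S \<Longrightarrow> v \<in> lists S \<Longrightarrow> cls u = cls v \<longleftrightarrow> word_cong R u v"
  unfolding word_class_def using word_cong.refl word_cong.sym word_cong.trans by (blast dest: equalityD2)

lemma carrier_PM: "carrier PM = cls ` lists S" by (simp add: presented_monoid_def)

lemma one_PM: "\<one>\<^bsub>PM\<^esub> = cls []" by (simp add: presented_monoid_def)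

lemma mult_PM:
  assumes "u \<in> lists S" "v \<in> lists S" shows "cls u \<otimes>\<^bsub>PM\<^esub> cls v = cls (u @ v)"
proof -
  have "{w \<in> lists S. \<exists>u'\<in>cls u. \<exists>v'\<in>cls v. word_cong R (u' @ v') w} = cls (u @ v)"
  proof (intro equalityI subsetI)
    fix w assume "w \<in> {w \<in> lists S. \<exists>u'\<in>cls u. \<exists>v'\<in>cls v. word_cong R (u' @ v') w}"
    then obtain u' v' where "w \<in> lists S" "word_cong R u u'" "word_cong R v v'" "word_cong R (u' @ v') w"
      by (auto simp: word_class_def)
    then show "w \<in> cls (u @ v)" unfolding word_class_def using word_cong_append[of R u u' v v'] word_cong.trans by blast
  next
    fix w assume "w \<in> cls (u @ v)"
    then show "w \<in> {w \<in> lists S. \<exists>u'\<in>cls u. \<exists>v'\<in>cls v. word_cong R (u' @ v') w}"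
      using assms by (auto simp: word_class_def intro!: bexI[of _ u] bexI[of _ v] word_cong.refl)
  qed
  then show ?thesis by (simp add: presented_monoid_def)
qed

lemma monoid_PM: "monoid PM"
proof (rule monoidI)
  fix x y z assume "x \<in> carrier PM" "y \<in> carrier PM" "z \<in> carrier PM"
  then obtain u v w where e: "u \<in> lists S" "v \<in> lists S" "w \<in> lists S" "x = cls u" "y = cls v" "z = cls w"
    unfolding carrier_PM by blast
  show "x \<otimes>\<^bsub>PM\<^esub> y \<in> carrier PM" using e by (simp only: mult_PM carrier_PM) simp
  show "x \<otimes>\<^bsub>PM\<^esub> y \<otimes>\<^bsub>PM\<^esub> z = x \<otimes>\<^bsub>PM\<^esub> (y \<otimes>\<^bsub>PM\<^esub> z)"
    using mult_PM[of u v] mult_PM[of v w] mult_PM[of "u @ v" w] mult_PM[of u "v @ w"] e by simp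
  show "\<one>\<^bsub>PM\<^esub> \<otimes>\<^bsub>PM\<^esub> x = x" "x \<otimes>\<^bsub>PM\<^esub> \<one>\<^bsub>PM\<^esub> = x"
    using e(1) unfolding e one_PM by (simp_all add: mult_PM)
qed (auto simp: carrier_PM one_PM)

lemma generated_PM:
  assumes "Q (cls [])" "\<And>w s. w \<in> lists S \<Longrightarrow> s \<in> S \<Longrightarrow> Q (cls w) \<Longrightarrow> Q (cls (w @ [s]))" "p \<in> carrier PM"
  shows "Q p"
proof -
  obtain w where w: "w \<in> lists S" "p = cls w" using assms(3) carrier_PM by auto
  have "Q (cls w)" using w(1) by (induction w rule: rev_induct) (use assms in auto)
  then show ?thesis using w by simp
qed

end

context coxeter begin

sublocale presentation S R by standard (rule R_lists)

lemma right_ideal_artin: "x \<in> lists S \<Longrightarrow> right_ideal PM (cls x) = cls ` {z \<in> lists S. divides x z}"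
proof (intro equalityI subsetI)
  fix p assume x: "x \<in> lists S" and "p \<in> right_ideal PM (cls x)"
  then obtain y where y0: "y \<in> lists S" "p = cls x \<otimes>\<^bsub>PM\<^esub> cls y" unfolding right_ideal_def carrier_PM by blast
  then have y: "y \<in> lists S" "p = cls (x @ y)" using mult_PM[OF x] by simp_all
  then show "p \<in> cls ` {z \<in> lists S. divides x z}" using x divides_refl by auto
next
  fix p assume x: "x \<in> lists S" and "p \<in> cls ` {z \<in> lists S. divides x z}"
  then obtain z r where z: "z \<in> lists S" "p = cls z" "z \<doteq> x @ r" by (auto simp: divides_def)
  then have xr: "x @ r \<in> lists S" using eqM_lists by blast
  then have "p = cls x \<otimes>\<^bsub>PM\<^esub> cls r" using z cls_eq[OF z(1) xr] x by (simp add: mult_PM)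
  then show "p \<in> right_ideal PM (cls x)" using xr by (auto simp: right_ideal_def carrier_PM)
qed

theorem right_lcm_artin: "right_lcm_monoid PM"
proof -
  interpret monoid PM by (rule monoid_PM)
  show ?thesis
  proof
    fix x y z assume "x \<in> carrier PM" "y \<in> carrier PM" "z \<in> carrier PM"
    then obtain u v w where e: "u \<in> lists S" "v \<in> lists S" "w \<in> lists S" "x = cls u" "y = cls v" "z = cls w" by (auto simp: carrier_PM)
    show "x \<otimes>\<^bsub>PM\<^esub> y = x \<otimes>\<^bsub>PM\<^esub> z \<Longrightarrow> y = z"
      using e left_cancel[of u v w] by (simp add: mult_PM cls_eq)
    show "x \<otimes>\<^bsub>PM\<^esub> y = \<one>\<^bsub>PM\<^esub> \<Longrightarrow> x = \<one>\<^bsub>PM\<^esub>"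
      using e eqM_length[of "u @ v" "[]"] by (simp add: mult_PM one_PM cls_eq)
    assume ne: "right_ideal PM x \<inter> right_ideal PM y \<noteq> {}"
    have i: "right_ideal PM x \<inter> right_ideal PM y = cls ` {a \<in> lists S. divides u a \<and> divides v a}"
    proof -
      have "divides v a" if "a \<in> lists S" "b \<in> lists S" "divides v b" "cls a = cls b" for a b
        using that divides_trans_cong by (simp add: cls_eq)
      then show ?thesis unfolding e(4,5) right_ideal_artin[OF e(1)] right_ideal_artin[OF e(2)] by blast
    qed
    then obtain a where "a \<in> lists S" "divides u a" "divides v a" using ne by auto
    then obtain L where L: "is_lcm u v L" using ex_lcm by blast
    then have LS: "L \<in> lists S" by (simp add: is_lcm_def)
    have "{a \<in> lists S. divides u a \<and> divides v a} = {a \<in> lists S. divides L a}"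
      using L divides_trans unfolding is_lcm_def by blast
    then show "\<exists>r\<in>carrier PM. right_ideal PM x \<inter> right_ideal PM y = right_ideal PM r"
      using i right_ideal_artin[OF LS] LS by (intro bexI[of _ "cls L"]) (auto simp: carrier_PM)
  qed
qed

lemma artin_generators_mem: "artin_generators S m \<subseteq> carrier PM - {\<one>\<^bsub>PM\<^esub>}"
  unfolding artin_generators_def using eqM_length by (force simp: carrier_PM one_PM cls_eq)

lemma artin_generated:
  assumes "Q \<one>\<^bsub>PM\<^esub>" "\<And>p s. p \<in> carrier PM \<Longrightarrow> s \<in> artin_generators S m \<Longrightarrow> Q p \<Longrightarrow> Q (p \<otimes>\<^bsub>PM\<^esub> s)" "p \<in> carrier PM"
  shows "Q p"
  using assms(3)
proof (rule generated_PM[rotated 2])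
  show "Q (cls [])" using assms(1) by (simp add: one_PM)
  fix w s assume "w \<in> lists S" "s \<in> S" "Q (cls w)"
  then show "Q (cls (w @ [s]))"
    using assms(2)[of "cls w" "cls [s]"] by (simp add: mult_PM carrier_PM artin_generators_def)
qed

end

lemma artin_monoid_eq: "artin_monoid S m = presented_monoid S (artin_relations S m)"
  by (simp add: artin_monoid_def)

section \<open>Normal forms in free products\<close>

text \<open>The factors live on disjoint subsets of one type of letters, distinguished by their
  tags.\<close>

locale monoid_family =
  fixes M :: "'i \<Rightarrow> 'l monoid" and tag :: "'l \<Rightarrow> 'i"
  assumes M: "right_lcm_monoid (M i)" and tag: "l \<in> carrier (M i) \<Longrightarrow> tag l = i"
begin

sublocale M: right_lcm_monoid "M i" for i by (rule M)

abbreviation letter_mult (infixl "\<odot>" 70) where "x \<odot> y \<equiv> x \<otimes>\<^bsub>M (tag x)\<^esub> y"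
abbreviation "unit l \<equiv> \<one>\<^bsub>M (tag l)\<^esub>"
definition "G = {l. l \<in> carrier (M (tag l))}"
definition "letter l \<longleftrightarrow> l \<in> G \<and> l \<noteq> unit l"

primrec reduced :: "'l list \<Rightarrow> bool" where
  "reduced [] \<longleftrightarrow> True"
| "reduced (x # ws) \<longleftrightarrow> letter x \<and> reduced ws \<and> (ws \<noteq> [] \<longrightarrow> tag (hd ws) \<noteq> tag x)"

text \<open>Left multiplication of a normal form by a letter. Merging two letters of the same
  factor never produces a unit, since the factors have no nontrivial units.\<close>

definition push :: "'l \<Rightarrow> 'l list \<Rightarrow> 'l list" where
  "push x ws = (if x = unit x then ws else if ws \<noteq> [] \<and> tag (hd ws) = tag x then (x \<odot> hd ws) # tl ws else x # ws)"

definition mul :: "'l list \<Rightarrow> 'l list \<Rightarrow> 'l list" where "mul u v = foldr push u v"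

definition NM :: "'l list monoid" where
  "NM = \<lparr>carrier = {ws. reduced ws}, monoid.mult = mul, one = []\<rparr>"

lemma NM_simps [simp]: "carrier NM = {ws. reduced ws}" "x \<otimes>\<^bsub>NM\<^esub> y = mul x y" "\<one>\<^bsub>NM\<^esub> = []"
  by (simp_all add: NM_def)

lemma mul_simps [simp]: "mul [] v = v" "mul (x # u) v = push x (mul u v)"
  by (simp_all add: mul_def)

lemma mul_append: "mul (u @ v) w = mul u (mul v w)" by (simp add: mul_def)

lemma G_carrier: "l \<in> G \<longleftrightarrow> l \<in> carrier (M (tag l))" by (simp add: G_def)

lemma carrier_G:
  assumes "l \<in> carrier (M i)" shows "l \<in> G"
  unfolding G_def using tag[OF assms] assms by simp

lemma unit_tag: "tag \<one>\<^bsub>M i\<^esub> = i" by (rule tag) (rule M.one_closed)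

lemma mult_G: "x \<in> G \<Longrightarrow> y \<in> G \<Longrightarrow> tag x = tag y \<Longrightarrow> x \<odot> y \<in> G \<and> tag (x \<odot> y) = tag x"
  using M.m_closed[of x "tag x" y] tag[of "x \<odot> y" "tag x"] by (auto simp: G_carrier)

lemma letter_mult_letter: "letter x \<Longrightarrow> y \<in> G \<Longrightarrow> tag x = tag y \<Longrightarrow> letter (x \<odot> y)"
  using mult_G[of x y] M.no_units[of x "tag x" y] by (auto simp: letter_def G_carrier)

lemma letter_G: "letter x \<Longrightarrow> x \<in> G" by (simp add: letter_def)

lemma push_letter: "letter x \<Longrightarrow> push x ws = (if ws \<noteq> [] \<and> tag (hd ws) = tag x then (x \<odot> hd ws) # tl ws else x # ws)"
  by (simp add: push_def letter_def)

lemma reduced_push: "x \<in> G \<Longrightarrow> reduced ws \<Longrightarrow> reduced (push x ws)"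
  by (cases ws; cases "x = unit x")
     (auto simp: push_def letter_def[of x] letter_mult_letter letter_G mult_G)

lemma reduced_mul: "set u \<subseteq> G \<Longrightarrow> reduced v \<Longrightarrow> reduced (mul u v)"
  by (induction u) (auto simp: reduced_push)

lemma reduced_set: "reduced ws \<Longrightarrow> set ws \<subseteq> G"
  by (induction ws) (auto simp: letter_G)

lemma push_unit: "push \<one>\<^bsub>M i\<^esub> ws = ws"
  by (simp add: push_def unit_tag)

lemma push_push:
  assumes "x \<in> G" "y \<in> G" "tag x = tag y" "reduced ws"
  shows "push x (push y ws) = push (x \<odot> y) ws"
proof (cases "x = unit x \<or> y = unit y")
  case True
  then show ?thesis
  proof
    assume "x = unit x"
    moreover have "unit x \<odot> y = y" using assms by (simp add: unit_tag G_carrier)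
    ultimately show ?thesis using push_unit[of "tag x" "push y ws"] by metis
  next
    assume "y = unit y"
    moreover have "x \<odot> unit y = x" using assms by (simp add: G_carrier)
    ultimately show ?thesis using push_unit[of "tag y" ws] by metis
  qed
next
  case False
  then have l: "letter x" "letter y" using assms by (auto simp: letter_def)
  have lxy: "letter (x \<odot> y)" by (rule letter_mult_letter[OF l(1) assms(2,3)])
  have t: "tag (x \<odot> y) = tag x" using mult_G assms by blast
  show ?thesis
  proof (cases "ws \<noteq> [] \<and> tag (hd ws) = tag y")
    case True
    then obtain h ws' where ws: "ws = h # ws'" "tag h = tag y" by (cases ws) auto
    have h: "h \<in> G" using assms(4) ws letter_G by simp
    have ty: "tag (y \<odot> h) = tag y" using mult_G[of y h] assms ws h by simp
    have "x \<odot> (y \<odot> h) = x \<odot> y \<odot> h"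
      using assms ws h t M.m_assoc[of x "tag x" y h] by (simp add: G_carrier)
    then show ?thesis using l lxy t ws ty assms(3) by (simp add: push_letter)
  next
    case False
    have "push y ws = y # ws" "push (x \<odot> y) ws = (x \<odot> y) # ws"
      using l lxy t assms(3) False by (auto simp: push_letter)
    then show ?thesis using l assms(3) by (simp add: push_letter)
  qed
qed

lemma mul_push:
  assumes "x \<in> G" "reduced v" "reduced w" shows "mul (push x v) w = push x (mul v w)"
proof (cases "x \<noteq> unit x \<and> v \<noteq> [] \<and> tag (hd v) = tag x")
  case True
  then obtain h t where v: "v = h # t" "tag h = tag x" by (cases v) auto
  have "reduced (mul t w)" using assms v reduced_set[of t] by (intro reduced_mul) auto
  then have "push x (push h (mul t w)) = push (x \<odot> h) (mul t w)"
    using v assms letter_G by (intro push_push) auto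
  moreover have "push x v = (x \<odot> h) # t" using True v by (simp add: push_def)
  ultimately show ?thesis using v by simp
next
  case False
  then consider "x = unit x" | "x \<noteq> unit x" "\<not> (v \<noteq> [] \<and> tag (hd v) = tag x)" by blast
  then show ?thesis
  proof cases
    case 1
    then show ?thesis by (simp add: push_def)
  next
    case 2
    then have "push x v = x # v" by (auto simp: push_def)
    then show ?thesis by simp
  qed
qed

lemma mul_assoc: "set u \<subseteq> G \<Longrightarrow> reduced v \<Longrightarrow> reduced w \<Longrightarrow> mul (mul u v) w = mul u (mul v w)"
  by (induction u) (auto simp: mul_push reduced_mul)

lemma mul_Nil: "reduced u \<Longrightarrow> mul u [] = u"
  by (induction u) (auto simp: push_letter)

lemma monoid_NM: "monoid NM"
  by (rule monoidI) (auto simp: mul_assoc mul_Nil reduced_mul reduced_set)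

text \<open>Membership in the right ideal of the normal form $j$: all letters of $j$ except the
  last must agree with those of $p$, and the last one has to divide its counterpart.\<close>

fun pre :: "'l list \<Rightarrow> 'l list \<Rightarrow> bool" where
  "pre [] p \<longleftrightarrow> True"
| "pre (x # j) p \<longleftrightarrow> p \<noteq> [] \<and> (if j = [] then tag (hd p) = tag x \<and> hd p \<in> right_ideal (M (tag x)) x else hd p = x \<and> pre j (tl p))"

lemma pre_hd: "pre j p \<Longrightarrow> j \<noteq> [] \<Longrightarrow> p \<noteq> [] \<and> tag (hd p) = tag (hd j)"
  by (cases j) (auto split: if_splits)

lemma pre_mul: "reduced j \<Longrightarrow> reduced v \<Longrightarrow> pre j (mul j v)"
proof (induction j)
  case (Cons x j)
  then have x: "letter x" "x \<in> carrier (M (tag x))" using letter_G by (auto simp: G_carrier)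
  show ?case
  proof (cases "j = []")
    case True
    have hr: "hd v \<in> G" if "v \<noteq> []" using Cons.prems(2) that by (cases v) (auto simp: letter_G)
    show ?thesis
    proof (cases "v \<noteq> [] \<and> tag (hd v) = tag x")
      case t: True
      then have "hd v \<in> carrier (M (tag x))" using hr by (simp add: G_carrier)
      then show ?thesis using True t x mult_G[of x "hd v"] hr letter_G
        by (auto simp: push_letter right_ideal_def)
    next
      case False
      then show ?thesis using True x M.rid_self[of x "tag x"] by (auto simp: push_letter)
    qed
  next
    case False
    then have "pre j (mul j v)" using Cons by simp
    then have "tag (hd (mul j v)) \<noteq> tag x" using pre_hd False Cons.prems by auto
    then show ?thesis using False x \<open>pre j (mul j v)\<close> by (simp add: push_letter)
  qed
qed simp

lemma pre_exists: "reduced j \<Longrightarrow> reduced p \<Longrightarrow> pre j p \<Longrightarrow> \<exists>v. reduced v \<and> p = mul j v"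
proof (induction j arbitrary: p)
  case (Cons x j)
  then have x: "letter x" "x \<in> carrier (M (tag x))" using letter_G by (auto simp: G_carrier)
  obtain y ps where p: "p = y # ps" using Cons.prems by (cases p) auto
  show ?case
  proof (cases "j = []")
    case True
    then obtain z where z: "z \<in> carrier (M (tag x))" "y = x \<odot> z" "tag y = tag x"
      using Cons.prems p by (auto simp: right_ideal_def)
    show ?thesis
    proof (cases "z = unit x")
      case u: True
      then have "y = x" using z x by simp
      then show ?thesis using True p Cons.prems x by (intro exI[of _ ps]) (auto simp: push_letter)
    next
      case False
      have tz: "tag z = tag x" by (rule tag[OF z(1)])
      then have "letter z" using False z by (auto simp: letter_def G_carrier)
      then show ?thesis using True p Cons.prems x z tz by (intro exI[of _ "z # ps"]) (auto simp: push_letter)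
    qed
  next
    case False
    then have "y = x" "pre j ps" using Cons.prems p by auto
    then obtain v where "reduced v" "ps = mul j v" using Cons p by auto
    then show ?thesis using Cons.prems p x \<open>y = x\<close> by (intro exI[of _ v]) (auto simp: push_letter)
  qed
qed auto

lemma rid_iff: "reduced j \<Longrightarrow> p \<in> right_ideal NM j \<longleftrightarrow> reduced p \<and> pre j p"
  unfolding right_ideal_def using pre_mul pre_exists reduced_mul reduced_set by (auto simp: image_iff)

lemma push_inj: "letter x \<Longrightarrow> reduced v \<Longrightarrow> reduced w \<Longrightarrow> push x v = push x w \<Longrightarrow> v = w"
proof -
  assume x: "letter x" and vw: "reduced v" "reduced w" "push x v = push x w"
  have xc: "x \<in> carrier (M (tag x))" using letter_G[OF x] by (simp add: G_carrier)
  have no_fix: "h = unit h" if h: "h \<in> carrier (M (tag x))" "x \<odot> h = x" for h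
  proof -
    have "h = unit x" by (rule M.l_cancel_monoid[of x "tag x"]) (use h xc in simp_all)
    then show ?thesis using unit_tag by simp
  qed
  have hd: "letter (hd u)" "hd u \<in> carrier (M (tag (hd u)))" if "reduced u" "u \<noteq> []" for u
    using that letter_G by (cases u; auto simp: G_carrier)+
  let ?c = "\<lambda>u. u \<noteq> [] \<and> tag (hd u) = tag x"
  consider "?c v" "?c w" | "?c v" "\<not> ?c w" | "\<not> ?c v" "?c w" | "\<not> ?c v" "\<not> ?c w" by blast
  then show "v = w"
  proof cases
    case 1
    then have e: "x \<odot> hd v = x \<odot> hd w" "tl v = tl w" using vw(3) x by (auto simp: push_letter)
    have "hd v = hd w"
      by (rule M.l_cancel_monoid[OF xc _ _ e(1)]) (use hd(2)[OF vw(1)] hd(2)[OF vw(2)] 1 in auto)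
    then show ?thesis using e 1 by (metis list.collapse)
  next
    case 2
    then have "x \<odot> hd v = x" using vw(3) x by (auto simp: push_letter)
    then show ?thesis using no_fix[of "hd v"] hd[OF vw(1)] 2 by (auto simp: letter_def)
  next
    case 3
    then have "x \<odot> hd w = x" using vw(3) x by (auto simp: push_letter)
    then show ?thesis using no_fix[of "hd w"] hd[OF vw(2)] 3 by (auto simp: letter_def)
  next
    case 4 then show ?thesis using vw(3) x by (simp add: push_letter split: if_splits)
  qed
qed

lemma mul_inj: "reduced u \<Longrightarrow> reduced v \<Longrightarrow> reduced w \<Longrightarrow> mul u v = mul u w \<Longrightarrow> v = w"
proof (induction u)
  case (Cons x u)
  have "mul u v = mul u w"
    by (rule push_inj[of x]) (use Cons.prems reduced_mul reduced_set in auto)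
  then show ?case using Cons by simp
qed simp

text \<open>Two normal forms with a common multiple can only differ at the last letter of the
  shorter one, and there a least common multiple in one factor is available.\<close>

lemma inter_pre:
  "reduced j \<Longrightarrow> reduced k \<Longrightarrow> \<exists>p. reduced p \<and> pre j p \<and> pre k p \<Longrightarrow>
   \<exists>L. reduced L \<and> (\<forall>p. reduced p \<longrightarrow> (pre j p \<and> pre k p \<longleftrightarrow> pre L p))"
proof (induction j arbitrary: k)
  case Nil then show ?case by auto
next
  case (Cons x j)
  show ?case
  proof (cases k)
    case Nil then show ?thesis using Cons.prems by (intro exI[of _ "x # j"]) simp
  next
    case k: (Cons y k')
    obtain p where p: "reduced p" "pre (x # j) p" "pre (y # k') p" using Cons.prems k by auto
    have txy: "tag x = tag y" using pre_hd[OF p(2)] pre_hd[OF p(3)] by simp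
    have l: "letter x" "letter y" using Cons.prems k by auto
    have "x \<in> carrier (M (tag x))" "y \<in> carrier (M (tag x))"
      using letter_G[OF l(1)] letter_G[OF l(2)] unfolding G_carrier txy .
    note xy = this l
    consider "j = []" "k' = []" | "j = []" "k' \<noteq> []" | "j \<noteq> []" "k' = []" | "j \<noteq> []" "k' \<noteq> []" by blast
    then show ?thesis
    proof cases
      case 1
      then have "hd p \<in> right_ideal (M (tag x)) x \<inter> right_ideal (M (tag x)) y" using p txy by auto
      then obtain r where r: "r \<in> carrier (M (tag x))" "right_ideal (M (tag x)) x \<inter> right_ideal (M (tag x)) y = right_ideal (M (tag x)) r"
        using M.inter_ideals[OF xy(1,2)] by blast
      have tr: "tag r = tag x" by (rule tag[OF r(1)])
      have "r \<in> right_ideal (M (tag x)) x" using M.rid_self[OF r(1)] r(2) by blast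
      then obtain z where z: "z \<in> carrier (M (tag x))" "r = x \<odot> z" by (auto simp: right_ideal_def)
      have "letter r" unfolding z(2)
        by (rule letter_mult_letter[OF xy(3) carrier_G[OF z(1)]]) (simp add: tag[OF z(1)])
      then show ?thesis using 1 k r tr txy by (intro exI[of _ "[r]"]) auto
    next
      case 2
      then have "hd p = y" "hd p \<in> right_ideal (M (tag x)) x" using p by auto
      then show ?thesis using 2 k txy Cons.prems by (intro exI[of _ k]) auto
    next
      case 3
      then have "hd p = x" "hd p \<in> right_ideal (M (tag x)) y" using p txy by auto
      then show ?thesis using 3 k txy Cons.prems by (intro exI[of _ "x # j"]) auto
    next
      case 4
      then have e: "x = y" "pre j (tl p)" "pre k' (tl p)" using p by auto
      have "reduced (tl p)" using p(1) by (cases p) auto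
      then obtain L where L: "reduced L" "\<And>q. reduced q \<Longrightarrow> pre j q \<and> pre k' q \<longleftrightarrow> pre L q"
        using Cons.IH[of k'] Cons.prems k e by auto
      have "pre j L" using L pre_mul[of L "[]"] mul_Nil by auto
      then have Lh: "L \<noteq> []" "tag (hd L) = tag (hd j)" using pre_hd 4 by blast+
      have "reduced (x # L)" using L Lh Cons.prems 4 by auto
      moreover have "pre (x # j) q \<and> pre k q \<longleftrightarrow> pre (x # L) q" if "reduced q" for q
        using L(2)[of "tl q"] that 4 k e Lh by (cases q) auto
      ultimately show ?thesis by blast
    qed
  qed
qed

theorem right_lcm_NM: "right_lcm_monoid NM"
proof -
  interpret monoid NM by (rule monoid_NM)
  show ?thesis
  proof
    fix x y z assume "x \<in> carrier NM" "y \<in> carrier NM" "z \<in> carrier NM"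
    then have r: "reduced x" "reduced y" "reduced z" by auto
    show "y = z" if "x \<otimes>\<^bsub>NM\<^esub> y = x \<otimes>\<^bsub>NM\<^esub> z" using mul_inj[OF r] that unfolding NM_simps by blast
    show "x = \<one>\<^bsub>NM\<^esub>" if "x \<otimes>\<^bsub>NM\<^esub> y = \<one>\<^bsub>NM\<^esub>"
    proof -
      have "pre x []" using pre_mul[OF r(1,2)] that by simp
      then show ?thesis by (cases x) simp_all
    qed
    assume "right_ideal NM x \<inter> right_ideal NM y \<noteq> {}"
    then obtain L where L: "reduced L" "\<forall>p. reduced p \<longrightarrow> (pre x p \<and> pre y p \<longleftrightarrow> pre L p)"
      using inter_pre[OF r(1,2)] rid_iff[OF r(1)] rid_iff[OF r(2)] by auto
    have "right_ideal NM x \<inter> right_ideal NM y = right_ideal NM L"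
      by (rule Set.set_eqI) (use L(2) in \<open>simp only: Int_iff rid_iff[OF r(1)] rid_iff[OF r(2)] rid_iff[OF L(1)], blast\<close>)
    then show "\<exists>r\<in>carrier NM. right_ideal NM x \<inter> right_ideal NM y = right_ideal NM r" using L by auto
  qed
qed

sublocale NM: right_lcm_monoid NM by (rule right_lcm_NM)

section \<open>Complements of right ideals in a free product\<close>

lemma Omega_NM: "J \<subseteq> carrier NM \<Longrightarrow> Omega_set NM J = {p. reduced p \<and> (\<forall>j\<in>J. \<not> pre j p)}"
  unfolding Omega_set_def using rid_iff by auto

text \<open>The component of a normal form in the factor $i$: its first letter if that belongs
  to this factor, and the unit otherwise.\<close>

definition hdt :: "'i \<Rightarrow> 'l list \<Rightarrow> 'l" where
  "hdt i p = (if p \<noteq> [] \<and> tag (hd p) = i then hd p else \<one>\<^bsub>M i\<^esub>)"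

definition word :: "'l \<Rightarrow> 'l list" where "word q = (if q = unit q then [] else [q])"

lemma reduced_word: "q \<in> carrier (M i) \<Longrightarrow> reduced (word q)"
  using tag[of q i] by (auto simp: word_def letter_def G_carrier)

lemma hdt_carrier: "reduced p \<Longrightarrow> hdt i p \<in> carrier (M i)"
  by (cases p) (auto simp: hdt_def dest: letter_G simp: G_carrier)

lemma unit_not_in_ideal:
  assumes "letter x" "tag x = i" shows "\<one>\<^bsub>M i\<^esub> \<notin> right_ideal (M i) x"
proof
  assume "\<one>\<^bsub>M i\<^esub> \<in> right_ideal (M i) x"
  then obtain z where "z \<in> carrier (M i)" "x \<otimes>\<^bsub>M i\<^esub> z = \<one>\<^bsub>M i\<^esub>" unfolding right_ideal_def by (metis imageE)
  then have "x = \<one>\<^bsub>M i\<^esub>" using M.no_units[of x i z] letter_G[OF assms(1)] assms(2) by (simp add: G_carrier)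
  then show False using assms by (simp add: letter_def)
qed

lemma pre_word: "q \<in> carrier (M i) \<Longrightarrow> reduced p \<Longrightarrow> pre (word q) p \<longleftrightarrow> hdt i p \<in> right_ideal (M i) q"
proof -
  assume q: "q \<in> carrier (M i)" and p: "reduced p"
  have t: "tag q = i" by (rule tag[OF q])
  show ?thesis
  proof (cases "q = unit q")
    case True
    then have "right_ideal (M i) q = carrier (M i)" using M.rid_one[of i] t by simp
    then show ?thesis using True hdt_carrier[OF p, of i] by (simp add: word_def)
  next
    case False
    then have "letter q" using q t by (simp add: letter_def G_carrier)
    then show ?thesis using False t unit_not_in_ideal[of q i] by (auto simp: word_def hdt_def)
  qed
qed

lemma hdt_mul_word: "q \<in> carrier (M i) \<Longrightarrow> reduced v \<Longrightarrow> hdt i (mul (word q) v) = q \<otimes>\<^bsub>M i\<^esub> hdt i v"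
proof -
  assume q: "q \<in> carrier (M i)" and v: "reduced v"
  have t: "tag q = i" by (rule tag[OF q])
  show ?thesis
  proof (cases "q = unit q")
    case True
    then have "q = \<one>\<^bsub>M i\<^esub>" using t by simp
    then show ?thesis using True hdt_carrier[OF v, of i] by (simp add: word_def)
  next
    case False
    then have l: "letter q" using q t by (simp add: letter_def G_carrier)
    show ?thesis
    proof (cases "v \<noteq> [] \<and> tag (hd v) = i")
      case True
      then have "hd v \<in> carrier (M i)" using hdt_carrier[OF v, of i] by (simp add: hdt_def)
      then have "tag (q \<otimes>\<^bsub>M i\<^esub> hd v) = i" by (intro tag M.m_closed q)
      then show ?thesis using l False True t by (simp add: word_def push_letter hdt_def)
    next
      case F: False
      have "mul (word q) v = q # v" using l False F t by (auto simp: word_def push_letter)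
      then show ?thesis using F t q by (auto simp: hdt_def)
    qed
  qed
qed

context
  fixes Pa :: "'i \<Rightarrow> 'l set"
  assumes Pa: "\<And>i. Pa i \<subseteq> carrier (M i) - {\<one>\<^bsub>M i\<^esub>}" and om: "\<And>i. omega_property (M i) (Pa i)"
begin

definition "PaN = {[s] | s i. s \<in> Pa i}"

lemma Pa_letter: "s \<in> Pa i \<Longrightarrow> letter s \<and> tag s = i"
  using Pa[of i] tag[of s i] by (auto simp: letter_def G_carrier)

lemma PaN_carrier: "PaN \<subseteq> carrier NM" using Pa_letter by (auto simp: PaN_def)

text \<open>All conditions involved concern the component in one factor only.\<close>

lemma translate_word_Omega:
  assumes q: "q \<in> carrier (M i)" and K: "K \<subseteq> Pa i"
  shows "(\<lambda>x. mul (word q) x) ` Omega_set NM ((\<lambda>s. [s]) ` K) = {p. reduced p \<and> hdt i p \<in> (\<lambda>x. q \<otimes>\<^bsub>M i\<^esub> x) ` Omega_set (M i) K}"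
proof -
  have KN: "(\<lambda>s. [s]) ` K \<subseteq> carrier NM" using K Pa_letter by auto
  have O: "v \<in> Omega_set NM ((\<lambda>s. [s]) ` K) \<longleftrightarrow> reduced v \<and> hdt i v \<in> Omega_set (M i) K" for v
  proof -
    have "pre [s] v \<longleftrightarrow> hdt i v \<in> right_ideal (M i) s" if "s \<in> K" "reduced v" for s
    proof -
      have "s \<in> carrier (M i)" "word s = [s]" using that K Pa[of i] tag[of s i] by (auto simp: word_def)
      then show ?thesis using pre_word[of s i v] that by simp
    qed
    moreover have "v \<in> Omega_set NM ((\<lambda>s. [s]) ` K) \<longleftrightarrow> reduced v \<and> (\<forall>s\<in>K. \<not> pre [s] v)"
      unfolding Omega_NM[OF KN] by (simp del: pre.simps)
    moreover have "hdt i v \<in> Omega_set (M i) K \<longleftrightarrow> (\<forall>s\<in>K. hdt i v \<notin> right_ideal (M i) s)" if "reduced v"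
      using hdt_carrier[OF that, of i] by (auto simp: Omega_set_def)
    ultimately show ?thesis by blast
  qed
  show ?thesis
  proof (intro equalityI subsetI)
    fix p assume "p \<in> (\<lambda>x. mul (word q) x) ` Omega_set NM ((\<lambda>s. [s]) ` K)"
    then obtain v where v: "p = mul (word q) v" "reduced v" "hdt i v \<in> Omega_set (M i) K" using O by blast
    have "reduced p" unfolding v(1) using v(2) reduced_word[OF q] by (intro reduced_mul reduced_set)
    then show "p \<in> {p. reduced p \<and> hdt i p \<in> (\<lambda>x. q \<otimes>\<^bsub>M i\<^esub> x) ` Omega_set (M i) K}"
      using v hdt_mul_word[OF q v(2)] by auto
  next
    fix p assume "p \<in> {p. reduced p \<and> hdt i p \<in> (\<lambda>x. q \<otimes>\<^bsub>M i\<^esub> x) ` Omega_set (M i) K}"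
    then obtain w where p: "reduced p" "hdt i p = q \<otimes>\<^bsub>M i\<^esub> w" "w \<in> Omega_set (M i) K" by auto
    have wc: "w \<in> carrier (M i)" using p by (auto simp: Omega_set_def)
    then have "pre (word q) p" using pre_word[OF q p(1)] p(2) by (auto simp: right_ideal_def)
    then obtain v where v: "reduced v" "p = mul (word q) v" using pre_exists[OF reduced_word[OF q] p(1)] by blast
    have "q \<otimes>\<^bsub>M i\<^esub> hdt i v = q \<otimes>\<^bsub>M i\<^esub> w" using hdt_mul_word[OF q v(1)] v(2) p(2) by simp
    then have "hdt i v = w" using M.l_cancel_monoid[OF q] hdt_carrier[OF v(1), of i] wc by blast
    then show "p \<in> (\<lambda>x. mul (word q) x) ` Omega_set NM ((\<lambda>s. [s]) ` K)" using O v p by auto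
  qed
qed

text \<open>The letters of $J$ from one factor $i$ are replaced at once, by decomposing their
  complement in that factor into pieces $q\Omega_K$. For $q\ne e$ the words of the piece begin
  in factor $i$ and avoid the ideals of all letters from other factors. For $q=e$ generators
  have taken the place of letters, so fewer letters that are not generators remain.\<close>

lemma Omega_letters:
  "finite J \<Longrightarrow> (\<And>j. j \<in> J \<Longrightarrow> \<exists>x. j = [x] \<and> letter x) \<Longrightarrow> Omega_set NM J \<in> atom_family NM PaN"
proof (induction "card (J - PaN)" arbitrary: J rule: less_induct)
  case less
  have JN: "J \<subseteq> carrier NM" using less.prems(2) by force
  show ?case
  proof (cases "J \<subseteq> PaN")
    case True
    have "(\<lambda>x. [] \<otimes>\<^bsub>NM\<^esub> x) ` Omega_set NM J \<in> atom_family NM PaN"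
      by (rule atom_familyI) (use True less.prems in auto)
    then show ?thesis by simp
  next
    case False
    then obtain x where x: "[x] \<in> J" "[x] \<notin> PaN" "letter x" using less.prems(2) by blast
    define i where "i = tag x"
    define Y where "Y = {y. [y] \<in> J \<and> tag y = i}"
    define J' where "J' = {j \<in> J. tag (hd j) \<noteq> i}"
    have finY: "finite Y"
    proof -
      have "(\<lambda>y. [y]) ` Y \<subseteq> J" by (auto simp: Y_def)
      then have "finite ((\<lambda>y. [y]) ` Y)" using less.prems(1) finite_subset by blast
      then show ?thesis by (rule finite_imageD) (simp add: inj_on_def)
    qed
    have Yl: "letter y \<and> y \<in> carrier (M i)" if "y \<in> Y" for y
      using that less.prems(2)[of "[y]"] letter_G[of y] by (auto simp: Y_def G_carrier)
    have J_split: "J = (\<lambda>y. [y]) ` Y \<union> J'" using less.prems(2) by (force simp: Y_def J'_def)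
    have J'N: "J' \<subseteq> carrier NM" using JN by (auto simp: J'_def)
    have OY: "Omega_set (M i) Y \<in> atom_family (M i) (Pa i)" using om[of i] finY Yl by (auto simp: omega_property_def)
    obtain \<C> q K where C: "finite \<C>" "disjoint \<C>" "Omega_set (M i) Y = \<Union>\<C>"
      and qK: "\<And>C. C \<in> \<C> \<Longrightarrow> q C \<in> carrier (M i) \<and> finite (K C) \<and> K C \<subseteq> Pa i \<and> C = (\<lambda>x. q C \<otimes>\<^bsub>M i\<^esub> x) ` Omega_set (M i) (K C)"
      using atom_familyE[OF OY] by (elim exE conjE) (rule that, assumption+, erule (1) bspec)
    have piece: "{p. reduced p \<and> hdt i p \<in> C \<and> (\<forall>j\<in>J'. \<not> pre j p)} \<in> atom_family NM PaN" if c: "C \<in> \<C>" for C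
    proof -
      let ?KN = "(\<lambda>s. [s]) ` K C"
      have q: "q C \<in> carrier (M i)" "finite (K C)" "K C \<subseteq> Pa i" using qK[OF c] by auto
      have Ceq: "(\<lambda>x. q C \<otimes>\<^bsub>M i\<^esub> x) ` Omega_set (M i) (K C) = C" using qK[OF c] by argo
      have KN: "?KN \<subseteq> PaN" "finite ?KN" using q by (auto simp: PaN_def)
      have tr: "(\<lambda>x. mul (word (q C)) x) ` Omega_set NM ?KN = {p. reduced p \<and> hdt i p \<in> C}"
        using translate_word_Omega[OF q(1,3)] unfolding Ceq .
      show ?thesis
      proof (cases "q C = unit (q C)")
        case True
        then have w: "word (q C) = []" by (simp add: word_def)
        have KNN: "?KN \<subseteq> carrier NM" using KN PaN_carrier by blast
        have e: "{p. reduced p \<and> hdt i p \<in> C} = {p. reduced p \<and> (\<forall>j\<in>?KN. \<not> pre j p)}"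
          using tr w unfolding Omega_NM[OF KNN] by (simp del: pre.simps)
        have C_iff: "hdt i p \<in> C \<longleftrightarrow> (\<forall>j\<in>?KN. \<not> pre j p)" if "reduced p" for p
        proof -
          have "p \<in> {p. reduced p \<and> hdt i p \<in> C} \<longleftrightarrow> p \<in> {p. reduced p \<and> (\<forall>j\<in>?KN. \<not> pre j p)}" unfolding e ..
          then show ?thesis using that by (simp only: mem_Collect_eq simp_thms)
        qed
        have "?KN \<union> J' \<subseteq> carrier NM" using KNN J'N by blast
        note U = Omega_NM[OF this]
        have "{p. reduced p \<and> hdt i p \<in> C \<and> (\<forall>j\<in>J'. \<not> pre j p)} = Omega_set NM (?KN \<union> J')"
          unfolding U ball_Un
        proof (rule Collect_cong)
          fix p show "(reduced p \<and> hdt i p \<in> C \<and> (\<forall>j\<in>J'. \<not> pre j p)) =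
            (reduced p \<and> (\<forall>j\<in>?KN. \<not> pre j p) \<and> (\<forall>j\<in>J'. \<not> pre j p))"
            by (cases "reduced p") (simp_all only: C_iff simp_thms)
        qed
        moreover have "Omega_set NM (?KN \<union> J') \<in> atom_family NM PaN"
        proof (rule less.hyps)
          have "(?KN \<union> J') - PaN \<subseteq> J - PaN - {[x]}" using KN by (auto simp: J'_def i_def)
          then have "(?KN \<union> J') - PaN \<subset> J - PaN" using x by blast
          then show "card ((?KN \<union> J') - PaN) < card (J - PaN)" using less.prems(1) by (intro psubset_card_mono) auto
          show "finite (?KN \<union> J')" using KN less.prems(1) by (simp add: J'_def)
          show "\<exists>x. j = [x] \<and> letter x" if "j \<in> ?KN \<union> J'" for j
            using that less.prems(2) q(3) Pa_letter by (auto simp: J'_def)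
        qed
        ultimately show ?thesis by simp
      next
        case False
        have "\<not> pre j p" if "reduced p" "hdt i p \<in> C" "j \<in> J'" for j p
        proof
          assume pj: "pre j p"
          have "j \<noteq> []" using less.prems(2)[of j] that by (auto simp: J'_def)
          then have "tag (hd p) \<noteq> i" using pre_hd[OF pj] that by (auto simp: J'_def)
          then have "hdt i p = \<one>\<^bsub>M i\<^esub>" by (simp add: hdt_def)
          then have "\<one>\<^bsub>M i\<^esub> \<in> (\<lambda>x. q C \<otimes>\<^bsub>M i\<^esub> x) ` Omega_set (M i) (K C)" using that Ceq by simp
          then have "q C = \<one>\<^bsub>M i\<^esub>" using M.no_units[OF q(1)] by (auto simp: Omega_set_def)
          then show False using False unit_tag by simp
        qed
        then have "{p. reduced p \<and> hdt i p \<in> C \<and> (\<forall>j\<in>J'. \<not> pre j p)} = (\<lambda>x. mul (word (q C)) x) ` Omega_set NM ?KN"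
          unfolding tr by blast
        moreover have "(\<lambda>x. word (q C) \<otimes>\<^bsub>NM\<^esub> x) ` Omega_set NM ?KN \<in> atom_family NM PaN"
          by (rule atom_familyI) (use KN reduced_word[OF q(1)] in auto)
        ultimately show ?thesis by simp
      qed
    qed
    have "Omega_set NM J = (\<Union>C\<in>\<C>. {p. reduced p \<and> hdt i p \<in> C \<and> (\<forall>j\<in>J'. \<not> pre j p)})"
    proof -
      have Y_iff: "(\<forall>y\<in>Y. \<not> pre [y] p) \<longleftrightarrow> hdt i p \<in> Omega_set (M i) Y" if p: "reduced p" for p
      proof -
        have "pre [y] p \<longleftrightarrow> hdt i p \<in> right_ideal (M i) y" if "y \<in> Y" for y
        proof -
          have "word y = [y]" using Yl[OF that] by (auto simp: word_def letter_def)
          then show ?thesis using pre_word[of y i p] Yl[OF that] p by simp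
        qed
        then show ?thesis using hdt_carrier[OF p, of i] by (auto simp: Omega_set_def)
      qed
      have J_iff: "(\<forall>j\<in>J. \<not> pre j p) \<longleftrightarrow> (\<forall>y\<in>Y. \<not> pre [y] p) \<and> (\<forall>j\<in>J'. \<not> pre j p)" for p
        by (subst J_split) (simp add: ball_Un del: pre.simps)
      have iff: "(\<forall>j\<in>J. \<not> pre j p) \<longleftrightarrow> (\<exists>C\<in>\<C>. hdt i p \<in> C) \<and> (\<forall>j\<in>J'. \<not> pre j p)" if "reduced p" for p
        by (simp only: J_iff Y_iff[OF that] C(3) Union_iff)
      show ?thesis unfolding Omega_NM[OF JN]
      proof (rule Set.set_eqI)
        fix p show "p \<in> {p. reduced p \<and> (\<forall>j\<in>J. \<not> pre j p)} \<longleftrightarrow>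
            p \<in> (\<Union>C\<in>\<C>. {p. reduced p \<and> hdt i p \<in> C \<and> (\<forall>j\<in>J'. \<not> pre j p)})"
          by (cases "reduced p") (simp_all add: iff del: pre.simps)
      qed
    qed
    also have "\<dots> \<in> atom_family NM PaN"
      by (rule atom_family_UN[OF C(1) piece]) (use C(2) in \<open>auto simp: disjoint_def\<close>)
    finally show ?thesis .
  qed
qed

text \<open>The total length of the words that are not single letters.\<close>

definition weight :: "'l list set \<Rightarrow> nat" where "weight J = (\<Sum>j\<in>{j\<in>J. 2 \<le> length j}. length j)"

text \<open>Among the first letters of the longer words in $J$ let $x$ be one that divides no
  other. Separate the elements in the ideal of $x$ from the rest. Outside this ideal the words
  beginning with $x$ impose no condition and may be replaced by $x$ itself. Inside it, $x$ can
  be cancelled: a longer word in $J$ matters only if it begins with $x$, by the choice of $x$,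
  and single letters $y$ are replaced by what is missing from $x$ to the least common multiple
  of $x$ and $y$. Both steps lower the weight.\<close>

theorem Omega_free: "finite J \<Longrightarrow> J \<subseteq> carrier NM \<Longrightarrow> Omega_set NM J \<in> atom_family NM PaN"
proof (induction "weight J" arbitrary: J rule: less_induct)
  case less
  have red: "reduced j" if "j \<in> J" for j using less.prems that by auto
  show ?case
  proof (cases "[] \<in> J \<or> (\<forall>j\<in>J. length j \<le> 1)")
    case True
    show ?thesis
    proof (cases "[] \<in> J")
      case True
      then have "Omega_set NM J = {}" unfolding Omega_NM[OF less.prems(2)] by (auto intro: bexI[of _ "[]"])
      then show ?thesis by (simp add: atom_family_empty)
    next
      case False
      have "\<exists>x. j = [x] \<and> letter x" if "j \<in> J" for j
      proof -
        have "length j \<le> 1" "j \<noteq> []" using True False that by auto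
        then obtain x where "j = [x]" by (cases j) auto
        then show ?thesis using red[OF that] by simp
      qed
      then show ?thesis by (rule Omega_letters[OF less.prems(1)])
    qed
  next
    case False
    define L where "L = {x. \<exists>j'. j' \<noteq> [] \<and> x # j' \<in> J}"
    have Lne: "L \<noteq> {}"
    proof -
      obtain j where "j \<in> J" "1 < length j" using False by force
      then obtain x j' where "j = x # j'" "j' \<noteq> []" by (cases j) auto
      then show ?thesis using \<open>j \<in> J\<close> by (auto simp: L_def)
    qed
    have "L \<subseteq> hd ` J" by (force simp: L_def image_iff)
    then have finL: "finite L" using less.prems(1) finite_subset by blast
    have Lc: "letter x" "x \<in> carrier (M (tag x))" if "x \<in> L" for x
      using that red letter_G by (force simp: L_def G_carrier)+
    define mm where "mm x = card {y\<in>L. tag y = tag x \<and> y \<in> right_ideal (M (tag x)) x}" for x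
    obtain x where x: "x \<in> L" "\<And>y. y \<in> L \<Longrightarrow> mm x \<le> mm y"
    proof -
      have "Min (mm ` L) \<in> mm ` L" using finL Lne by (intro Min_in) auto
      then obtain x where "x \<in> L" "mm x = Min (mm ` L)" by force
      then show ?thesis using that finL Min_le[of "mm ` L"] by force
    qed
    define i where "i = tag x"
    have xc: "letter x" "x \<in> carrier (M i)" "word x = [x]" using Lc[OF x(1)] by (auto simp: i_def word_def letter_def)
    \<comment> \<open>Another letter of $L$ in the ideal of $x$ would have fewer letters of $L$
      in its own ideal.\<close>
    have maximal: "y = x" if y: "y \<in> L" "tag y = i" "y \<in> right_ideal (M i) x" for y
    proof (rule ccontr)
      assume "y \<noteq> x"
      have yc: "y \<in> carrier (M i)" using Lc y by auto
      have "x \<notin> right_ideal (M i) y" using M.rid_antisym[OF xc(2) yc] y \<open>y \<noteq> x\<close> by blast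
      moreover have "{z\<in>L. tag z = tag y \<and> z \<in> right_ideal (M (tag y)) y} \<subseteq> {z\<in>L. tag z = tag x \<and> z \<in> right_ideal (M (tag x)) x}"
        using M.rid_mono[OF xc(2) y(3)] y by (auto simp: i_def)
      moreover have "x \<in> {z\<in>L. tag z = tag x \<and> z \<in> right_ideal (M (tag x)) x}" using x M.rid_self[OF xc(2)] by (auto simp: i_def)
      ultimately have "{z\<in>L. tag z = tag y \<and> z \<in> right_ideal (M (tag y)) y} \<subset> {z\<in>L. tag z = tag x \<and> z \<in> right_ideal (M (tag x)) x}"
        using y by auto
      then have "mm y < mm x" unfolding mm_def using finL by (intro psubset_card_mono) auto
      then show False using x(2)[OF y(1)] by simp
    qed
    define T where "T = {j'. j' \<noteq> [] \<and> x # j' \<in> J}"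
    define Y where "Y = {y. [y] \<in> J \<and> tag y = i}"
    have Yc: "y \<in> carrier (M i)" if "y \<in> Y" for y
    proof -
      have "letter y" "tag y = i" using that red[of "[y]"] by (auto simp: Y_def)
      then show ?thesis using letter_G[of y] by (simp add: G_carrier)
    qed
    have "\<exists>w. w \<in> carrier (M i) \<and> right_ideal (M i) x \<inter> right_ideal (M i) y = right_ideal (M i) (x \<otimes>\<^bsub>M i\<^esub> w)"
      if y: "y \<in> Y" and ne: "right_ideal (M i) x \<inter> right_ideal (M i) y \<noteq> {}" for y
    proof -
      obtain r where r: "r \<in> carrier (M i)" "right_ideal (M i) x \<inter> right_ideal (M i) y = right_ideal (M i) r"
        using M.inter_ideals[OF xc(2) Yc[OF y] ne] by blast
      then have "r \<in> right_ideal (M i) x" using M.rid_self[OF r(1)] by blast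
      then show ?thesis using r by (auto simp: right_ideal_def)
    qed
    then obtain w where w: "\<And>y. y \<in> Y \<Longrightarrow> right_ideal (M i) x \<inter> right_ideal (M i) y \<noteq> {} \<Longrightarrow>
      w y \<in> carrier (M i) \<and> right_ideal (M i) x \<inter> right_ideal (M i) y = right_ideal (M i) (x \<otimes>\<^bsub>M i\<^esub> w y)" by metis
    define W where "W = (\<lambda>y. word (w y)) ` {y\<in>Y. right_ideal (M i) x \<inter> right_ideal (M i) y \<noteq> {}}"
    have finT: "finite T"
    proof -
      have "(#) x ` T \<subseteq> J" by (auto simp: T_def)
      then have "finite ((#) x ` T)" using less.prems(1) finite_subset by blast
      then show ?thesis by (rule finite_imageD) (simp add: inj_on_def)
    qed
    have finY: "finite Y"
    proof -
      have "(\<lambda>y. [y]) ` Y \<subseteq> J" by (auto simp: Y_def)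
      then have "finite ((\<lambda>y. [y]) ` Y)" using less.prems(1) finite_subset by blast
      then show ?thesis by (rule finite_imageD) (simp add: inj_on_def)
    qed
    define J'' where "J'' = T \<union> W"
    define J1 where "J1 = insert [x] (J - (#) x ` T)"
    have "reduced j" if "j \<in> T" for j using red[of "x # j"] that by (auto simp: T_def)
    moreover have "reduced j" if "j \<in> W" for j using that reduced_word w unfolding W_def by blast
    ultimately have J''N: "J'' \<subseteq> carrier NM" by (auto simp: J''_def)
    have J1N: "J1 \<subseteq> carrier NM" using less.prems(2) xc by (auto simp: J1_def)
    have fin: "finite J''" "finite J1" using finT finY less.prems(1) by (auto simp: J''_def W_def J1_def)
    have long: "2 \<le> length (x # j')" if "j' \<in> T" for j' using that by (cases j') (auto simp: T_def)
    have Tne: "T \<noteq> {}" using x by (auto simp: T_def L_def)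
    have finlong: "finite {j\<in>J. 2 \<le> length j}" using less.prems(1) by simp
    have sub: "(#) x ` T \<subseteq> {j\<in>J. 2 \<le> length j}" using long by (auto simp: T_def)
    have wJ: "(\<Sum>j\<in>(#) x ` T. length j) \<le> weight J" unfolding weight_def by (rule sum_mono2[OF finlong sub]) simp
    have sumT: "(\<Sum>j\<in>(#) x ` T. length j) = (\<Sum>j'\<in>T. Suc (length j'))" by (subst sum.reindex) (auto simp: inj_on_def)
    have "weight J'' \<le> (\<Sum>j'\<in>T. length j')" unfolding weight_def
    proof (rule sum_mono2[OF finT])
      show "{j \<in> J''. 2 \<le> length j} \<subseteq> T" by (auto simp: J''_def W_def word_def split: if_splits)
    qed simp
    also have "\<dots> < (\<Sum>j'\<in>T. Suc (length j'))" using finT Tne by (intro sum_strict_mono) auto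
    finally have w1: "weight J'' < weight J" using wJ sumT by simp
    have w2: "weight J1 < weight J"
    proof -
      have "{j\<in>J1. 2 \<le> length j} = {j\<in>J. 2 \<le> length j} - (#) x ` T" by (auto simp: J1_def)
      then have "weight J1 + (\<Sum>j\<in>(#) x ` T. length j) = weight J"
        unfolding weight_def using sum.subset_diff[OF sub finlong, of length] by simp
      moreover have "0 < (\<Sum>j\<in>(#) x ` T. length j)" unfolding sumT using finT Tne by (intro sum_pos) auto
      ultimately show ?thesis by linarith
    qed
    have key: "(\<forall>j\<in>J. \<not> pre j (mul [x] v)) \<longleftrightarrow> (\<forall>j\<in>J''. \<not> pre j v)" if v: "reduced v" for v
    proof -
      let ?p = "mul [x] v"
      have hp: "hdt i ?p = x \<otimes>\<^bsub>M i\<^esub> hdt i v" using hdt_mul_word[OF xc(2) v] xc(3) by simp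
      have pp: "pre [x] ?p" using pre_mul[of "[x]" v] xc v by simp
      have pn: "?p \<noteq> []" "tag (hd ?p) = i" using pre_hd[OF pp] by (auto simp: i_def)
      have hv: "hdt i v \<in> carrier (M i)" by (rule hdt_carrier[OF v])
      have rp: "reduced ?p" using xc v letter_G by (intro reduced_mul) auto
      have letters: "pre [y] ?p \<longleftrightarrow> right_ideal (M i) x \<inter> right_ideal (M i) y \<noteq> {} \<and> pre (word (w y)) v" if y: "y \<in> Y" for y
      proof -
        have wy: "word y = [y]" using red[of "[y]"] y by (auto simp: Y_def word_def letter_def)
        have "pre [y] ?p \<longleftrightarrow> x \<otimes>\<^bsub>M i\<^esub> hdt i v \<in> right_ideal (M i) y" using pre_word[OF Yc[OF y] rp] wy hp by simp
        also have "\<dots> \<longleftrightarrow> x \<otimes>\<^bsub>M i\<^esub> hdt i v \<in> right_ideal (M i) x \<inter> right_ideal (M i) y" using hv by (auto simp: right_ideal_def)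
        also have "\<dots> \<longleftrightarrow> right_ideal (M i) x \<inter> right_ideal (M i) y \<noteq> {} \<and> hdt i v \<in> right_ideal (M i) (w y)"
        proof (cases "right_ideal (M i) x \<inter> right_ideal (M i) y = {}")
          case False
          then show ?thesis using w[OF y False] M.rid_cancel[OF xc(2) _ hv, of "w y"] by simp
        qed simp
        also have "\<dots> \<longleftrightarrow> right_ideal (M i) x \<inter> right_ideal (M i) y \<noteq> {} \<and> pre (word (w y)) v"
          using w[OF y] pre_word[of "w y" i v] v by blast
        finally show ?thesis .
      qed
      have longs: "pre (y # j') ?p \<longleftrightarrow> y = x \<and> pre j' v" if yj: "y # j' \<in> J" "j' \<noteq> []" for y j'
      proof
        assume a: "pre (y # j') ?p"
        then have hy: "hd ?p = y" "pre j' (tl ?p)" using yj by auto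
        have yL: "y \<in> L" using yj by (auto simp: L_def)
        have "hdt i ?p = y" using hy pn by (simp add: hdt_def)
        then have "y \<in> right_ideal (M i) x" using hp hv by (auto simp: right_ideal_def)
        then have yx: "y = x" using maximal[OF yL] hy pn by simp
        have "x \<otimes>\<^bsub>M i\<^esub> hdt i v = x \<otimes>\<^bsub>M i\<^esub> \<one>\<^bsub>M i\<^esub>" using hp \<open>hdt i ?p = y\<close> yx xc by simp
        then have "hdt i v = \<one>\<^bsub>M i\<^esub>" using M.l_cancel_monoid[OF xc(2) hv] by blast
        then have "\<not> (v \<noteq> [] \<and> tag (hd v) = i)" using v by (cases v) (auto simp: hdt_def letter_def)
        then have "?p = x # v" using xc by (auto simp: push_letter i_def)
        then show "y = x \<and> pre j' v" using hy yx by simp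
      next
        assume a: "y = x \<and> pre j' v"
        have "tag (hd j') \<noteq> i" using red[OF yj(1)] yj a by (simp add: i_def)
        then have "\<not> (v \<noteq> [] \<and> tag (hd v) = i)" using pre_hd[of j' v] a yj by auto
        then have "?p = x # v" using xc by (auto simp: push_letter i_def)
        then show "pre (y # j') ?p" using a yj by simp
      qed
      have others: "\<not> pre [y] ?p" if "tag y \<noteq> i" for y using pre_hd[of "[y]" ?p] pn that by auto
      have "[] \<notin> J" using False by blast
      then have "(\<exists>j\<in>J. pre j ?p) \<longleftrightarrow> (\<exists>y. [y] \<in> J \<and> pre [y] ?p) \<or> (\<exists>y j'. j' \<noteq> [] \<and> y # j' \<in> J \<and> pre (y # j') ?p)"
        by (metis list.exhaust)
      also have "\<dots> \<longleftrightarrow> (\<exists>y\<in>Y. pre [y] ?p) \<or> (\<exists>j'\<in>T. pre j' v)"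
      proof -
        have "(\<exists>y. [y] \<in> J \<and> pre [y] ?p) \<longleftrightarrow> (\<exists>y\<in>Y. pre [y] ?p)" using others unfolding Y_def by blast
        moreover have "(\<exists>y j'. j' \<noteq> [] \<and> y # j' \<in> J \<and> pre (y # j') ?p) \<longleftrightarrow> (\<exists>j'\<in>T. pre j' v)"
          using longs unfolding T_def by blast
        ultimately show ?thesis by simp
      qed
      also have "\<dots> \<longleftrightarrow> (\<exists>j\<in>J''. pre j v)" using letters by (auto simp: J''_def W_def simp del: pre.simps)
      finally show ?thesis by blast
    qed
    have "Omega_set NM J = (\<lambda>v. mul [x] v) ` Omega_set NM J'' \<union> Omega_set NM J1"
    proof (intro equalityI subsetI)
      fix p assume "p \<in> Omega_set NM J"
      then have p: "reduced p" "\<forall>j\<in>J. \<not> pre j p" unfolding Omega_NM[OF less.prems(2)] by auto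
      show "p \<in> (\<lambda>v. mul [x] v) ` Omega_set NM J'' \<union> Omega_set NM J1"
      proof (cases "pre [x] p")
        case True
        then obtain v where v: "reduced v" "p = mul [x] v" using pre_exists[of "[x]" p] xc p by auto
        then have "v \<in> Omega_set NM J''" unfolding Omega_NM[OF J''N] using key[OF v(1)] p by blast
        then show ?thesis using v by blast
      next
        case False
        then show ?thesis unfolding Omega_NM[OF J1N] using p by (auto simp: J1_def simp del: pre.simps)
      qed
    next
      fix p assume "p \<in> (\<lambda>v. mul [x] v) ` Omega_set NM J'' \<union> Omega_set NM J1"
      then show "p \<in> Omega_set NM J"
      proof
        assume "p \<in> (\<lambda>v. mul [x] v) ` Omega_set NM J''"
        then obtain v where v: "p = mul [x] v" "reduced v" "\<forall>j\<in>J''. \<not> pre j v" unfolding Omega_NM[OF J''N] by blast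
        have "reduced p" unfolding v(1) using xc v letter_G by (intro reduced_mul) auto
        then show ?thesis unfolding Omega_NM[OF less.prems(2)] using key[OF v(2)] v by blast
      next
        assume "p \<in> Omega_set NM J1"
        then have p: "reduced p" "\<forall>j\<in>J1. \<not> pre j p" unfolding Omega_NM[OF J1N] by auto
        have nx: "\<not> pre [x] p" using p by (auto simp: J1_def simp del: pre.simps)
        have "\<not> pre (x # j') p" if "j' \<in> T" for j'
        proof
          assume "pre (x # j') p"
          then have "p \<noteq> []" "hd p = x" using that by (auto simp: T_def)
          then have "pre [x] p" using M.rid_self[OF xc(2)] by (simp add: i_def)
          then show False using nx by blast
        qed
        then show ?thesis unfolding Omega_NM[OF less.prems(2)] using p by (auto simp: J1_def simp del: pre.simps)
      qed
    qed
    moreover have "(\<lambda>v. mul [x] v) ` Omega_set NM J'' \<inter> Omega_set NM J1 = {}"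
    proof (intro equals0I)
      fix p assume p: "p \<in> (\<lambda>v. mul [x] v) ` Omega_set NM J'' \<inter> Omega_set NM J1"
      then obtain v where "p = mul [x] v" "reduced v" unfolding Omega_NM[OF J''N] by blast
      then have "pre [x] p" using pre_mul[of "[x]" v] xc by simp
      then show False using p unfolding Omega_NM[OF J1N] by (auto simp: J1_def simp del: pre.simps)
    qed
    moreover have "(\<lambda>v. [x] \<otimes>\<^bsub>NM\<^esub> v) ` Omega_set NM J'' \<in> atom_family NM PaN"
      by (rule atom_family_translate[OF right_lcm_NM _ PaN_carrier less.hyps[OF w1 fin(1) J''N]]) (use xc in simp)
    moreover have "Omega_set NM J1 \<in> atom_family NM PaN" by (rule less.hyps[OF w2 fin(2) J1N])
    ultimately show ?thesis using atom_family_Un[of "(\<lambda>v. mul [x] v) ` Omega_set NM J''" NM PaN "Omega_set NM J1"] by simp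
  qed
qed

end

section \<open>Free products by generators and relations\<close>

definition "fam_relations = {([a, b], [a \<odot> b]) | a b. a \<in> G \<and> b \<in> G \<and> tag a = tag b} \<union> {([\<one>\<^bsub>M i\<^esub>], []) | i. True}"

sublocale FP: presentation G fam_relations
  by standard (use mult_G carrier_G[OF M.one_closed] in \<open>auto simp: fam_relations_def\<close>)

text \<open>The defining relations hold for the action of words on normal forms, so congruent
  words have the same normal form.\<close>

lemma mul_cong: "word_cong fam_relations u v \<Longrightarrow> set u \<subseteq> G \<longrightarrow> (\<forall>ws. reduced ws \<longrightarrow> mul u ws = mul v ws)"
proof (induction rule: word_cong.induct)
  case (rel u v x y)
  show ?case
  proof (intro impI allI)
    fix ws assume a: "set (x @ u @ y) \<subseteq> G" "reduced ws"
    then have "reduced (mul y ws)" by (intro reduced_mul) auto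
    then have "mul u (mul y ws) = mul v (mul y ws)"
      using rel push_push push_unit by (auto simp: fam_relations_def)
    then show "mul (x @ u @ y) ws = mul (x @ v @ y) ws" by (simp add: mul_append)
  qed
next
  case (sym u v)
  then show ?case using word_cong_lists[OF sym(1) FP.R_words] by (metis in_lists_conv_set subset_code(1))
next
  case (trans u v w)
  then show ?case using word_cong_lists[OF trans(1) FP.R_words] by (metis in_lists_conv_set subset_code(1))
qed simp

lemma push_cong: "x \<in> G \<Longrightarrow> reduced ws \<Longrightarrow> word_cong fam_relations (x # ws) (push x ws)"
proof (cases "x = unit x")
  case True
  then have "([x], []) \<in> fam_relations" by (auto simp: fam_relations_def)
  then have "word_cong fam_relations ([] @ [x] @ ws) ([] @ [] @ ws)" by (rule word_cong.rel)
  then show ?thesis using True by (simp add: push_def)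
next
  case False
  assume x: "x \<in> G" and ws: "reduced ws"
  show ?thesis
  proof (cases "ws \<noteq> [] \<and> tag (hd ws) = tag x")
    case True
    then obtain h t where h: "ws = h # t" "tag h = tag x" by (cases ws) auto
    then have "([x, h], [x \<odot> h]) \<in> fam_relations" using x ws letter_G by (auto simp: fam_relations_def)
    then have "word_cong fam_relations ([] @ [x, h] @ t) ([] @ [x \<odot> h] @ t)" by (rule word_cong.rel)
    then show ?thesis using False h by (simp add: push_def)
  next
    case F: False
    then have "push x ws = x # ws" using False by (auto simp: push_def)
    then show ?thesis by (simp add: word_cong.refl)
  qed
qed

lemma mul_word_cong: "set u \<subseteq> G \<Longrightarrow> reduced v \<Longrightarrow> word_cong fam_relations (u @ v) (mul u v)"
proof (induction u)
  case (Cons x u)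
  have "word_cong fam_relations ([x] @ (u @ v)) ([x] @ mul u v)" using Cons by (intro word_cong_append word_cong.refl) auto
  also have "word_cong fam_relations ([x] @ mul u v) (push x (mul u v))"
    using push_cong[of x "mul u v"] Cons reduced_mul by simp
  finally show ?case by simp
qed (simp add: word_cong.refl)

lemma iso_FP: "monoid_iso NM FP.PM FP.cls"
proof
  have words: "u \<in> lists G" if "reduced u" for u using reduced_set[OF that] by auto
  show "bij_betw FP.cls (carrier NM) (carrier FP.PM)"
    unfolding bij_betw_def
  proof (intro conjI inj_onI equalityI subsetI)
    fix u v assume "u \<in> carrier NM" "v \<in> carrier NM" and e: "FP.cls u = FP.cls v"
    then have r: "reduced u" "reduced v" by auto
    then have "word_cong fam_relations u v" using e FP.cls_eq words by blast
    then have "mul u [] = mul v []" using mul_cong reduced_set[OF r(1)] by auto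
    then show "u = v" using r by (simp add: mul_Nil)
  next
    fix p assume "p \<in> FP.cls ` carrier NM"
    then show "p \<in> carrier FP.PM" using words by (auto simp: FP.carrier_PM)
  next
    fix p assume "p \<in> carrier FP.PM"
    then obtain w where w: "w \<in> lists G" "p = FP.cls w" unfolding FP.carrier_PM by blast
    then have s: "set w \<subseteq> G" by auto
    have r: "reduced (mul w [])" using reduced_mul[OF s] by simp
    have "word_cong fam_relations w (mul w [])" using mul_word_cong[OF s, of "[]"] by simp
    then have "p = FP.cls (mul w [])" using w FP.cls_eq[OF w(1) words[OF r]] by simp
    then show "p \<in> FP.cls ` carrier NM" using r by auto
  qed
  show "FP.cls (x \<otimes>\<^bsub>NM\<^esub> y) = FP.cls x \<otimes>\<^bsub>FP.PM\<^esub> FP.cls y" if xy: "x \<in> carrier NM" "y \<in> carrier NM" for x y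
  proof -
    have r: "reduced x" "reduced y" using xy by auto
    have "word_cong fam_relations (x @ y) (mul x y)" using mul_word_cong reduced_set[OF r(1)] r by blast
    then have "FP.cls (x @ y) = FP.cls (mul x y)"
      using FP.cls_eq[of "x @ y" "mul x y"] words[OF r(1)] words[OF r(2)] words[OF reduced_mul[OF reduced_set[OF r(1)] r(2)]] by simp
    then show ?thesis using words r by (simp add: FP.mult_PM)
  qed
  show "FP.cls \<one>\<^bsub>NM\<^esub> = \<one>\<^bsub>FP.PM\<^esub>" by (simp add: FP.one_PM)
qed

lemma generated_FP:
  assumes gen: "\<And>i Q p. Q \<one>\<^bsub>M i\<^esub> \<Longrightarrow> (\<And>p s. p \<in> carrier (M i) \<Longrightarrow> s \<in> Pa i \<Longrightarrow> Q p \<Longrightarrow> Q (p \<otimes>\<^bsub>M i\<^esub> s)) \<Longrightarrow> p \<in> carrier (M i) \<Longrightarrow> Q p"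
    and Pa: "\<And>i. Pa i \<subseteq> carrier (M i)"
    and Q: "Q \<one>\<^bsub>FP.PM\<^esub>" "\<And>p s i. p \<in> carrier FP.PM \<Longrightarrow> s \<in> Pa i \<Longrightarrow> Q p \<Longrightarrow> Q (p \<otimes>\<^bsub>FP.PM\<^esub> FP.cls [s])"
    and p: "p \<in> carrier FP.PM"
  shows "Q p"
  using p
proof (rule FP.generated_PM[rotated 2])
  show "Q (FP.cls [])" using Q(1) by (simp add: FP.one_PM)
  fix w l assume w: "w \<in> lists G" "l \<in> G" "Q (FP.cls w)"
  let ?i = "tag l"
  show "Q (FP.cls (w @ [l]))"
  proof (rule gen[of "\<lambda>l. Q (FP.cls (w @ [l]))" ?i])
    have "word_cong fam_relations (w @ [\<one>\<^bsub>M ?i\<^esub>] @ []) (w @ [] @ [])"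
      by (rule word_cong.rel) (auto simp: fam_relations_def)
    then have "FP.cls (w @ [\<one>\<^bsub>M ?i\<^esub>]) = FP.cls w"
      using FP.cls_eq[of "w @ [\<one>\<^bsub>M ?i\<^esub>]" w] w carrier_G[OF M.one_closed] by simp
    then show "Q (FP.cls (w @ [\<one>\<^bsub>M ?i\<^esub>]))" using w by simp
  next
    fix p s assume ps: "p \<in> carrier (M ?i)" "s \<in> Pa ?i" "Q (FP.cls (w @ [p]))"
    have sG: "s \<in> carrier (M ?i)" using ps Pa by blast
    have t: "tag p = ?i" "tag s = ?i" by (rule tag[OF ps(1)], rule tag[OF sG])
    have g: "p \<in> G" "s \<in> G" using carrier_G ps sG by blast+
    have "word_cong fam_relations (w @ [p, s] @ []) (w @ [p \<odot> s] @ [])"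
      by (rule word_cong.rel) (use g t in \<open>auto simp: fam_relations_def\<close>)
    then have "FP.cls (w @ [p \<odot> s]) = FP.cls ((w @ [p]) @ [s])"
      using FP.cls_eq[of "w @ [p, s]" "w @ [p \<odot> s]"] w g mult_G[OF g] t by simp
    also have "\<dots> = FP.cls (w @ [p]) \<otimes>\<^bsub>FP.PM\<^esub> FP.cls [s]" using w g by (intro FP.mult_PM[symmetric]) auto
    finally show "Q (FP.cls (w @ [p \<otimes>\<^bsub>M ?i\<^esub> s]))"
      using Q(2)[of "FP.cls (w @ [p])" s ?i] ps w g t by (simp add: FP.carrier_PM)
  qed (use w in \<open>simp add: G_carrier\<close>)
qed

end

section \<open>Admissible generators\<close>

definition generated_by :: "('p, 'k) monoid_scheme \<Rightarrow> 'p set \<Rightarrow> bool" where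
  "generated_by P Pa \<longleftrightarrow>
    (\<forall>Q. Q \<one>\<^bsub>P\<^esub> \<longrightarrow> (\<forall>p\<in>carrier P. \<forall>s\<in>Pa. Q p \<longrightarrow> Q (p \<otimes>\<^bsub>P\<^esub> s)) \<longrightarrow> (\<forall>p\<in>carrier P. Q p))"

lemma generated_byI:
  assumes "\<And>Q p. \<lbrakk>Q \<one>\<^bsub>P\<^esub>; \<And>p s. \<lbrakk>p \<in> carrier P; s \<in> Pa; Q p\<rbrakk> \<Longrightarrow> Q (p \<otimes>\<^bsub>P\<^esub> s); p \<in> carrier P\<rbrakk> \<Longrightarrow> Q p"
  shows "generated_by P Pa"
  unfolding generated_by_def by (intro allI impI ballI) (rule assms, auto)

lemma generated_byD:
  assumes "generated_by P Pa" "Q \<one>\<^bsub>P\<^esub>" "\<And>p s. \<lbrakk>p \<in> carrier P; s \<in> Pa; Q p\<rbrakk> \<Longrightarrow> Q (p \<otimes>\<^bsub>P\<^esub> s)" "p \<in> carrier P"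
  shows "Q p"
  using assms(1)[unfolded generated_by_def, THEN spec[of _ Q]] assms(2-4) by blast

text \<open>The properties of a monoid and its generators from which the reduction
  follows.\<close>

definition admissible_generators :: "('p, 'k) monoid_scheme \<Rightarrow> 'p set \<Rightarrow> bool" where
  "admissible_generators P Pa \<longleftrightarrow>
    right_lcm_monoid P \<and> Pa \<subseteq> carrier P - {\<one>\<^bsub>P\<^esub>} \<and> generated_by P Pa \<and> omega_property P Pa"

section \<open>Direct products\<close>

lemma (in right_lcm_monoid) ideal_mem_atom_family: "p \<in> carrier P \<Longrightarrow> right_ideal P p \<in> atom_family P Pa"
  using atom_familyI[of p P "{}" Pa] by (simp add: Omega_set_def right_ideal_def)

lemma DirProd_sel:
  "carrier (A \<times>\<times> B) = carrier A \<times> carrier B" "\<one>\<^bsub>A \<times>\<times> B\<^esub> = (\<one>\<^bsub>A\<^esub>, \<one>\<^bsub>B\<^esub>)"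
  "(p, q) \<otimes>\<^bsub>A \<times>\<times> B\<^esub> (p', q') = (p \<otimes>\<^bsub>A\<^esub> p', q \<otimes>\<^bsub>B\<^esub> q')"
  by (simp_all add: DirProd_def)

lemma right_ideal_DirProd: "right_ideal (A \<times>\<times> B) (p, q) = right_ideal A p \<times> right_ideal B q"
  unfolding right_ideal_def by (force simp: DirProd_sel image_iff)

context
  fixes A :: "'p monoid" and B :: "'q monoid" and Pa Qa
  assumes A: "right_lcm_monoid A" and B: "right_lcm_monoid B"
    and Pa: "Pa \<subseteq> carrier A - {\<one>\<^bsub>A\<^esub>}" and Qa: "Qa \<subseteq> carrier B - {\<one>\<^bsub>B\<^esub>}"
begin

interpretation A: right_lcm_monoid A by (rule A)
interpretation B: right_lcm_monoid B by (rule B)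

lemma right_lcm_DirProd: "right_lcm_monoid (A \<times>\<times> B)"
proof -
  interpret monoid "A \<times>\<times> B" by (rule DirProd_monoid) unfold_locales
  show ?thesis
  proof
    fix x y z assume "x \<in> carrier (A \<times>\<times> B)" "y \<in> carrier (A \<times>\<times> B)" "z \<in> carrier (A \<times>\<times> B)"
    then obtain a b c d e f where x: "x = (a, b)" "a \<in> carrier A" "b \<in> carrier B"
      and y: "y = (c, d)" "c \<in> carrier A" "d \<in> carrier B" and z: "z = (e, f)" "e \<in> carrier A" "f \<in> carrier B"
      by (auto simp: DirProd_sel)
    show "y = z" if "x \<otimes>\<^bsub>A \<times>\<times> B\<^esub> y = x \<otimes>\<^bsub>A \<times>\<times> B\<^esub> z"
      using that A.l_cancel_monoid[OF x(2) y(2) z(2)] B.l_cancel_monoid[OF x(3) y(3) z(3)]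
      unfolding x(1) y(1) z(1) DirProd_sel by blast
    show "x = \<one>\<^bsub>A \<times>\<times> B\<^esub>" if "x \<otimes>\<^bsub>A \<times>\<times> B\<^esub> y = \<one>\<^bsub>A \<times>\<times> B\<^esub>"
      using that A.no_units[OF x(2) y(2)] B.no_units[OF x(3) y(3)]
      unfolding x(1) y(1) DirProd_sel by blast
    assume "right_ideal (A \<times>\<times> B) x \<inter> right_ideal (A \<times>\<times> B) y \<noteq> {}"
    then have "right_ideal A a \<inter> right_ideal A c \<noteq> {}" "right_ideal B b \<inter> right_ideal B d \<noteq> {}"
      unfolding x(1) y(1) right_ideal_DirProd by blast+
    then obtain r s where r: "r \<in> carrier A" "right_ideal A a \<inter> right_ideal A c = right_ideal A r"
      and s: "s \<in> carrier B" "right_ideal B b \<inter> right_ideal B d = right_ideal B s"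
      using A.inter_ideals[OF x(2) y(2)] B.inter_ideals[OF x(3) y(3)] by blast
    show "\<exists>r\<in>carrier (A \<times>\<times> B). right_ideal (A \<times>\<times> B) x \<inter> right_ideal (A \<times>\<times> B) y = right_ideal (A \<times>\<times> B) r"
      by (rule bexI[of _ "(r, s)"])
         (simp_all add: x(1) y(1) right_ideal_DirProd Times_Int_Times r s DirProd_sel)
  qed
qed

abbreviation "gens \<equiv> direct_product_generators A Pa B Qa"

lemma direct_product_generators_mem: "gens \<subseteq> carrier (A \<times>\<times> B) - {\<one>\<^bsub>A \<times>\<times> B\<^esub>}"
  using Pa Qa by (auto simp: direct_product_generators_def DirProd_sel)

text \<open>The ideal of $(s,e)$ is $sA\times B$, so $\Omega_K\times\Omega_L$ is the complement
  of ideals of generators of the product.\<close>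

lemma rectangle_mem:
  assumes "U \<in> atom_family A Pa" "V \<in> atom_family B Qa" shows "U \<times> V \<in> atom_family (A \<times>\<times> B) gens"
proof -
  obtain \<C> q K where C: "finite \<C>" "disjoint \<C>" "U = \<Union>\<C>"
    and qK: "\<And>C. C \<in> \<C> \<Longrightarrow> q C \<in> carrier A \<and> finite (K C) \<and> K C \<subseteq> Pa \<and> C = (\<lambda>x. q C \<otimes>\<^bsub>A\<^esub> x) ` Omega_set A (K C)"
    using atom_familyE[OF assms(1)] by (elim exE conjE) (rule that, assumption+, erule (1) bspec)
  obtain \<D> r L where D: "finite \<D>" "disjoint \<D>" "V = \<Union>\<D>"
    and rL: "\<And>D. D \<in> \<D> \<Longrightarrow> r D \<in> carrier B \<and> finite (L D) \<and> L D \<subseteq> Qa \<and> D = (\<lambda>x. r D \<otimes>\<^bsub>B\<^esub> x) ` Omega_set B (L D)"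
    using atom_familyE[OF assms(2)] by (elim exE conjE) (rule that, assumption+, erule (1) bspec)
  have piece: "C \<times> D \<in> atom_family (A \<times>\<times> B) gens" if c: "C \<in> \<C>" and d: "D \<in> \<D>" for C D
  proof -
    let ?K = "(\<lambda>s. (s, \<one>\<^bsub>B\<^esub>)) ` K C \<union> (\<lambda>t. (\<one>\<^bsub>A\<^esub>, t)) ` L D"
    have O: "Omega_set (A \<times>\<times> B) ?K = Omega_set A (K C) \<times> Omega_set B (L D)"
      unfolding Omega_set_def by (auto simp: right_ideal_DirProd A.rid_one B.rid_one DirProd_sel)
    have "(\<lambda>x. (q C, r D) \<otimes>\<^bsub>A \<times>\<times> B\<^esub> x) ` Omega_set (A \<times>\<times> B) ?K
        = ((\<lambda>x. q C \<otimes>\<^bsub>A\<^esub> x) ` Omega_set A (K C)) \<times> ((\<lambda>x. r D \<otimes>\<^bsub>B\<^esub> x) ` Omega_set B (L D))"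
      unfolding O by (force simp: DirProd_sel image_iff)
    also have "\<dots> = C \<times> D"
    proof -
      have eC: "(\<lambda>x. q C \<otimes>\<^bsub>A\<^esub> x) ` Omega_set A (K C) = C" using qK[OF c] by argo
      have eD: "(\<lambda>x. r D \<otimes>\<^bsub>B\<^esub> x) ` Omega_set B (L D) = D" using rL[OF d] by argo
      show ?thesis unfolding eC eD ..
    qed
    finally have e: "(\<lambda>x. (q C, r D) \<otimes>\<^bsub>A \<times>\<times> B\<^esub> x) ` Omega_set (A \<times>\<times> B) ?K = C \<times> D" .
    have K: "(q C, r D) \<in> carrier (A \<times>\<times> B)" "finite ?K" "?K \<subseteq> gens"
      using qK[OF c] rL[OF d] by (auto simp: DirProd_sel direct_product_generators_def)
    show ?thesis using atom_familyI[OF K] unfolding e .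
  qed
  have "(\<Union>t\<in>\<C> \<times> \<D>. fst t \<times> snd t) \<in> atom_family (A \<times>\<times> B) gens"
  proof (rule atom_family_UN)
    show "finite (\<C> \<times> \<D>)" using C D by simp
    show "fst t \<times> snd t \<in> atom_family (A \<times>\<times> B) gens" if "t \<in> \<C> \<times> \<D>" for t
      using that by (intro piece) auto
    show "fst s \<times> snd s \<inter> fst t \<times> snd t = {}" if "s \<in> \<C> \<times> \<D>" "t \<in> \<C> \<times> \<D>" "s \<noteq> t" for s t
    proof -
      have "fst s \<inter> fst t = {} \<or> snd s \<inter> snd t = {}"
        using that C(2) D(2) unfolding disjoint_def by (metis mem_Times_iff prod_eqI)
      then show ?thesis by auto
    qed
  qed
  also have "(\<Union>t\<in>\<C> \<times> \<D>. fst t \<times> snd t) = U \<times> V" unfolding C(3) D(3) by force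
  finally show ?thesis .
qed

text \<open>A point of the rectangle lies outside the ideal of $(p, q)$ if its first coordinate lies
  outside $pA$, or its first coordinate lies in $pA$ and its second one outside $qB$; both cases cut
  out smaller rectangles, so the ideals can be removed one after the other.\<close>

lemma rectangle_Int_Omega:
  assumes algA: "Sigma_Algebra.algebra (carrier A) (atom_family A Pa)"
    and algB: "Sigma_Algebra.algebra (carrier B) (atom_family B Qa)"
    and "finite J" "J \<subseteq> carrier (A \<times>\<times> B)" "U \<in> atom_family A Pa" "V \<in> atom_family B Qa"
  shows "(U \<times> V) \<inter> Omega_set (A \<times>\<times> B) J \<in> atom_family (A \<times>\<times> B) gens"
  using assms(3-6)
proof (induction J arbitrary: U V rule: finite_induct)
  case empty
  interpret SA: Sigma_Algebra.algebra "carrier A" "atom_family A Pa" by (rule algA)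
  interpret SB: Sigma_Algebra.algebra "carrier B" "atom_family B Qa" by (rule algB)
  have "U \<times> V \<inter> Omega_set (A \<times>\<times> B) {} = U \<times> V"
    using SA.sets_into_space[OF empty(2)] SB.sets_into_space[OF empty(3)] by (auto simp: Omega_set_def DirProd_sel)
  then show ?case using rectangle_mem empty by simp
next
  case (insert j J)
  interpret SA: Sigma_Algebra.algebra "carrier A" "atom_family A Pa" by (rule algA)
  interpret SB: Sigma_Algebra.algebra "carrier B" "atom_family B Qa" by (rule algB)
  obtain p q where j: "j = (p, q)" "p \<in> carrier A" "q \<in> carrier B" using insert.prems(1) by (auto simp: DirProd_sel)
  have p: "right_ideal A p \<in> atom_family A Pa" by (rule A.ideal_mem_atom_family[OF j(2)])
  have q: "right_ideal B q \<in> atom_family B Qa" by (rule B.ideal_mem_atom_family[OF j(3)])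
  let ?O = "Omega_set (A \<times>\<times> B) J"
  have "((U - right_ideal A p) \<times> V) \<inter> ?O \<union> ((U \<inter> right_ideal A p) \<times> (V - right_ideal B q)) \<inter> ?O
      \<in> atom_family (A \<times>\<times> B) gens"
    by (intro atom_family_Un insert.IH SA.Diff SA.Int SB.Diff p q) (use insert.prems in auto)
  also have "((U - right_ideal A p) \<times> V) \<inter> ?O \<union> ((U \<inter> right_ideal A p) \<times> (V - right_ideal B q)) \<inter> ?O
      = (U \<times> V) \<inter> Omega_set (A \<times>\<times> B) (insert j J)"
    unfolding j(1) Omega_set_def by (auto simp: right_ideal_DirProd)
  finally show ?case .
qed

lemma omega_property_DirProd:
  assumes algA: "Sigma_Algebra.algebra (carrier A) (atom_family A Pa)"
    and algB: "Sigma_Algebra.algebra (carrier B) (atom_family B Qa)"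
  shows "omega_property (A \<times>\<times> B) gens"
  unfolding omega_property_def
proof (intro allI impI, elim conjE)
  fix J assume J: "finite J" "J \<subseteq> carrier (A \<times>\<times> B)"
  have "carrier A \<in> atom_family A Pa" "carrier B \<in> atom_family B Qa"
    using A.ideal_mem_atom_family[OF A.one_closed] B.ideal_mem_atom_family[OF B.one_closed]
    by (simp_all only: A.rid_one B.rid_one)
  from rectangle_Int_Omega[OF algA algB J this]
  show "Omega_set (A \<times>\<times> B) J \<in> atom_family (A \<times>\<times> B) gens"
    by (simp add: Omega_set_def DirProd_sel Int_absorb1 Int_left_absorb)
qed

lemma generated_by_DirProd:
  assumes gA: "generated_by A Pa" and gB: "generated_by B Qa"
  shows "generated_by (A \<times>\<times> B) gens"
proof (rule generated_byI)
  fix Q x assume Q: "Q \<one>\<^bsub>A \<times>\<times> B\<^esub>" and x: "x \<in> carrier (A \<times>\<times> B)"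
    and step: "\<And>p s. \<lbrakk>p \<in> carrier (A \<times>\<times> B); s \<in> gens; Q p\<rbrakk> \<Longrightarrow> Q (p \<otimes>\<^bsub>A \<times>\<times> B\<^esub> s)"
  have 1: "Q (p, \<one>\<^bsub>B\<^esub>)" if "p \<in> carrier A" for p
  proof (rule generated_byD[OF gA, of "\<lambda>p. Q (p, \<one>\<^bsub>B\<^esub>)"])
    show "Q (\<one>\<^bsub>A\<^esub>, \<one>\<^bsub>B\<^esub>)" using Q by (simp add: DirProd_sel)
    fix p s assume "p \<in> carrier A" "s \<in> Pa" "Q (p, \<one>\<^bsub>B\<^esub>)"
    then show "Q (p \<otimes>\<^bsub>A\<^esub> s, \<one>\<^bsub>B\<^esub>)"
      using step[of "(p, \<one>\<^bsub>B\<^esub>)" "(s, \<one>\<^bsub>B\<^esub>)"] by (auto simp: DirProd_sel direct_product_generators_def)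
  qed (rule that)
  have 2: "Q (p, q)" if "p \<in> carrier A" "q \<in> carrier B" for p q
  proof (rule generated_byD[OF gB, of "\<lambda>q. Q (p, q)"])
    show "Q (p, \<one>\<^bsub>B\<^esub>)" by (rule 1[OF that(1)])
    fix q t assume "q \<in> carrier B" "t \<in> Qa" "Q (p, q)"
    then show "Q (p, q \<otimes>\<^bsub>B\<^esub> t)"
      using step[of "(p, q)" "(\<one>\<^bsub>A\<^esub>, t)"] that(1) by (auto simp: DirProd_sel direct_product_generators_def)
  qed (rule that(2))
  show "Q x" using 2 x by (auto simp: DirProd_sel)
qed

theorem admissible_generators_DirProd:
  assumes "Sigma_Algebra.algebra (carrier A) (atom_family A Pa)" "Sigma_Algebra.algebra (carrier B) (atom_family B Qa)"
    and "generated_by A Pa" "generated_by B Qa"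
  shows "admissible_generators (A \<times>\<times> B) gens"
  unfolding admissible_generators_def
  using assms right_lcm_DirProd direct_product_generators_mem generated_by_DirProd omega_property_DirProd by blast

end

section \<open>The free product of two monoids\<close>

context monoid_iso begin

lemma generated_by_image:
  assumes Pa: "Pa \<subseteq> carrier A" and gen: "generated_by A Pa" shows "generated_by B (h ` Pa)"
proof (rule generated_byI)
  fix Q y assume Q: "Q \<one>\<^bsub>B\<^esub>" and step: "\<And>p s. \<lbrakk>p \<in> carrier B; s \<in> h ` Pa; Q p\<rbrakk> \<Longrightarrow> Q (p \<otimes>\<^bsub>B\<^esub> s)" and y: "y \<in> carrier B"
  obtain x where x: "x \<in> carrier A" "y = h x" using y unfolding surj[symmetric] by blast
  have "Q (h x)"
  proof (rule generated_byD[OF gen, of "\<lambda>x. Q (h x)"])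
    show "Q (h \<one>\<^bsub>A\<^esub>)" using Q by (simp add: h_one)
    show "Q (h (p \<otimes>\<^bsub>A\<^esub> s))" if "p \<in> carrier A" "s \<in> Pa" "Q (h p)" for p s
      using step[of "h p" "h s"] that Pa h_mem hom[of p s] by auto
  qed (rule x)
  then show "Q y" using x by simp
qed

lemma admissible_generators_image:
  assumes "admissible_generators A Pa" shows "admissible_generators B (h ` Pa)"
proof -
  have Pa: "Pa \<subseteq> carrier A - {\<one>\<^bsub>A\<^esub>}" and gen: "generated_by A Pa" and om: "omega_property A Pa"
    using assms by (auto simp: admissible_generators_def)
  have sub: "Pa \<subseteq> carrier A" using Pa by blast
  have "h ` Pa \<subseteq> carrier B - {\<one>\<^bsub>B\<^esub>}"
  proof (rule image_subsetI)
    fix s assume "s \<in> Pa"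
    then have s: "s \<in> carrier A" "s \<noteq> \<one>\<^bsub>A\<^esub>" using Pa by blast+
    show "h s \<in> carrier B - {\<one>\<^bsub>B\<^esub>}" using h_mem[OF s(1)] h_eq[OF s(1) A.one_closed] s(2) by (simp add: h_one)
  qed
  then show ?thesis unfolding admissible_generators_def
    using right_lcm generated_by_image[OF sub gen] omega_property[OF sub om] by blast
qed

end

definition tagged :: "('p \<Rightarrow> 'l) \<Rightarrow> ('p, 'k) monoid_scheme \<Rightarrow> 'l monoid" where
  "tagged f P = \<lparr>carrier = f ` carrier P, monoid.mult = (\<lambda>x y. f (inv_into UNIV f x \<otimes>\<^bsub>P\<^esub> inv_into UNIV f y)), one = f \<one>\<^bsub>P\<^esub>\<rparr>"

lemma tagged_simps:
  "carrier (tagged f P) = f ` carrier P" "\<one>\<^bsub>tagged f P\<^esub> = f \<one>\<^bsub>P\<^esub>"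
  "inj f \<Longrightarrow> f x \<otimes>\<^bsub>tagged f P\<^esub> f y = f (x \<otimes>\<^bsub>P\<^esub> y)"
  by (simp_all add: tagged_def inv_f_f)

lemma monoid_iso_tagged:
  assumes "right_lcm_monoid P" "inj f" shows "monoid_iso P (tagged f P) f"
  by (rule monoid_iso.intro)
     (use assms in \<open>auto simp: tagged_simps bij_betw_def intro: inj_on_subset\<close>)

definition summand :: "('p, 'k) monoid_scheme \<Rightarrow> ('q, 'l) monoid_scheme \<Rightarrow> bool \<Rightarrow> ('p + 'q) monoid" where
  "summand P Q b = (if b then tagged Inl P else tagged Inr Q)"

lemma monoid_family_summand:
  fixes P :: "('p, 'k) monoid_scheme" and Q :: "('q, 'l) monoid_scheme"
  assumes "right_lcm_monoid P" "right_lcm_monoid Q" shows "monoid_family (summand P Q) isl"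
proof (rule monoid_family.intro)
  have "right_lcm_monoid (tagged (Inl :: 'p \<Rightarrow> 'p + 'q) P)"
    by (rule monoid_iso.right_lcm[OF monoid_iso_tagged[OF assms(1) inj_Inl]])
  moreover have "right_lcm_monoid (tagged (Inr :: 'q \<Rightarrow> 'p + 'q) Q)"
    by (rule monoid_iso.right_lcm[OF monoid_iso_tagged[OF assms(2) inj_Inr]])
  ultimately show "right_lcm_monoid (summand P Q i)" for i by (simp add: summand_def)
  show "isl l = i" if "l \<in> carrier (summand P Q i)" for l i
    using that by (auto simp: summand_def tagged_simps split: if_splits)
qed

text \<open>The free product is the presented monoid of the family consisting of tagged copies
  of the two factors, and all properties are transported from its normal forms.\<close>

theorem admissible_generators_free_product:
  fixes P :: "'p monoid" and Q :: "'q monoid"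
  assumes P: "admissible_generators P Pa" and Q: "admissible_generators Q Qa"
  shows "admissible_generators (free_product P Q) (free_product_generators P Pa Q Qa)"
proof -
  have lcm: "right_lcm_monoid P" "right_lcm_monoid Q" using P Q by (auto simp: admissible_generators_def)
  interpret F: monoid_family "summand P Q" isl by (rule monoid_family_summand[OF lcm])
  define Pf where "Pf b = (if b then Inl ` Pa else Inr ` Qa)" for b
  have "admissible_generators (tagged (Inl :: 'p \<Rightarrow> 'p + 'q) P) (Inl ` Pa)"
    by (rule monoid_iso.admissible_generators_image[OF monoid_iso_tagged[OF lcm(1) inj_Inl] P])
  moreover have "admissible_generators (tagged (Inr :: 'q \<Rightarrow> 'p + 'q) Q) (Inr ` Qa)"
    by (rule monoid_iso.admissible_generators_image[OF monoid_iso_tagged[OF lcm(2) inj_Inr] Q])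
  ultimately have adm: "admissible_generators (summand P Q b) (Pf b)" for b
    by (simp add: summand_def Pf_def)
  have Pf: "Pf b \<subseteq> carrier (summand P Q b) - {\<one>\<^bsub>summand P Q b\<^esub>}" and om: "omega_property (summand P Q b) (Pf b)"
    and gen: "generated_by (summand P Q b) (Pf b)" for b
    using adm[of b] unfolding admissible_generators_def by blast+
  have sT: "summand P Q True = tagged Inl P" and sF: "summand P Q False = tagged Inr Q" by (simp_all add: summand_def)
  have G: "F.G = free_product_gens P Q"
  proof (rule Set.set_eqI)
    fix l show "l \<in> F.G \<longleftrightarrow> l \<in> free_product_gens P Q"
      by (cases l) (auto simp: F.G_carrier free_product_gens_def sT sF tagged_simps)
  qed
  have R: "F.fam_relations = free_product_relations P Q"
  proof (intro equalityI subsetI)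
    fix r assume "r \<in> F.fam_relations"
    then consider a b where "r = ([a, b], [a \<otimes>\<^bsub>summand P Q (isl a)\<^esub> b])" "a \<in> F.G" "b \<in> F.G" "isl a = isl b"
      | i where "r = ([\<one>\<^bsub>summand P Q i\<^esub>], [])"
      unfolding F.fam_relations_def by blast
    then show "r \<in> free_product_relations P Q"
    proof cases
      case 1
      then show ?thesis unfolding G
        by (cases a; cases b) (auto simp: free_product_gens_def free_product_relations_def sT sF tagged_simps)
    next
      case 2
      then show ?thesis by (cases i) (simp_all add: sT sF tagged_simps free_product_relations_def)
    qed
  next
    fix r assume "r \<in> free_product_relations P Q"
    then consider a b where "r = ([Inl a, Inl b], [Inl (a \<otimes>\<^bsub>P\<^esub> b)])" "a \<in> carrier P" "b \<in> carrier P"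
      | a b where "r = ([Inr a, Inr b], [Inr (a \<otimes>\<^bsub>Q\<^esub> b)])" "a \<in> carrier Q" "b \<in> carrier Q"
      | "r = ([Inl \<one>\<^bsub>P\<^esub>], [])" | "r = ([Inr \<one>\<^bsub>Q\<^esub>], [])"
      unfolding free_product_relations_def by blast
    then show "r \<in> F.fam_relations"
    proof cases
      case 1
      then have "Inl a \<in> F.G" "Inl b \<in> F.G" "isl (Inl a :: 'p + 'q) = isl (Inl b :: 'p + 'q)"
        by (auto simp: G free_product_gens_def)
      then have "([Inl a, Inl b], [Inl a \<otimes>\<^bsub>summand P Q (isl (Inl a :: 'p + 'q))\<^esub> Inl b]) \<in> F.fam_relations"
        unfolding F.fam_relations_def by blast
      then show ?thesis using 1 by (simp add: sT tagged_simps)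
    next
      case 2
      then have "Inr a \<in> F.G" "Inr b \<in> F.G" "isl (Inr a :: 'p + 'q) = isl (Inr b :: 'p + 'q)"
        by (auto simp: G free_product_gens_def)
      then have "([Inr a, Inr b], [Inr a \<otimes>\<^bsub>summand P Q (isl (Inr a :: 'p + 'q))\<^esub> Inr b]) \<in> F.fam_relations"
        unfolding F.fam_relations_def by blast
      then show ?thesis using 2 by (simp add: sF tagged_simps)
    next
      case 3
      then show ?thesis unfolding F.fam_relations_def
        by (intro UnI2 CollectI exI[of _ True]) (simp add: sT tagged_simps)
    next
      case 4
      then show ?thesis unfolding F.fam_relations_def
        by (intro UnI2 CollectI exI[of _ False]) (simp add: sF tagged_simps)
    qed
  qed
  have sub: "F.PaN Pf \<subseteq> carrier F.NM" by (rule F.PaN_carrier[OF Pf om])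
  have cls_PaN: "F.FP.cls ` F.PaN Pf = (\<lambda>x. F.FP.cls [x]) ` (Pa <+> Qa)"
  proof -
    have "F.PaN Pf = (\<lambda>x. [x]) ` (\<Union>b. Pf b)"
      unfolding F.PaN_def[OF Pf om] by blast
    also have "(\<Union>b. Pf b) = Pa <+> Qa" by (auto simp: Pf_def Plus_def UNIV_bool)
    finally show ?thesis by (simp add: image_image)
  qed
  have "omega_property F.NM (F.PaN Pf)"
    unfolding omega_property_def using F.Omega_free[OF Pf om] by blast
  then have om': "omega_property F.FP.PM (F.FP.cls ` F.PaN Pf)" by (rule monoid_iso.omega_property[OF F.iso_FP sub])
  have ne: "F.FP.cls ` F.PaN Pf \<subseteq> carrier F.FP.PM - {\<one>\<^bsub>F.FP.PM\<^esub>}"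
  proof (rule image_subsetI)
    fix s assume s: "s \<in> F.PaN Pf"
    then have "s \<in> carrier F.NM" "s \<noteq> \<one>\<^bsub>F.NM\<^esub>" using sub by (auto simp: F.PaN_def[OF Pf om])
    then show "F.FP.cls s \<in> carrier F.FP.PM - {\<one>\<^bsub>F.FP.PM\<^esub>}"
      using monoid_iso.h_mem[OF F.iso_FP] monoid_iso.h_eq[OF F.iso_FP, of s "\<one>\<^bsub>F.NM\<^esub>"]
        monoid_iso.h_one[OF F.iso_FP] F.NM.one_closed by auto
  qed
  have gen': "generated_by F.FP.PM (F.FP.cls ` F.PaN Pf)"
  proof (rule generated_byI)
    fix Q' p assume Q': "Q' \<one>\<^bsub>F.FP.PM\<^esub>" and p: "p \<in> carrier F.FP.PM"
      and step: "\<And>p s. \<lbrakk>p \<in> carrier F.FP.PM; s \<in> F.FP.cls ` F.PaN Pf; Q' p\<rbrakk> \<Longrightarrow> Q' (p \<otimes>\<^bsub>F.FP.PM\<^esub> s)"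
    show "Q' p"
    proof (rule F.generated_FP[of Pf Q', OF _ _ Q' _ p])
      show "Q'' p" if "Q'' \<one>\<^bsub>summand P Q i\<^esub>"
          "\<And>p s. p \<in> carrier (summand P Q i) \<Longrightarrow> s \<in> Pf i \<Longrightarrow> Q'' p \<Longrightarrow> Q'' (p \<otimes>\<^bsub>summand P Q i\<^esub> s)"
          "p \<in> carrier (summand P Q i)" for i Q'' p
        using gen[of i] that by (rule generated_byD)
      show "Pf i \<subseteq> carrier (summand P Q i)" for i using Pf[of i] by blast
      show "Q' (p \<otimes>\<^bsub>F.FP.PM\<^esub> F.FP.cls [s])" if "p \<in> carrier F.FP.PM" "s \<in> Pf i" "Q' p" for p s i
        using step[OF that(1) _ that(3)] that(2) by (auto simp: F.PaN_def[OF Pf om])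
    qed
  qed
  have "admissible_generators F.FP.PM (F.FP.cls ` F.PaN Pf)"
    unfolding admissible_generators_def using om' ne gen' monoid_iso.right_lcm[OF F.iso_FP] by blast
  then show ?thesis
    unfolding cls_PaN by (simp add: G R free_product_def free_product_generators_def)
qed

section \<open>Reduction for Artin monoids\<close>

theorem reduction_to_generators_admissible:
  assumes adm: "admissible_generators P Pa"
    and X: "product_system P X \<mu> j" and N: "N \<in> hom P positive_reals"
  shows "reduction_to_generators P Pa X N \<beta>"
proof (rule reduction_to_generators_criterion)
  show "right_lcm_monoid P" "Pa \<subseteq> carrier P - {\<one>\<^bsub>P\<^esub>}" using adm by (auto simp: admissible_generators_def)
  show "product_system P X \<mu> j" "N \<in> hom P positive_reals" by fact+
  show "Q p" if "Q \<one>\<^bsub>P\<^esub>" "\<And>p s. \<lbrakk>p \<in> carrier P; s \<in> Pa; Q p\<rbrakk> \<Longrightarrow> Q (p \<otimes>\<^bsub>P\<^esub> s)" "p \<in> carrier P" for Q p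
    using adm[unfolded admissible_generators_def, THEN conjunct2, THEN conjunct2, THEN conjunct1] that by (rule generated_byD)
  show "Omega_set P J \<in> atom_family P Pa" if "finite J" "J \<subseteq> carrier P" for J
    using adm that by (simp add: admissible_generators_def omega_property_def)
qed

lemma admissible_generators_artin:
  assumes "coxeter_matrix S m"
    and "Sigma_Algebra.algebra (carrier (artin_monoid S m)) (atom_family (artin_monoid S m) (artin_generators S m))"
  shows "admissible_generators (artin_monoid S m) (artin_generators S m)"
proof -
  interpret coxeter S m by (unfold_locales) (rule assms)
  have "generated_by PM (artin_generators S m)" by (rule generated_byI) (rule artin_generated)
  then show ?thesis
    using omega_property_if_algebra[OF assms(2)] right_lcm_artin artin_generators_mem
    unfolding admissible_generators_def artin_monoid_eq by blast
qed

theorem corollary7p10: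
  fixes S\<^sub>1 :: "'s set" and m\<^sub>1 :: "'s \<Rightarrow> 's \<Rightarrow> enat"
    and S\<^sub>2 :: "'t set" and m\<^sub>2 :: "'t \<Rightarrow> 't \<Rightarrow> enat"
  defines "P\<^sub>1 \<equiv> artin_monoid S\<^sub>1 m\<^sub>1" and "Pa\<^sub>1 \<equiv> artin_generators S\<^sub>1 m\<^sub>1"
    and "P\<^sub>2 \<equiv> artin_monoid S\<^sub>2 m\<^sub>2" and "Pa\<^sub>2 \<equiv> artin_generators S\<^sub>2 m\<^sub>2"
  assumes "coxeter_matrix S\<^sub>1 m\<^sub>1" and "coxeter_matrix S\<^sub>2 m\<^sub>2"
    and "Sigma_Algebra.algebra (carrier P\<^sub>1) (atom_family P\<^sub>1 Pa\<^sub>1)"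
    and "Sigma_Algebra.algebra (carrier P\<^sub>2) (atom_family P\<^sub>2 Pa\<^sub>2)"
  shows "(\<forall>(X :: ('s list set + 't list set) list set
                \<Rightarrow> ('a::cstar_algebra, 'x::complex_vector) correspondence) \<mu> j N \<beta>.
           compactly_aligned_product_system (free_product P\<^sub>1 P\<^sub>2) X \<mu> j \<longrightarrow>
           (\<forall>p \<in> carrier (free_product P\<^sub>1 P\<^sub>2). essential (X p)) \<longrightarrow>
           N \<in> hom (free_product P\<^sub>1 P\<^sub>2) positive_reals \<longrightarrow>
           reduction_to_generators (free_product P\<^sub>1 P\<^sub>2)
             (free_product_generators P\<^sub>1 Pa\<^sub>1 P\<^sub>2 Pa\<^sub>2) X N \<beta>) \<and>
         (\<forall>(X :: 's list set \<times> 't list set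
                \<Rightarrow> ('a, 'x) correspondence) \<mu> j N \<beta>.
           compactly_aligned_product_system (P\<^sub>1 \<times>\<times> P\<^sub>2) X \<mu> j \<longrightarrow>
           (\<forall>p \<in> carrier (P\<^sub>1 \<times>\<times> P\<^sub>2). essential (X p)) \<longrightarrow>
           N \<in> hom (P\<^sub>1 \<times>\<times> P\<^sub>2) positive_reals \<longrightarrow>
           reduction_to_generators (P\<^sub>1 \<times>\<times> P\<^sub>2)
             (direct_product_generators P\<^sub>1 Pa\<^sub>1 P\<^sub>2 Pa\<^sub>2) X N \<beta>)"
proof -
  have adm: "admissible_generators P\<^sub>1 Pa\<^sub>1" "admissible_generators P\<^sub>2 Pa\<^sub>2"
    unfolding P\<^sub>1_def Pa\<^sub>1_def P\<^sub>2_def Pa\<^sub>2_def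
    by (rule admissible_generators_artin; use assms in simp)+
  have free: "admissible_generators (free_product P\<^sub>1 P\<^sub>2) (free_product_generators P\<^sub>1 Pa\<^sub>1 P\<^sub>2 Pa\<^sub>2)"
    by (rule admissible_generators_free_product[OF adm])
  have direct: "admissible_generators (P\<^sub>1 \<times>\<times> P\<^sub>2) (direct_product_generators P\<^sub>1 Pa\<^sub>1 P\<^sub>2 Pa\<^sub>2)"
    using adm assms(7,8) unfolding admissible_generators_def[of "P\<^sub>1"] admissible_generators_def[of "P\<^sub>2"]
    by (intro admissible_generators_DirProd) auto
  show ?thesis
    using reduction_to_generators_admissible[OF free] reduction_to_generators_admissible[OF direct]
    unfolding compactly_aligned_product_system_def by blast
qed

end
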